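(* Let $F(x)=\pi^{-1/2}\int_x^\infty e^{-z^2/4}\,dz$ and $$K(x,y)=\begin{pmatrix} -F''(y-x) & -F'(y-x)\\ F'(y-x) & \mathrm{sgn}(y-x)\,F(|y-x|)\end{pmatrix},\qquad x,y\in\mathbf{R},$$ where $\mathrm{sgn}(z)=1$ for $z>0$, $\mathrm{sgn}(z)=-1$ for $z<0$ and $\mathrm{sgn}(0)=0$. Let $t>0$. Under the maximal entrance law for coalescing Brownian motions on $\mathbf{R}$, the particle positions at time $t$ form a Pfaffian point process with kernel $t^{-1/2}K(xt^{-1/2},yt^{-1/2})$. Under the maximal entrance law for annihilating Brownian motions on $\mathbf{R}$, the particle positions at time $t$ form a Pfaffian point process with kernel $\tfrac12 t^{-1/2}K(xt^{-1/2},yt^{-1/2})$.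
   Context: Coalescing (respectively annihilating) Brownian motions on $\mathbf{R}$: particles move as independent standard Brownian motions; whenever two particles meet, they instantly merge into a single particle (respectively, both are instantly removed). $N_t$ denotes the empirical (counting) measure of the particle positions at time $t$. For $a_1<\dots<a_{2m}$, $P^A_{(a_i)}$ denotes the law of annihilating Brownian motions started from the $2m$ particles $a_1,\dots,a_{2m}$, and $\tau$ is the time at which all particles have disappeared. Maximal entrance law for coalescing Brownian motions, $P^C_\infty$ (intuitively, one particle started at every point of $\mathbf{R}$): it is an entrance law whose law of $N_t$, for each fixed $t>0$, is the unique law on locally finite point measures with atoms of mass one such that for all $m\ge1$ and $a_1<a_2<\dots<a_{2m}$, $$P^C_\infty\big[N_t((a_1,a_2))=N_t((a_3,a_4))=\dots=N_t((a_{2m-1},a_{2m}))=0\big]=P^A_{(a_i)}[\tau<t].$$ Maximal entrance law for annihilating Brownian motions, $P^A_\infty$: for each fixed $t>0$, the law of the particle positions at time $t$ is that obtained from the law of the particle positions at time $t$ under $P^C_\infty$ by removing each particle independently with probability $1/2$. The $n$-point density $\rho^{(n)}(x_1,\dots,x_n)$ of a point process with counting measure $N$ is the symmetric function which is the Lebesgue density of $E[N(dx_1)\cdots N(dx_n)]$ on $\{x_1<\dots<x_n\}$. Pfaffian point process: let $K(x,y)=(K_{ij}(x,y))_{i,j\in\{1,2\}}$ be a measurable $2\times2$ matrix-valued kernel on $\mathbf{R}\times\mathbf{R}$ that is anti-symmetric, i.e. $K_{ij}(x,y)=-K_{ji}(y,x)$ for all $i,j\in\{1,2\}$, $x,y\in\mathbf{R}$,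 and that is the kernel of a bounded operator on $L^2(\mathbf{R})\oplus L^2(\mathbf{R})$. A point process is a Pfaffian point process with kernel $K$ if for every $n\ge1$ its $n$-point density $\rho^{(n)}(x_1,\dots,x_n)$ is the Pfaffian of the $2n\times2n$ anti-symmetric matrix formed by the $n^2$ two-by-two blocks $(K(x_i,x_j):i,j=1,\dots,n)$. The sign convention for the Pfaffian is $\mathrm{Pf}\begin{pmatrix}0&a\\-a&0\end{pmatrix}=a$. *)

theory Defs
  imports "HOL-Probability.Probability"
begin

definition standard_brownian_motion :: "'w measure \<Rightarrow> (real \<Rightarrow> 'w \<Rightarrow> real) \<Rightarrow> bool" where
  "standard_brownian_motion W B \<longleftrightarrow>
     (\<forall>s\<ge>0. B s \<in> borel_measurable W) \<and>
     (\<forall>\<omega>\<in>space W. B 0 \<omega> = 0 \<and> continuous_on {0..} (\<lambda>s. B s \<omega>)) \<and>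
     (\<forall>r s. 0 \<le> r \<and> r < s \<longrightarrow>
        distributed W lborel (\<lambda>\<omega>. B s \<omega> - B r \<omega>) (normal_density 0 (sqrt (s - r)))) \<and>
     (\<forall>n (u :: nat \<Rightarrow> real). 0 \<le> u 0 \<and> strict_mono_on {..n} u \<longrightarrow>
        prob_space.indep_vars W (\<lambda>_. borel) (\<lambda>k \<omega>. B (u (Suc k)) \<omega> - B (u k) \<omega>) {..<n})"

definition independent_brownian_motions ::
    "'w measure \<Rightarrow> (nat \<Rightarrow> real \<Rightarrow> 'w \<Rightarrow> real) \<Rightarrow> bool" where
  "independent_brownian_motions W B \<longleftrightarrow>
     prob_space W \<and>
     (\<forall>i. standard_brownian_motion W (B i)) \<and>
     prob_space.indep_vars W (\<lambda>_. PiM {0..} (\<lambda>_. borel)) (\<lambda>i \<omega>. \<lambda>s\<in>{0..}. B i s \<omega>) UNIV"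

definition meeting :: "(nat \<Rightarrow> real \<Rightarrow> real) \<Rightarrow> nat set \<Rightarrow> real \<Rightarrow> nat set" where
  "meeting x A s = {i \<in> A. \<exists>j\<in>A. j \<noteq> i \<and> x i s = x j s}"

text \<open>
  A state \<open>(s, A)\<close> records that the particles in \<open>A\<close> are those remaining after the removals at
  time \<open>s\<close>. One step moves to the next meeting time of remaining particles and removes the
  particles that meet; the state is unchanged if there is no further meeting. For continuous paths
  the infimum is attained. Independent Brownian motions almost surely have no simultaneous meeting
  of three particles, so almost surely particles are removed in pairs.
\<close>

definition annihilate ::
    "(nat \<Rightarrow> real \<Rightarrow> real) \<Rightarrow> real \<times> nat set \<Rightarrow> real \<times> nat set" where
  "annihilate x = (\<lambda>(s, A).
     if \<exists>u\<ge>s. meeting x A u \<noteq> {}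
     then let u = Inf {u. s \<le> u \<and> meeting x A u \<noteq> {}} in (u, A - meeting x A u)
     else (s, A))"

definition extinction_time :: "(nat \<Rightarrow> real \<Rightarrow> real) \<Rightarrow> nat set \<Rightarrow> ereal" where
  "extinction_time x A = Inf {ereal s | s k. (annihilate x ^^ k) (0, A) = (s, {})}"

text \<open>
  The probability that annihilating Brownian motions started from \<open>a 0, \<dots>, a (n - 1)\<close> die out
  before time \<open>t\<close>. Particle \<open>i\<close> follows \<open>a i + B i\<close> until its removal.
\<close>

definition annihilating_extinction_prob ::
    "'w measure \<Rightarrow> (nat \<Rightarrow> real \<Rightarrow> 'w \<Rightarrow> real) \<Rightarrow> nat \<Rightarrow> (nat \<Rightarrow> real) \<Rightarrow> real \<Rightarrow> real" where
  "annihilating_extinction_prob W B n a t =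
     measure W {\<omega> \<in> space W. extinction_time (\<lambda>i s. a i + B i s \<omega>) {..<n} < ereal t}"

text \<open>
  A locally finite point measure on the line with atoms of mass one is represented by its set of
  atoms; \<open>counting X\<close> is the point measure itself.
\<close>

definition configurations :: "real set set" where
  "configurations = {X. \<forall>A. bounded A \<longrightarrow> finite (X \<inter> A)}"

definition counting :: "real set \<Rightarrow> real measure" where
  "counting X = distr (count_space X) borel (\<lambda>x. x)"

definition config_space :: "real set measure" where
  "config_space =
     (SUP A\<in>sets borel. vimage_algebra configurations (\<lambda>X. emeasure (counting X) A) borel)"

definition point_process_law :: "real set measure \<Rightarrow> bool" where
  "point_process_law L \<longleftrightarrow> prob_space L \<and> sets L = sets config_space"

definition independent_removal :: "real \<Rightarrow> real set \<Rightarrow> real set measure" where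
  "independent_removal p X =
     distr (PiM X (\<lambda>_. measure_pmf (bernoulli_pmf p))) config_space (\<lambda>removed. {x \<in> X. \<not> removed x})"

definition maximal_coalescing_law ::
    "'w measure \<Rightarrow> (nat \<Rightarrow> real \<Rightarrow> 'w \<Rightarrow> real) \<Rightarrow> real \<Rightarrow> real set measure \<Rightarrow> bool" where
  "maximal_coalescing_law W B t L \<longleftrightarrow>
     point_process_law L \<and>
     (\<forall>m\<ge>1. \<forall>a. strict_mono_on {..<2 * m} a \<longrightarrow>
        measure L {X \<in> space L. \<forall>i<m. emeasure (counting X) {a (2 * i)<..<a (2 * i + 1)} = 0} =
        annihilating_extinction_prob W B (2 * m) a t)"

definition maximal_annihilating_law ::
    "'w measure \<Rightarrow> (nat \<Rightarrow> real \<Rightarrow> 'w \<Rightarrow> real) \<Rightarrow> real \<Rightarrow> real set measure \<Rightarrow> bool" where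
  "maximal_annihilating_law W B t L \<longleftrightarrow>
     (\<exists>L'. maximal_coalescing_law W B t L' \<and> L = L' \<bind> independent_removal (1 / 2))"

text \<open>The Pfaffian of an anti-symmetric matrix with rows and columns indexed by \<open>0, \<dots>, 2 n - 1\<close>.\<close>

definition pfaffian :: "nat \<Rightarrow> (nat \<Rightarrow> nat \<Rightarrow> real) \<Rightarrow> real" where
  "pfaffian n A =
     (\<Sum>p | p permutes {..<2 * n}. of_int (sign p) * (\<Prod>i<n. A (p (2 * i)) (p (2 * i + 1))))
     / (2 ^ n * fact n)"

text \<open>Rows \<open>2 i\<close> and \<open>2 i + 1\<close> are the first and second row of the \<open>i\<close>-th row of blocks.\<close>

definition block_matrix ::
    "(real \<Rightarrow> real \<Rightarrow> real ^ 2 ^ 2) \<Rightarrow> (nat \<Rightarrow> real) \<Rightarrow> nat \<Rightarrow> nat \<Rightarrow> real" where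
  "block_matrix K x k l =
     K (x (k div 2)) (x (l div 2)) $ (if even k then 1 else 2) $ (if even l then 1 else 2)"

definition n_point_density ::
    "real set measure \<Rightarrow> nat \<Rightarrow> ((nat \<Rightarrow> real) \<Rightarrow> real) \<Rightarrow> bool" where
  "n_point_density L n \<rho> \<longleftrightarrow>
     \<rho> \<in> borel_measurable (PiM {..<n} (\<lambda>_. lborel)) \<and>
     (\<forall>x\<in>space (PiM {..<n} (\<lambda>_. lborel)). \<forall>p. p permutes {..<n} \<longrightarrow> \<rho> (x \<circ> p) = \<rho> x) \<and>
     (AE x in PiM {..<n} (\<lambda>_. lborel). 0 \<le> \<rho> x) \<and>
     (\<forall>E\<in>sets (PiM {..<n} (\<lambda>_. lborel)). (\<forall>x\<in>E. strict_mono_on {..<n} x) \<longrightarrow>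
        (\<integral>\<^sup>+ X. emeasure (PiM {..<n} (\<lambda>_. counting X)) E \<partial>L) =
        (\<integral>\<^sup>+ x\<in>E. ennreal (\<rho> x) \<partial>PiM {..<n} (\<lambda>_. lborel)))"

definition antisymmetric_kernel :: "(real \<Rightarrow> real \<Rightarrow> real ^ 2 ^ 2) \<Rightarrow> bool" where
  "antisymmetric_kernel K \<longleftrightarrow> (\<forall>x y i j. K x y $ i $ j = - (K y x $ j $ i))"

text \<open>The direct sum of two copies of \<open>L\<^sup>2\<close> of the line is \<open>L\<^sup>2\<close> with values in the plane.\<close>

definition bounded_L2_kernel :: "(real \<Rightarrow> real \<Rightarrow> real ^ 2 ^ 2) \<Rightarrow> bool" where
  "bounded_L2_kernel K \<longleftrightarrow>
     (\<exists>C. \<forall>f :: real \<Rightarrow> real ^ 2.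
        f \<in> borel_measurable lborel \<and> integrable lborel (\<lambda>y. (norm (f y))\<^sup>2) \<longrightarrow>
          (AE x in lborel. integrable lborel (\<lambda>y. K x y *v f y)) \<and>
          integrable lborel (\<lambda>x. (norm (\<integral>y. K x y *v f y \<partial>lborel))\<^sup>2) \<and>
          (\<integral>x. (norm (\<integral>y. K x y *v f y \<partial>lborel))\<^sup>2 \<partial>lborel) \<le>
            C * (\<integral>y. (norm (f y))\<^sup>2 \<partial>lborel))"

definition pfaffian_point_process ::
    "real set measure \<Rightarrow> (real \<Rightarrow> real \<Rightarrow> real ^ 2 ^ 2) \<Rightarrow> bool" where
  "pfaffian_point_process L K \<longleftrightarrow>
     point_process_law L \<and>
     (\<lambda>(x, y). K x y) \<in> borel_measurable (borel \<Otimes>\<^sub>M borel) \<and>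
     antisymmetric_kernel K \<and>
     bounded_L2_kernel K \<and>
     (\<forall>n\<ge>1. n_point_density L n (\<lambda>x. pfaffian n (block_matrix K x)))"

definition F :: "real \<Rightarrow> real" where
  "F x = (1 / sqrt pi) * (LINT z:{x..}|lborel. exp (- z\<^sup>2 / 4))"

definition K :: "real \<Rightarrow> real \<Rightarrow> real ^ 2 ^ 2" where
  "K x y = vector [vector [- deriv (deriv F) (y - x), - deriv F (y - x)],
                   vector [deriv F (y - x), sgn (y - x) * F \<bar>y - x\<bar>]]"

end

theory Submission imports Defs begin

text \<open>
  A Pfaffian with entries \<open>F ((a l - a k) / sqrt t)\<close> solves the heat equation in the starting points and
  collapses to the Pfaffian of the remaining particles when two neighbours meet. Along annihilating
  Brownian motions it is therefore a martingale, which is \<open>1\<close> at extinction and tends to \<open>0\<close> with the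
  remaining time if particles are left, so that it is the probability of extinction before \<open>t\<close>. The
  martingale is only used on a time grid whose mesh tends to \<open>0\<close>; almost surely no three particles
  meet at once, so that in the limit the particles disappear in neighbouring pairs. Void probabilities of disjoint
  intervals under the coalescing law are then Pfaffians as well. By row operations, the probability
  that all of \<open>n\<close> small intervals are hit is the Pfaffian of a matrix of difference quotients of \<open>F\<close>, and
  summing over dyadic cells gives the moments of products of counts over boxes as integrals of the
  Pfaffian of the derivatives of \<open>F\<close>. Up to a permutation and scaling of rows this is the Pfaffian of
  the kernel \<open>K\<close>. Thinning multiplies the density of order \<open>n\<close> by \<open>1 / 2 ^ n\<close>.
\<close>

section \<open>Pfaffians\<close>

text \<open>For two particles at distance d, \<open>F (d / sqrt t)\<close> is the probability that
  they meet before t; by reflection it is twice the probability that free motions have exchanged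
  their order at t. Hence the terminal condition \<open>crossed\<close> has the value 2 on reversed
  pairs, and the Pfaffian follows labels instead of positions: given the survivors at time s, the
  terminal Pfaffian of freely moving particles has as its mean the Pfaffian of \<open>F\<close> with
  remaining time t - s. Such means need the Markov property at deterministic times only, and no
  stopping times occur. The price is that a removal is recorded at the end of a grid cell, when the
  colliding pair has already separated a little; the error is a difference of two conditional
  Pfaffians, which is zero at the true collision time and small nearby. This breaks down where three
  particles meet. Their relative positions form a planar Brownian motion, for which points are only
  just polar, so a logarithmic Green function estimate is required.\<close>

lemma prod_pairs: "(\<Prod>i<n. f (2 * i) * f (2 * i + 1)) = prod f {..<2 * n}"
  for f :: "nat \<Rightarrow> 'a::comm_monoid_mult"
  by (induction n) (simp_all add: mult_ac lessThan_Suc)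

definition pfterm :: "nat \<Rightarrow> (nat \<Rightarrow> nat \<Rightarrow> real) \<Rightarrow> (nat \<Rightarrow> nat) \<Rightarrow> real" where
  "pfterm n A p = of_int (sign p) * (\<Prod>i<n. A (p (2 * i)) (p (2 * i + 1)))"

lemma pfaffian_alt: "pfaffian n A = (\<Sum>p | p permutes {..<2 * n}. pfterm n A p) / (2 ^ n * fact n)"
  by (simp add: pfaffian_def pfterm_def)

lemma permutes_permutation: "p permutes {..<k::nat} \<Longrightarrow> permutation p"
  using permutation_permutes by blast

lemma pfaffian_permute:
  assumes q: "q permutes {..<2 * n}"
  shows "pfaffian n (\<lambda>k l. A (q k) (q l)) = of_int (sign q) * pfaffian n A"
proof -
  have e: "pfterm n A (q \<circ> p) = of_int (sign q) * pfterm n (\<lambda>k l. A (q k) (q l)) p"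
    if "p permutes {..<2 * n}" for p
    using that q by (simp add: pfterm_def sign_compose permutes_permutation)
  have "(\<Sum>p | p permutes {..<2 * n}. pfterm n A p) =
      (\<Sum>p | p permutes {..<2 * n}. pfterm n A (q \<circ> p))"
    using q by (rule setum_permutations_compose_left)
  also have "\<dots> = of_int (sign q) * (\<Sum>p | p permutes {..<2 * n}. pfterm n (\<lambda>k l. A (q k) (q l)) p)"
    unfolding sum_distrib_left by (intro sum.cong) (auto simp: e)
  finally have "of_int (sign q) * (\<Sum>p | p permutes {..<2 * n}. pfterm n A p) =
      (of_int (sign q * sign q) :: real) * (\<Sum>p | p permutes {..<2 * n}. pfterm n (\<lambda>k l. A (q k) (q l)) p)"
    by (simp only: of_int_mult mult.assoc)
  then show ?thesis
    by (simp add: pfaffian_alt)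
qed

text \<open>Both indices of a factor are values of the injective \<open>p\<close> at different
  places, so diagonal entries never enter.\<close>

lemma pfaffian_cong:
  assumes "\<And>k l. k < 2 * n \<Longrightarrow> l < 2 * n \<Longrightarrow> k \<noteq> l \<Longrightarrow> A k l = B k l"
  shows "pfaffian n A = pfaffian n B"
proof -
  have "A (p (2 * i)) (p (2 * i + 1)) = B (p (2 * i)) (p (2 * i + 1))"
    if p: "p permutes {..<2 * n}" and "i < n" for p i
  proof (rule assms)
    show "p (2 * i) < 2 * n" "p (2 * i + 1) < 2 * n"
      using permutes_in_image[OF p] that(2) by auto
    show "p (2 * i) \<noteq> p (2 * i + 1)"
      using permutes_inj[OF p] by (metis add_cancel_right_right inj_eq zero_neq_one)
  qed
  then show ?thesis
    unfolding pfaffian_alt pfterm_def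
    by (intro arg_cong2[where f = divide] sum.cong refl arg_cong2[where f = times] prod.cong) auto
qed

text \<open>Each index occurs in exactly one factor of each term, once as a row or as a
  column.\<close>

lemma pfaffian_scale:
  "pfaffian n (\<lambda>k l. d k * d l * A k l) = (\<Prod>k<2 * n. d k) * pfaffian n A"
proof -
  have "pfterm n (\<lambda>k l. d k * d l * A k l) p = (\<Prod>k<2 * n. d k) * pfterm n A p"
    if p: "p permutes {..<2 * n}" for p
  proof -
    have "(\<Prod>i<n. d (p (2 * i)) * d (p (2 * i + 1))) = (\<Prod>k<2 * n. d (p k))"
      using prod_pairs[of "\<lambda>k. d (p k)" n] by simp
    also have "\<dots> = (\<Prod>k<2 * n. d k)"
      using prod.permute[OF p, of d] by (simp add: o_def)
    finally show ?thesis
      by (simp add: pfterm_def prod.distrib)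
  qed
  then show ?thesis
    by (simp add: pfaffian_alt sum_distrib_left)
qed

text \<open>In each term exactly one factor contains the index \<open>q\<close>, as its row or as
  its column. The Pfaffian is therefore linear in row and column \<open>q\<close> taken together;
  inclusion-exclusion over intervals rests on this.\<close>

lemma pfaffian_row_diff:
  assumes q: "q < 2 * n"
    and eq1: "\<And>k l. k < 2 * n \<Longrightarrow> l < 2 * n \<Longrightarrow> k \<noteq> q \<Longrightarrow> l \<noteq> q \<Longrightarrow> A' k l = A k l"
    and eq2: "\<And>k l. k < 2 * n \<Longrightarrow> l < 2 * n \<Longrightarrow> k \<noteq> q \<Longrightarrow> l \<noteq> q \<Longrightarrow> A'' k l = A k l"
    and row: "\<And>k. k < 2 * n \<Longrightarrow> k \<noteq> q \<Longrightarrow> A q k = A' q k - A'' q k"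
    and col: "\<And>k. k < 2 * n \<Longrightarrow> k \<noteq> q \<Longrightarrow> A k q = A' k q - A'' k q"
  shows "pfaffian n A = pfaffian n A' - pfaffian n A''"
proof -
  have "pfterm n A p = pfterm n A' p - pfterm n A'' p" if p: "p permutes {..<2 * n}" for p
  proof -
    have inj: "inj p" by (rule permutes_inj[OF p])
    have lt: "p k < 2 * n" if "k < 2 * n" for k
      using permutes_in_image[OF p] that by auto
    obtain w where w: "p w = q" using permutes_surj[OF p] by (metis surjD)
    have w2: "w < 2 * n" using permutes_in_image[OF p, of w] w q by auto
    define i where "i = w div 2"
    have i: "i < n" using w2 by (auto simp: i_def)
    have wi: "w = 2 * i \<or> w = 2 * i + 1" by (auto simp: i_def)
    have ne: "p (2 * j) \<noteq> q" "p (2 * j + 1) \<noteq> q" if "j \<noteq> i" for j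
    proof -
      have "2 * j \<noteq> w" "2 * j + 1 \<noteq> w" using that by (auto simp: i_def)
      then show "p (2 * j) \<noteq> q" "p (2 * j + 1) \<noteq> q" using inj w by (metis injD)+
    qed
    have oth: "(\<Prod>j\<in>{..<n} - {i}. A' (p (2 * j)) (p (2 * j + 1))) = (\<Prod>j\<in>{..<n} - {i}. A (p (2 * j)) (p (2 * j + 1)))"
      "(\<Prod>j\<in>{..<n} - {i}. A'' (p (2 * j)) (p (2 * j + 1))) = (\<Prod>j\<in>{..<n} - {i}. A (p (2 * j)) (p (2 * j + 1)))"
      using ne by (auto intro!: prod.cong eq1 eq2 lt)
    have pne: "p (2 * i) \<noteq> p (2 * i + 1)" using inj by (simp add: inj_eq)
    have main: "A (p (2 * i)) (p (2 * i + 1)) = A' (p (2 * i)) (p (2 * i + 1)) - A'' (p (2 * i)) (p (2 * i + 1))"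
      using wi
    proof
      assume "w = 2 * i"
      with w have "p (2 * i) = q" by simp
      with pne lt[of "2 * i + 1"] i row show ?thesis by auto
    next
      assume "w = 2 * i + 1"
      with w have "p (2 * i + 1) = q" by simp
      with pne lt[of "2 * i"] i col show ?thesis by auto
    qed
    have r: "(\<Prod>j<n. f j) = f i * (\<Prod>j\<in>{..<n} - {i}. f j)" for f :: "nat \<Rightarrow> real"
      using i by (simp add: prod.remove)
    show ?thesis
      unfolding pfterm_def r oth main by (simp add: algebra_simps)
  qed
  then show ?thesis
    by (simp add: pfaffian_alt sum_subtractf diff_divide_distrib)
qed

lemma abs_prod_le_power:
  fixes a :: "nat \<Rightarrow> real"
  assumes "\<And>i. i < n \<Longrightarrow> \<bar>a i\<bar> \<le> M"
  shows "\<bar>\<Prod>i<n. a i\<bar> \<le> M ^ n"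
proof -
  have "(\<Prod>i<n. \<bar>a i\<bar>) \<le> (\<Prod>i<n. M)"
    using assms by (intro prod_mono) auto
  then show ?thesis by (simp add: abs_prod)
qed

lemma abs_prod_diff_le:
  fixes a b :: "nat \<Rightarrow> real"
  assumes "1 \<le> M" "\<And>i. i < n \<Longrightarrow> \<bar>a i\<bar> \<le> M" "\<And>i. i < n \<Longrightarrow> \<bar>b i\<bar> \<le> M"
    and "\<And>i. i < n \<Longrightarrow> \<bar>a i - b i\<bar> \<le> e" "0 \<le> e"
  shows "\<bar>(\<Prod>i<n. a i) - (\<Prod>i<n. b i)\<bar> \<le> n * M ^ n * e"
  using assms(2-4)
proof (induction n)
  case (Suc n)
  have IH: "\<bar>(\<Prod>i<n. a i) - (\<Prod>i<n. b i)\<bar> \<le> n * M ^ n * e" using Suc by auto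
  have "(\<Prod>i<Suc n. a i) - (\<Prod>i<Suc n. b i) =
      ((\<Prod>i<n. a i) - (\<Prod>i<n. b i)) * a n + (\<Prod>i<n. b i) * (a n - b n)"
    by (simp add: algebra_simps)
  also have "\<bar>\<dots>\<bar> \<le> (n * M ^ n * e) * M + M ^ n * e"
    unfolding abs_mult[symmetric]
    using Suc.prems IH assms(1,5)
    by (intro order_trans[OF abs_triangle_ineq] add_mono)
       (auto simp: abs_mult intro!: mult_mono abs_prod_le_power)
  also have "\<dots> \<le> (n * M ^ n * e) * M + M ^ n * e * M"
    using assms(1,5) mult_left_mono[of 1 M "M ^ n * e"] by (intro add_left_mono) simp
  finally show ?case by (simp add: algebra_simps)
qed simp

text \<open>Crude bounds suffice: \<open>fact (2 * n)\<close> terms, each a product of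
  \<open>n\<close> bounded entries, and a normalising factor of at least 1. They serve for
  domination and for the error when intervals shrink.\<close>

lemma
  assumes M: "1 \<le> M" and A: "\<And>k l. k < 2 * n \<Longrightarrow> l < 2 * n \<Longrightarrow> \<bar>A k l\<bar> \<le> M"
  shows abs_pfaffian_le: "\<bar>pfaffian n A\<bar> \<le> fact (2 * n) * M ^ n"
    and abs_pfaffian_diff_le: "\<lbrakk>\<And>k l. k < 2 * n \<Longrightarrow> l < 2 * n \<Longrightarrow> \<bar>B k l\<bar> \<le> M;
      \<And>k l. k < 2 * n \<Longrightarrow> l < 2 * n \<Longrightarrow> \<bar>A k l - B k l\<bar> \<le> e; 0 \<le> e\<rbrakk> \<Longrightarrow>
      \<bar>pfaffian n A - pfaffian n B\<bar> \<le> fact (2 * n) * (n * M ^ n * e)"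
proof -
  have c: "card {p. p permutes {..<2 * n}} = fact (2 * n)"
    by (rule card_permutations) auto
  have d: "1 \<le> (2 ^ n * fact n :: real)"
    using mult_mono[of 1 "2 ^ n" 1 "fact n :: real"] by (simp add: fact_ge_1)
  have dd: "x / (2 ^ n * fact n) \<le> x" if "0 \<le> x" for x :: real
    using d that by (simp add: divide_le_eq mult_le_cancel_left1 zero_less_mult_iff)
  have lt: "p (2 * i) < 2 * n" "p (2 * i + 1) < 2 * n" if "p permutes {..<2 * n}" "i < n" for p i
    using permutes_in_image[OF that(1)] that(2) by auto
  have sg: "\<bar>of_int (sign p)\<bar> = (1 :: real)" for p by (simp add: sign_def)
  have "\<bar>\<Sum>p | p permutes {..<2 * n}. pfterm n A p\<bar> \<le> (\<Sum>p | p permutes {..<2 * n}. M ^ n)"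
    unfolding pfterm_def using lt
    by (intro order_trans[OF sum_abs] sum_mono) (auto simp: abs_mult sg intro!: abs_prod_le_power A)
  then have *: "\<bar>\<Sum>p | p permutes {..<2 * n}. pfterm n A p\<bar> \<le> fact (2 * n) * M ^ n"
    by (simp add: c)
  show "\<bar>pfaffian n A\<bar> \<le> fact (2 * n) * M ^ n"
    unfolding pfaffian_alt abs_divide
    using order_trans[OF dd *] by (simp add: abs_mult)
  assume B: "\<And>k l. k < 2 * n \<Longrightarrow> l < 2 * n \<Longrightarrow> \<bar>B k l\<bar> \<le> M"
    "\<And>k l. k < 2 * n \<Longrightarrow> l < 2 * n \<Longrightarrow> \<bar>A k l - B k l\<bar> \<le> e" "0 \<le> e"
  have "\<bar>\<Sum>p | p permutes {..<2 * n}. pfterm n A p - pfterm n B p\<bar>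
      \<le> (\<Sum>p | p permutes {..<2 * n}. n * M ^ n * e)"
    unfolding pfterm_def right_diff_distrib[symmetric] using lt
    by (intro order_trans[OF sum_abs] sum_mono)
       (auto simp: abs_mult sg intro!: abs_prod_diff_le A B M)
  then have *: "\<bar>\<Sum>p | p permutes {..<2 * n}. pfterm n A p - pfterm n B p\<bar> \<le> fact (2 * n) * (n * M ^ n * e)"
    by (simp add: c)
  have "pfaffian n A - pfaffian n B = (\<Sum>p | p permutes {..<2 * n}. pfterm n A p - pfterm n B p) / (2 ^ n * fact n)"
    by (simp add: pfaffian_alt sum_subtractf diff_divide_distrib)
  then show "\<bar>pfaffian n A - pfaffian n B\<bar> \<le> fact (2 * n) * (n * M ^ n * e)"
    using order_trans[OF dd *] by (simp add: abs_mult)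
qed

section \<open>Permutations of two-by-two blocks\<close>

definition blockperm :: "(nat \<Rightarrow> nat) \<Rightarrow> nat \<Rightarrow> nat" where
  "blockperm q k = 2 * q (k div 2) + k mod 2"

lemma blockperm_simps [simp]:
  "blockperm q (2 * i) = 2 * q i" "blockperm q (Suc (2 * i)) = Suc (2 * q i)"
  by (simp_all add: blockperm_def)

lemma blockperm_div [simp]: "blockperm q k div 2 = q (k div 2)"
  and even_blockperm [simp]: "even (blockperm q k) = even k"
  by (simp_all add: blockperm_def even_iff_mod_2_eq_zero)

lemma blockperm_id: "blockperm id = id"
  by (simp add: blockperm_def fun_eq_iff)

lemma blockperm_comp: "blockperm (p \<circ> q) = blockperm p \<circ> blockperm q"
  by (simp add: blockperm_def fun_eq_iff)

lemma blockperm_transpose: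
  "blockperm (Transposition.transpose a b) = Transposition.transpose (2 * a) (2 * b) \<circ> Transposition.transpose (Suc (2 * a)) (Suc (2 * b))"
proof
  fix k :: nat
  have "k = 2 * (k div 2) \<or> k = Suc (2 * (k div 2))" by linarith
  then obtain i where "k = 2 * i \<or> k = Suc (2 * i)" by blast
  moreover have "2 * i \<noteq> Suc (2 * j)" "Suc (2 * j) \<noteq> 2 * i" for i j :: nat by presburger+
  ultimately show "blockperm (Transposition.transpose a b) k =
      (Transposition.transpose (2 * a) (2 * b) \<circ> Transposition.transpose (Suc (2 * a)) (Suc (2 * b))) k"
    by (auto simp: Transposition.transpose_def split: if_splits)
qed

text \<open>A transposition of two blocks lifts to two disjoint transpositions of rows, so block
  permutations are even.\<close>

lemma blockperm_permutes_sign: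
  assumes "q permutes {..<n}"
  shows "blockperm q permutes {..<2 * n} \<and> sign (blockperm q) = 1"
  using assms finite_lessThan
proof (induction rule: permutes_induct)
  case id
  have "blockperm (\<lambda>a. a) = id" using blockperm_id by (simp add: id_def)
  then show ?case using permutes_id[of "{..<2 * n}"] by (simp add: id_def)
next
  case (swap a b p)
  let ?s = "Transposition.transpose (2 * a) (2 * b)" and ?t = "Transposition.transpose (Suc (2 * a)) (Suc (2 * b))"
  have st: "?s permutes {..<2 * n}" "?t permutes {..<2 * n}"
    by (rule permutes_swap_id; use swap(1,2) in simp)+
  note perm = st[THEN permutes_permutation] swap.IH[THEN conjunct1, THEN permutes_permutation]
  have "sign (?s \<circ> ?t) = 1"
    unfolding sign_compose[OF perm(1,2)] using \<open>a \<noteq> b\<close> by (simp add: sign_swap_id)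
  then have "sign ((?s \<circ> ?t) \<circ> blockperm p) = 1"
    unfolding sign_compose[OF permutation_compose[OF perm(1,2)] perm(3)] using swap.IH by simp
  moreover have "(?s \<circ> ?t) \<circ> blockperm p permutes {..<2 * n}"
    using st swap.IH by (intro permutes_compose) auto
  ultimately show ?case
    unfolding blockperm_comp blockperm_transpose by (simp only: simp_thms)
qed

lemmas blockperm_permutes = blockperm_permutes_sign[THEN conjunct1]
  and sign_blockperm = blockperm_permutes_sign[THEN conjunct2]

lemma pfterm_blockperm:
  assumes q: "q permutes {..<n}" and p: "p permutes {..<2 * n}"
  shows "pfterm n A (p \<circ> blockperm q) = pfterm n A p"
proof -
  have "sign (p \<circ> blockperm q) = sign p"
    by (simp add: sign_compose permutes_permutation[OF blockperm_permutes[OF q]]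
        permutes_permutation[OF p] sign_blockperm[OF q])
  then show ?thesis
    using prod.permute[OF q, of "\<lambda>i. A (p (2 * i)) (p (2 * i + 1))"] by (simp add: pfterm_def)
qed

text \<open>Let \<open>u\<close> and \<open>v\<close> be the last two indices. Permutations that do
  not pair them cancel in twos under the exchange of \<open>u\<close> and \<open>v\<close>, since
  the two rows agree elsewhere. Those that pair them put the pair at one of \<open>Suc n\<close>
  places in one of two orders; the factor \<open>2 * Suc n\<close> is the quotient of the two
  normalisations.\<close>

lemma pfaffian_Suc_collapse:
  assumes anti: "\<And>k l. k < 2 * Suc n \<Longrightarrow> l < 2 * Suc n \<Longrightarrow> A k l = - A l k"
    and one: "A (2 * n) (Suc (2 * n)) = 1"
    and same: "\<And>k. k < 2 * n \<Longrightarrow> A (2 * n) k = A (Suc (2 * n)) k"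
  shows "pfaffian (Suc n) A = pfaffian n A"
proof -
  define u v where "u = 2 * n" and "v = Suc (2 * n)"
  define S where "S = {..<2 * Suc n}"
  define P where "P = {p. p permutes S}"
  define T where "T k = {p \<in> P. {p (2 * k), p (2 * k + 1)} = {u, v}}" for k
  define R where "R = P - (\<Union>k<Suc n. T k)"
  define f where "f = pfterm (Suc n) A"
  define \<tau> where "\<tau> = Transposition.transpose u v"
  have fin: "finite P" by (simp add: P_def S_def finite_permutations)
  have uv: "u \<in> S" "v \<in> S" "u \<noteq> v" by (auto simp: u_def v_def S_def)
  have \<tau>: "\<tau> permutes S" using uv by (auto simp: \<tau>_def intro: permutes_swap_id)
  have \<tau>s [simp]: "\<tau> u = v" "\<tau> v = u" "k \<noteq> u \<Longrightarrow> k \<noteq> v \<Longrightarrow> \<tau> k = k" for k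
    by (auto simp: \<tau>_def)
  have \<tau>2: "\<tau> (\<tau> k) = k" for k by (simp add: \<tau>_def)
  have sgn\<tau>: "sign \<tau> = -1" using uv by (simp add: \<tau>_def sign_swap_id)
  have inS: "p k \<in> S" if "p \<in> P" "k \<in> S" for p k
    using that permutes_in_image[of p S k] by (auto simp: P_def)
  have lt: "k < 2 * Suc n" if "k \<in> S" for k using that by (simp add: S_def)
  have inj: "inj p" if "p \<in> P" for p using that by (auto simp: P_def intro: permutes_inj)
  have perm: "permutation p" if "p \<in> P" for p
    using that by (auto simp: P_def S_def intro: permutes_permutation)
  have rowS: "A u k = A v k" if "k \<in> S" "k \<noteq> u" "k \<noteq> v" for k
    using that same[of k] by (auto simp: u_def v_def S_def)
  have colS: "A k u = A k v" if "k \<in> S" "k \<noteq> u" "k \<noteq> v" for k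
    using rowS[OF that] anti[of k u] anti[of k v] that uv lt by auto
  have TP: "T k \<subseteq> P" for k by (auto simp: T_def)
  have disj: "T k \<inter> T l = {}" if "k \<noteq> l" for k l
  proof -
    have "2 * k = 2 * l \<or> 2 * k = 2 * l + 1"
      if "p \<in> T k" "p \<in> T l" for p
    proof -
      have "p (2 * k) \<in> {p (2 * l), p (2 * l + 1)}" using that by (auto simp: T_def)
      then show ?thesis using inj[of p] that by (auto simp: T_def inj_eq)
    qed
    moreover have "2 * k \<noteq> 2 * l + 1" by presburger
    ultimately show ?thesis using that by auto
  qed
  \<comment> \<open>Composition with \<open>\<tau>\<close> is an involution of \<open>R\<close> that
    keeps every factor and reverses the sign, so the sum equals its own negative.\<close>
  have R0: "sum f R = 0"
  proof -
    have closed: "\<tau> \<circ> p \<in> R" if "p \<in> R" for p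
    proof -
      have "\<tau> \<circ> p \<in> P" using that \<tau> by (auto simp: R_def P_def intro: permutes_compose)
      moreover have "p \<in> T k" if "\<tau> \<circ> p \<in> T k" for k
      proof -
        have "{\<tau> (p (2 * k)), \<tau> (p (2 * k + 1))} = {u, v}"
          using that by (simp add: T_def)
        then have "p (2 * k) = \<tau> u \<and> p (2 * k + 1) = \<tau> v \<or> p (2 * k) = \<tau> v \<and> p (2 * k + 1) = \<tau> u"
          unfolding doubleton_eq_iff using \<tau>2 by metis
        then show ?thesis using \<open>p \<in> R\<close> by (auto simp: T_def R_def)
      qed
      ultimately show ?thesis using that by (auto simp: R_def)
    qed
    have \<tau>\<tau>: "\<tau> \<circ> (\<tau> \<circ> p) = p" for p by (simp add: \<tau>_def fun_eq_iff)
    have neg: "f (\<tau> \<circ> p) = - f p" if p: "p \<in> R" for p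
    proof -
      have pP: "p \<in> P" using p by (simp add: R_def)
      have "A (\<tau> (p (2 * i))) (\<tau> (p (2 * i + 1))) = A (p (2 * i)) (p (2 * i + 1))" if i: "i < Suc n" for i
      proof -
        let ?k = "p (2 * i)" and ?l = "p (2 * i + 1)"
        have kl: "?k \<in> S" "?l \<in> S" by (rule inS[OF pP]; use i in \<open>simp add: S_def\<close>)+
        have ne: "?k \<noteq> ?l" using inj[OF pP] by (simp add: inj_eq)
        have notT: "{?k, ?l} \<noteq> {u, v}" using p i pP by (auto simp: R_def T_def)
        consider "?k = u" "?l \<noteq> u" "?l \<noteq> v" | "?k = v" "?l \<noteq> u" "?l \<noteq> v"
          | "?l = u" "?k \<noteq> u" "?k \<noteq> v" | "?l = v" "?k \<noteq> u" "?k \<noteq> v"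
          | "?k \<noteq> u" "?k \<noteq> v" "?l \<noteq> u" "?l \<noteq> v"
          using ne notT by auto
        then show ?thesis
          by cases (use kl rowS colS in \<open>auto simp del: add_2_eq_Suc' One_nat_def\<close>)
      qed
      then have "(\<Prod>i<Suc n. A ((\<tau> \<circ> p) (2 * i)) ((\<tau> \<circ> p) (2 * i + 1))) = (\<Prod>i<Suc n. A (p (2 * i)) (p (2 * i + 1)))"
        by (intro prod.cong) auto
      moreover have "permutation \<tau>" using \<tau> by (simp add: S_def permutes_permutation)
      ultimately show ?thesis
        unfolding f_def pfterm_def by (simp add: sign_compose perm[OF pP] sgn\<tau> del: prod.lessThan_Suc)
    qed
    have "sum f R = sum (\<lambda>p. f (\<tau> \<circ> p)) R"
      by (rule sum.reindex_bij_witness[of R "(\<circ>) \<tau>" "(\<circ>) \<tau>"]) (auto simp: \<tau>\<tau> closed)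
    also have "\<dots> = - sum f R" by (simp add: neg sum_negf)
    finally show ?thesis by simp
  qed
  \<comment> \<open>Exchanging the blocks \<open>k\<close> and \<open>n\<close> of arguments is an
    even permutation; it moves the pair to the last place and keeps the value of the term.\<close>
  have Tk: "sum f (T k) = sum f (T n)" if k: "k < Suc n" for k
  proof -
    define c where "c = Transposition.transpose k n"
    have c: "c permutes {..<Suc n}" using k by (auto simp: c_def intro!: permutes_swap_id)
    have bP: "blockperm c permutes S" using blockperm_permutes[OF c] by (simp add: S_def)
    have bb: "p \<circ> blockperm c \<circ> blockperm c = p" for p :: "nat \<Rightarrow> nat"
      by (simp add: o_assoc[symmetric] blockperm_comp[symmetric]) (simp add: c_def blockperm_id)
    have cl: "p \<circ> blockperm c \<in> T (c l)" if "p \<in> T l" for p l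
    proof -
      have "c (c l) = l" by (simp add: c_def)
      then show ?thesis using that permutes_compose[OF bP, of p] by (simp add: T_def P_def)
    qed
    have "p \<circ> blockperm c \<in> T n" if "p \<in> T k" for p
      using cl[OF that] by (simp add: c_def)
    moreover have "p \<circ> blockperm c \<in> T k" if "p \<in> T n" for p
      using cl[OF that] by (simp add: c_def)
    moreover have "f (p \<circ> blockperm c) = f p" if "p \<in> T k" for p
      using that pfterm_blockperm[OF c, of p A] by (simp add: f_def T_def P_def S_def)
    ultimately show ?thesis
      using bb by (intro sum.reindex_bij_witness[of _ "\<lambda>p. p \<circ> blockperm c" "\<lambda>p. p \<circ> blockperm c"]) auto
  qed
  define Q where "Q = {p. p permutes {..<2 * n}}"
  have QP: "Q \<subseteq> P" by (auto simp: Q_def P_def S_def intro: permutes_subset)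
  have Quv: "p u = u" "p v = v" if "p \<in> Q" for p
    using that permutes_not_in[of p "{..<2 * n}"] by (auto simp: Q_def u_def v_def)
  have QI: "p \<in> Q" if "p \<in> P" "p u = u" "p v = v" for p
    unfolding Q_def mem_Collect_eq
    by (rule permutes_superset[of p S]) (use that in \<open>auto simp: P_def S_def u_def v_def less_Suc_eq\<close>)
  \<comment> \<open>With the pair in the last place only its order is free: \<open>Q\<close> keeps
    it, and composition with \<open>\<tau>\<close> reverses it.\<close>
  have "T n = Q \<union> (\<lambda>p. p \<circ> \<tau>) ` Q"
  proof (intro equalityI subsetI)
    fix p assume "p \<in> T n"
    then have p: "p \<in> P" "{p u, p v} = {u, v}" by (auto simp: T_def u_def v_def)
    show "p \<in> Q \<union> (\<lambda>p. p \<circ> \<tau>) ` Q"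
    proof (cases "p u = u")
      case True
      then have "p v = v" using p by (auto simp: doubleton_eq_iff)
      with True show ?thesis using QI p by auto
    next
      case False
      then have "p u = v" "p v = u" using p by (auto simp: doubleton_eq_iff)
      moreover have "p \<circ> \<tau> \<in> P" using p \<tau> by (auto simp: P_def intro: permutes_compose)
      ultimately have "p \<circ> \<tau> \<in> Q" by (intro QI) auto
      moreover have "p = p \<circ> \<tau> \<circ> \<tau>" by (simp add: \<tau>_def o_assoc[symmetric])
      ultimately show ?thesis by blast
    qed
  next
    fix p assume "p \<in> Q \<union> (\<lambda>p. p \<circ> \<tau>) ` Q"
    then show "p \<in> T n"
    proof
      assume "p \<in> Q"
      then show ?thesis using Quv[of p] QP by (auto simp: T_def u_def v_def)
    next
      assume "p \<in> (\<lambda>p. p \<circ> \<tau>) ` Q"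
      then obtain q where q: "q \<in> Q" "p = q \<circ> \<tau>" by auto
      have "p \<in> P" using q QP \<tau> by (auto simp: P_def intro: permutes_compose)
      moreover have "p u = v" "p v = u" using q Quv[of q] by auto
      then have "p (2 * n) = v" "p (2 * n + 1) = u" by (simp_all add: u_def v_def)
      ultimately show ?thesis by (simp add: T_def insert_commute)
    qed
  qed
  moreover have "Q \<inter> (\<lambda>p. p \<circ> \<tau>) ` Q = {}" using Quv uv by fastforce
  moreover have "inj_on (\<lambda>p. p \<circ> \<tau>) Q"
  proof (rule inj_on_inverseI)
    show "(\<lambda>p. p \<circ> \<tau>) (p \<circ> \<tau>) = p" for p :: "nat \<Rightarrow> nat" by (simp add: \<tau>_def o_assoc[symmetric])
  qed
  moreover have finQ: "finite Q" using QP fin finite_subset by blast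
  ultimately have TnQ: "sum f (T n) = sum f Q + sum (\<lambda>p. f (p \<circ> \<tau>)) Q"
    by (simp add: sum.union_disjoint sum.reindex)
  have fQ: "f p = pfterm n A p" "f (p \<circ> \<tau>) = pfterm n A p" if p: "p \<in> Q" for p
  proof -
    have pP: "p \<in> P" using p QP by auto
    show "f p = pfterm n A p"
      using Quv[OF p] one by (simp add: f_def pfterm_def u_def v_def)
    have "\<tau> (2 * i) = 2 * i" "\<tau> (Suc (2 * i)) = Suc (2 * i)" if "i < n" for i
      by (rule \<tau>s(3); use that in \<open>simp add: u_def v_def; presburger?\<close>)+
    then have "(\<Prod>i<n. A ((p \<circ> \<tau>) (2 * i)) ((p \<circ> \<tau>) (2 * i + 1))) = (\<Prod>i<n. A (p (2 * i)) (p (2 * i + 1)))"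
      by (intro prod.cong) auto
    moreover have "(p \<circ> \<tau>) (2 * n) = v" "(p \<circ> \<tau>) (2 * n + 1) = u"
      using Quv[OF p] \<tau>s by (auto simp: u_def v_def)
    moreover have "A v u = -1" using anti[of v u] one by (simp add: u_def v_def)
    moreover have "permutation \<tau>" using \<tau> by (simp add: S_def permutes_permutation)
    ultimately show "f (p \<circ> \<tau>) = pfterm n A p"
      unfolding f_def pfterm_def by (simp add: sign_compose perm[OF pP] sgn\<tau>)
  qed
  have "sum f P = sum f R + sum f (\<Union>k<Suc n. T k)"
    unfolding R_def using fin TP by (intro sum.subset_diff) auto
  also have "sum f (\<Union>k<Suc n. T k) = (\<Sum>k<Suc n. sum f (T k))"
    using disj finite_subset[OF TP fin] by (intro sum.UNION_disjoint) auto
  also have "\<dots> = (\<Sum>k<Suc n. sum f (T n))"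
    by (intro sum.cong refl Tk) auto
  also have "\<dots> = Suc n * (2 * sum (pfterm n A) Q)"
    using TnQ by (simp add: fQ cong: sum.cong)
  finally have "sum f P = 2 * Suc n * sum (pfterm n A) Q" by (simp add: R0)
  moreover have "2 ^ Suc n * fact (Suc n) = (2 * Suc n) * (2 ^ n * fact n :: real)"
    by simp
  ultimately show ?thesis
    unfolding pfaffian_alt f_def[symmetric] S_def[symmetric] P_def[symmetric] Q_def[symmetric]
    by (simp only:) (subst mult_divide_mult_cancel_left, simp_all)
qed

section \<open>Pfaffians along a list of indices\<close>

definition pfl :: "('i \<Rightarrow> 'i \<Rightarrow> real) \<Rightarrow> 'i list \<Rightarrow> real" where
  "pfl a xs = pfaffian (length xs div 2) (\<lambda>k l. a (xs ! k) (xs ! l))"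

lemma pfl_swap:
  assumes "even (length us + length vs)"
  shows "pfl a (us @ [x, y] @ vs) = - pfl a (us @ [y, x] @ vs)"
proof -
  let ?xs = "us @ [x, y] @ vs" and ?ys = "us @ [y, x] @ vs"
  let ?q = "Transposition.transpose (length us) (Suc (length us))"
  define n where "n = length ?xs div 2"
  have n: "2 * n = length ?xs" using assms by (auto simp: n_def)
  have q: "?q permutes {..<2 * n}" unfolding n by (intro permutes_swap_id) auto
  have "?ys ! k = ?xs ! ?q k" if "k < 2 * n" for k
    using that unfolding n by (auto simp: nth_append Transposition.transpose_def nth_Cons split: nat.splits)
  then have "pfaffian n (\<lambda>k l. a (?ys ! k) (?ys ! l)) = pfaffian n (\<lambda>k l. a (?xs ! ?q k) (?xs ! ?q l))"
    by (intro pfaffian_cong) auto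
  also have "\<dots> = - pfaffian n (\<lambda>k l. a (?xs ! k) (?xs ! l))"
    using pfaffian_permute[OF q, of "\<lambda>k l. a (?xs ! k) (?xs ! l)"] by (simp add: sign_swap_id)
  finally show ?thesis by (simp add: pfl_def n_def)
qed

text \<open>The pair is carried to the end of the list past one element at a time. Each passage
  takes two exchanges of neighbours, whose signs cancel.\<close>

lemma pfl_collapse:
  assumes "even (length us + length vs)"
    and anti: "\<And>k l. k \<in> set (us @ [i, j] @ vs) \<Longrightarrow> l \<in> set (us @ [i, j] @ vs) \<Longrightarrow> a k l = - a l k"
    and one: "a i j = 1"
    and same: "\<And>k. k \<in> set (us @ vs) \<Longrightarrow> a i k = a j k"
  shows "pfl a (us @ [i, j] @ vs) = pfl a (us @ vs)"
  using assms
proof (induction vs arbitrary: us)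
  case Nil
  define n where "n = length us div 2"
  have n: "length us = 2 * n" using Nil.prems(1) by (simp add: n_def)
  have "pfaffian (Suc n) (\<lambda>k l. a ((us @ [i, j]) ! k) ((us @ [i, j]) ! l)) =
      pfaffian n (\<lambda>k l. a ((us @ [i, j]) ! k) ((us @ [i, j]) ! l))"
  proof (rule pfaffian_Suc_collapse)
    fix k l assume "k < 2 * Suc n" "l < 2 * Suc n"
    then have "(us @ [i, j]) ! k \<in> set (us @ [i, j])" "(us @ [i, j]) ! l \<in> set (us @ [i, j])"
      using n by (auto simp del: set_append intro!: nth_mem)
    then show "a ((us @ [i, j]) ! k) ((us @ [i, j]) ! l) = - a ((us @ [i, j]) ! l) ((us @ [i, j]) ! k)"
      by (intro Nil.prems(2)) auto
  next
    fix k assume "k < 2 * n"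
    then show "a ((us @ [i, j]) ! (2 * n)) ((us @ [i, j]) ! k) = a ((us @ [i, j]) ! Suc (2 * n)) ((us @ [i, j]) ! k)"
      using Nil.prems(4)[of "us ! k"] n by (auto simp: nth_append)
  qed (use n Nil.prems(3) in \<open>auto simp: nth_append\<close>)
  also have "\<dots> = pfaffian n (\<lambda>k l. a (us ! k) (us ! l))"
    using n by (intro pfaffian_cong) (auto simp: nth_append)
  finally show ?case using n by (simp add: pfl_def)
next
  case (Cons y vs)
  have "pfl a (us @ [i, j] @ y # vs) = - pfl a (us @ [i, y] @ j # vs)"
    using pfl_swap[of "us @ [i]" vs a j y] Cons.prems(1) by simp
  also have "\<dots> = pfl a ((us @ [y]) @ [i, j] @ vs)"
    using pfl_swap[of us "j # vs" a i y] Cons.prems(1) by simp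
  also have "\<dots> = pfl a ((us @ [y]) @ vs)"
  proof (rule Cons.IH)
    show "even (length (us @ [y]) + length vs)" using Cons.prems(1) by simp
    show "a k l = - a l k" if "k \<in> set ((us @ [y]) @ [i, j] @ vs)" "l \<in> set ((us @ [y]) @ [i, j] @ vs)" for k l
      using that by (intro Cons.prems(2)) auto
    show "a i k = a j k" if "k \<in> set ((us @ [y]) @ vs)" for k
      using that by (intro Cons.prems(4)) auto
  qed (rule Cons.prems(3))
  finally show ?case by simp
qed

section \<open>Brownian motions\<close>

context prob_space begin

text \<open>Independence of increments along finite grids gives the product rule for
  finite-dimensional cylinders of the past. These are stable under intersection, so the rule extends
  to the sigma-algebra they generate.\<close>

lemma brownian_past_indep_increment:
  assumes X: "standard_brownian_motion M X" and s: "0 \<le> s" "s < s'"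
  shows "indep_set (sigma_sets (space M) {X r -` S \<inter> space M | r S. 0 \<le> r \<and> r \<le> s \<and> S \<in> sets borel})
    {(\<lambda>\<omega>. X s' \<omega> - X s \<omega>) -` S \<inter> space M | S. S \<in> sets borel}"
proof -
  define E where "E = {(\<Inter>r\<in>J. X r -` S r \<inter> space M) | J S.
    finite J \<and> J \<noteq> {} \<and> J \<subseteq> {0..s} \<and> (\<forall>r. S r \<in> sets borel)}"
  define D where "D = {(\<lambda>\<omega>. X s' \<omega> - X s \<omega>) -` S \<inter> space M | S. S \<in> sets borel}"
  have meas [measurable]: "X r \<in> borel_measurable M" if "0 \<le> r" for r
    using X that by (auto simp: standard_brownian_motion_def)
  have X0: "X 0 \<omega> = 0" if "\<omega> \<in> space M" for \<omega>
    using X that by (auto simp: standard_brownian_motion_def)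
  have EE: "E \<subseteq> events"
  proof
    fix a assume "a \<in> E"
    then obtain J S where J: "finite J" "J \<noteq> {}" "J \<subseteq> {0..s}" "\<And>r. S r \<in> sets borel"
      "a = (\<Inter>r\<in>J. X r -` S r \<inter> space M)"
      unfolding E_def mem_Collect_eq by blast
    show "a \<in> events"
      unfolding J(5) using J by (intro sets.finite_INT measurable_sets[OF meas]) auto
  qed
  have [measurable]: "X s' \<in> borel_measurable M" "X s \<in> borel_measurable M" using s by auto
  have DD: "D \<subseteq> events"
    unfolding D_def by (auto intro!: measurable_sets)
  have "indep_set E D"
  proof (rule indep_setI[OF EE DD])
    fix a b assume "a \<in> E" "b \<in> D"
    then obtain J S S' where J: "finite J" "J \<noteq> {}" "J \<subseteq> {0..s}" and S: "\<And>r. S r \<in> sets borel"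
      and a: "a = (\<Inter>r\<in>J. X r -` S r \<inter> space M)"
      and b: "b = (\<lambda>\<omega>. X s' \<omega> - X s \<omega>) -` S' \<inter> space M" and S': "S' \<in> sets borel"
      unfolding E_def D_def mem_Collect_eq by blast
    \<comment> \<open>Adding 0 makes every earlier position a partial sum of increments, since the
      path starts at 0; adding \<open>s\<close> makes the last increment exactly the one from
      \<open>s\<close> to \<open>s'\<close>.\<close>
    define J' where "J' = insert 0 (insert s J)"
    define xs where "xs = sorted_list_of_set J'"
    define n where "n = length xs - 1"
    define u where "u k = (xs @ [s']) ! k" for k
    have J': "finite J'" "J' \<noteq> {}" "J' \<subseteq> {0..s}" "0 \<in> J'" "s \<in> J'" "J \<subseteq> J'"
      using J s by (auto simp: J'_def)
    have xs: "set xs = J'" "sorted xs" "distinct xs" "xs \<noteq> []" "length xs = Suc n"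
    proof -
      have "card J' = Suc (card J' - 1)" using J' by (metis Suc_diff_1 card_gt_0_iff)
      moreover have "length xs = card J'" by (simp add: xs_def)
      ultimately show "set xs = J'" "sorted xs" "distinct xs" "xs \<noteq> []" "length xs = Suc n"
        using J' by (simp_all add: xs_def n_def)
    qed
    have uxs: "u k = xs ! k" if "k \<le> n" for k
      using that xs by (auto simp: u_def nth_append)
    have uS: "u (Suc n) = s'" using xs by (auto simp: u_def nth_append)
    have mono: "u k < u l" if "k < l" "l \<le> n" for k l
    proof -
      have "sorted_wrt (<) xs" using xs by (simp add: strict_sorted_iff)
      then show ?thesis using that xs uxs[of k] uxs[of l] by (simp add: sorted_wrt_nth_less)
    qed
    have rng: "u k \<in> J'" if "k \<le> n" for k
      using that xs uxs[of k] nth_mem[of k xs] by auto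
    have idx: "\<exists>k\<le>n. u k = r" if "r \<in> J'" for r
      using that xs uxs by (metis in_set_conv_nth less_Suc_eq_le)
    have u0: "u 0 = 0"
    proof -
      obtain k where k: "k \<le> n" "u k = 0" using idx[OF J'(4)] by auto
      have "u 0 \<ge> 0" using rng[of 0] J' by auto
      then show ?thesis using mono[of 0 k] k by (cases "k = 0") auto
    qed
    have un: "u n = s"
    proof -
      obtain k where k: "k \<le> n" "u k = s" using idx[OF J'(5)] by auto
      have "u n \<le> s" using rng[of n] J' by auto
      then show ?thesis using mono[of k n] k by (cases "k = n") auto
    qed
    have strict: "strict_mono_on {..Suc n} u"
    proof (rule strict_mono_onI)
      fix k l assume "k \<in> {..Suc n}" "l \<in> {..Suc n}" "k < l"
      then show "u k < u l"
        using mono[of k l] uS rng[of k] J' s by (cases "l = Suc n") force+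
    qed
    let ?I = "\<lambda>k \<omega>. X (u (Suc k)) \<omega> - X (u k) \<omega>"
    have "indep_vars (\<lambda>_. borel) ?I {..<Suc n}"
      using X strict u0 unfolding standard_brownian_motion_def by auto
    then have iv: "indep_var (PiM {..<n} (\<lambda>_. borel)) (\<lambda>\<omega>. restrict (\<lambda>k. ?I k \<omega>) {..<n})
        (PiM {n} (\<lambda>_. borel)) (\<lambda>\<omega>. restrict (\<lambda>k. ?I k \<omega>) {n})"
      by (rule indep_var_restrict) auto
    obtain ix where ix: "\<And>r. r \<in> J' \<Longrightarrow> ix r \<le> n \<and> u (ix r) = r" using idx by metis
    let ?A = "{y \<in> space (PiM {..<n} (\<lambda>_. borel)). \<forall>r\<in>J. (\<Sum>l<ix r. y l) \<in> S r}"
    let ?B = "{z \<in> space (PiM {n} (\<lambda>_. borel)). z n \<in> S'}"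
    have [measurable]: "S r \<in> sets borel" "S' \<in> sets borel" for r using S S' by auto
    have A: "?A \<in> sets (PiM {..<n} (\<lambda>_. borel))"
    proof (intro sets.sets_Collect_finite_All' J)
      fix r assume "r \<in> J"
      then have "ix r \<le> n" using ix J' by auto
      then have "(\<lambda>y. \<Sum>l<ix r. 1 * y l) \<in> borel_measurable (PiM {..<n} (\<lambda>_. borel :: real measure))"
        by (intro borel_measurable_sum borel_measurable_times borel_measurable_const measurable_component_singleton) auto
      from measurable_sets[OF this S[of r]]
      have "(\<lambda>y. \<Sum>l<ix r. y l) -` S r \<inter> space (PiM {..<n} (\<lambda>_. borel)) \<in> sets (PiM {..<n} (\<lambda>_. borel))"
        by simp
      moreover have "(\<lambda>y. \<Sum>l<ix r. y l) -` S r \<inter> space (PiM {..<n} (\<lambda>_. borel)) =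
          {y \<in> space (PiM {..<n} (\<lambda>_. borel)). (\<Sum>l<ix r. y l) \<in> S r}" by auto
      ultimately show "{y \<in> space (PiM {..<n} (\<lambda>_. borel)). (\<Sum>l<ix r. y l) \<in> S r} \<in> sets (PiM {..<n} (\<lambda>_. borel))"
        by simp
    qed
    have B: "?B \<in> sets (PiM {n} (\<lambda>_. borel))" by measurable
    have tele: "(\<Sum>l<k. X (u (Suc l)) \<omega> - X (u l) \<omega>) = X (u k) \<omega>" if "\<omega> \<in> space M" for \<omega> k
      using sum_lessThan_telescope[of "\<lambda>l. X (u l) \<omega>" k] X0[OF that] u0 by simp
    have sumA: "(\<Sum>l<ix r. restrict (\<lambda>k. ?I k \<omega>) {..<n} l) = X r \<omega>" if "\<omega> \<in> space M" "r \<in> J" for \<omega> r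
    proof -
      have "ix r \<le> n" "u (ix r) = r" using ix that J' by auto
      then have "(\<Sum>l<ix r. restrict (\<lambda>k. ?I k \<omega>) {..<n} l) = (\<Sum>l<ix r. ?I l \<omega>)"
        by (intro sum.cong) auto
      then show ?thesis using tele[OF that(1)] \<open>u (ix r) = r\<close> by simp
    qed
    have a': "a = (\<lambda>\<omega>. restrict (\<lambda>k. ?I k \<omega>) {..<n}) -` ?A \<inter> space M"
      unfolding a using J(2) sumA by (auto simp: space_PiM simp del: restrict_apply)
    have b': "b = (\<lambda>\<omega>. restrict (\<lambda>k. ?I k \<omega>) {n}) -` ?B \<inter> space M"
      unfolding b by (auto simp: space_PiM un uS)
    have ab': "a \<inter> b = (\<lambda>\<omega>. (restrict (\<lambda>k. ?I k \<omega>) {..<n}, restrict (\<lambda>k. ?I k \<omega>) {n})) -` (?A \<times> ?B) \<inter> space M"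
      unfolding a' b' by auto
    show "prob (a \<inter> b) = prob a * prob b"
      unfolding ab' using indep_varD[OF iv A B] a' b' by simp
  qed
  moreover have "Int_stable E"
  proof (rule Int_stableI)
    fix a b assume "a \<in> E" "b \<in> E"
    obtain J S where J: "finite J" "J \<noteq> {}" "J \<subseteq> {0..s}" "\<And>r. S r \<in> sets borel"
      "a = (\<Inter>r\<in>J. X r -` S r \<inter> space M)"
      using \<open>a \<in> E\<close> unfolding E_def mem_Collect_eq by blast
    obtain J2 S2 where J2: "finite J2" "J2 \<noteq> {}" "J2 \<subseteq> {0..s}" "\<And>r. S2 r \<in> sets borel"
      "b = (\<Inter>r\<in>J2. X r -` S2 r \<inter> space M)"
      using \<open>b \<in> E\<close> unfolding E_def mem_Collect_eq by blast
    define S' where "S' r = (if r \<in> J then S r else UNIV) \<inter> (if r \<in> J2 then S2 r else UNIV)" for r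
    have "a \<inter> b = (\<Inter>r\<in>J \<union> J2. X r -` S' r \<inter> space M)"
      using J(2) J2(2) unfolding J(5) J2(5) S'_def by (auto split: if_splits)
    moreover have "S' r \<in> sets borel" for r using J J2 by (auto simp: S'_def)
    ultimately show "a \<inter> b \<in> E"
      unfolding E_def mem_Collect_eq using J J2 by (intro exI[of _ "J \<union> J2"] exI[of _ S']) auto
  qed
  moreover have "Int_stable D"
    unfolding D_def
  proof (rule Int_stableI, clarify)
    fix S S2 :: "real set" assume "S \<in> sets borel" "S2 \<in> sets borel"
    then show "\<exists>T. ((\<lambda>\<omega>. X s' \<omega> - X s \<omega>) -` S \<inter> space M) \<inter> ((\<lambda>\<omega>. X s' \<omega> - X s \<omega>) -` S2 \<inter> space M) =
        (\<lambda>\<omega>. X s' \<omega> - X s \<omega>) -` T \<inter> space M \<and> T \<in> sets borel"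
      by (intro exI[of _ "S \<inter> S2"]) auto
  qed
  ultimately have ind: "indep_set (sigma_sets (space M) E) (sigma_sets (space M) D)"
    by (rule indep_set_sigma_sets)
  show ?thesis
    unfolding D_def[symmetric]
  proof (rule indep_setI)
    let ?P = "sigma_sets (space M) {X r -` S \<inter> space M | r S. 0 \<le> r \<and> r \<le> s \<and> S \<in> sets borel}"
    have sub: "?P \<subseteq> sigma_sets (space M) E"
    proof (rule sigma_sets_mono')
      show "{X r -` S \<inter> space M | r S. 0 \<le> r \<and> r \<le> s \<and> S \<in> sets borel} \<subseteq> E"
      proof clarify
        fix r and S :: "real set" assume "0 \<le> r" "r \<le> s" "S \<in> sets borel"
        then show "X r -` S \<inter> space M \<in> E"
          unfolding E_def by (intro CollectI exI[of _ "{r}"] exI[of _ "\<lambda>_. S"]) auto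
      qed
    qed
    show "?P \<subseteq> events"
      using sub sets.sigma_sets_subset[OF EE] by blast
    show "D \<subseteq> events" by (rule DD)
    fix a b assume "a \<in> ?P" "b \<in> D"
    then show "prob (a \<inter> b) = prob a * prob b"
      using sub by (intro indep_setD[OF ind]) (auto intro: sigma_sets.Basic)
  qed
qed

end

section \<open>The common past of all motions and the Markov property\<close>

definition past :: "'w measure \<Rightarrow> (nat \<Rightarrow> real \<Rightarrow> 'w \<Rightarrow> real) \<Rightarrow> real \<Rightarrow> 'w measure" where
  "past W B s = sigma (space W) {B i r -` S \<inter> space W | i r S. 0 \<le> r \<and> r \<le> s \<and> S \<in> sets borel}"

lemma space_past [simp]: "space (past W B s) = space W"
  unfolding past_def by (rule space_measure_of) auto

lemma sets_past: "sets (past W B s) =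
    sigma_sets (space W) {B i r -` S \<inter> space W | i r S. 0 \<le> r \<and> r \<le> s \<and> S \<in> sets borel}"
  unfolding past_def by (rule sets_measure_of) auto

lemma measurable_past [measurable (raw)]:
  assumes "0 \<le> r" "r \<le> s"
  shows "B i r \<in> borel_measurable (past W B s)"
proof (rule measurableI)
  fix S :: "real set" assume "S \<in> sets borel"
  then show "B i r -` S \<inter> space (past W B s) \<in> sets (past W B s)"
    unfolding sets_past space_past using assms by (intro sigma_sets.Basic) auto
qed simp

definition gauss :: "nat \<Rightarrow> real \<Rightarrow> (nat \<Rightarrow> real) measure" where
  "gauss n v = PiM {..<n} (\<lambda>_. density lborel (\<lambda>x. ennreal (normal_density 0 (sqrt v) x)))"

lemma sets_gauss [measurable_cong]: "sets (gauss n v) = sets (PiM {..<n} (\<lambda>_. borel))"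
  unfolding gauss_def by (intro sets_PiM_cong) auto

lemma prob_space_normal: "0 < v \<Longrightarrow> prob_space (density lborel (\<lambda>x. ennreal (normal_density 0 (sqrt v) x)))"
  by (rule prob_space_normal_density) simp

lemma prob_space_gauss: "0 < v \<Longrightarrow> prob_space (gauss n v)"
  unfolding gauss_def by (intro prob_space_PiM prob_space_normal)

locale brownian =
  fixes W :: "'w measure" and B :: "nat \<Rightarrow> real \<Rightarrow> 'w \<Rightarrow> real"
  assumes ibm: "independent_brownian_motions W B"
begin

sublocale prob_space W
  using ibm by (simp add: independent_brownian_motions_def)

lemma sbm: "standard_brownian_motion W (B i)"
  using ibm by (simp add: independent_brownian_motions_def)

lemma B_measurable [measurable (raw)]: "0 \<le> r \<Longrightarrow> B i r \<in> borel_measurable W"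
  using sbm[of i] by (simp add: standard_brownian_motion_def)

lemma B_0: "\<omega> \<in> space W \<Longrightarrow> B i 0 \<omega> = 0"
  and B_cont: "\<omega> \<in> space W \<Longrightarrow> continuous_on {0..} (\<lambda>s. B i s \<omega>)"
  using sbm[of i] by (simp_all add: standard_brownian_motion_def)

lemma indep_paths: "indep_vars (\<lambda>_. PiM {0..} (\<lambda>_. borel)) (\<lambda>i \<omega>. \<lambda>s\<in>{0..}. B i s \<omega>) UNIV"
  using ibm by (simp add: independent_brownian_motions_def)

lemma past_subset: "sets (past W B s) \<subseteq> sets W"
  unfolding sets_past by (intro sets.sigma_sets_subset) (auto intro!: measurable_sets)

lemma past_mono: "s \<le> s' \<Longrightarrow> sets (past W B s) \<subseteq> sets (past W B s')"
  unfolding sets_past by (intro sigma_sets_mono') force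

lemma measurable_from_past: "f \<in> measurable (past W B s) N \<Longrightarrow> f \<in> measurable W N"
  using past_subset by (auto simp: measurable_def)

lemma measurable_past_mono: "f \<in> measurable (past W B s) N \<Longrightarrow> s \<le> s' \<Longrightarrow> f \<in> measurable (past W B s') N"
  using past_mono by (fastforce simp: measurable_def)

definition incr :: "nat \<Rightarrow> real \<Rightarrow> real \<Rightarrow> 'w \<Rightarrow> nat \<Rightarrow> real" where
  "incr n s s' \<omega> = (\<lambda>i\<in>{..<n}. B i s' \<omega> - B i s \<omega>)"

text \<open>Different paths are independent, and for each motion the past is independent of the
  increment. Together this gives one independent family indexed by the motion and by the kind, past
  or increment, which is then regrouped by kind.\<close>

lemma past_indep_incr:
  assumes s: "0 \<le> s" "s < s'"
    and A: "A \<in> sets (past W B s)" and C: "C \<in> sets (PiM {..<n} (\<lambda>_. borel))"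
  shows "prob (A \<inter> (incr n s s' -` C \<inter> space W)) = prob A * prob (incr n s s' -` C \<inter> space W)"
proof -
  define P where "P i = sigma_sets (space W) {B i r -` S \<inter> space W | r S. 0 \<le> r \<and> r \<le> s \<and> S \<in> sets borel}" for i
  define D where "D i = {(\<lambda>\<omega>. B i s' \<omega> - B i s \<omega>) -` S \<inter> space W | S. S \<in> sets borel}" for i
  define E where "E = (\<lambda>(i, b). if b then D i else P i)"
  define Z where "Z i = {(\<lambda>\<omega>. \<lambda>s\<in>{0..}. B i s \<omega>) -` A \<inter> space W | A. A \<in> sets (PiM {0..} (\<lambda>_. borel))}" for i
  have PD: "indep_set (P i) (D i)" for i
    unfolding P_def D_def by (rule brownian_past_indep_increment[OF sbm s])
  have Pev: "P i \<subseteq> events" and Dev: "D i \<subseteq> events" for i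
    using PD[of i] unfolding indep_sets2_eq by auto
  have indZ: "indep_sets Z UNIV"
    using indep_paths unfolding indep_vars_def2 Z_def by simp
  have coord: "(\<lambda>y. y r) \<in> borel_measurable (PiM {0..} (\<lambda>_. borel))" if "0 \<le> r" for r :: real
    using that by (intro measurable_component_singleton) auto
  have paths_sp: "(\<lambda>\<omega>. \<lambda>s\<in>{0..}. B i s \<omega>) \<in> space W \<rightarrow> space (PiM {0..} (\<lambda>_. borel))" for i
    by (auto simp: space_PiM)
  have Zalg: "sigma_algebra (space W) (Z i)" for i
  proof -
    have "Z i = sets (vimage_algebra (space W) (\<lambda>\<omega>. \<lambda>s\<in>{0..}. B i s \<omega>) (PiM {0..} (\<lambda>_. borel)))"
      unfolding Z_def by (rule sets_vimage_algebra2[OF paths_sp, symmetric])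
    then show ?thesis by (metis sets.sigma_algebra_axioms space_vimage_algebra)
  qed
  have PZ: "P i \<subseteq> Z i" for i
    unfolding P_def
  proof (rule sigma_algebra.sigma_sets_subset[OF Zalg], clarify)
    fix r and S :: "real set" assume r: "0 \<le> r" "r \<le> s" and S: "S \<in> sets borel"
    have "B i r -` S \<inter> space W = (\<lambda>\<omega>. \<lambda>s\<in>{0..}. B i s \<omega>) -` ((\<lambda>y. y r) -` S \<inter> space (PiM {0..} (\<lambda>_. borel))) \<inter> space W"
      using r by (auto simp: space_PiM)
    then show "B i r -` S \<inter> space W \<in> Z i"
      unfolding Z_def using measurable_sets[OF coord[OF r(1)] S] by blast
  qed
  have DZ: "D i \<subseteq> Z i" for i
    unfolding D_def
  proof clarify
    fix S :: "real set" assume S: "S \<in> sets borel"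
    have m: "(\<lambda>y. y s' - y s) \<in> borel_measurable (PiM {0..} (\<lambda>_. borel :: real measure))"
      using s by (intro borel_measurable_diff coord) auto
    have "(\<lambda>\<omega>. B i s' \<omega> - B i s \<omega>) -` S \<inter> space W =
        (\<lambda>\<omega>. \<lambda>s\<in>{0..}. B i s \<omega>) -` ((\<lambda>y. y s' - y s) -` S \<inter> space (PiM {0..} (\<lambda>_. borel))) \<inter> space W"
      using s by (auto simp: space_PiM)
    then show "(\<lambda>\<omega>. B i s' \<omega> - B i s \<omega>) -` S \<inter> space W \<in> Z i"
      unfolding Z_def using measurable_sets[OF m S] by blast
  qed
  have indE: "indep_sets E UNIV"
    unfolding indep_sets_def
  proof (intro conjI ballI allI impI)
    fix p show "E p \<subseteq> events" using Pev Dev by (auto simp: E_def split: prod.splits if_splits)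
  next
    fix K A assume K: "K \<subseteq> UNIV" "K \<noteq> {}" "finite K" and A: "A \<in> Pi K E"
    \<comment> \<open>Missing events are filled with the whole space, so that every index in
      \<open>I\<close> has both a past event and an increment event.\<close>
    define A' where "A' p = (if p \<in> K then A p else space W)" for p
    define I where "I = fst ` K"
    have AE: "A p \<in> E p" if "p \<in> K" for p by (rule Pi_mem[OF A that])
    have A'P: "A' (i, False) \<in> P i" "A' (i, True) \<in> D i" for i
    proof -
      show "A' (i, False) \<in> P i"
      proof -
        have "A (i, False) \<in> P i" if "(i, False) \<in> K"
          using AE[OF that] by (simp add: E_def)
        moreover have "space W \<in> P i" by (simp add: P_def sigma_sets_top)
        ultimately show ?thesis by (simp add: A'_def)
      qed
      have "space W \<in> D i" unfolding D_def by (intro CollectI exI[of _ UNIV]) auto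
      moreover have "A (i, True) \<in> D i" if "(i, True) \<in> K"
        using AE[OF that] by (simp add: E_def)
      ultimately show "A' (i, True) \<in> D i"
        by (simp add: A'_def)
    qed
    have A'Z: "A' (i, False) \<inter> A' (i, True) \<in> Z i" for i
    proof -
      interpret Z: sigma_algebra "space W" "Z i" by (rule Zalg)
      show ?thesis by (rule Z.Int) (use A'P PZ DZ in blast)+
    qed
    have sp: "A' p \<subseteq> space W" for p
    proof -
      obtain i b where p: "p = (i, b)" by (cases p)
      have "A' (i, False) \<in> events" "A' (i, True) \<in> events"
        by (rule subsetD[OF Pev A'P(1)], rule subsetD[OF Dev A'P(2)])
      then have "A' p \<in> events" by (cases b) (simp_all add: p)
      then show ?thesis by (rule sets.sets_into_space)
    qed
    have fI: "finite I" "I \<noteq> {}" using K by (simp_all add: I_def)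
    have "(\<Inter>p\<in>K. A p) = (\<Inter>i\<in>I. A' (i, False) \<inter> A' (i, True))"
    proof (intro equalityI subsetI)
      fix x assume x: "x \<in> (\<Inter>p\<in>K. A p)"
      obtain p where "p \<in> K" using K by blast
      then have "x \<in> A' p" using x by (simp add: A'_def)
      then have "x \<in> space W" using sp[of p] by blast
      then show "x \<in> (\<Inter>i\<in>I. A' (i, False) \<inter> A' (i, True))" using x by (auto simp: A'_def)
    next
      fix x assume x: "x \<in> (\<Inter>i\<in>I. A' (i, False) \<inter> A' (i, True))"
      show "x \<in> (\<Inter>p\<in>K. A p)"
      proof
        fix p assume p: "p \<in> K"
        obtain i b where ib: "p = (i, b)" by (cases p)
        then have "i \<in> I" using p by (force simp: I_def)
        then have "x \<in> A' p" using x ib by (cases b) auto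
        then show "x \<in> A p" using p by (simp add: A'_def)
      qed
    qed
    moreover have "prob (\<Inter>i\<in>I. A' (i, False) \<inter> A' (i, True)) = (\<Prod>i\<in>I. prob (A' (i, False) \<inter> A' (i, True)))"
      by (rule indep_setsD[OF indZ subset_UNIV fI(2,1)]) (simp add: A'Z)
    ultimately have "prob (\<Inter>p\<in>K. A p) = (\<Prod>i\<in>I. prob (A' (i, False) \<inter> A' (i, True)))"
      by (simp only:)
    also have "\<dots> = (\<Prod>i\<in>I. \<Prod>b\<in>UNIV. prob (A' (i, b)))"
    proof (intro prod.cong refl)
      fix i
      show "prob (A' (i, False) \<inter> A' (i, True)) = (\<Prod>b\<in>UNIV. prob (A' (i, b)))"
        using indep_setD[OF PD A'P[of i]] by (simp add: UNIV_bool mult.commute)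
    qed
    also have "\<dots> = (\<Prod>p\<in>I \<times> UNIV. prob (A' p))"
      by (simp add: prod.cartesian_product)
    also have "\<dots> = (\<Prod>p\<in>K. prob (A' p))"
    proof (rule prod.mono_neutral_right)
      show "finite (I \<times> (UNIV :: bool set))" using fI by simp
      show "K \<subseteq> I \<times> UNIV" by (force simp: I_def)
      show "\<forall>p\<in>I \<times> UNIV - K. prob (A' p) = 1" by (simp add: A'_def prob_space)
    qed
    also have "\<dots> = (\<Prod>p\<in>K. prob (A p))"
      by (simp add: A'_def)
    finally show "prob (\<Inter>p\<in>K. A p) = (\<Prod>p\<in>K. prob (A p))" .
  qed
  have stD: "Int_stable (D i)" for i
    unfolding D_def
  proof (rule Int_stableI, clarify)
    fix S S2 :: "real set" assume "S \<in> sets borel" "S2 \<in> sets borel"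
    then show "\<exists>T. ((\<lambda>\<omega>. B i s' \<omega> - B i s \<omega>) -` S \<inter> space W) \<inter> ((\<lambda>\<omega>. B i s' \<omega> - B i s \<omega>) -` S2 \<inter> space W) =
        (\<lambda>\<omega>. B i s' \<omega> - B i s \<omega>) -` T \<inter> space W \<and> T \<in> sets borel"
      by (intro exI[of _ "S \<inter> S2"]) auto
  qed
  have stP: "Int_stable (P i)" for i
  proof (rule Int_stableI)
    have "{B i r -` S \<inter> space W | r S. 0 \<le> r \<and> r \<le> s \<and> S \<in> sets borel} \<subseteq> Pow (space W)" by blast
    then interpret P: sigma_algebra "space W" "P i"
      unfolding P_def by (rule sigma_algebra_sigma_sets)
    show "a \<inter> b \<in> P i" if "a \<in> P i" "b \<in> P i" for a b
      using that by (rule P.Int)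
  qed
  \<comment> \<open>Regrouping by the Boolean: all pasts together against all increments
    together.\<close>
  have coll: "indep_sets (\<lambda>b. sigma_sets (space W) (\<Union>p\<in>UNIV \<times> {b}. E p)) (UNIV :: bool set)"
  proof (rule indep_sets_collect_sigma)
    show "indep_sets E (\<Union>b\<in>UNIV. UNIV \<times> {b})" by (rule indep_sets_mono_index[OF subset_UNIV indE])
    show "Int_stable (E p)" for p by (cases p) (simp add: E_def stP stD)
    show "disjoint_family_on (\<lambda>b. UNIV \<times> {b}) UNIV" by (auto simp: disjoint_family_on_def)
  qed
  define G where "G b = sigma_sets (space W) (\<Union>p\<in>UNIV \<times> {b}. E p)" for b
  have Esp: "(\<Union>p\<in>UNIV \<times> {b}. E p) \<subseteq> Pow (space W)" for b
  proof (rule UN_least)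
    fix p
    have "E p \<subseteq> events" by (cases p) (simp add: E_def Pev Dev)
    then show "E p \<subseteq> Pow (space W)" using sets.space_closed by blast
  qed
  have past_G: "sets (past W B s) \<subseteq> G False"
    unfolding sets_past G_def
  proof (rule sigma_sets_mono', clarify)
    fix i r and S :: "real set" assume "0 \<le> r" "r \<le> s" "S \<in> sets borel"
    then have "B i r -` S \<inter> space W \<in> E (i, False)"
      unfolding E_def P_def prod.case if_False by (intro sigma_sets.Basic) blast
    then show "B i r -` S \<inter> space W \<in> (\<Union>p\<in>UNIV \<times> {False}. E p)" by blast
  qed
  define MT where "MT = sigma (space W) (\<Union>p\<in>UNIV \<times> {True}. E p)"
  have MT: "space MT = space W" "sets MT = G True"
    unfolding MT_def G_def by (simp_all add: Esp)
  have incrMT: "incr n s s' \<in> measurable MT (PiM {..<n} (\<lambda>_. borel))"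
    unfolding incr_def
  proof (rule measurable_restrict, rule measurableI)
    fix i and S :: "real set" assume "S \<in> sets borel"
    then show "(\<lambda>\<omega>. B i s' \<omega> - B i s \<omega>) -` S \<inter> space MT \<in> sets MT"
    proof -
      have "(\<lambda>\<omega>. B i s' \<omega> - B i s \<omega>) -` S \<inter> space W \<in> E (i, True)"
        unfolding E_def D_def prod.case if_True using \<open>S \<in> sets borel\<close> by blast
      then show ?thesis unfolding MT G_def by (intro sigma_sets.Basic) blast
    qed
  qed simp
  have "incr n s s' -` C \<inter> space W \<in> G True"
    using measurable_sets[OF incrMT C] by (simp only: MT)
  moreover have "indep_set (G True) (G False)"
  proof -
    have "case_bool (G True) (G False) = G" by (simp add: fun_eq_iff split: bool.split)
    then show ?thesis using coll by (simp add: indep_set_def G_def[symmetric])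
  qed
  ultimately have "prob ((incr n s s' -` C \<inter> space W) \<inter> A) = prob (incr n s s' -` C \<inter> space W) * prob A"
    using A past_G by (intro indep_setD) blast+
  then show ?thesis by (simp only: Int_commute mult.commute)
qed

lemma distr_incr:
  assumes s: "0 \<le> s" "s < s'" and n: "0 < n"
  shows "distr W (PiM {..<n} (\<lambda>_. borel)) (incr n s s') = gauss n (s' - s)"
proof -
  have "indep_vars (\<lambda>_. borel) (\<lambda>i \<omega>. (\<lambda>y. y s' - y s) (\<lambda>s\<in>{0..}. B i s \<omega>)) UNIV"
    using s by (intro indep_vars_compose2[OF indep_paths] borel_measurable_diff measurable_component_singleton) auto
  then have "indep_vars (\<lambda>_. borel) (\<lambda>i \<omega>. B i s' \<omega> - B i s \<omega>) UNIV"
    using s by simp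
  then have iv: "indep_vars (\<lambda>_. borel) (\<lambda>i \<omega>. B i s' \<omega> - B i s \<omega>) {..<n}"
    by (rule indep_vars_subset) simp
  have d: "distr W borel (\<lambda>\<omega>. B i s' \<omega> - B i s \<omega>) = density lborel (\<lambda>x. ennreal (normal_density 0 (sqrt (s' - s)) x))" for i
  proof -
    have "distributed W lborel (\<lambda>\<omega>. B i s' \<omega> - B i s \<omega>) (normal_density 0 (sqrt (s' - s)))"
      using sbm[of i] s unfolding standard_brownian_motion_def by blast
    from distributed_distr_eq_density[OF this]
    have "distr W lborel (\<lambda>\<omega>. B i s' \<omega> - B i s \<omega>) = density lborel (\<lambda>x. ennreal (normal_density 0 (sqrt (s' - s)) x))" .
    moreover have "distr W lborel (\<lambda>\<omega>. B i s' \<omega> - B i s \<omega>) = distr W borel (\<lambda>\<omega>. B i s' \<omega> - B i s \<omega>)"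
      by (rule distr_cong) auto
    ultimately show ?thesis by simp
  qed
  have "distr W (PiM {..<n} (\<lambda>_. borel)) (\<lambda>\<omega>. \<lambda>i\<in>{..<n}. B i s' \<omega> - B i s \<omega>) =
      PiM {..<n} (\<lambda>i. distr W borel (\<lambda>\<omega>. B i s' \<omega> - B i s \<omega>))"
    by (rule iffD1[OF indep_vars_iff_distr_eq_PiM' iv]) (use s n in auto)
  moreover have "incr n s s' = (\<lambda>\<omega>. \<lambda>i\<in>{..<n}. B i s' \<omega> - B i s \<omega>)"
    by (simp add: incr_def fun_eq_iff)
  ultimately show ?thesis
    by (simp only: d gauss_def)
qed

lemma id_past_measurable: "(\<lambda>\<omega>. \<omega>) \<in> measurable W (past W B s)"
proof (rule measurableI)
  fix A assume A: "A \<in> sets (past W B s)"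
  have "(\<lambda>\<omega>. \<omega>) -` A \<inter> space W = A" using sets.sets_into_space[OF A] by auto
  then show "(\<lambda>\<omega>. \<omega>) -` A \<inter> space W \<in> events" using A past_subset by auto
qed simp

lemma incr_measurable [measurable (raw)]:
  "0 \<le> s \<Longrightarrow> 0 \<le> s' \<Longrightarrow> incr n s s' \<in> measurable W (PiM {..<n} (\<lambda>_. borel))"
  unfolding incr_def by (intro measurable_restrict) auto

text \<open>The image of \<open>W\<close> under the identity into \<open>past W B s\<close> is the
  restriction of \<open>W\<close> to the past. Independence makes the joint law a product measure,
  so that Fubini can freeze the past; the Markov property is used in this form throughout.\<close>

lemma markov_distr:
  assumes s: "0 \<le> s" "s < s'" "0 < n"
  shows "distr W (past W B s \<Otimes>\<^sub>M PiM {..<n} (\<lambda>_. borel)) (\<lambda>\<omega>. (\<omega>, incr n s s' \<omega>)) =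
    distr W (past W B s) (\<lambda>\<omega>. \<omega>) \<Otimes>\<^sub>M gauss n (s' - s)"
proof (rule pair_measure_eqI[symmetric])
  interpret G: prob_space "gauss n (s' - s)" using s by (intro prob_space_gauss) auto
  interpret D: prob_space "distr W (past W B s) (\<lambda>\<omega>. \<omega>)"
    by (rule prob_space_distr[OF id_past_measurable])
  show "sigma_finite_measure (gauss n (s' - s))" "sigma_finite_measure (distr W (past W B s) (\<lambda>\<omega>. \<omega>))" ..
  have pair: "(\<lambda>\<omega>. (\<omega>, incr n s s' \<omega>)) \<in> measurable W (past W B s \<Otimes>\<^sub>M PiM {..<n} (\<lambda>_. borel))"
    using id_past_measurable incr_measurable s by (intro measurable_Pair) auto
  show "sets (distr W (past W B s) (\<lambda>\<omega>. \<omega>) \<Otimes>\<^sub>M gauss n (s' - s)) =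
      sets (distr W (past W B s \<Otimes>\<^sub>M PiM {..<n} (\<lambda>_. borel)) (\<lambda>\<omega>. (\<omega>, incr n s s' \<omega>)))"
    unfolding sets_distr by (rule sets_pair_measure_cong[OF sets_distr sets_gauss])
  fix A C assume "A \<in> sets (distr W (past W B s) (\<lambda>\<omega>. \<omega>))" "C \<in> sets (gauss n (s' - s))"
  then have A: "A \<in> sets (past W B s)" and C: "C \<in> sets (PiM {..<n} (\<lambda>_. borel))"
    by (simp_all add: sets_gauss)
  have Asp: "A \<subseteq> space W" using sets.sets_into_space[OF A] by simp
  have Aev: "A \<in> events" using A past_subset by auto
  have m: "incr n s s' \<in> measurable W (PiM {..<n} (\<lambda>_. borel))" using s by simp
  have "(\<lambda>\<omega>. (\<omega>, incr n s s' \<omega>)) -` (A \<times> C) \<inter> space W = A \<inter> (incr n s s' -` C \<inter> space W)"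
    using Asp by auto
  then have "emeasure (distr W (past W B s \<Otimes>\<^sub>M PiM {..<n} (\<lambda>_. borel)) (\<lambda>\<omega>. (\<omega>, incr n s s' \<omega>))) (A \<times> C) =
      ennreal (prob A * prob (incr n s s' -` C \<inter> space W))"
    using past_indep_incr[OF s(1,2) A C] by (subst emeasure_distr[OF pair]) (use A C in \<open>auto simp: emeasure_eq_measure\<close>)
  also have "\<dots> = emeasure W A * emeasure W (incr n s s' -` C \<inter> space W)"
    by (simp add: emeasure_eq_measure ennreal_mult)
  also have "emeasure W (incr n s s' -` C \<inter> space W) = emeasure (gauss n (s' - s)) C"
    unfolding distr_incr[OF s, symmetric] by (rule emeasure_distr[OF m C, symmetric])
  also have "emeasure W A = emeasure (distr W (past W B s) (\<lambda>\<omega>. \<omega>)) A"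
    using Asp by (simp add: emeasure_distr[OF id_past_measurable A] Int_absorb2 vimage_def)
  finally show "emeasure (distr W (past W B s) (\<lambda>\<omega>. \<omega>)) A * emeasure (gauss n (s' - s)) C =
      emeasure (distr W (past W B s \<Otimes>\<^sub>M PiM {..<n} (\<lambda>_. borel)) (\<lambda>\<omega>. (\<omega>, incr n s s' \<omega>))) (A \<times> C)" ..
qed

lemma markov_nn_integral:
  assumes s: "0 \<le> s" "s < s'" "0 < n"
    and f: "f \<in> borel_measurable (past W B s \<Otimes>\<^sub>M PiM {..<n} (\<lambda>_. borel))"
  shows "(\<integral>\<^sup>+\<omega>. f (\<omega>, incr n s s' \<omega>) \<partial>W) = (\<integral>\<^sup>+\<omega>. (\<integral>\<^sup>+y. f (\<omega>, y) \<partial>gauss n (s' - s)) \<partial>W)"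
proof -
  interpret G: prob_space "gauss n (s' - s)" using s by (intro prob_space_gauss) auto
  have pair: "(\<lambda>\<omega>. (\<omega>, incr n s s' \<omega>)) \<in> measurable W (past W B s \<Otimes>\<^sub>M PiM {..<n} (\<lambda>_. borel))"
    using id_past_measurable incr_measurable s by (intro measurable_Pair) auto
  have f': "f \<in> borel_measurable (past W B s \<Otimes>\<^sub>M gauss n (s' - s))"
    using f by (simp cong: measurable_cong_sets add: sets_pair_measure_cong[OF refl sets_gauss])
  have "(\<integral>\<^sup>+\<omega>. f (\<omega>, incr n s s' \<omega>) \<partial>W) =
      (\<integral>\<^sup>+z. f z \<partial>distr W (past W B s \<Otimes>\<^sub>M PiM {..<n} (\<lambda>_. borel)) (\<lambda>\<omega>. (\<omega>, incr n s s' \<omega>)))"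
    by (rule nn_integral_distr[OF pair, symmetric]) (simp add: f)
  also have "\<dots> = (\<integral>\<^sup>+\<omega>. (\<integral>\<^sup>+y. f (\<omega>, y) \<partial>gauss n (s' - s)) \<partial>distr W (past W B s) (\<lambda>\<omega>. \<omega>))"
    unfolding markov_distr[OF s]
    by (rule G.nn_integral_fst[symmetric]) (simp add: f' cong: measurable_cong_sets)
  also have "\<dots> = (\<integral>\<^sup>+\<omega>. (\<integral>\<^sup>+y. f (\<omega>, y) \<partial>gauss n (s' - s)) \<partial>W)"
    using G.borel_measurable_nn_integral_fst[OF f'] by (intro nn_integral_distr[OF id_past_measurable]) simp
  finally show ?thesis .
qed

lemma markov_integral:
  fixes f :: "'w \<times> (nat \<Rightarrow> real) \<Rightarrow> real"
  assumes s: "0 \<le> s" "s < s'" "0 < n"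
    and f: "f \<in> borel_measurable (past W B s \<Otimes>\<^sub>M PiM {..<n} (\<lambda>_. borel))"
    and bd: "\<And>z. \<bar>f z\<bar> \<le> C"
  shows "(\<integral>\<omega>. f (\<omega>, incr n s s' \<omega>) \<partial>W) = (\<integral>\<omega>. (\<integral>y. f (\<omega>, y) \<partial>gauss n (s' - s)) \<partial>W)"
proof -
  interpret G: prob_space "gauss n (s' - s)" using s by (intro prob_space_gauss) auto
  interpret D: prob_space "distr W (past W B s) (\<lambda>\<omega>. \<omega>)"
    by (rule prob_space_distr[OF id_past_measurable])
  interpret DG: pair_prob_space "distr W (past W B s) (\<lambda>\<omega>. \<omega>)" "gauss n (s' - s)" ..
  have pair: "(\<lambda>\<omega>. (\<omega>, incr n s s' \<omega>)) \<in> measurable W (past W B s \<Otimes>\<^sub>M PiM {..<n} (\<lambda>_. borel))"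
    using id_past_measurable incr_measurable s by (intro measurable_Pair) auto
  have f': "f \<in> borel_measurable (past W B s \<Otimes>\<^sub>M gauss n (s' - s))"
    using f by (simp cong: measurable_cong_sets add: sets_pair_measure_cong[OF refl sets_gauss])
  have f'': "f \<in> borel_measurable (distr W (past W B s) (\<lambda>\<omega>. \<omega>) \<Otimes>\<^sub>M gauss n (s' - s))"
    using f' by (simp cong: measurable_cong_sets)
  have int: "integrable (distr W (past W B s) (\<lambda>\<omega>. \<omega>) \<Otimes>\<^sub>M gauss n (s' - s)) f"
    by (rule DG.P.integrable_const_bound[of _ C]) (use bd f'' in auto)
  have "(\<integral>\<omega>. f (\<omega>, incr n s s' \<omega>) \<partial>W) =
      (\<integral>z. f z \<partial>distr W (past W B s \<Otimes>\<^sub>M PiM {..<n} (\<lambda>_. borel)) (\<lambda>\<omega>. (\<omega>, incr n s s' \<omega>)))"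
    by (rule integral_distr[OF pair f, symmetric])
  also have "\<dots> = (\<integral>\<omega>. (\<integral>y. f (\<omega>, y) \<partial>gauss n (s' - s)) \<partial>distr W (past W B s) (\<lambda>\<omega>. \<omega>))"
    unfolding markov_distr[OF s] by (rule DG.integral_fst'[OF int, symmetric])
  also have "\<dots> = (\<integral>\<omega>. (\<integral>y. f (\<omega>, y) \<partial>gauss n (s' - s)) \<partial>W)"
    using G.borel_measurable_lebesgue_integral[of "\<lambda>\<omega> y. f (\<omega>, y)" "past W B s"] f'
    by (intro integral_distr[OF id_past_measurable]) simp
  finally show ?thesis .
qed

end

section \<open>Pfaffians over the surviving labels\<close>

text \<open>The sign is decided by the labels and not by the positions. The entry thus remains
  meaningful for free motions that have crossed, where \<open>g\<close> is evaluated at a negative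
  difference.\<close>

definition pair_entry :: "(real \<Rightarrow> real) \<Rightarrow> (nat \<Rightarrow> real) \<Rightarrow> nat \<Rightarrow> nat \<Rightarrow> real" where
  "pair_entry g y i j = (if i < j then g (y j - y i) else if j < i then - g (y i - y j) else 0)"

definition pfs :: "nat set \<Rightarrow> (real \<Rightarrow> real) \<Rightarrow> (nat \<Rightarrow> real) \<Rightarrow> real" where
  "pfs C g y = pfl (pair_entry g y) (sorted_list_of_set C)"

lemma pfs_lessThan: "pfs {..<2 * m} g y = pfaffian m (pair_entry g y)"
proof -
  have "sorted_list_of_set {..<2 * m} = [0..<2 * m]"
    by (metis lessThan_atLeast0 sorted_list_of_set_range)
  then show ?thesis
    unfolding pfs_def pfl_def by (simp, intro pfaffian_cong) simp
qed

lemma pfs_empty [simp]: "pfs {} g y = 1"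
  by (simp add: pfs_def pfl_def pfaffian_def)

lemma pfaffian_zero:
  assumes "0 < n" "\<And>k l. k < 2 * n \<Longrightarrow> l < 2 * n \<Longrightarrow> A k l = 0"
  shows "pfaffian n A = 0"
proof -
  have "pfterm n A p = 0" if "p permutes {..<2 * n}" for p
  proof -
    have "p 0 < 2 * n" "p 1 < 2 * n" using permutes_in_image[OF that, of 0] permutes_in_image[OF that, of 1] assms(1) by auto
    then have "A (p (2 * 0)) (p (2 * 0 + 1)) = 0" using assms(2) by simp
    then have "\<exists>i<n. A (p (2 * i)) (p (2 * i + 1)) = 0" using assms(1) by blast
    then show ?thesis by (auto simp: pfterm_def)
  qed
  then show ?thesis by (simp add: pfaffian_alt)
qed

text \<open>Applied to \<open>crossed\<close>: survivors that are still in their original order at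
  the final time contribute nothing.\<close>

lemma pfs_zero:
  assumes C: "finite C" "even (card C)" "C \<noteq> {}"
    and z: "\<And>i j. i \<in> C \<Longrightarrow> j \<in> C \<Longrightarrow> i < j \<Longrightarrow> g (y j - y i) = 0"
  shows "pfs C g y = 0"
  unfolding pfs_def pfl_def
proof (rule pfaffian_zero)
  show "0 < length (sorted_list_of_set C) div 2"
    using C by (auto elim!: evenE simp: card_gt_0_iff[symmetric])
  fix k l assume "k < 2 * (length (sorted_list_of_set C) div 2)" "l < 2 * (length (sorted_list_of_set C) div 2)"
  then have "sorted_list_of_set C ! k \<in> C" "sorted_list_of_set C ! l \<in> C"
    using C(1) nth_mem[of _ "sorted_list_of_set C"] by auto
  then show "pair_entry g y (sorted_list_of_set C ! k) (sorted_list_of_set C ! l) = 0"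
    using z by (auto simp: pair_entry_def)
qed

lemma abs_pfs_le:
  assumes C: "C \<subseteq> {..<2 * m}" and g: "\<And>d. \<bar>g d\<bar> \<le> 2"
  shows "\<bar>pfs C g y\<bar> \<le> fact (2 * m) * 2 ^ m"
proof -
  have fin: "finite C" using C finite_subset by blast
  define n where "n = card C div 2"
  have "card C \<le> 2 * m" using C card_mono[of "{..<2 * m}" C] by auto
  then have nm: "n \<le> m" by (auto simp: n_def)
  have "\<bar>pfs C g y\<bar> \<le> fact (2 * n) * 2 ^ n"
    unfolding pfs_def pfl_def length_sorted_list_of_set n_def[symmetric]
    by (rule abs_pfaffian_le) (use g in \<open>auto simp: pair_entry_def\<close>)
  also have "\<dots> \<le> fact (2 * m) * (2 ^ m :: real)"
    using nm by (intro mult_mono fact_mono power_increasing) auto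
  finally show ?thesis .
qed

lemma sorted_list_of_set_split:
  fixes C :: "nat set"
  assumes C: "finite C" "i \<in> C" "j \<in> C" "i < j" and bt: "\<And>k. k \<in> C \<Longrightarrow> i < k \<Longrightarrow> k < j \<Longrightarrow> False"
  defines "us \<equiv> sorted_list_of_set {k \<in> C. k < i}" and "vs \<equiv> sorted_list_of_set {k \<in> C. j < k}"
  shows "sorted_list_of_set C = us @ [i, j] @ vs" "sorted_list_of_set (C - {i, j}) = us @ vs"
proof -
  have us: "set us = {k \<in> C. k < i}" "sorted us" "distinct us"
    and vs: "set vs = {k \<in> C. j < k}" "sorted vs" "distinct vs"
    using C by (auto simp: us_def vs_def)
  have tri: "k < i \<or> k = i \<or> k = j \<or> j < k" if "k \<in> C" for k
  proof -
    have "\<not> (i < k \<and> k < j)" using bt[OF that] by blast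
    then show ?thesis by linarith
  qed
  have "sorted (us @ [i, j] @ vs)" "distinct (us @ [i, j] @ vs)"
    using us(2,3) vs(2,3) \<open>i < j\<close> by (auto simp: sorted_append us(1) vs(1))
  then have "sorted_list_of_set (set (us @ [i, j] @ vs)) = us @ [i, j] @ vs"
    by (rule sorted_list_of_set.idem_if_sorted_distinct)
  moreover have "set (us @ [i, j] @ vs) = C"
    using us(1) vs(1) \<open>i \<in> C\<close> \<open>j \<in> C\<close> tri by auto
  ultimately show "sorted_list_of_set C = us @ [i, j] @ vs" by (simp only:)
  have "sorted (us @ vs)" "distinct (us @ vs)"
    using us(2,3) vs(2,3) \<open>i < j\<close> by (auto simp: sorted_append us(1) vs(1))
  then have "sorted_list_of_set (set (us @ vs)) = us @ vs"
    by (rule sorted_list_of_set.idem_if_sorted_distinct)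
  moreover have "set (us @ vs) = C - {i, j}"
    using us(1) vs(1) \<open>i < j\<close> tri by auto
  ultimately show "sorted_list_of_set (C - {i, j}) = us @ vs" by (simp only:)
qed

text \<open>The two order assumptions allow only neighbouring labels of \<open>C\<close> to
  coincide, and never three of them, so the coincidences form disjoint neighbouring pairs. They are
  removed one pair at a time by \<open>pfl_collapse\<close>; \<open>g 0 = 1\<close> supplies the
  entry of the pair.\<close>

lemma pfs_collapse:
  fixes y :: "nat \<Rightarrow> real"
  assumes "finite C" "even (card C)" "g 0 = 1"
    and "\<And>i j. i \<in> C \<Longrightarrow> j \<in> C \<Longrightarrow> i < j \<Longrightarrow> y i \<le> y j"
    and "\<And>i j k. i \<in> C \<Longrightarrow> j \<in> C \<Longrightarrow> k \<in> C \<Longrightarrow> i < j \<Longrightarrow> j < k \<Longrightarrow> y i < y k"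
  shows "pfs (C - {i \<in> C. \<exists>j\<in>C. j \<noteq> i \<and> y i = y j}) g y = pfs C g y \<and>
    even (card (C - {i \<in> C. \<exists>j\<in>C. j \<noteq> i \<and> y i = y j}))"
  using assms
proof (induction "card C" arbitrary: C rule: less_induct)
  case (less C)
  let ?E = "\<lambda>C. {i \<in> C. \<exists>j\<in>C. j \<noteq> i \<and> y i = y j}"
  show ?case
  proof (cases "?E C = {}")
    case True
    then have "C - ?E C = C" by blast
    then show ?thesis using less.prems(2) by (simp only: simp_thms)
  next
    case False
    then obtain i j where ij: "i \<in> C" "j \<in> C" "i < j" "y i = y j"
    proof -
      obtain i j where "i \<in> C" "j \<in> C" "j \<noteq> i" "y i = y j" using False by blast
      then show thesis using that[of i j] that[of j i] by (cases "i < j") auto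
    qed
    have bt: False if "k \<in> C" "i < k" "k < j" for k
      using less.prems(5)[OF ij(1) that(1) ij(2)] that ij by simp
    let ?D = "C - {i, j}"
    let ?us = "sorted_list_of_set {k \<in> C. k < i}" and ?vs = "sorted_list_of_set {k \<in> C. j < k}"
    have sl: "sorted_list_of_set C = ?us @ [i, j] @ ?vs" "sorted_list_of_set ?D = ?us @ ?vs"
      by (rule sorted_list_of_set_split[OF less.prems(1) ij(1-3)]; rule bt; assumption)+
    have cD: "card C = card ?D + 2"
    proof -
      have "card ?D = card C - card {i, j}" by (rule card_Diff_subset) (use ij in auto)
      moreover have "card {i, j} \<le> card C" by (rule card_mono) (use ij less.prems(1) in auto)
      moreover have c: "card {i, j} = 2" using ij(3) by simp
      ultimately show ?thesis unfolding c by linarith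
    qed
    have len: "length ?us + length ?vs = card ?D"
      using arg_cong[OF sl(2), where f = length] by (simp only: length_append length_sorted_list_of_set)
    have "pfs C g y = pfs ?D g y"
      unfolding pfs_def sl
    proof (rule pfl_collapse)
      show "even (length ?us + length ?vs)" using len cD less.prems(2) by simp
      show "pair_entry g y k l = - pair_entry g y l k" for k l by (auto simp: pair_entry_def)
      show "pair_entry g y i j = 1" using ij less.prems(3) by (simp add: pair_entry_def)
      show "pair_entry g y i k = pair_entry g y j k" if "k \<in> set (?us @ ?vs)" for k
        using that less.prems(1) ij by (auto simp: pair_entry_def)
    qed
    moreover have "pfs (?D - ?E ?D) g y = pfs ?D g y \<and> even (card (?D - ?E ?D))"
    proof (rule less.hyps)
      show "card ?D < card C" "even (card ?D)" using cD less.prems(2) by simp_all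
      show "finite ?D" using less.prems(1) by simp
      show "y k \<le> y l" if "k \<in> ?D" "l \<in> ?D" "k < l" for k l
        using that by (intro less.prems(4)) auto
      show "y k < y p" if "k \<in> ?D" "l \<in> ?D" "p \<in> ?D" "k < l" "l < p" for k l p
        using that by (intro less.prems(5)[of k l p]) auto
    qed (rule less.prems(3))
    \<comment> \<open>No third label sits at the place of \<open>i\<close> and \<open>j\<close>, so
      deleting these two leaves the other coincidences intact.\<close>
    moreover have "?D - ?E ?D = C - ?E C"
    proof -
      have ne: "y k \<noteq> y i" if "k \<in> C" "k \<noteq> i" "k \<noteq> j" for k
      proof -
        have "k < i \<or> j < k" using bt[OF that(1)] that(2,3) by (metis linorder_neqE_nat)
        then show ?thesis
        proof
          assume "k < i"
          then show ?thesis using less.prems(5)[OF that(1) ij(1,2)] ij(3,4) by simp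
        next
          assume "j < k"
          then show ?thesis using less.prems(5)[OF ij(1,2) that(1)] ij(3) by simp
        qed
      qed
      show ?thesis
      proof (intro equalityI subsetI)
        fix k assume k: "k \<in> ?D - ?E ?D"
        then have "y k \<noteq> y i" "y k \<noteq> y j" using ne[of k] ij(4) by auto
        then show "k \<in> C - ?E C" using k by auto
      next
        fix k assume k: "k \<in> C - ?E C"
        then have "k \<noteq> i" "k \<noteq> j" using ij by auto
        then show "k \<in> ?D - ?E ?D" using k by auto
      qed
    qed
    ultimately show ?thesis by simp
  qed
qed

section \<open>Annihilating paths observed on a grid\<close>

text \<open>All participants of meetings anywhere in the cell are removed together, without regard
  to the order of the meetings inside it. For a fixed path without later surprises in the cell, that
  is for a fine enough mesh, this reproduces the true annihilation, while the result depends only on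
  the past up to \<open>d\<close>.\<close>

definition grid_step :: "(nat \<Rightarrow> real \<Rightarrow> real) \<Rightarrow> real \<Rightarrow> real \<Rightarrow> nat set \<Rightarrow> nat set" where
  "grid_step x c d A = A - (\<Union>v\<in>{c..d}. meeting x A v)"

primrec grid :: "(nat \<Rightarrow> real \<Rightarrow> real) \<Rightarrow> real \<Rightarrow> nat \<Rightarrow> nat set \<Rightarrow> nat \<Rightarrow> nat set" where
  "grid x t N A 0 = A"
| "grid x t N A (Suc p) = grid_step x (real p * t / real N) (real (Suc p) * t / real N) (grid x t N A p)"

lemma meeting_subset: "meeting x A v \<subseteq> A"
  by (auto simp: meeting_def)

lemma grid_subset: "grid x t N A p \<subseteq> A"
  by (induction p) (auto simp: grid_step_def)

lemma meeting_Diff_meeting: "meeting x (C - meeting x C v) v = {}"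
  by (auto simp: meeting_def)

lemma meeting_mono: "A \<subseteq> C \<Longrightarrow> meeting x A v \<subseteq> meeting x C v"
  by (auto simp: meeting_def)

text \<open>The ceiling selects the first index with grid time at least \<open>u\<close>, so a
  collision at a time \<open>u > 0\<close> falls into the cell that ends at this index.\<close>

definition grid_index :: "real \<Rightarrow> real \<Rightarrow> nat \<Rightarrow> nat" where
  "grid_index t u N = nat \<lceil>u * N / t\<rceil>"

lemma grid_index_0 [simp]: "grid_index t 0 N = 0"
  by (simp add: grid_index_def)

lemma grid_index_le:
  assumes "0 < t" "u \<le> t"
  shows "grid_index t u N \<le> N"
proof -
  have "u * N / t \<le> N"
    using mult_right_mono[OF assms(2), of "real N"] assms(1) by (simp add: pos_divide_le_eq mult.commute)
  then show ?thesis unfolding grid_index_def by (simp add: nat_le_iff ceiling_le_iff)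
qed

lemma grid_index_le_iff:
  assumes "0 < t" "0 < N"
  shows "grid_index t u N \<le> p \<longleftrightarrow> u \<le> p * t / N"
  unfolding grid_index_def nat_le_iff ceiling_le_iff
  using assms by (simp add: pos_divide_le_eq pos_le_divide_eq)

text \<open>A closed time horizon fits the closed grid cells. The strict inequality in the
  extinction probability is recovered later from horizons increasing to \<open>t\<close>.\<close>

definition extinct_by :: "(nat \<Rightarrow> real \<Rightarrow> real) \<Rightarrow> real \<Rightarrow> real \<Rightarrow> nat set \<Rightarrow> bool" where
  "extinct_by x t u C \<longleftrightarrow> (\<exists>k s. (annihilate x ^^ k) (u, C) = (s, {}) \<and> s \<le> t)"

context
  fixes x :: "nat \<Rightarrow> real \<Rightarrow> real" and t :: real
  assumes cont: "\<And>i. continuous_on {0..} (x i)" and t: "0 < t"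
begin

lemma closed_meeting_times:
  assumes "finite C" "0 \<le> u"
  shows "closed {v. u \<le> v \<and> meeting x C v \<noteq> {}}"
proof -
  have "{v. u \<le> v \<and> meeting x C v \<noteq> {}} = (\<Union>i\<in>C. \<Union>j\<in>C - {i}. {v \<in> {u..}. x i v - x j v = 0})"
    by (auto simp: meeting_def)
  moreover have "closed {v \<in> {u..}. x i v - x j v = 0}" for i j
    using assms(2) by (intro continuous_closed_preimage_constant continuous_on_diff continuous_on_subset[OF cont]) auto
  ultimately show ?thesis using assms(1) by (simp, intro closed_UN ballI) simp_all
qed

lemma Inf_meeting_time:
  assumes C: "finite C" "0 \<le> u" "meeting x C u = {}" and ex: "\<exists>v\<ge>u. meeting x C v \<noteq> {}"
  defines "u' \<equiv> Inf {v. u \<le> v \<and> meeting x C v \<noteq> {}}"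
  shows "u < u'" "meeting x C u' \<noteq> {}" "\<And>v. u \<le> v \<Longrightarrow> v < u' \<Longrightarrow> meeting x C v = {}"
    "annihilate x (u, C) = (u', C - meeting x C u')"
proof -
  let ?S = "{v. u \<le> v \<and> meeting x C v \<noteq> {}}"
  have bdd: "bdd_below ?S" by (auto intro!: bdd_belowI[of _ u])
  have mem: "u' \<in> ?S"
    unfolding u'_def using ex bdd closed_meeting_times[OF C(1,2)] by (intro closed_contains_Inf) auto
  then show "meeting x C u' \<noteq> {}" by simp
  show "u < u'" using mem C(3) by (cases "u = u'") auto
  show "meeting x C v = {}" if "u \<le> v" "v < u'" for v
    using cInf_lower[OF _ bdd, of v] that unfolding u'_def by force
  show "annihilate x (u, C) = (u', C - meeting x C u')"
    using ex by (simp add: annihilate_def u'_def Let_def)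
qed

text \<open>Induction along the collisions up to time \<open>t\<close>. Each collision removes at
  least one label, so the number of labels decreases and there are finitely many steps.\<close>

lemma annihilation_induct [consumes 4, case_names stop step]:
  assumes "finite C" "0 \<le> u" "u \<le> t" "meeting x C u = {}"
    and stop: "\<And>u C. \<lbrakk>finite C; 0 \<le> u; u \<le> t; \<And>v. u \<le> v \<Longrightarrow> v \<le> t \<Longrightarrow> meeting x C v = {}\<rbrakk> \<Longrightarrow> P u C"
    and step: "\<And>u C u'. \<lbrakk>finite C; 0 \<le> u; u < u'; u' \<le> t; meeting x C u' \<noteq> {};
      \<And>v. u \<le> v \<Longrightarrow> v < u' \<Longrightarrow> meeting x C v = {};
      annihilate x (u, C) = (u', C - meeting x C u'); P u' (C - meeting x C u')\<rbrakk> \<Longrightarrow> P u C"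
  shows "P u C"
  using assms(1-4)
proof (induction "card C" arbitrary: u C rule: less_induct)
  case (less C u)
  show ?case
  proof (cases "\<exists>v\<ge>u. v \<le> t \<and> meeting x C v \<noteq> {}")
    case False
    then show ?thesis using less.prems by (intro stop) auto
  next
    case True
    then obtain v where v: "u \<le> v" "v \<le> t" "meeting x C v \<noteq> {}" by auto
    define u' where "u' = Inf {v. u \<le> v \<and> meeting x C v \<noteq> {}}"
    have ex: "\<exists>v\<ge>u. meeting x C v \<noteq> {}" using v by auto
    note I = Inf_meeting_time[OF less.prems(1,2,4) ex, folded u'_def]
    have "u' \<le> t" using I(3)[of v] v by (cases "v < u'") auto
    have "meeting x C u' \<subset> C \<or> meeting x C u' = C" using meeting_subset by blast
    have "card (C - meeting x C u') < card C"
      using I(2) less.prems(1) meeting_subset[of x C u'] by (intro psubset_card_mono) auto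
    then have "P u' (C - meeting x C u')"
      using I(1) \<open>u' \<le> t\<close> less.prems by (intro less.hyps) (auto simp: meeting_Diff_meeting)
    then show ?thesis
      using I \<open>u' \<le> t\<close> less.prems by (intro step[of C u u']) auto
  qed
qed

text \<open>There are finitely many pairs, and those that are apart at \<open>u\<close> stay apart
  near \<open>u\<close> by continuity.\<close>

lemma meeting_near:
  assumes "finite C" "0 \<le> u"
  shows "\<exists>e>0. \<forall>v\<ge>0. \<bar>v - u\<bar> < e \<longrightarrow> meeting x C v \<subseteq> meeting x C u"
proof -
  have "\<forall>\<^sub>F v in at u within {0..}. x i v \<noteq> x j v" if "x i u \<noteq> x j u" for i j
  proof -
    have "((\<lambda>v. x i v - x j v) \<longlongrightarrow> x i u - x j u) (at u within {0..})"
      using cont[of i] cont[of j] assms(2) by (intro tendsto_diff) (auto simp: continuous_on_def)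
    from tendsto_imp_eventually_ne[OF this, of 0] that show ?thesis by (auto elim: eventually_mono)
  qed
  then have "\<forall>\<^sub>F v in at u within {0..}. \<forall>i\<in>C. \<forall>j\<in>C. x i u \<noteq> x j u \<longrightarrow> x i v \<noteq> x j v"
    using assms(1) by (intro eventually_ball_finite ballI) (auto simp: eventually_mono)
  then obtain e where e: "e > 0" "\<And>v. v \<ge> 0 \<Longrightarrow> v \<noteq> u \<Longrightarrow> \<bar>v - u\<bar> < e \<Longrightarrow> \<forall>i\<in>C. \<forall>j\<in>C. x i u \<noteq> x j u \<longrightarrow> x i v \<noteq> x j v"
    unfolding eventually_at by (auto simp: dist_real_def)
  show ?thesis
  proof (intro exI[of _ e] conjI allI impI)
    fix v :: real assume v: "0 \<le> v" "\<bar>v - u\<bar> < e"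
    show "meeting x C v \<subseteq> meeting x C u"
    proof (cases "v = u")
      case False
      then show ?thesis using e(2)[OF v(1) False v(2)] by (force simp: meeting_def)
    qed simp
  qed (rule e(1))
qed

lemma grid_constant:
  fixes p q :: nat
  assumes "0 < N" "grid x t N A (grid_index t u N) = C"
    and "\<And>v. u \<le> v \<Longrightarrow> v \<le> q * t / N \<Longrightarrow> meeting x C v = {}"
    and p: "grid_index t u N \<le> p" "p \<le> q"
  shows "grid x t N A p = C"
  using p
proof (induction p rule: dec_induct)
  case base
  show ?case by (rule assms(2))
next
  case (step p)
  have "u \<le> p * t / N" using step(1) grid_index_le_iff[OF t assms(1)] by simp
  moreover have "Suc p * t / N \<le> q * t / N"
    using step.prems t by (intro divide_right_mono mult_right_mono) auto
  ultimately have "meeting x C v = {}" if "v \<in> {p * t / N..Suc p * t / N}" for v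
    using that by (intro assms(3)) auto
  then show ?case using step by (simp add: grid_step_def)
qed

lemma grid_stop:
  assumes u: "0 \<le> u" "u \<le> t" and none: "\<And>v. u \<le> v \<Longrightarrow> v \<le> t \<Longrightarrow> meeting x C v = {}"
    and ev: "\<forall>\<^sub>F N in sequentially. grid x t N A (grid_index t u N) = C"
  shows "\<forall>\<^sub>F N in sequentially. \<forall>p. grid_index t u N \<le> p \<longrightarrow> p \<le> N \<longrightarrow> grid x t N A p = C"
  using ev eventually_gt_at_top[of 0]
proof eventually_elim
  case (elim N)
  show ?case
  proof (intro allI impI)
    fix p assume p: "grid_index t u N \<le> p" "p \<le> N"
    have "real N * t / real N = t" using elim(2) by simp
    then show "grid x t N A p = C"
      using none by (intro grid_constant[OF elim(2,1) _ p]) simp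
  qed
qed

text \<open>On a fine mesh the cell containing \<open>u'\<close> lies in a neighbourhood where only
  the pairs colliding at \<open>u'\<close> can meet, and the cells between \<open>u\<close> and this
  one are free of meetings. So the grid performs exactly the removal at \<open>u'\<close>.\<close>

lemma grid_next:
  assumes C: "finite C" and u: "0 \<le> u" "u < u'" "u' \<le> t"
    and before: "\<And>v. u \<le> v \<Longrightarrow> v < u' \<Longrightarrow> meeting x C v = {}"
    and ev: "\<forall>\<^sub>F N in sequentially. grid x t N A (grid_index t u N) = C"
  shows "\<forall>\<^sub>F N in sequentially. grid_index t u N < grid_index t u' N \<and>
    (\<forall>p. grid_index t u N \<le> p \<longrightarrow> p < grid_index t u' N \<longrightarrow> grid x t N A p = C) \<and>
    grid x t N A (grid_index t u' N) = C - meeting x C u'"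
proof -
  obtain e where e: "e > 0" "\<And>v. v \<ge> 0 \<Longrightarrow> \<bar>v - u'\<bar> < e \<Longrightarrow> meeting x C v \<subseteq> meeting x C u'"
    using meeting_near[OF C, of u'] u by auto
  have "(\<lambda>N. t / real N) \<longlonglongrightarrow> 0" by (rule lim_const_over_n)
  \<comment> \<open>A mesh below \<open>e\<close> keeps the cell inside the neighbourhood; a mesh
    below \<open>u' - u\<close> keeps its left end after \<open>u\<close>.\<close>
  then have "\<forall>\<^sub>F N in sequentially. t / real N < min e (u' - u)"
    using e(1) u by (intro order_tendstoD(2)) auto
  with ev eventually_gt_at_top[of 0] show ?thesis
  proof eventually_elim
    case (elim N)
    define q where "q = grid_index t u' N"
    note iff = grid_index_le_iff[OF t \<open>0 < N\<close>]
    have "0 < q" using iff[of u' 0] u by (auto simp: q_def)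
    then obtain p where p: "q = Suc p" by (cases q) auto
    have lt: "p * t / N < u'" using iff[of u' p] p by (auto simp: q_def)
    have ge: "u' \<le> Suc p * t / N" using iff[of u' q] p by (auto simp: q_def)
    have eq: "Suc p * t / N = p * t / N + t / N" by (simp add: add_divide_distrib distrib_right)
    have te: "t / N < e" "t / N < u' - u" using elim(3) by simp_all
    then have "u \<le> p * t / N" using ge eq by linarith
    then have le: "grid_index t u N \<le> p" using iff by simp
    have const: "grid x t N A p' = C" if "grid_index t u N \<le> p'" "p' \<le> p" for p'
    proof (rule grid_constant[OF elim(2,1) _ that])
      fix v assume "u \<le> v" "v \<le> p * t / N"
      then show "meeting x C v = {}" using lt by (intro before) linarith+
    qed
    have "(\<Union>v\<in>{p * t / N..Suc p * t / N}. meeting x C v) = meeting x C u'"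
    proof (intro equalityI UN_least)
      show "meeting x C u' \<subseteq> (\<Union>v\<in>{p * t / N..Suc p * t / N}. meeting x C v)"
        using lt ge by (intro UN_upper) auto
      fix v assume v: "v \<in> {p * t / N..Suc p * t / N}"
      have "0 \<le> p * t / N" using t by simp
      then have "0 \<le> v" using v by simp
      moreover have "\<bar>v - u'\<bar> < e"
      proof -
        have "p * t / N \<le> v" "v \<le> Suc p * t / N" using v by simp_all
        then show ?thesis using lt ge eq te(1) by linarith
      qed
      ultimately show "meeting x C v \<subseteq> meeting x C u'" by (rule e(2))
    qed
    then have "grid x t N A (Suc p) = C - meeting x C u'"
      using const[OF le order_refl] by (simp add: grid_step_def)
    then show ?case
      unfolding q_def[symmetric] p using le const by (simp add: less_Suc_eq_le)
  qed
qed

lemma fst_annihilate: "finite (snd z) \<Longrightarrow> 0 \<le> fst z \<Longrightarrow> fst z \<le> fst (annihilate x z)"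
  by (cases z) (auto simp: annihilate_def Let_def intro!: cInf_greatest)

lemma annihilate_funpow_mono:
  assumes "finite C" "0 \<le> u"
  shows "u \<le> fst ((annihilate x ^^ k) (u, C)) \<and> snd ((annihilate x ^^ k) (u, C)) \<subseteq> C"
proof (induction k)
  case (Suc k)
  have "snd (annihilate x z) \<subseteq> snd z" for z
    by (cases z) (auto simp: annihilate_def Let_def)
  moreover have "fst ((annihilate x ^^ k) (u, C)) \<le> fst (annihilate x ((annihilate x ^^ k) (u, C)))"
    using Suc assms by (intro fst_annihilate) (auto intro: finite_subset)
  ultimately show ?case
    unfolding funpow.simps o_apply using Suc.IH by (meson order_trans)
qed simp

text \<open>The grid reproduces each collision of the history in turn, and after the last collision
  up to \<open>t\<close> neither process changes.\<close>

lemma grid_extinct: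
  assumes "finite C" "0 \<le> u" "u \<le> t" "meeting x C u = {}"
    and "\<forall>\<^sub>F N in sequentially. grid x t N A (grid_index t u N) = C"
  shows "\<forall>\<^sub>F N in sequentially. grid x t N A N = {} \<longleftrightarrow> extinct_by x t u C"
  using assms
proof (induction u C rule: annihilation_induct)
  case (stop u C)
  \<comment> \<open>If particles remain, a step of \<open>annihilate\<close> leads beyond
    \<open>t\<close> or nowhere, so extinction by \<open>t\<close> means that none was left.\<close>
  have "extinct_by x t u C \<longleftrightarrow> C = {}"
  proof
    assume "C = {}"
    then show "extinct_by x t u C"
      unfolding extinct_by_def using stop by (intro exI[of _ "0::nat"] exI[of _ u]) auto
  next
    assume "extinct_by x t u C"
    then obtain k s where k: "(annihilate x ^^ k) (u, C) = (s, {})" "s \<le> t" by (auto simp: extinct_by_def)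
    show "C = {}"
    proof (cases "\<exists>v\<ge>u. meeting x C v \<noteq> {}")
      case False
      then have "annihilate x (u, C) = (u, C)" by (auto simp: annihilate_def)
      then have "(annihilate x ^^ k) (u, C) = (u, C)" by (induction k) auto
      then show ?thesis using k by simp
    next
      case True
      define u' where "u' = Inf {v. u \<le> v \<and> meeting x C v \<noteq> {}}"
      have "meeting x C u = {}" using stop by auto
      note I = Inf_meeting_time[OF stop(1,2) this True, folded u'_def]
      have "t < u'" using I(1,2) stop(4)[of u'] by (cases "u' \<le> t") auto
      show ?thesis
      proof (cases k)
        case (Suc k')
        then have "(annihilate x ^^ k') (u', C - meeting x C u') = (s, {})"
          using k I(4) by (simp add: funpow_Suc_right del: funpow.simps)
        then have "u' \<le> s" using annihilate_funpow_mono[of "C - meeting x C u'" u' k'] stop(1,2) I(1) by auto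
        then show ?thesis using \<open>t < u'\<close> k(2) by simp
      qed (use k in auto)
    qed
  qed
  moreover have "\<forall>\<^sub>F N in sequentially. \<forall>p. grid_index t u N \<le> p \<longrightarrow> p \<le> N \<longrightarrow> grid x t N A p = C"
    using stop by (intro grid_stop) auto
  ultimately show ?case
    using grid_index_le[OF t stop(3)] by (auto elim!: eventually_mono)
next
  case (step u C u')
  have "\<forall>\<^sub>F N in sequentially. grid x t N A (grid_index t u' N) = C - meeting x C u'"
    by (rule eventually_mono[OF grid_next[OF step(1-4,6) step(9)]]) auto
  from step.IH[OF this] have "\<forall>\<^sub>F N in sequentially. grid x t N A N = {} \<longleftrightarrow> extinct_by x t u' (C - meeting x C u')" .
  moreover have "extinct_by x t u C \<longleftrightarrow> extinct_by x t u' (C - meeting x C u')"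
  proof
    assume "extinct_by x t u C"
    then obtain k s where k: "(annihilate x ^^ k) (u, C) = (s, {})" "s \<le> t" by (auto simp: extinct_by_def)
    have "C \<noteq> {}" using step(5) meeting_subset[of x C u'] by auto
    with k obtain k' where "k = Suc k'" by (cases k) auto
    then show "extinct_by x t u' (C - meeting x C u')"
      using k step(7) unfolding extinct_by_def by (auto simp: funpow_Suc_right simp del: funpow.simps)
  next
    assume "extinct_by x t u' (C - meeting x C u')"
    then obtain k s where k: "(annihilate x ^^ k) (u', C - meeting x C u') = (s, {})" "s \<le> t" by (auto simp: extinct_by_def)
    then have "(annihilate x ^^ Suc k) (u, C) = (s, {})" using step(7) by (simp add: funpow_Suc_right del: funpow.simps)
    then show "extinct_by x t u C" using k unfolding extinct_by_def by blast
  qed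
  ultimately show ?case by simp
qed

lemma grid_time_tendsto:
  assumes "0 \<le> u"
  shows "(\<lambda>N. grid_index t u N * t / N) \<longlonglongrightarrow> u"
proof (rule tendsto_sandwich[of "\<lambda>_. u" _ _ "\<lambda>N. u + t / real N"])
  show "\<forall>\<^sub>F N in sequentially. u \<le> grid_index t u N * t / N"
    using eventually_gt_at_top[of 0]
    by eventually_elim (simp add: grid_index_le_iff[OF t, symmetric])
  show "\<forall>\<^sub>F N in sequentially. grid_index t u N * t / N \<le> u + t / N"
    using eventually_gt_at_top[of 0]
  proof eventually_elim
    case (elim N)
    have "real (grid_index t u N) \<le> u * N / t + 1"
      unfolding grid_index_def using assms t by (simp add: of_nat_nat ceiling_correct)
    then have "grid_index t u N * t / N \<le> (u * N / t + 1) * t / N"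
      using t elim by (intro divide_right_mono mult_right_mono) auto
    also have "\<dots> = u + t / N" using t elim by (simp add: add_divide_distrib distrib_right)
    finally show ?case .
  qed
  have "(\<lambda>N. u + t / real N) \<longlonglongrightarrow> u + 0" by (intro tendsto_add tendsto_const lim_const_over_n)
  then show "(\<lambda>N. u + t / real N) \<longlonglongrightarrow> u" by simp
qed simp

lemma no_crossing:
  assumes "0 \<le> u" "u \<le> w" "x i u < x j u" "\<And>v. u \<le> v \<Longrightarrow> v < w \<Longrightarrow> x i v \<noteq> x j v"
  shows "x i w \<le> x j w"
proof (rule ccontr)
  assume "\<not> x i w \<le> x j w"
  then have gt: "x j w < x i w" by simp
  have "continuous_on {u..w} (\<lambda>v. x i v - x j v)"
    using assms(1) by (intro continuous_on_diff continuous_on_subset[OF cont]) auto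
  then have "\<exists>v\<ge>u. v \<le> w \<and> x i v - x j v = 0"
    by (intro IVT') (use assms(2,3) gt in simp_all)
  then obtain v where v: "u \<le> v" "v \<le> w" "x i v = x j v" by auto
  have "v \<noteq> w" using v(3) gt by auto
  then show False using assms(4)[OF v(1)] v(2,3) by simp
qed

text \<open>A functional \<open>H\<close> of the surviving set and of time that is insensitive to the removal of
  colliding pairs changes by a vanishing amount along the grid approximation.\<close>

lemma grid_jumps_tendsto_0:
  fixes H :: "nat set \<Rightarrow> real \<Rightarrow> real"
  assumes "finite C" "0 \<le> u" "u \<le> t" "meeting x C u = {}"
    and "\<forall>\<^sub>F N in sequentially. grid x t N A (grid_index t u N) = C"
    and "C \<subseteq> A" "even (card C)" "\<And>i j. i \<in> C \<Longrightarrow> j \<in> C \<Longrightarrow> i < j \<Longrightarrow> x i u < x j u"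
    and last: "meeting x A t = {}"
    and triple: "\<And>i j k v. i \<in> A \<Longrightarrow> j \<in> A \<Longrightarrow> k \<in> A \<Longrightarrow> i < j \<Longrightarrow> j < k \<Longrightarrow> 0 \<le> v \<Longrightarrow> v \<le> t \<Longrightarrow>
      \<not> (x i v = x j v \<and> x j v = x k v)"
    and Hcont: "\<And>D. continuous_on {0..<t} (H D)"
    and Hcol: "\<And>D v. D \<subseteq> A \<Longrightarrow> even (card D) \<Longrightarrow> 0 \<le> v \<Longrightarrow> v < t \<Longrightarrow>
      (\<And>i j. i \<in> D \<Longrightarrow> j \<in> D \<Longrightarrow> i < j \<Longrightarrow> x i v \<le> x j v) \<Longrightarrow>
      (\<And>i j k. i \<in> D \<Longrightarrow> j \<in> D \<Longrightarrow> k \<in> D \<Longrightarrow> i < j \<Longrightarrow> j < k \<Longrightarrow> x i v < x k v) \<Longrightarrow>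
      H (D - meeting x D v) v = H D v \<and> even (card (D - meeting x D v))"
  shows "(\<lambda>N. \<Sum>p=grid_index t u N..<N. H (grid x t N A p) (Suc p * t / N) - H (grid x t N A (Suc p)) (Suc p * t / N)) \<longlonglongrightarrow> 0
    \<and> (\<forall>\<^sub>F N in sequentially. even (card (grid x t N A N)))
    \<and> (\<forall>\<^sub>F N in sequentially. \<forall>i\<in>grid x t N A N. \<forall>j\<in>grid x t N A N. i < j \<longrightarrow> x i t < x j t)"
  using assms(1-8)
proof (induction u C rule: annihilation_induct)
  case (stop u C)
  have ev: "\<forall>\<^sub>F N in sequentially. \<forall>p. grid_index t u N \<le> p \<longrightarrow> p \<le> N \<longrightarrow> grid x t N A p = C"
    using stop by (intro grid_stop) auto
  have lt: "x i t < x j t" if "i \<in> C" "j \<in> C" "i < j" for i j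
  proof -
    have "x i v \<noteq> x j v" if "u \<le> v" "v \<le> t" for v
      using stop(4)[OF that] \<open>i \<in> C\<close> \<open>j \<in> C\<close> \<open>i < j\<close> by (auto simp: meeting_def)
    then have "x i t \<le> x j t" "x i t \<noteq> x j t"
      using stop that by (auto intro!: no_crossing[of u])
    then show ?thesis by simp
  qed
  show ?case
  proof (intro conjI)
    show "(\<lambda>N. \<Sum>p=grid_index t u N..<N. H (grid x t N A p) (Suc p * t / N) - H (grid x t N A (Suc p)) (Suc p * t / N)) \<longlonglongrightarrow> 0"
      by (rule tendsto_eventually) (use ev in \<open>auto elim!: eventually_mono intro!: sum.neutral simp del: grid.simps\<close>)
    show "\<forall>\<^sub>F N in sequentially. even (card (grid x t N A N))"
      using ev grid_index_le[OF t stop(3)] stop by (auto elim!: eventually_mono)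
    show "\<forall>\<^sub>F N in sequentially. \<forall>i\<in>grid x t N A N. \<forall>j\<in>grid x t N A N. i < j \<longrightarrow> x i t < x j t"
      using ev
    proof eventually_elim
      case (elim N)
      then have "grid x t N A N = C" using grid_index_le[OF t stop(3)] by auto
      then show ?case using lt by auto
    qed
  qed
next
  case (step u C u')
  let ?C = "C - meeting x C u'"
  define J where "J N p = H (grid x t N A p) (Suc p * t / N) - H (grid x t N A (Suc p)) (Suc p * t / N)" for N p
  have CA: "C \<subseteq> A" using step by simp
  \<comment> \<open>A collision at \<open>t\<close> itself is excluded by \<open>last\<close>; this
    matters because \<open>H\<close> is continuous only before \<open>t\<close>.\<close>
  have "u' < t"
  proof -
    have "meeting x C t = {}" using last meeting_mono[OF CA, of x t] by auto
    then show ?thesis using step(4,5) by (cases "u' = t") auto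
  qed
  have neq: "x i v \<noteq> x j v" if "i \<in> C" "j \<in> C" "i < j" "u \<le> v" "v < u'" for i j v
    using step(6)[OF that(4,5)] that(1-3) by (auto simp: meeting_def)
  have le: "x i u' \<le> x j u'" if "i \<in> C" "j \<in> C" "i < j" for i j
    using step that neq by (intro no_crossing[of u]) auto
  have tr: "x i u' < x k u'" if "i \<in> C" "j \<in> C" "k \<in> C" "i < j" "j < k" for i j k
    using le[of i j] le[of j k] triple[of i j k u'] that CA step(2-4) by (force simp: less_le)
  have Hc: "H ?C u' = H C u' \<and> even (card ?C)"
    using step \<open>u' < t\<close> le tr CA by (intro Hcol) auto
  have ev: "\<forall>\<^sub>F N in sequentially. grid_index t u N < grid_index t u' N \<and>
    (\<forall>p. grid_index t u N \<le> p \<longrightarrow> p < grid_index t u' N \<longrightarrow> grid x t N A p = C) \<and>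
    grid x t N A (grid_index t u' N) = ?C"
    using step by (intro grid_next) auto
  then have ev': "\<forall>\<^sub>F N in sequentially. grid x t N A (grid_index t u' N) = ?C"
    by (auto elim: eventually_mono)
  have lt: "x i u' < x j u'" if "i \<in> ?C" "j \<in> ?C" "i < j" for i j
    using le[of i j] that by (auto simp: meeting_def less_le)
  have IH: "(\<lambda>N. \<Sum>p=grid_index t u' N..<N. J N p) \<longlonglongrightarrow> 0
    \<and> (\<forall>\<^sub>F N in sequentially. even (card (grid x t N A N)))
    \<and> (\<forall>\<^sub>F N in sequentially. \<forall>i\<in>grid x t N A N. \<forall>j\<in>grid x t N A N. i < j \<longrightarrow> x i t < x j t)"
    unfolding J_def using ev' Hc lt CA by (intro step.IH) auto
  have H1: "(\<lambda>N. H D (grid_index t u' N * t / N)) \<longlonglongrightarrow> H D u'" for D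
  proof -
    have "isCont (H D) u' \<or> True" by simp
    have "(H D \<longlongrightarrow> H D u') (at u' within {0..<t})"
      using Hcont[of D] step(2,3) \<open>u' < t\<close> by (simp add: continuous_on_def)
    moreover have "\<forall>\<^sub>F N in sequentially. grid_index t u' N * t / N \<in> {0..<t}"
    proof -
      have "\<forall>\<^sub>F N in sequentially. grid_index t u' N * t / N < t"
        using step(2,3) \<open>u' < t\<close> by (intro order_tendstoD(2)[OF grid_time_tendsto]) auto
      then show ?thesis using t by (auto elim!: eventually_mono)
    qed
    ultimately show ?thesis
      using step(2,3) \<open>u' < t\<close> grid_time_tendsto[of u'] Hcont[of D]
      by (intro continuous_on_tendsto_compose[of "{0..<t}" "H D"]) auto
  qed
  \<comment> \<open>Only the cell containing \<open>u'\<close> changes the surviving set. Its jump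
    is read at the end of the cell and tends to \<open>H C u' - H ?C u'\<close>, which is 0 by
    \<open>Hcol\<close>.\<close>
  have "(\<lambda>N. H C (grid_index t u' N * t / N) - H ?C (grid_index t u' N * t / N)) \<longlonglongrightarrow> H C u' - H ?C u'"
    by (intro tendsto_diff H1)
  then have "(\<lambda>N. (H C (grid_index t u' N * t / N) - H ?C (grid_index t u' N * t / N)) + (\<Sum>p=grid_index t u' N..<N. J N p)) \<longlonglongrightarrow> 0"
    using Hc IH by (auto intro: tendsto_add_zero)
  moreover have "\<forall>\<^sub>F N in sequentially. (\<Sum>p=grid_index t u N..<N. J N p) =
      (H C (grid_index t u' N * t / N) - H ?C (grid_index t u' N * t / N)) + (\<Sum>p=grid_index t u' N..<N. J N p)"
    using ev
  proof eventually_elim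
    case (elim N)
    then obtain q where q: "grid_index t u' N = Suc q" by (cases "grid_index t u' N") auto
    have qN: "Suc q \<le> N" using grid_index_le[OF t step(4), of N] q by simp
    have "(\<Sum>p=grid_index t u N..<N. J N p) =
        (\<Sum>p=grid_index t u N..<Suc q. J N p) + (\<Sum>p=Suc q..<N. J N p)"
      using elim q qN by (intro sum.atLeastLessThan_concat[symmetric]) auto
    also have "(\<Sum>p=grid_index t u N..<Suc q. J N p) = (\<Sum>p=grid_index t u N..<q. J N p) + J N q"
      using elim q by simp
    also have "(\<Sum>p=grid_index t u N..<q. J N p) = 0"
      using elim q by (intro sum.neutral) (auto simp: J_def simp del: grid.simps)
    also have "J N q = H C (Suc q * t / N) - H ?C (Suc q * t / N)"
      using elim q unfolding J_def by (auto simp del: grid.simps)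
    finally show ?case using q by simp
  qed
  ultimately have "(\<lambda>N. \<Sum>p=grid_index t u N..<N. J N p) \<longlonglongrightarrow> 0"
    by (rule Lim_transform_eventually[OF _ eventually_mono]) auto
  then show ?case using IH unfolding J_def by blast
qed

end

section \<open>The Gaussian tail function\<close>

text \<open>The half-line integral of exp(- x^2), rescaled by x = z / 2. It fixes the normalisation
  \<open>F 0 = 1\<close> on which the collapse of a colliding pair depends.\<close>

lemma gaussian_half_line: "has_bochner_integral lborel (\<lambda>z. indicator {0..} z *\<^sub>R exp (- z\<^sup>2 / 4)) (sqrt pi)"
proof -
  have "has_bochner_integral lborel (\<lambda>x. indicator {0..} (0 + (1 / 2) * x) *\<^sub>R exp (- (0 + (1 / 2) * x)\<^sup>2)) ((sqrt pi / 2) /\<^sub>R \<bar>1 / 2\<bar>)"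
    using lborel_has_bochner_integral_real_affine_iff[of "1 / 2" "\<lambda>x. indicator {0..} x *\<^sub>R exp (- x\<^sup>2)" "sqrt pi / 2" 0]
      gaussian_moment_0 by simp
  then show ?thesis
    by (simp add: indicator_def zero_le_mult_iff power_divide field_simps cong: if_cong)
qed

lemma integrable_gaussian: "integrable lborel (\<lambda>z::real. exp (- z\<^sup>2 / 4))"
proof -
  have "(\<lambda>z::real. exp (- z\<^sup>2 / 4)) = (\<lambda>z. sqrt (2 * pi * (sqrt 2)\<^sup>2) * normal_density 0 (sqrt 2) z)"
    by (simp add: normal_density_def fun_eq_iff)
  then show ?thesis using integrable_normal_density[of "sqrt 2" 0] by simp
qed

lemma set_integrable_gaussian: "A \<in> sets borel \<Longrightarrow> set_integrable lborel A (\<lambda>z::real. exp (- z\<^sup>2 / 4))"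
  unfolding set_integrable_def using integrable_gaussian
  by (intro integrable_mult_indicator[of _ lborel, unfolded real_scaleR_def]) simp_all

lemma F_0: "F 0 = 1"
  using has_bochner_integral_integral_eq[OF gaussian_half_line]
  by (simp add: F_def set_lebesgue_integral_def)

lemma F_diff:
  assumes "a \<le> b"
  shows "F a = F b + (1 / sqrt pi) * integral {a..b} (\<lambda>z. exp (- z\<^sup>2 / 4))"
proof -
  have "(LINT z:{a..<b} \<union> {b..}|lborel. exp (- z\<^sup>2 / 4)) =
      (LINT z:{a..<b}|lborel. exp (- z\<^sup>2 / 4)) + (LINT z:{b..}|lborel. exp (- z\<^sup>2 / 4))"
    by (intro set_integral_Un set_integrable_gaussian) auto
  moreover have "{a..<b} \<union> {b..} = {a..}" using assms by auto
  moreover have "(LINT z:{a..<b}|lborel. exp (- z\<^sup>2 / 4)) = (LINT z:{a..b}|lborel. exp (- z\<^sup>2 / 4))"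
    unfolding set_lebesgue_integral_def
  proof (rule integral_cong_AE)
    show "AE z in lborel. indicator {a..<b} z *\<^sub>R exp (- z\<^sup>2 / 4) = indicator {a..b} z *\<^sub>R exp (- z\<^sup>2 / 4)"
      using AE_lborel_singleton[of b] by eventually_elim (auto simp: indicator_def)
  qed simp_all
  moreover have "(LINT z:{a..b}|lborel. exp (- z\<^sup>2 / 4)) = integral {a..b} (\<lambda>z. exp (- z\<^sup>2 / 4))"
    by (intro set_borel_integral_eq_integral set_integrable_gaussian) simp
  ultimately show ?thesis by (simp add: F_def algebra_simps)
qed

lemma F_has_derivative [derivative_intros]:
  "(F has_real_derivative - exp (- x\<^sup>2 / 4) / sqrt pi) (at x)"
proof -
  let ?g = "\<lambda>z::real. exp (- z\<^sup>2 / 4)"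
  have "((\<lambda>y. integral {x - 1..y} ?g) has_real_derivative ?g x) (at x within {x - 1..x + 1})"
    by (rule integral_has_real_derivative) (auto intro!: continuous_intros)
  then have "((\<lambda>y. F (x - 1) - (1 / sqrt pi) * integral {x - 1..y} ?g) has_real_derivative 0 - (1 / sqrt pi) * ?g x) (at x within {x - 1..x + 1})"
    by (intro DERIV_diff DERIV_const DERIV_cmult)
  moreover have "at x within {x - 1..x + 1} = at x"
    by (rule at_within_interior) (simp add: interior_atLeastAtMost_real)
  ultimately have "((\<lambda>y. F (x - 1) - (1 / sqrt pi) * integral {x - 1..y} ?g) has_real_derivative - ?g x / sqrt pi) (at x)"
    by simp
  then show ?thesis
  proof (rule has_field_derivative_transform_within[where d = 1])
    show "F (x - 1) - 1 / sqrt pi * integral {x - 1..y} ?g = F y" if "dist y x < 1" for y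
      using F_diff[of "x - 1" y] that by (auto simp: dist_real_def)
  qed simp_all
qed

lemma F_nonneg: "0 \<le> F x"
  by (simp add: F_def set_lebesgue_integral_def)

text \<open>The bound 2 is the limit of \<open>F\<close> at minus infinity; negative arguments occur
  because differences follow the labels.\<close>

lemma F_le_2: "F x \<le> 2"
proof -
  have "(LINT z:{x..}|lborel. exp (- z\<^sup>2 / 4)) \<le> (LINT z|lborel. exp (- z\<^sup>2 / 4))"
    unfolding set_lebesgue_integral_def
    using integrable_gaussian set_integrable_gaussian[of "{x..}"]
    by (intro integral_mono) (auto simp: indicator_def set_integrable_def)
  also have "(LINT z|lborel. exp (- z\<^sup>2 / 4)) = 2 * sqrt pi"
  proof -
    have "(\<lambda>z::real. exp (- z\<^sup>2 / 4)) = (\<lambda>z. (2 * sqrt pi) * normal_density 0 (sqrt 2) z)"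
      by (simp add: normal_density_def fun_eq_iff real_sqrt_mult)
    then show ?thesis by (simp add: integral_normal_density)
  qed
  finally show ?thesis by (simp add: F_def divide_le_eq)
qed

lemma isCont_F: "isCont F x"
  using F_has_derivative DERIV_isCont by blast

lemma continuous_on_F [continuous_intros]: "continuous_on A f \<Longrightarrow> continuous_on A (\<lambda>x. F (f x))"
  by (rule continuous_on_compose2[of UNIV F]) (auto intro: continuous_at_imp_continuous_on isCont_F)

lemma F_measurable [measurable]: "F \<in> borel_measurable borel"
  by (intro borel_measurable_continuous_onI continuous_on_F continuous_on_id)

section \<open>Gaussian averages of the terminal Pfaffian\<close>

text \<open>For d different from 0 this is the limit of \<open>F (d / sqrt v)\<close> as v decreases
  to 0: the terminal condition of the backward heat flow.\<close>

definition crossed :: "real \<Rightarrow> real" where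
  "crossed d = (if d < 0 then 2 else 0)"

lemma crossed_measurable [measurable]: "crossed \<in> borel_measurable borel"
  unfolding crossed_def by measurable

lemma abs_crossed_le: "\<bar>crossed d\<bar> \<le> 2" and abs_F_le: "\<bar>F d\<bar> \<le> 2"
  using F_nonneg[of d] F_le_2[of d] by (auto simp: crossed_def)

lemma gauss_distributed:
  assumes "0 < v" "i < n"
  shows "distributed (gauss n v) lborel (\<lambda>y. y i) (normal_density 0 (sqrt v))"
proof -
  let ?N = "density lborel (\<lambda>x. ennreal (normal_density 0 (sqrt v) x))"
  have "distr (gauss n v) ?N (\<lambda>y. y i) = ?N"
    unfolding gauss_def using assms by (intro distr_PiM_component prob_space_normal) auto
  moreover have "distr (gauss n v) lborel (\<lambda>y. y i) = distr (gauss n v) ?N (\<lambda>y. y i)"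
    by (rule distr_cong) auto
  moreover have "(\<lambda>y. y i) \<in> measurable (gauss n v) lborel"
    unfolding measurable_cong_sets[OF sets_gauss sets_lborel]
    using assms by (intro measurable_component_singleton) auto
  ultimately show ?thesis
    by (simp add: distributed_def)
qed

lemma gauss_indep:
  assumes "0 < v" "0 < n"
  shows "prob_space.indep_vars (gauss n v) (\<lambda>_. borel) (\<lambda>i y. y i) {..<n}"
proof -
  let ?N = "density lborel (\<lambda>x. ennreal (normal_density 0 (sqrt v) x))"
  interpret prob_space "gauss n v" by (rule prob_space_gauss[OF assms(1)])
  have "distr (gauss n v) (PiM {..<n} (\<lambda>_. borel)) (\<lambda>y. \<lambda>i\<in>{..<n}. y i) = distr (gauss n v) (gauss n v) (\<lambda>y. y)"
  proof (rule distr_cong)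
    show "sets (PiM {..<n} (\<lambda>_. borel)) = sets (gauss n v)" by (rule sets_gauss[symmetric])
    show "(\<lambda>i\<in>{..<n}. y i) = y" if "y \<in> space (gauss n v)" for y
      using that by (simp add: gauss_def space_PiM PiE_def extensional_restrict)
  qed simp
  also have "\<dots> = gauss n v" by (rule distr_id)
  also have "\<dots> = PiM {..<n} (\<lambda>i. distr (gauss n v) borel (\<lambda>y. y i))"
    unfolding gauss_def[of n v]
  proof (rule PiM_cong)
    fix i assume "i \<in> {..<n}"
    then have "distr (gauss n v) ?N (\<lambda>y. y i) = ?N"
      unfolding gauss_def using assms by (intro distr_PiM_component prob_space_normal) auto
    moreover have "distr (gauss n v) borel (\<lambda>y. y i) = distr (gauss n v) ?N (\<lambda>y. y i)"
      by (rule distr_cong) auto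
    ultimately show "?N = distr (PiM {..<n} (\<lambda>_. ?N)) borel (\<lambda>y. y i)"
      by (simp add: gauss_def)
  qed simp
  finally show ?thesis
    using assms gauss_distributed[OF assms(1)]
    by (subst indep_vars_iff_distr_eq_PiM') (auto dest!: distributed_measurable[rotated])
qed

lemma gauss_diff_distributed:
  assumes v: "0 < v" and ij: "i < n" "j < n" "i \<noteq> j"
  shows "distributed (gauss n v) lborel (\<lambda>y. y j - y i) (normal_density 0 (sqrt (v + v)))"
proof -
  interpret prob_space "gauss n v" by (rule prob_space_gauss[OF v])
  have "0 < n" using ij by auto
  have "indep_var borel (\<lambda>y. y j) borel (\<lambda>y. y i)"
  proof -
    have "indep_vars (\<lambda>_. borel) (\<lambda>i y. y i) {..<n}" by (rule gauss_indep[OF v \<open>0 < n\<close>])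
    from indep_var_restrict[OF this, of "{j}" "{i}"]
    have "indep_var (PiM {j} (\<lambda>_. borel)) (\<lambda>y. restrict y {j}) (PiM {i} (\<lambda>_. borel)) (\<lambda>y. restrict y {i})"
      using ij by auto
    from indep_var_compose[OF this, of "\<lambda>z. z j" borel "\<lambda>z. z i" borel]
    show ?thesis by (auto simp: o_def intro: measurable_component_singleton)
  qed
  from diff_indep_normal[OF this _ _ gauss_distributed[OF v ij(2)] gauss_distributed[OF v ij(1)]] v
  show ?thesis by simp
qed

text \<open>The difference of two increments has variance \<open>2 * v\<close>, so the left side is
  twice a normal tail probability. In units of \<open>sqrt v\<close> twice the normal density is the
  integrand of \<open>F\<close>, whose total mass is 2.\<close>

lemma gauss_crossed:
  assumes v: "0 < v" and ij: "i < n" "j < n" "i \<noteq> j"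
  shows "(\<integral>y. crossed (d + (y j - y i)) \<partial>gauss n v) = F (d / sqrt v)"
proof -
  have "(\<integral>y. crossed (d + (y j - y i)) \<partial>gauss n v) = (\<integral>z. normal_density 0 (sqrt (v + v)) z * crossed (d + z) \<partial>lborel)"
    by (rule distributed_integral[symmetric, OF gauss_diff_distributed[OF v ij]]) simp_all
  \<comment> \<open>The substitution z = - sqrt v * u reverses the orientation, so that the event d
    + z < 0 becomes an upper tail.\<close>
  also have "\<dots> = \<bar>- sqrt v\<bar> *\<^sub>R (\<integral>u. normal_density 0 (sqrt (v + v)) (0 + - sqrt v * u) * crossed (d + (0 + - sqrt v * u)) \<partial>lborel)"
    using v by (intro lborel_integral_real_affine) simp
  also have "\<dots> = (\<integral>u. sqrt v * (normal_density 0 (sqrt (v + v)) (0 + - sqrt v * u) * crossed (d + (0 + - sqrt v * u))) \<partial>lborel)"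
    using v by simp
  also have "\<dots> = (\<integral>u. (1 / sqrt pi) * (indicator {d / sqrt v..} u *\<^sub>R exp (- u\<^sup>2 / 4)) \<partial>lborel)"
  proof (rule integral_cong_AE)
    have nd: "sqrt v * normal_density 0 (sqrt (v + v)) (- sqrt v * u) = exp (- u\<^sup>2 / 4) / (2 * sqrt pi)" for u
    proof -
      have "sqrt (2 * pi * (v + v)) = 2 * sqrt pi * sqrt v"
        using v by (simp add: real_sqrt_mult[symmetric] algebra_simps) (simp add: real_sqrt_mult)
      then show ?thesis
        using v by (simp add: normal_density_def power_mult_distrib)
    qed
    \<comment> \<open>Equality fails at one point: \<open>crossed\<close> has a strict inequality,
      whereas the half-line in \<open>F\<close> is closed.\<close>
    show "AE u in lborel. sqrt v * (normal_density 0 (sqrt (v + v)) (0 + - sqrt v * u) * crossed (d + (0 + - sqrt v * u))) =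
        (1 / sqrt pi) * (indicator {d / sqrt v..} u *\<^sub>R exp (- u\<^sup>2 / 4))"
      using AE_lborel_singleton[of "d / sqrt v"]
    proof eventually_elim
      case (elim u)
      have iff: "d + - sqrt v * u < 0 \<longleftrightarrow> d / sqrt v \<le> u"
        using elim v by (auto simp: pos_divide_le_eq mult.commute field_simps)
      have "sqrt v * (normal_density 0 (sqrt (v + v)) (0 + - sqrt v * u) * crossed (d + (0 + - sqrt v * u))) =
          exp (- u\<^sup>2 / 4) / (2 * sqrt pi) * crossed (d + - sqrt v * u)"
        unfolding nd[symmetric] by simp
      then show ?case unfolding crossed_def iff by (simp add: indicator_def)
    qed
  qed simp_all
  also have "\<dots> = F (d / sqrt v)"
    by (simp add: F_def set_lebesgue_integral_def)
  finally show ?thesis .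
qed

lemma pfs_cong:
  assumes C: "finite C" and "\<And>i. i \<in> C \<Longrightarrow> y i = z i"
  shows "pfs C g y = pfs C g z"
  unfolding pfs_def pfl_def
proof (rule pfaffian_cong)
  fix k l assume "k < 2 * (length (sorted_list_of_set C) div 2)" "l < 2 * (length (sorted_list_of_set C) div 2)"
  then have "sorted_list_of_set C ! k \<in> C" "sorted_list_of_set C ! l \<in> C"
    using C nth_mem[of _ "sorted_list_of_set C"] by auto
  then show "pair_entry g y (sorted_list_of_set C ! k) (sorted_list_of_set C ! l) =
      pair_entry g z (sorted_list_of_set C ! k) (sorted_list_of_set C ! l)"
    using assms(2) by (simp add: pair_entry_def)
qed

lemma pair_entry_measurable:
  assumes "g \<in> borel_measurable borel" "(\<lambda>w. y w i) \<in> borel_measurable M" "(\<lambda>w. y w j) \<in> borel_measurable M"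
  shows "(\<lambda>w. pair_entry g (y w) i j) \<in> borel_measurable M"
  using assms unfolding pair_entry_def by measurable

lemma pfs_measurable:
  assumes C: "finite C" and [measurable]: "g \<in> borel_measurable borel"
    and y: "\<And>i. i \<in> C \<Longrightarrow> (\<lambda>w. y w i) \<in> borel_measurable M"
  shows "(\<lambda>w. pfs C g (y w)) \<in> borel_measurable M"
proof -
  let ?xs = "sorted_list_of_set C" and ?n = "card C div 2"
  have "(\<lambda>w. pair_entry g (y w) (?xs ! p (2 * i)) (?xs ! p (2 * i + 1))) \<in> borel_measurable M"
    if p: "p permutes {..<2 * ?n}" and "i < ?n" for p i
  proof -
    have "p (2 * i) < 2 * ?n" "p (2 * i + 1) < 2 * ?n" using permutes_in_image[OF p] that(2) by auto
    then have "?xs ! p (2 * i) \<in> C" "?xs ! p (2 * i + 1) \<in> C"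
      using C nth_mem[of _ ?xs] by auto
    then show ?thesis by (intro pair_entry_measurable y) auto
  qed
  then show ?thesis
    unfolding pfs_def pfl_def pfaffian_alt pfterm_def length_sorted_list_of_set
    by (intro borel_measurable_divide borel_measurable_sum borel_measurable_times borel_measurable_prod borel_measurable_const) auto
qed

text \<open>The pairs of a matching involve disjoint sets of coordinates, so the expectation of the
  Pfaffian is the Pfaffian of the expectations.\<close>

lemma pfs_gauss:
  assumes v: "0 < v" and C: "C \<subseteq> {..<n}" and n: "0 < n"
  shows "(\<integral>y. pfs C crossed (\<lambda>i. x i + y i) \<partial>gauss n v) = pfs C (\<lambda>d. F (d / sqrt v)) x"
proof -
  interpret prob_space "gauss n v" by (rule prob_space_gauss[OF v])
  have fin: "finite C" using C finite_subset by blast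
  have coord: "(\<lambda>y. y i) \<in> borel_measurable (gauss n v)" if "i < n" for i
    using distributed_measurable[OF gauss_distributed[OF v that]] by simp
  let ?xs = "sorted_list_of_set C" and ?n = "card C div 2"
  define E where "E p k y = pair_entry crossed (\<lambda>i. x i + y i) (?xs ! p (2 * k)) (?xs ! p (2 * k + 1))" for p :: "nat \<Rightarrow> nat" and k :: nat and y :: "nat \<Rightarrow> real"
  have bd: "\<bar>E p k y\<bar> \<le> 2" for p k y
    using abs_crossed_le by (auto simp: E_def pair_entry_def)
  have main: "integrable (gauss n v) (\<lambda>y. \<Prod>k<?n. E p k y) \<and> (\<integral>y. (\<Prod>k<?n. E p k y) \<partial>gauss n v) =
      (\<Prod>k<?n. pair_entry (\<lambda>d. F (d / sqrt v)) x (?xs ! p (2 * k)) (?xs ! p (2 * k + 1)))"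
    if p: "p permutes {..<2 * ?n}" for p
  proof -
    have lt: "p (2 * k) < 2 * ?n" "p (2 * k + 1) < 2 * ?n" if "k < ?n" for k
      using permutes_in_image[OF p] that by auto
    have inC: "?xs ! l \<in> C" if "l < 2 * ?n" for l
      using fin nth_mem[of l ?xs] that by auto
    have neq: "?xs ! k \<noteq> ?xs ! l" if "k < 2 * ?n" "l < 2 * ?n" "k \<noteq> l" for k l
      using nth_eq_iff_index_eq[of ?xs k l] that fin by simp
    have pinj: "p k = p l \<longleftrightarrow> k = l" for k l using permutes_inj[OF p] by (simp add: inj_eq)
    define Kk where "Kk k = {?xs ! p (2 * k), ?xs ! p (2 * k + 1)}" for k
    have Ksub: "Kk k \<subseteq> {..<n}" if "k < ?n" for k
      using inC[OF lt(1)[OF that]] inC[OF lt(2)[OF that]] C by (auto simp: Kk_def)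
    have par: "2 * k \<noteq> Suc (2 * l)" "Suc (2 * l) \<noteq> 2 * k" for k l :: nat by presburger+
    have disj: "disjoint_family_on Kk {..<?n}"
      unfolding disjoint_family_on_def
    proof (intro ballI impI)
      fix k l assume kl: "k \<in> {..<?n}" "l \<in> {..<?n}" "k \<noteq> l"
      then have "?xs ! p a \<noteq> ?xs ! p b" if "a \<in> {2 * k, 2 * k + 1}" "b \<in> {2 * l, 2 * l + 1}" for a b
        using that lt[of k] lt[of l] by (intro neq) (auto simp: pinj par)
      then show "Kk k \<inter> Kk l = {}" by (auto simp: Kk_def)
    qed
    have "indep_vars (\<lambda>k. PiM (Kk k) (\<lambda>_. borel)) (\<lambda>k y. restrict (\<lambda>i. y i) (Kk k)) {..<?n}"
      by (rule indep_vars_restrict[OF gauss_indep[OF v n] _ disj]) (use Ksub in auto)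
    then have "indep_vars (\<lambda>_. borel) (\<lambda>k y. E p k (restrict (\<lambda>i. y i) (Kk k))) {..<?n}"
    proof (rule indep_vars_compose2)
      fix k assume "k \<in> {..<?n}"
      show "E p k \<in> borel_measurable (PiM (Kk k) (\<lambda>_. borel))"
        unfolding E_def by (intro pair_entry_measurable borel_measurable_add measurable_component_singleton) (auto simp: Kk_def)
    qed
    moreover have "E p k (restrict (\<lambda>i. y i) (Kk k)) = E p k y" for k y
      by (simp add: E_def pair_entry_def Kk_def)
    ultimately have iv: "indep_vars (\<lambda>_. borel) (\<lambda>k y. E p k y) {..<?n}" by simp
    have int: "integrable (gauss n v) (E p k)" if "k < ?n" for k
    proof (rule integrable_const_bound[of _ 2])
      show "E p k \<in> borel_measurable (gauss n v)"
        using iv that by (auto simp: indep_vars_def)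
    qed (use bd in auto)
    have "(\<integral>y. E p k y \<partial>gauss n v) = pair_entry (\<lambda>d. F (d / sqrt v)) x (?xs ! p (2 * k)) (?xs ! p (2 * k + 1))"
      if k: "k < ?n" for k
    proof -
      define i j where "i = ?xs ! p (2 * k)" and "j = ?xs ! p (2 * k + 1)"
      have ij: "i < n" "j < n" "i \<noteq> j"
        using inC[OF lt(1)[OF k]] inC[OF lt(2)[OF k]] C neq[OF lt[OF k]] by (auto simp: i_def j_def pinj)
      have re: "(x b + y b) - (x a + y a) = (x b - x a) + (y b - y a)" for a b and y :: "nat \<Rightarrow> real" by simp
      show ?thesis
        unfolding E_def i_def[symmetric] j_def[symmetric] pair_entry_def re
        using gauss_crossed[OF v ij(1,2,3)] gauss_crossed[OF v ij(2,1)] ij(3) by auto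
    qed
    then show ?thesis
      using indep_vars_lebesgue_integral[OF finite_lessThan iv] indep_vars_integrable[OF finite_lessThan iv] int
      by simp
  qed
  have "(\<integral>y. pfs C crossed (\<lambda>i. x i + y i) \<partial>gauss n v) =
      (\<integral>y. (\<Sum>p | p permutes {..<2 * ?n}. of_int (sign p) * (\<Prod>k<?n. E p k y)) / (2 ^ ?n * fact ?n) \<partial>gauss n v)"
    unfolding pfs_def pfl_def pfaffian_alt pfterm_def E_def by simp
  also have "\<dots> = (\<Sum>p | p permutes {..<2 * ?n}. of_int (sign p) * (\<integral>y. (\<Prod>k<?n. E p k y) \<partial>gauss n v)) / (2 ^ ?n * fact ?n)"
    using main by (subst integral_divide_zero, subst Bochner_Integration.integral_sum) auto
  also have "\<dots> = pfs C (\<lambda>d. F (d / sqrt v)) x"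
    unfolding pfs_def pfl_def pfaffian_alt pfterm_def length_sorted_list_of_set
    using main by (intro arg_cong2[where f = divide] sum.cong refl) auto
  finally show ?thesis .
qed

section \<open>No triple collisions\<close>

text \<open>Replaces an uncountable choice of times by countable operations over rational times,
  which makes meeting events measurable. Continuity and density of the rationals give one direction,
  the minimum on a compact interval the other.\<close>

lemma zero_on_interval_iff:
  fixes f :: "real \<Rightarrow> real"
  assumes cont: "continuous_on {c..d} f" and cd: "c < d" and nonneg: "\<And>v. 0 \<le> f v"
  shows "(\<exists>v\<in>{c..d}. f v = 0) \<longleftrightarrow> (\<forall>k::nat. \<exists>q\<in>\<rat> \<inter> {c..d}. f q < 1 / Suc k)"
proof
  assume "\<exists>v\<in>{c..d}. f v = 0"
  then obtain v where v: "v \<in> {c..d}" "f v = 0" by auto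
  show "\<forall>k::nat. \<exists>q\<in>\<rat> \<inter> {c..d}. f q < 1 / Suc k"
  proof
    fix k :: nat
    have "0 < 1 / real (Suc k)" by simp
    then obtain e where e: "e > 0" "\<And>w. w \<in> {c..d} \<Longrightarrow> dist w v < e \<Longrightarrow> dist (f w) (f v) < 1 / Suc k"
      using cont v(1) unfolding continuous_on_iff by meson
    have "max c (v - e) < min d (v + e)" using v e cd by auto
    then obtain q where q: "q \<in> \<rat>" "max c (v - e) < q" "q < min d (v + e)"
      using Rats_dense_in_real by blast
    then have "f q < 1 / Suc k"
      using e(2)[of q] v(2) nonneg[of q] by (auto simp: dist_real_def)
    then show "\<exists>q\<in>\<rat> \<inter> {c..d}. f q < 1 / Suc k" using q by (intro bexI[of _ q]) auto
  qed
next
  assume *: "\<forall>k::nat. \<exists>q\<in>\<rat> \<inter> {c..d}. f q < 1 / Suc k"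
  obtain v where v: "v \<in> {c..d}" "\<And>w. w \<in> {c..d} \<Longrightarrow> f v \<le> f w"
    using continuous_attains_inf[of "{c..d}" f] cont cd by auto
  have "f v < 1 / Suc k" for k
  proof -
    obtain q where "q \<in> \<rat> \<inter> {c..d}" "f q < 1 / Suc k" using * by blast
    then show ?thesis using v(2)[of q] by simp
  qed
  then have "\<not> 0 < f v" using reals_Archimedean[of "f v"] by (metis inverse_eq_divide less_asym)
  then show "\<exists>v\<in>{c..d}. f v = 0" using v(1) nonneg[of v] by (intro bexI[of _ v]) auto
qed

section \<open>A Green function for three particles\<close>

lemma normal_density_minus: "normal_density 0 \<sigma> (- z) = normal_density 0 \<sigma> z"
  by (simp add: normal_density_def)

lemma nn_integral_normal_shift:
  assumes "0 < v" "0 < \<delta>"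
  shows "(\<integral>\<^sup>+z. ennreal (normal_density 0 (sqrt v) (m - (x + z))) \<partial>density lborel (\<lambda>x. ennreal (normal_density 0 (sqrt \<delta>) x)))
    = ennreal (normal_density 0 (sqrt (v + \<delta>)) (m - x))"
proof -
  have "(\<integral>\<^sup>+z. ennreal (normal_density 0 (sqrt v) (m - (x + z))) \<partial>density lborel (\<lambda>x. ennreal (normal_density 0 (sqrt \<delta>) x))) =
      (\<integral>\<^sup>+z. ennreal (normal_density 0 (sqrt v) ((m - x) - z) * normal_density 0 (sqrt \<delta>) z) \<partial>lborel)"
    by (subst nn_integral_density) (auto simp: ennreal_mult' mult.commute diff_diff_eq intro!: nn_integral_cong)
  also have "\<dots> = ennreal (normal_density 0 (sqrt ((sqrt v)\<^sup>2 + (sqrt \<delta>)\<^sup>2)) (m - x))"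
    using conv_normal_density_zero_mean[of "sqrt v" "sqrt \<delta>"] assms by (simp add: fun_eq_iff)
  finally show ?thesis using assms by simp
qed

text \<open>A positive function of the positions of the particles in \<open>I\<close> that only depends on their
  mutual distances and is turned into itself, with a larger \<open>v\<close>, by the heat flow.\<close>

definition spread :: "nat set \<Rightarrow> real \<Rightarrow> (nat \<Rightarrow> real) \<Rightarrow> ennreal" where
  "spread I v x = (\<integral>\<^sup>+m. (\<Prod>l\<in>I. ennreal (normal_density 0 (sqrt v) (m - x l))) \<partial>lborel)"

lemma spread_measurable:
  assumes "finite I" "\<And>l. l \<in> I \<Longrightarrow> (\<lambda>w. x w l) \<in> borel_measurable M"
  shows "(\<lambda>w. spread I v (x w)) \<in> borel_measurable M"
proof -
  have "(\<lambda>(w, m). \<Prod>l\<in>I. ennreal (normal_density 0 (sqrt v) (m - x w l))) \<in> borel_measurable (M \<Otimes>\<^sub>M lborel)"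
    unfolding split_beta'
  proof (intro borel_measurable_prod_ennreal)
    fix l assume "l \<in> I"
    note [measurable] = assms(2)[OF this]
    show "(\<lambda>p. ennreal (normal_density 0 (sqrt v) (snd p - x (fst p) l))) \<in> borel_measurable (M \<Otimes>\<^sub>M lborel)"
      by measurable
  qed
  then show ?thesis
    unfolding spread_def by (rule sigma_finite_measure.borel_measurable_nn_integral[OF sigma_finite_lborel])
qed

text \<open>Fubini moves the Gaussian average inside the integral over \<open>m\<close>, where the
  coordinates separate and each factor is a convolution of normal densities. The function
  \<open>h\<close> fills the coordinates outside \<open>I\<close> with 1.\<close>

lemma spread_gauss:
  assumes v: "0 < v" "0 < \<delta>" and I: "I \<subseteq> {..<n}"
  shows "(\<integral>\<^sup>+y. spread I v (\<lambda>l. x l + y l) \<partial>gauss n \<delta>) = spread I (v + \<delta>) x"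
proof -
  let ?N = "density lborel (\<lambda>x. ennreal (normal_density 0 (sqrt \<delta>) x))"
  interpret N: prob_space ?N by (rule prob_space_normal[OF v(2)])
  interpret P: product_sigma_finite "\<lambda>_. ?N" ..
  interpret G: prob_space "gauss n \<delta>" by (rule prob_space_gauss[OF v(2)])
  interpret pair_sigma_finite "gauss n \<delta>" lborel ..
  have fin: "finite I" using I finite_subset by blast
  define h where "h m l z = (if l \<in> I then ennreal (normal_density 0 (sqrt v) (m - (x l + z))) else 1)" for m l z
  have [measurable]: "h m l \<in> borel_measurable ?N" for m l
    unfolding h_def by (cases "l \<in> I") auto
  have prod_h: "(\<Prod>l<n. h m l (y l)) = (\<Prod>l\<in>I. ennreal (normal_density 0 (sqrt v) (m - (x l + y l))))" for m y
  proof -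
    have "(\<Prod>l<n. h m l (y l)) = (\<Prod>l\<in>I. h m l (y l))"
      using I by (intro prod.mono_neutral_right) (auto simp: h_def)
    then show ?thesis by (simp add: h_def)
  qed
  have "(\<integral>\<^sup>+y. spread I v (\<lambda>l. x l + y l) \<partial>gauss n \<delta>) =
      (\<integral>\<^sup>+m. (\<integral>\<^sup>+y. (\<Prod>l\<in>I. ennreal (normal_density 0 (sqrt v) (m - (x l + y l)))) \<partial>gauss n \<delta>) \<partial>lborel)"
    unfolding spread_def
  proof (rule Fubini'[symmetric])
    show "(\<lambda>(y, m). \<Prod>l\<in>I. ennreal (normal_density 0 (sqrt v) (m - (x l + y l)))) \<in> borel_measurable (gauss n \<delta> \<Otimes>\<^sub>M lborel)"
      unfolding split_beta'
    proof (intro borel_measurable_prod_ennreal)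
      fix l assume "l \<in> I"
      then have [measurable]: "(\<lambda>y. y l) \<in> borel_measurable (gauss n \<delta>)"
        using I distributed_measurable[OF gauss_distributed[OF v(2)], of l n] by auto
      show "(\<lambda>p. ennreal (normal_density 0 (sqrt v) (snd p - (x l + fst p l)))) \<in> borel_measurable (gauss n \<delta> \<Otimes>\<^sub>M lborel)"
        by measurable
    qed
  qed
  also have "\<dots> = (\<integral>\<^sup>+m. (\<Prod>l\<in>I. ennreal (normal_density 0 (sqrt (v + \<delta>)) (m - x l))) \<partial>lborel)"
  proof (rule nn_integral_cong)
    fix m
    have "(\<integral>\<^sup>+y. (\<Prod>l\<in>I. ennreal (normal_density 0 (sqrt v) (m - (x l + y l)))) \<partial>gauss n \<delta>) =
        (\<integral>\<^sup>+y. (\<Prod>l<n. h m l (y l)) \<partial>gauss n \<delta>)"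
      by (simp only: prod_h)
    also have "\<dots> = (\<Prod>l<n. \<integral>\<^sup>+z. h m l z \<partial>?N)"
      unfolding gauss_def by (rule P.product_nn_integral_prod) auto
    also have "\<dots> = (\<Prod>l\<in>I. \<integral>\<^sup>+z. h m l z \<partial>?N)"
      using I N.emeasure_space_1 by (intro prod.mono_neutral_right) (auto simp: h_def)
    also have "\<dots> = (\<Prod>l\<in>I. ennreal (normal_density 0 (sqrt (v + \<delta>)) (m - x l)))"
      by (intro prod.cong refl) (simp add: h_def nn_integral_normal_shift[OF v])
    finally show "(\<integral>\<^sup>+y. (\<Prod>l\<in>I. ennreal (normal_density 0 (sqrt v) (m - (x l + y l)))) \<partial>gauss n \<delta>) =
        (\<Prod>l\<in>I. ennreal (normal_density 0 (sqrt (v + \<delta>)) (m - x l)))" .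
  qed
  finally show ?thesis by (simp add: spread_def)
qed

text \<open>One factor is bounded by its maximum, the other two convolve to a normal density of
  variance \<open>2 * v\<close>. With \<open>w\<close> the squared distance over
  \<open>4 * v\<close>, the bound exp(- w) <= 1 / w cancels the dependence on
  \<open>v\<close>.\<close>

lemma spread_upper:
  assumes v: "0 < v" and ijk: "i \<noteq> j" "i \<noteq> k" "j \<noteq> k" and d: "x i \<noteq> x j"
  shows "spread {i, j, k} v x \<le> ennreal (4 / (x i - x j)\<^sup>2)"
proof -
  let ?p = "\<lambda>l m. normal_density 0 (sqrt v) (m - x l)"
  have nn: "0 \<le> ?p l m" for l m by simp
  have pk: "?p k m \<le> 1 / sqrt (2 * pi * v)" for m
    using v by (simp add: normal_density_def divide_right_mono)
  have "spread {i, j, k} v x \<le> (\<integral>\<^sup>+m. ennreal (1 / sqrt (2 * pi * v)) * ennreal (?p i m * ?p j m) \<partial>lborel)"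
    unfolding spread_def
  proof (rule nn_integral_mono)
    fix m
    have "?p i m * (?p j m * ?p k m) \<le> 1 / sqrt (2 * pi * v) * (?p i m * ?p j m)"
      using mult_left_mono[OF pk[of m], of "?p i m * ?p j m"] by (simp add: mult_ac)
    then show "(\<Prod>l\<in>{i, j, k}. ennreal (?p l m)) \<le> ennreal (1 / sqrt (2 * pi * v)) * ennreal (?p i m * ?p j m)"
      using ijk v by (simp add: ennreal_mult[symmetric] ennreal_leI)
  qed
  also have "\<dots> = ennreal (1 / sqrt (2 * pi * v)) * (\<integral>\<^sup>+m. ennreal (?p i m * ?p j m) \<partial>lborel)"
    by (rule nn_integral_cmult) simp
  also have "(\<integral>\<^sup>+m. ennreal (?p i m * ?p j m) \<partial>lborel) =
      (\<integral>\<^sup>+z. ennreal (normal_density 0 (sqrt v) ((x j - x i) - z) * normal_density 0 (sqrt v) z) \<partial>lborel)"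
  proof -
    have "(\<integral>\<^sup>+m. ennreal (?p i m * ?p j m) \<partial>lborel) = ennreal \<bar>-1\<bar> * (\<integral>\<^sup>+z. ennreal (?p i (x j + (-1) * z) * ?p j (x j + (-1) * z)) \<partial>lborel)"
      by (rule nn_integral_real_affine) auto
    then show ?thesis
      by (simp add: normal_density_minus algebra_simps)
  qed
  also have "\<dots> = ennreal (normal_density 0 (sqrt (v + v)) (x j - x i))"
    using conv_normal_density_zero_mean[of "sqrt v" "sqrt v"] v by (simp add: fun_eq_iff)
  also have "ennreal (1 / sqrt (2 * pi * v)) * \<dots> = ennreal (1 / sqrt (2 * pi * v) * normal_density 0 (sqrt (v + v)) (x j - x i))"
    by (rule ennreal_mult[symmetric]) (use v in auto)
  also have "\<dots> \<le> ennreal (4 / (x i - x j)\<^sup>2)"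
  proof (rule ennreal_leI)
    define w where "w = (x i - x j)\<^sup>2 / (4 * v)"
    have w: "0 < w" using d v by (simp add: w_def)
    have "w * exp (- w) \<le> 1"
    proof -
      have "w \<le> exp w" using exp_ge_add_one_self[of w] by linarith
      then show ?thesis by (simp add: exp_minus divide_le_eq flip: divide_inverse)
    qed
    then have e: "exp (- w) \<le> 1 / w" using w by (simp add: field_simps)
    have sq: "sqrt (2 * pi * v) * sqrt (2 * pi * (v + v)) = 2 * pi * v * sqrt 2"
    proof -
      have "2 * pi * v * (2 * pi * (v + v)) = (2 * pi * v)\<^sup>2 * 2" by (simp add: power2_eq_square)
      then have "sqrt (2 * pi * v) * sqrt (2 * pi * (v + v)) = sqrt ((2 * pi * v)\<^sup>2 * 2)"
        by (simp only: real_sqrt_mult[symmetric])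
      also have "\<dots> = 2 * pi * v * sqrt 2"
        using v by (subst real_sqrt_mult) simp
      finally show ?thesis .
    qed
    have "1 / sqrt (2 * pi * v) * normal_density 0 (sqrt (v + v)) (x j - x i) = exp (- w) / (2 * pi * v * sqrt 2)"
      using v sq by (simp add: normal_density_def w_def power2_commute)
    also have "\<dots> \<le> (1 / w) / (2 * pi * v * sqrt 2)"
      using e v by (intro divide_right_mono) auto
    also have "\<dots> = 4 / (x i - x j)\<^sup>2 / (2 * pi * sqrt 2)"
      using v by (simp add: w_def)
    also have "\<dots> \<le> 4 / (x i - x j)\<^sup>2 / 1"
    proof (intro divide_left_mono)
      have "1 * 1 \<le> 2 * pi * sqrt 2"
        using pi_ge_two by (intro mult_mono) auto
      then show "1 \<le> 2 * pi * sqrt 2" by simp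
    qed auto
    finally show "1 / sqrt (2 * pi * v) * normal_density 0 (sqrt (v + v)) (x j - x i) \<le> 4 / (x i - x j)\<^sup>2" by simp
  qed
  finally show ?thesis .
qed

text \<open>For \<open>m\<close> within \<open>sqrt v\<close> of \<open>x i\<close>, all three
  particles are within \<open>2 * sqrt v\<close> of \<open>m\<close>, so each density is at least
  exp(- 2) / sqrt(2 * pi * v). The window has length \<open>2 * sqrt v\<close>, which leaves the
  order 1 / v; its sum over time diverges logarithmically as \<eta> tends to 0.\<close>

lemma spread_lower:
  assumes v: "0 < \<eta>" "\<eta> \<le> v" and ijk: "i \<noteq> j" "i \<noteq> k" "j \<noteq> k"
    and close: "\<bar>x j - x i\<bar> \<le> sqrt \<eta>" "\<bar>x k - x i\<bar> \<le> sqrt \<eta>"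
  shows "ennreal (2 * (exp (- 2) / sqrt (2 * pi)) ^ 3 / v) \<le> spread {i, j, k} v x"
proof -
  define b where "b = exp (- 2) / sqrt (2 * pi)"
  have vpos: "0 < v" using v by simp
  have \<eta>v: "sqrt \<eta> \<le> sqrt v" using v by simp
  have lower: "b / sqrt v \<le> normal_density 0 (sqrt v) (m - x l)"
    if "m \<in> {x i - sqrt v..x i + sqrt v}" "l \<in> {i, j, k}" for m l
  proof -
    have "\<bar>x l - x i\<bar> \<le> sqrt v" using that(2) order_trans[OF close(1) \<eta>v] order_trans[OF close(2) \<eta>v] vpos by auto
    moreover have "\<bar>m - x i\<bar> \<le> sqrt v" using that(1) by (simp add: abs_le_iff)
    ultimately have "\<bar>m - x l\<bar> \<le> 2 * sqrt v" by linarith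
    then have "(m - x l)\<^sup>2 \<le> (2 * sqrt v)\<^sup>2" by (metis abs_ge_zero power2_abs power_mono)
    then have "(m - x l)\<^sup>2 \<le> 4 * v" using vpos by (simp add: power_mult_distrib)
    then have "- 2 \<le> - (m - x l)\<^sup>2 / (2 * v)" using vpos by (simp add: field_simps)
    then have "exp (- 2) \<le> exp (- (m - x l)\<^sup>2 / (2 * v))" by simp
    then have "exp (- 2) / sqrt (2 * pi * v) \<le> exp (- (m - x l)\<^sup>2 / (2 * v)) / sqrt (2 * pi * v)"
      using vpos by (intro divide_right_mono) auto
    then show ?thesis using vpos by (simp add: b_def normal_density_def real_sqrt_mult)
  qed
  have b: "0 \<le> b / sqrt v" using vpos by (simp add: b_def)
  have "ennreal (2 * b ^ 3 / v) = ennreal ((b / sqrt v) ^ 3) * emeasure lborel {x i - sqrt v..x i + sqrt v}"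
  proof -
    have "sqrt v ^ 3 = v * sqrt v" using vpos by (simp add: power3_eq_cube)
    then have "(b / sqrt v) ^ 3 * (2 * sqrt v) = 2 * b ^ 3 / v"
      using vpos by (simp add: power_divide)
    moreover have "emeasure lborel {x i - sqrt v..x i + sqrt v} = ennreal (2 * sqrt v)"
      using vpos by simp
    ultimately show ?thesis using b vpos by (simp add: ennreal_mult[symmetric])
  qed
  also have "\<dots> = (\<integral>\<^sup>+m. ennreal ((b / sqrt v) ^ 3) * indicator {x i - sqrt v..x i + sqrt v} m \<partial>lborel)"
    by (subst nn_integral_cmult_indicator) auto
  also have "\<dots> \<le> spread {i, j, k} v x"
    unfolding spread_def
  proof (rule nn_integral_mono)
    fix m
    show "ennreal ((b / sqrt v) ^ 3) * indicator {x i - sqrt v..x i + sqrt v} m \<le>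
        (\<Prod>l\<in>{i, j, k}. ennreal (normal_density 0 (sqrt v) (m - x l)))"
    proof (cases "m \<in> {x i - sqrt v..x i + sqrt v}")
      case True
      have "ennreal ((b / sqrt v) ^ 3) = (\<Prod>l\<in>{i, j, k}. ennreal (b / sqrt v))"
        using ijk b by (simp add: ennreal_mult[symmetric] power3_eq_cube mult_ac)
      also have "\<dots> \<le> (\<Prod>l\<in>{i, j, k}. ennreal (normal_density 0 (sqrt v) (m - x l)))"
        using lower[OF True] by (intro prod_mono_ennreal ennreal_leI) auto
      finally show ?thesis using True by simp
    qed simp
  qed
  finally show ?thesis by (simp add: b_def)
qed

text \<open>Comparison with the integral of 1 / v, one step at a time by ln(1 + x) <= x.\<close>

lemma sum_inverse_ge_ln:
  fixes \<eta> \<delta> :: real and N :: nat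
  assumes "0 < \<eta>" "0 < \<delta>"
  shows "ln ((\<eta> + N * \<delta>) / \<eta>) \<le> (\<Sum>l<N. \<delta> / (\<eta> + l * \<delta>))"
proof (induction N)
  case (Suc N)
  have pos: "0 < \<eta> + N * \<delta>" "0 < \<eta> + Suc N * \<delta>" using assms by (simp_all add: add_pos_nonneg)
  have "ln ((\<eta> + Suc N * \<delta>) / \<eta>) = ln ((\<eta> + N * \<delta>) / \<eta>) + ln (1 + \<delta> / (\<eta> + N * \<delta>))"
  proof -
    have "(X + \<delta>) / \<eta> = (X / \<eta>) * (1 + \<delta> / X)" if "0 < X" for X
      using that assms by (simp add: field_simps)
    from this[OF pos(1)] have "(\<eta> + Suc N * \<delta>) / \<eta> = ((\<eta> + N * \<delta>) / \<eta>) * (1 + \<delta> / (\<eta> + N * \<delta>))"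
      by (simp add: algebra_simps)
    moreover have "ln (((\<eta> + N * \<delta>) / \<eta>) * (1 + \<delta> / (\<eta> + N * \<delta>))) = ln ((\<eta> + N * \<delta>) / \<eta>) + ln (1 + \<delta> / (\<eta> + N * \<delta>))"
      by (intro ln_mult_pos divide_pos_pos pos(1) add_pos_pos[OF zero_less_one] assms)
    ultimately show ?thesis by (simp only:)
  qed
  also have "ln (1 + \<delta> / (\<eta> + N * \<delta>)) \<le> \<delta> / (\<eta> + N * \<delta>)"
    using pos assms by (intro ln_add_one_self_le_self) simp
  finally show ?case using Suc by simp
qed simp


context brownian begin

section \<open>Measurability of collisions and absence of triple collisions\<close>

definition pos :: "(nat \<Rightarrow> real) \<Rightarrow> 'w \<Rightarrow> nat \<Rightarrow> real \<Rightarrow> real" where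
  "pos a \<omega> i s = a i + B i s \<omega>"

lemma pos_measurable_past [measurable (raw)]:
  "0 \<le> s \<Longrightarrow> s \<le> s' \<Longrightarrow> (\<lambda>\<omega>. pos a \<omega> i s) \<in> borel_measurable (past W B s')"
  unfolding pos_def by (intro borel_measurable_add measurable_past) auto

lemma pos_measurable [measurable (raw)]: "0 \<le> s \<Longrightarrow> (\<lambda>\<omega>. pos a \<omega> i s) \<in> borel_measurable W"
  unfolding pos_def by (intro borel_measurable_add B_measurable) auto

lemma pos_0: "\<omega> \<in> space W \<Longrightarrow> pos a \<omega> i 0 = a i"
  by (simp add: pos_def B_0)

lemma pos_cont: "\<omega> \<in> space W \<Longrightarrow> continuous_on {0..} (pos a \<omega> i)"
  unfolding pos_def by (intro continuous_on_add continuous_on_const B_cont)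

lemma pos_incr: "i < n \<Longrightarrow> pos a \<omega> i s' = pos a \<omega> i s + incr n s s' \<omega> i"
  by (simp add: pos_def incr_def)

lemma zero_in_interval_past:
  fixes D :: "real \<Rightarrow> 'w \<Rightarrow> real"
  assumes cd: "0 \<le> c" "c < d"
    and meas: "\<And>v. c \<le> v \<Longrightarrow> v \<le> d \<Longrightarrow> D v \<in> borel_measurable (past W B d)"
    and cont: "\<And>\<omega>. \<omega> \<in> space W \<Longrightarrow> continuous_on {c..d} (\<lambda>v. D v \<omega>)"
    and nonneg: "\<And>v \<omega>. 0 \<le> D v \<omega>"
  shows "{\<omega> \<in> space W. \<exists>v\<in>{c..d}. D v \<omega> = 0} \<in> sets (past W B d)"
proof -
  have "{\<omega> \<in> space W. \<exists>v\<in>{c..d}. D v \<omega> = (0::real)} =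
      {\<omega> \<in> space (past W B d). \<forall>k::nat. \<exists>q\<in>\<rat> \<inter> {c..d}. D q \<omega> < 1 / Suc k}"
    using zero_on_interval_iff[OF cont cd(2) nonneg] by auto
  also have "\<dots> \<in> sets (past W B d)"
  proof -
    have "(\<Union>q\<in>\<rat> \<inter> {c..d}. {\<omega> \<in> space (past W B d). D q \<omega> < 1 / Suc k}) \<in> sets (past W B d)" for k
    proof (rule sets.countable_UN'')
      show "countable (\<rat> \<inter> {c..d})" using countable_rat by blast
      fix q assume "q \<in> \<rat> \<inter> {c..d}"
      then have [measurable]: "D q \<in> borel_measurable (past W B d)" by (intro meas) auto
      show "{\<omega> \<in> space (past W B d). D q \<omega> < 1 / Suc k} \<in> sets (past W B d)" by measurable
    qed
    moreover have "(\<Union>q\<in>\<rat> \<inter> {c..d}. {\<omega> \<in> space (past W B d). D q \<omega> < 1 / Suc k}) =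
        {\<omega> \<in> space (past W B d). \<exists>q\<in>\<rat> \<inter> {c..d}. D q \<omega> < 1 / Suc k}" for k
      by blast
    ultimately show ?thesis
      by (intro sets.sets_Collect_countable_All) simp
  qed
  finally show ?thesis .
qed

definition triple_dist :: "(nat \<Rightarrow> real) \<Rightarrow> nat \<Rightarrow> nat \<Rightarrow> nat \<Rightarrow> real \<Rightarrow> 'w \<Rightarrow> real" where
  "triple_dist a i j k v \<omega> = \<bar>pos a \<omega> i v - pos a \<omega> j v\<bar> + \<bar>pos a \<omega> j v - pos a \<omega> k v\<bar>"

lemma triple_dist_0: "triple_dist a i j k v \<omega> = 0 \<longleftrightarrow> pos a \<omega> i v = pos a \<omega> j v \<and> pos a \<omega> j v = pos a \<omega> k v"
  by (auto simp: triple_dist_def abs_if split: if_splits)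

lemma triple_set_past:
  assumes "0 \<le> c" "c < d"
  shows "{\<omega> \<in> space W. \<exists>v\<in>{c..d}. triple_dist a i j k v \<omega> = 0} \<in> sets (past W B d)"
proof (rule zero_in_interval_past[OF assms])
  fix v assume "c \<le> v" "v \<le> d"
  then have [measurable]: "(\<lambda>\<omega>. pos a \<omega> l v) \<in> borel_measurable (past W B d)" for l
    using assms by (intro pos_measurable_past) auto
  show "triple_dist a i j k v \<in> borel_measurable (past W B d)"
    unfolding triple_dist_def by measurable
next
  fix \<omega> assume "\<omega> \<in> space W"
  then show "continuous_on {c..d} (\<lambda>v. triple_dist a i j k v \<omega>)"
    unfolding triple_dist_def
    using assms by (intro continuous_on_add continuous_on_rabs continuous_on_diff continuous_on_subset[OF pos_cont]) auto
qed (simp add: triple_dist_def)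

definition clear_until :: "(nat \<Rightarrow> real) \<Rightarrow> nat \<Rightarrow> nat \<Rightarrow> nat \<Rightarrow> real \<Rightarrow> 'w set" where
  "clear_until a i j k s = {\<omega> \<in> space W. \<not> (\<exists>v\<in>{0..s}. triple_dist a i j k v \<omega> = 0)}"

text \<open>At time 0 the interval shrinks to a point, where approximation by rational times fails;
  there the distinct starting points decide.\<close>

lemma clear_until_past:
  assumes "0 \<le> s" "a i \<noteq> a j"
  shows "clear_until a i j k s \<in> sets (past W B s)"
proof (cases "s = 0")
  case True
  then have "clear_until a i j k s = space (past W B s)"
    using assms(2) by (auto simp: clear_until_def triple_dist_0 pos_0)
  then show ?thesis by (simp only: sets.top)
next
  case False
  then have "{\<omega> \<in> space W. \<exists>v\<in>{0..s}. triple_dist a i j k v \<omega> = 0} \<in> sets (past W B s)"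
    using assms by (intro triple_set_past) auto
  then have "space (past W B s) - {\<omega> \<in> space W. \<exists>v\<in>{0..s}. triple_dist a i j k v \<omega> = 0} \<in> sets (past W B s)"
    by (rule sets.compl_sets)
  moreover have "clear_until a i j k s = space (past W B s) - {\<omega> \<in> space W. \<exists>v\<in>{0..s}. triple_dist a i j k v \<omega> = 0}"
    by (auto simp: clear_until_def)
  ultimately show ?thesis by simp
qed

lemma spread_markov:
  assumes s: "0 \<le> s" "s < s'" and v: "0 < v" and I: "finite I" and E: "E \<in> sets (past W B s)"
  shows "(\<integral>\<^sup>+\<omega>. indicator E \<omega> * spread I v (\<lambda>l. pos a \<omega> l s') \<partial>W) =
    (\<integral>\<^sup>+\<omega>. indicator E \<omega> * spread I (v + (s' - s)) (\<lambda>l. pos a \<omega> l s) \<partial>W)"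
proof -
  obtain n where n: "I \<subseteq> {..<n}" "0 < n"
    using I by (metis finite_nat_iff_bounded less_Suc_eq lessThan_iff subset_iff zero_less_Suc)
  define f where "f = (\<lambda>(\<omega>, y). indicator E \<omega> * spread I v (\<lambda>l. pos a \<omega> l s + y l))"
  have "f \<in> borel_measurable (past W B s \<Otimes>\<^sub>M PiM {..<n} (\<lambda>_. borel))"
    unfolding f_def split_beta'
  proof (intro borel_measurable_times_ennreal spread_measurable[OF I])
    show "(\<lambda>p. indicator E (fst p)) \<in> borel_measurable (past W B s \<Otimes>\<^sub>M PiM {..<n} (\<lambda>_. borel :: real measure))"
      using E by measurable
    fix l assume "l \<in> I"
    then have [measurable]: "(\<lambda>y. y l) \<in> borel_measurable (PiM {..<n} (\<lambda>_. borel :: real measure))"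
      using n by (intro measurable_component_singleton) auto
    have [measurable]: "(\<lambda>\<omega>. pos a \<omega> l s) \<in> borel_measurable (past W B s)" using s by (intro pos_measurable_past) auto
    show "(\<lambda>p. pos a (fst p) l s + snd p l) \<in> borel_measurable (past W B s \<Otimes>\<^sub>M PiM {..<n} (\<lambda>_. borel))"
      by measurable
  qed
  from markov_nn_integral[OF s n(2) this]
  have "(\<integral>\<^sup>+\<omega>. f (\<omega>, incr n s s' \<omega>) \<partial>W) = (\<integral>\<^sup>+\<omega>. (\<integral>\<^sup>+y. f (\<omega>, y) \<partial>gauss n (s' - s)) \<partial>W)" .
  moreover have "f (\<omega>, incr n s s' \<omega>) = indicator E \<omega> * spread I v (\<lambda>l. pos a \<omega> l s')" for \<omega>
  proof -
    have "spread I v (\<lambda>l. pos a \<omega> l s + incr n s s' \<omega> l) = spread I v (\<lambda>l. pos a \<omega> l s')"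
      unfolding spread_def using n pos_incr[of _ n a \<omega> s' s] by (intro nn_integral_cong prod.cong refl) auto
    then show ?thesis by (simp add: f_def)
  qed
  moreover have "(\<integral>\<^sup>+y. f (\<omega>, y) \<partial>gauss n (s' - s)) = indicator E \<omega> * spread I (v + (s' - s)) (\<lambda>l. pos a \<omega> l s)" for \<omega>
  proof -
    have "(\<lambda>y. spread I v (\<lambda>l. pos a \<omega> l s + y l)) \<in> borel_measurable (gauss n (s' - s))"
    proof (rule spread_measurable[OF I])
      fix l assume "l \<in> I"
      then have [measurable]: "(\<lambda>y. y l) \<in> borel_measurable (gauss n (s' - s))"
        using n distributed_measurable[OF gauss_distributed[of "s' - s" l n]] s by auto
      show "(\<lambda>y. pos a \<omega> l s + y l) \<in> borel_measurable (gauss n (s' - s))" by measurable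
    qed
    then show ?thesis
      using spread_gauss[of v "s' - s" I n "\<lambda>l. pos a \<omega> l s"] v s n
      by (simp add: f_def nn_integral_cmult)
  qed
  ultimately show ?thesis by simp
qed

text \<open>The truncated Green function \<open>\<Sum>l. \<delta> * spread I (\<eta> + l * \<delta>)\<close> is a supermartingale along the
  grid. It is bounded at the start uniformly in \<open>\<eta>\<close> and at least of order \<open>ln (1 / \<eta>)\<close> at a
  triple collision.\<close>

lemma AE_no_triple_collision:
  assumes ijk: "i \<noteq> j" "i \<noteq> k" "j \<noteq> k" and aij: "a i \<noteq> a j" and t: "0 < t"
  shows "AE \<omega> in W. \<forall>v\<in>{0..t}. \<not> (pos a \<omega> i v = pos a \<omega> j v \<and> pos a \<omega> j v = pos a \<omega> k v)"
proof -
  let ?I = "{i, j, k}"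
  define Tr where "Tr = {\<omega> \<in> space W. \<exists>v\<in>{0..t}. triple_dist a i j k v \<omega> = 0}"
  have Tr: "Tr \<in> events" unfolding Tr_def using triple_set_past[OF order_refl t] past_subset[of t] by blast
  define c where "c = 2 * (exp (- 2) / sqrt (2 * pi)) ^ 3"
  have c: "0 < c" by (simp add: c_def)
  define Q where "Q = 4 / (a i - a j)\<^sup>2"
  have Q: "0 < Q" using aij by (simp add: Q_def)
  have key: "prob Tr * (c * ln (1 + t / \<eta>)) \<le> 3 * t * Q" if \<eta>: "0 < \<eta>" for \<eta>
  proof -
    \<comment> \<open>The horizon is twice the number of steps: at every grid index up to
      \<open>N\<close> at least \<open>N\<close> terms remain, enough to produce the
      logarithm.\<close>
    define g where "g N p \<omega> = (\<Sum>l<2 * N - p. ennreal (t / N) * spread ?I (\<eta> + l * (t / N)) (\<lambda>l. pos a \<omega> l (p * t / N)))" for N p :: nat and \<omega>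
    define E where "E N p = clear_until a i j k (p * t / N)" for N p :: nat
    \<comment> \<open>The sets \<open>E N p - E N (Suc p)\<close> locate the cell of the first
      triple collision; \<open>G\<close> is the Green function read at the end of this cell.\<close>
    define G where "G N \<omega> = (\<Sum>p<N. indicator (E N p - E N (Suc p)) \<omega> * g N (Suc p) \<omega>)" for N :: nat and \<omega>
    have Epast: "E N p \<in> sets (past W B (p * t / N))" for N p
      unfolding E_def using t aij by (intro clear_until_past) auto
    then have Eev: "E N p \<in> events" for N p using past_subset by blast
    have sm: "(\<lambda>\<omega>. spread ?I v (\<lambda>l. pos a \<omega> l s)) \<in> borel_measurable W" if "0 \<le> s" for v s
      using that by (intro spread_measurable pos_measurable) auto
    have gm: "g N p \<in> borel_measurable W" for N p
      unfolding g_def using t by (intro borel_measurable_sum borel_measurable_times_ennreal sm) auto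
    have Gm: "G N \<in> borel_measurable W" for N
      unfolding G_def using Eev by (intro borel_measurable_sum borel_measurable_times_ennreal gm borel_measurable_indicator) auto
    have dec: "E N (Suc p) \<subseteq> E N p" for N p
    proof -
      have "p * t / N \<le> Suc p * t / N" using t by (intro divide_right_mono mult_right_mono) auto
      then show ?thesis unfolding E_def clear_until_def by fastforce
    qed
    \<comment> \<open>One step of the heat flow turns term \<open>l\<close> into term
      \<open>Suc l\<close>. The resulting sum lacks the term with index 0, whence the
      inequality.\<close>
    have super: "(\<integral>\<^sup>+\<omega>. indicator (E N p) \<omega> * g N (Suc p) \<omega> \<partial>W) \<le> (\<integral>\<^sup>+\<omega>. indicator (E N p) \<omega> * g N p \<omega> \<partial>W)"
      if N: "0 < N" and p: "p < N" for N p
    proof -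
      let ?s = "p * t / N" and ?s' = "Suc p * t / N" and ?\<delta> = "t / N"
      let ?sp = "\<lambda>l s \<omega>. spread ?I (\<eta> + real l * ?\<delta>) (\<lambda>l. pos a \<omega> l s)"
      have s: "0 \<le> ?s" "?s < ?s'" "?s' - ?s = ?\<delta>" using t N by (auto simp: field_simps)
      have pull: "(\<integral>\<^sup>+\<omega>. indicator (E N p) \<omega> * (\<Sum>l<m. ennreal ?\<delta> * ?sp (h l) r \<omega>) \<partial>W) =
          (\<Sum>l<m. ennreal ?\<delta> * (\<integral>\<^sup>+\<omega>. indicator (E N p) \<omega> * ?sp (h l) r \<omega> \<partial>W))" if "0 \<le> r" for m r h
      proof -
        have "(\<integral>\<^sup>+\<omega>. indicator (E N p) \<omega> * (\<Sum>l<m. ennreal ?\<delta> * ?sp (h l) r \<omega>) \<partial>W) =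
            (\<integral>\<^sup>+\<omega>. (\<Sum>l<m. ennreal ?\<delta> * (indicator (E N p) \<omega> * ?sp (h l) r \<omega>)) \<partial>W)"
          by (simp add: sum_distrib_left mult_ac)
        also have "\<dots> = (\<Sum>l<m. \<integral>\<^sup>+\<omega>. ennreal ?\<delta> * (indicator (E N p) \<omega> * ?sp (h l) r \<omega>) \<partial>W)"
          by (intro nn_integral_sum borel_measurable_times_ennreal borel_measurable_const borel_measurable_indicator Eev sm that)
        also have "\<dots> = (\<Sum>l<m. ennreal ?\<delta> * (\<integral>\<^sup>+\<omega>. indicator (E N p) \<omega> * ?sp (h l) r \<omega> \<partial>W))"
          by (intro sum.cong refl nn_integral_cmult borel_measurable_times_ennreal borel_measurable_indicator Eev sm that)
        finally show ?thesis .
      qed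
      obtain m where m: "2 * N - p = Suc m" "2 * N - Suc p = m" using p by (cases "2 * N - p") auto
      have "(\<integral>\<^sup>+\<omega>. indicator (E N p) \<omega> * g N (Suc p) \<omega> \<partial>W) =
          (\<Sum>l<m. ennreal ?\<delta> * (\<integral>\<^sup>+\<omega>. indicator (E N p) \<omega> * ?sp l ?s' \<omega> \<partial>W))"
        unfolding g_def m using t by (intro pull) auto
      also have "\<dots> = (\<Sum>l<m. ennreal ?\<delta> * (\<integral>\<^sup>+\<omega>. indicator (E N p) \<omega> * ?sp (Suc l) ?s \<omega> \<partial>W))"
      proof (intro sum.cong refl arg_cong2[where f = times])
        fix l
        have "0 < \<eta> + real l * ?\<delta>" using \<eta> t by (simp add: add_pos_nonneg)
        then have "(\<integral>\<^sup>+\<omega>. indicator (E N p) \<omega> * ?sp l ?s' \<omega> \<partial>W) =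
            (\<integral>\<^sup>+\<omega>. indicator (E N p) \<omega> * spread ?I (\<eta> + real l * ?\<delta> + (?s' - ?s)) (\<lambda>l. pos a \<omega> l ?s) \<partial>W)"
          by (intro spread_markov s Epast) auto
        moreover have "\<eta> + real l * ?\<delta> + (?s' - ?s) = \<eta> + real (Suc l) * ?\<delta>"
          unfolding s(3) by (simp add: distrib_right add_divide_distrib)
        ultimately show "(\<integral>\<^sup>+\<omega>. indicator (E N p) \<omega> * ?sp l ?s' \<omega> \<partial>W) = (\<integral>\<^sup>+\<omega>. indicator (E N p) \<omega> * ?sp (Suc l) ?s \<omega> \<partial>W)"
          by (simp only:)
      qed
      also have "\<dots> = (\<integral>\<^sup>+\<omega>. indicator (E N p) \<omega> * (\<Sum>l<m. ennreal ?\<delta> * ?sp (Suc l) ?s \<omega>) \<partial>W)"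
        using s(1) by (intro pull[symmetric])
      also have "\<dots> \<le> (\<integral>\<^sup>+\<omega>. indicator (E N p) \<omega> * g N p \<omega> \<partial>W)"
        unfolding g_def m by (intro nn_integral_mono mult_left_mono) (simp_all add: sum.lessThan_Suc_shift del: sum.lessThan_Suc)
      finally show ?thesis .
    qed
    have tele: "(\<integral>\<^sup>+\<omega>. (\<Sum>p<q. indicator (E N p - E N (Suc p)) \<omega> * g N (Suc p) \<omega>) \<partial>W) + (\<integral>\<^sup>+\<omega>. indicator (E N q) \<omega> * g N q \<omega> \<partial>W)
        \<le> (\<integral>\<^sup>+\<omega>. indicator (E N 0) \<omega> * g N 0 \<omega> \<partial>W)" if N: "0 < N" and "q \<le> N" for N q
      using that(2)
    proof (induction q)
      case (Suc q)
      let ?D = "E N q - E N (Suc q)"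
      have "(\<integral>\<^sup>+\<omega>. (\<Sum>p<Suc q. indicator (E N p - E N (Suc p)) \<omega> * g N (Suc p) \<omega>) \<partial>W) =
          (\<integral>\<^sup>+\<omega>. (\<Sum>p<q. indicator (E N p - E N (Suc p)) \<omega> * g N (Suc p) \<omega>) \<partial>W) + (\<integral>\<^sup>+\<omega>. indicator ?D \<omega> * g N (Suc q) \<omega> \<partial>W)"
        unfolding sum.lessThan_Suc using Eev gm
        by (intro nn_integral_add borel_measurable_sum borel_measurable_times_ennreal borel_measurable_indicator) auto
      moreover have "(\<integral>\<^sup>+\<omega>. indicator ?D \<omega> * g N (Suc q) \<omega> \<partial>W) + (\<integral>\<^sup>+\<omega>. indicator (E N (Suc q)) \<omega> * g N (Suc q) \<omega> \<partial>W) =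
          (\<integral>\<^sup>+\<omega>. indicator (E N q) \<omega> * g N (Suc q) \<omega> \<partial>W)"
      proof (subst nn_integral_add[symmetric])
        have "indicator ?D \<omega> * g N (Suc q) \<omega> + indicator (E N (Suc q)) \<omega> * g N (Suc q) \<omega> = indicator (E N q) \<omega> * g N (Suc q) \<omega>" for \<omega>
          using dec[of N q] by (auto simp: indicator_def)
        then show "(\<integral>\<^sup>+\<omega>. indicator ?D \<omega> * g N (Suc q) \<omega> + indicator (E N (Suc q)) \<omega> * g N (Suc q) \<omega> \<partial>W) =
            (\<integral>\<^sup>+\<omega>. indicator (E N q) \<omega> * g N (Suc q) \<omega> \<partial>W)" by simp
      qed (use Eev gm in \<open>auto intro!: borel_measurable_times_ennreal borel_measurable_indicator\<close>)
      moreover have "(\<integral>\<^sup>+\<omega>. indicator (E N q) \<omega> * g N (Suc q) \<omega> \<partial>W) \<le> (\<integral>\<^sup>+\<omega>. indicator (E N q) \<omega> * g N q \<omega> \<partial>W)"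
        using Suc.prems N by (intro super) auto
      ultimately show ?case
        using Suc by (auto simp: add.assoc intro: order_trans add_left_mono)
    qed simp
    have upper: "(\<integral>\<^sup>+\<omega>. G N \<omega> \<partial>W) \<le> ennreal (3 * t * Q)" if N: "0 < N" for N
    proof -
      have "(\<integral>\<^sup>+\<omega>. G N \<omega> \<partial>W) \<le> (\<integral>\<^sup>+\<omega>. indicator (E N 0) \<omega> * g N 0 \<omega> \<partial>W)"
        using tele[OF N order_refl] unfolding G_def by (meson le_iff_add order_trans)
      also have "\<dots> \<le> (\<integral>\<^sup>+\<omega>. ennreal (3 * t * Q) \<partial>W)"
      proof (rule nn_integral_mono)
        fix \<omega> assume \<omega>: "\<omega> \<in> space W"
        have "g N 0 \<omega> \<le> (\<Sum>l<2 * N. ennreal (t / N) * ennreal Q)"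
          unfolding g_def diff_zero
        proof (intro sum_mono mult_left_mono)
          fix l
          have "0 < \<eta> + real l * (t / N)" using \<eta> t by (simp add: add_pos_nonneg)
          then show "spread ?I (\<eta> + real l * (t / N)) (\<lambda>l. pos a \<omega> l (real 0 * t / N)) \<le> ennreal Q"
            using spread_upper[OF _ ijk, of "\<eta> + real l * (t / N)" "\<lambda>l. pos a \<omega> l 0"] aij
            by (simp add: pos_0[OF \<omega>] Q_def)
        qed simp
        also have "\<dots> = ennreal (2 * t * Q)"
          using N t Q by (simp add: ennreal_mult[symmetric] ennreal_of_nat_eq_real_of_nat)
        also have "\<dots> \<le> ennreal (3 * t * Q)" using t Q by (intro ennreal_leI) simp
        finally show "indicator (E N 0) \<omega> * g N 0 \<omega> \<le> ennreal (3 * t * Q)"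
          by (auto simp: indicator_def)
      qed
      finally show ?thesis by (simp add: emeasure_space_1)
    qed
    \<comment> \<open>By uniform continuity of the path, a small mesh keeps the three particles
      within \<open>sqrt \<eta>\<close> of each other at the end of the collision cell, as
      \<open>spread_lower\<close> requires.\<close>
    have lower: "\<forall>\<^sub>F N in sequentially. ennreal (c * ln (1 + t / \<eta>)) \<le> G N \<omega>" if \<omega>: "\<omega> \<in> Tr" for \<omega>
    proof -
      have \<omega>W: "\<omega> \<in> space W" using \<omega> by (simp add: Tr_def)
      have uc: "uniformly_continuous_on {0..t} (\<lambda>v. triple_dist a i j k v \<omega>)"
        unfolding triple_dist_def using pos_cont[OF \<omega>W]
        by (intro compact_uniformly_continuous continuous_on_add continuous_on_rabs continuous_on_diff continuous_on_subset[OF pos_cont[OF \<omega>W]]) auto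
      then obtain e where e: "e > 0" "\<And>v w. v \<in> {0..t} \<Longrightarrow> w \<in> {0..t} \<Longrightarrow> dist w v < e \<Longrightarrow>
          dist (triple_dist a i j k w \<omega>) (triple_dist a i j k v \<omega>) < sqrt \<eta>"
        using \<eta> unfolding uniformly_continuous_on_def by (metis real_sqrt_gt_0_iff)
      have "(\<lambda>N. t / real N) \<longlonglongrightarrow> 0" by (rule lim_const_over_n)
      then have "\<forall>\<^sub>F N in sequentially. t / real N < e" using e(1) by (rule order_tendstoD(2))
      then show ?thesis using eventually_gt_at_top[of 0]
      proof eventually_elim
        case (elim N)
        have E0: "\<omega> \<in> E N 0" using \<omega>W aij by (auto simp: E_def clear_until_def triple_dist_0 pos_0)
        have EN: "\<omega> \<notin> E N N" using \<omega> elim(2) by (auto simp: E_def clear_until_def Tr_def)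
        define r where "r = (LEAST q. \<omega> \<notin> E N q)"
        have r: "\<omega> \<notin> E N r" "r \<le> N" 
          unfolding r_def using EN by (rule LeastI, intro Least_le EN)
        then obtain p where p: "r = Suc p" using E0 by (cases r) auto
        have inp: "\<omega> \<in> E N p" using not_less_Least[of p "\<lambda>q. \<omega> \<notin> E N q"] p by (auto simp: r_def)
        have pN: "p < N" using r p by simp
        let ?s = "Suc p * t / N"
        have s: "0 \<le> ?s" "?s \<le> t"
        proof -
          have "Suc p * t \<le> N * t" using pN t by (intro mult_right_mono) auto
          then show "?s \<le> t" using elim(2) by (simp add: pos_divide_le_eq mult.commute)
        qed (use t in auto)
        obtain v where v: "0 \<le> v" "v \<le> ?s" "triple_dist a i j k v \<omega> = 0"
          using r p \<omega>W by (auto simp: E_def clear_until_def)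
        have "\<not> v \<le> p * t / N" using inp v by (auto simp: E_def clear_until_def)
        moreover have "?s = p * t / N + t / N" by (simp add: add_divide_distrib distrib_right)
        ultimately have "dist ?s v < e" using v(2) elim(1) unfolding dist_real_def by linarith
        then have "triple_dist a i j k ?s \<omega> < sqrt \<eta>"
          using e(2)[of v ?s] v s by (auto simp: dist_real_def)
        then have close: "\<bar>pos a \<omega> j ?s - pos a \<omega> i ?s\<bar> \<le> sqrt \<eta>" "\<bar>pos a \<omega> k ?s - pos a \<omega> i ?s\<bar> \<le> sqrt \<eta>"
          unfolding triple_dist_def by linarith+
        have \<delta>: "0 < t / N" using t elim(2) by simp
        have "1 + t / \<eta> = (\<eta> + N * (t / N)) / \<eta>" using \<eta> elim(2) by (simp add: add_divide_distrib)
        then have "c * ln (1 + t / \<eta>) \<le> c * (\<Sum>l<N. (t / N) / (\<eta> + l * (t / N)))"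
          using sum_inverse_ge_ln[OF \<eta> \<delta>, of N] c by (intro mult_left_mono) auto
        also have "\<dots> \<le> c * (\<Sum>l<2 * N - Suc p. (t / N) / (\<eta> + l * (t / N)))"
          using pN c \<eta> t by (intro mult_left_mono sum_mono2) auto
        also have "\<dots> = (\<Sum>l<2 * N - Suc p. (t / N) * (c / (\<eta> + l * (t / N))))"
          by (simp add: sum_distrib_left mult_ac)
        finally have "ennreal (c * ln (1 + t / \<eta>)) \<le> (\<Sum>l<2 * N - Suc p. ennreal ((t / N) * (c / (\<eta> + l * (t / N)))))"
          using c \<eta> t by (subst sum_ennreal) (auto intro!: ennreal_leI)
        also have "\<dots> \<le> g N (Suc p) \<omega>"
          unfolding g_def
        proof (rule sum_mono)
          fix l :: nat
          have "ennreal (c / (\<eta> + l * (t / N))) \<le> spread ?I (\<eta> + l * (t / N)) (\<lambda>l. pos a \<omega> l ?s)"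
            unfolding c_def using \<eta> t close by (intro spread_lower[of \<eta>] ijk) auto
          then have "ennreal (t / N) * ennreal (c / (\<eta> + l * (t / N))) \<le>
              ennreal (t / N) * spread ?I (\<eta> + l * (t / N)) (\<lambda>l. pos a \<omega> l ?s)"
            by (rule mult_left_mono) simp
          moreover have "ennreal ((t / N) * (c / (\<eta> + l * (t / N)))) = ennreal (t / N) * ennreal (c / (\<eta> + l * (t / N)))"
            using \<delta> c \<eta> t by (intro ennreal_mult) (auto intro!: divide_nonneg_nonneg add_nonneg_nonneg)
          ultimately show "ennreal ((t / N) * (c / (\<eta> + l * (t / N)))) \<le>
              ennreal (t / N) * spread ?I (\<eta> + l * (t / N)) (\<lambda>l. pos a \<omega> l ?s)"
            by (simp only:)
        qed
        also have "\<dots> = indicator (E N p - E N (Suc p)) \<omega> * g N (Suc p) \<omega>" using inp r p by simp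
        also have "\<dots> \<le> G N \<omega>"
          unfolding G_def using pN by (intro member_le_sum) auto
        finally show ?case .
      qed
    qed
    \<comment> \<open>The mesh required in \<open>lower\<close> depends on the path, so the bound is
      carried to the integrals by Fatou's lemma.\<close>
    have "emeasure W Tr * ennreal (c * ln (1 + t / \<eta>)) = (\<integral>\<^sup>+\<omega>. ennreal (c * ln (1 + t / \<eta>)) * indicator Tr \<omega> \<partial>W)"
      by (subst nn_integral_cmult_indicator[OF Tr]) (rule mult.commute)
    also have "\<dots> \<le> (\<integral>\<^sup>+\<omega>. liminf (\<lambda>N. G N \<omega>) \<partial>W)"
      using lower by (intro nn_integral_mono) (auto simp: indicator_def intro!: Liminf_bounded)
    also have "\<dots> \<le> liminf (\<lambda>N. \<integral>\<^sup>+\<omega>. G N \<omega> \<partial>W)"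
      by (rule nn_integral_liminf) (rule Gm)
    also have "\<dots> \<le> ennreal (3 * t * Q)"
      by (intro Liminf_le eventually_mono[OF eventually_gt_at_top[of 0]] upper) auto
    finally have "ennreal (prob Tr * (c * ln (1 + t / \<eta>))) \<le> ennreal (3 * t * Q)"
      using c \<eta> t by (simp add: emeasure_eq_measure ennreal_mult ln_ge_zero)
    then show ?thesis using t Q by (simp add: ennreal_le_iff)
  qed
  have "prob Tr = 0"
  proof (rule ccontr)
    assume "prob Tr \<noteq> 0"
    then have P: "0 < prob Tr" by (simp add: zero_less_measure_iff)
    \<comment> \<open>Chosen so that \<open>prob Tr * (c * R)\<close> equals
      \<open>3 * t * Q + 1\<close>, which exceeds the bound in \<open>key\<close>.\<close>
    define R where "R = (3 * t * Q + 1) / (prob Tr * c)"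
    define \<eta> where "\<eta> = t / exp R"
    have \<eta>: "0 < \<eta>" using t by (simp add: \<eta>_def)
    have "1 + t / \<eta> = 1 + exp R" using t by (simp add: \<eta>_def)
    moreover have "ln (exp R) \<le> ln (1 + exp R)" by (subst ln_le_cancel_iff) (auto intro: add_pos_pos)
    ultimately have "R \<le> ln (1 + t / \<eta>)" by simp
    then have "prob Tr * (c * R) \<le> prob Tr * (c * ln (1 + t / \<eta>))"
      using P c by (intro mult_left_mono) auto
    also have "\<dots> \<le> 3 * t * Q" by (rule key[OF \<eta>])
    finally show False using P c by (simp add: R_def)
  qed
  then have "AE \<omega> in W. \<omega> \<notin> Tr"
    using Tr by (subst AE_iff_measurable[of Tr]) (auto simp: emeasure_eq_measure dest: sets.sets_into_space)
  with AE_space show ?thesis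
    by eventually_elim (auto simp: Tr_def triple_dist_0)
qed

end

section \<open>Extinction probabilities\<close>

lemma pfaffian_tendsto:
  assumes "\<And>k l. ((\<lambda>z. A z k l) \<longlongrightarrow> A' k l) G"
  shows "((\<lambda>z. pfaffian n (A z)) \<longlongrightarrow> pfaffian n A') G"
  unfolding pfaffian_alt pfterm_def
  by (intro tendsto_divide tendsto_sum tendsto_mult tendsto_const tendsto_prod assms) simp

lemma pfs_tendsto:
  assumes "\<And>i j. ((\<lambda>z. g z (y z j - y z i)) \<longlongrightarrow> g' (y' j - y' i)) G"
  shows "((\<lambda>z. pfs C (g z) (y z)) \<longlongrightarrow> pfs C g' y') G"
  unfolding pfs_def pfl_def
  by (intro pfaffian_tendsto) (auto simp: pair_entry_def intro!: tendsto_intros assms)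

lemma tendsto_F: "(f \<longlongrightarrow> l) G \<Longrightarrow> ((\<lambda>z. F (f z)) \<longlongrightarrow> F l) G"
  by (rule isCont_tendsto_compose[OF isCont_F])

text \<open>Every change removes at least one label. This bounds the number of jumps independently
  of the mesh and later dominates the telescoping sum.\<close>

lemma grid_changes_le:
  assumes "finite A"
  shows "(\<Sum>p<q. if grid x t N A p \<noteq> grid x t N A (Suc p) then 1 else 0) + card (grid x t N A q) \<le> card A"
proof (induction q)
  case (Suc q)
  have sub: "grid x t N A (Suc q) \<subseteq> grid x t N A q" by (auto simp: grid_step_def)
  have fin: "finite (grid x t N A q)" using grid_subset assms by (rule finite_subset)
  have "(if grid x t N A q \<noteq> grid x t N A (Suc q) then 1 else 0) + card (grid x t N A (Suc q)) \<le> card (grid x t N A q)"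
  proof (cases "grid x t N A q = grid x t N A (Suc q)")
    case False
    then have "card (grid x t N A (Suc q)) < card (grid x t N A q)"
      using sub fin by (intro psubset_card_mono) auto
    then show ?thesis using False by simp
  qed simp
  then show ?case using Suc unfolding sum.lessThan_Suc by linarith
qed simp

lemma grid_step_alt:
  "grid_step x c d D = {i \<in> D. \<forall>j\<in>D. j \<noteq> i \<longrightarrow> \<not> (\<exists>v\<in>{c..d}. x i v = x j v)}"
  by (auto simp: grid_step_def meeting_def)

context brownian begin

lemma meet_set_past:
  assumes "0 \<le> c" "c < d"
  shows "{\<omega> \<in> space W. \<exists>v\<in>{c..d}. pos a \<omega> i v = pos a \<omega> j v} \<in> sets (past W B d)"
proof -
  have "{\<omega> \<in> space W. \<exists>v\<in>{c..d}. \<bar>pos a \<omega> i v - pos a \<omega> j v\<bar> = 0} \<in> sets (past W B d)"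
  proof (rule zero_in_interval_past[OF assms])
    fix v assume "c \<le> v" "v \<le> d"
    then have [measurable]: "(\<lambda>\<omega>. pos a \<omega> l v) \<in> borel_measurable (past W B d)" for l
      using assms by (intro pos_measurable_past) auto
    show "(\<lambda>\<omega>. \<bar>pos a \<omega> i v - pos a \<omega> j v\<bar>) \<in> borel_measurable (past W B d)" by measurable
  next
    fix \<omega> assume "\<omega> \<in> space W"
    then show "continuous_on {c..d} (\<lambda>v. \<bar>pos a \<omega> i v - pos a \<omega> j v\<bar>)"
      using assms by (intro continuous_on_rabs continuous_on_diff continuous_on_subset[OF pos_cont]) auto
  qed simp
  then show ?thesis by simp
qed

lemma grid_step_measurable:
  assumes cd: "0 \<le> c" "c < d" and A: "finite A" "D \<subseteq> A"
  shows "(\<lambda>\<omega>. grid_step (pos a \<omega>) c d D) \<in> measurable (past W B d) (count_space (Pow A))"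
proof -
  have fin: "finite D" using A finite_subset by blast
  have hit: "Measurable.pred (past W B d) (\<lambda>\<omega>. \<exists>v\<in>{c..d}. pos a \<omega> i v = pos a \<omega> j v)" for i j
    using meet_set_past[OF cd, of a i j] by (simp add: pred_def)
  have "(\<lambda>\<omega>. grid_step (pos a \<omega>) c d D) -` {D'} \<inter> space (past W B d) \<in> sets (past W B d)" if "D' \<in> Pow A" for D'
  proof -
    have alive: "Measurable.pred (past W B d) (\<lambda>\<omega>. \<forall>j\<in>D. j \<noteq> i \<longrightarrow> \<not> (\<exists>v\<in>{c..d}. pos a \<omega> i v = pos a \<omega> j v))" for i
      by (intro pred_intros_finite pred_intros_imp' pred_intros_logic hit fin)
    have "Measurable.pred (past W B d) (\<lambda>\<omega>. \<forall>i\<in>A. i \<in> D' \<longleftrightarrow> (i \<in> D \<and> (\<forall>j\<in>D. j \<noteq> i \<longrightarrow> \<not> (\<exists>v\<in>{c..d}. pos a \<omega> i v = pos a \<omega> j v))))"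
      by (intro pred_intros_finite pred_intros_logic alive A) auto
    moreover have "(\<lambda>\<omega>. grid_step (pos a \<omega>) c d D) -` {D'} \<inter> space (past W B d) =
        {\<omega> \<in> space (past W B d). \<forall>i\<in>A. i \<in> D' \<longleftrightarrow> (i \<in> D \<and> (\<forall>j\<in>D. j \<noteq> i \<longrightarrow> \<not> (\<exists>v\<in>{c..d}. pos a \<omega> i v = pos a \<omega> j v)))}"
    proof -
      have "{i \<in> D. Q i} = D' \<longleftrightarrow> (\<forall>i\<in>A. i \<in> D' \<longleftrightarrow> i \<in> D \<and> Q i)" for Q
        using that A(2) by blast
      then have eq: "grid_step (pos a \<omega>) c d D = D' \<longleftrightarrow>
          (\<forall>i\<in>A. i \<in> D' \<longleftrightarrow> (i \<in> D \<and> (\<forall>j\<in>D. j \<noteq> i \<longrightarrow> \<not> (\<exists>v\<in>{c..d}. pos a \<omega> i v = pos a \<omega> j v))))" for \<omega>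
        unfolding grid_step_alt .
      have "(\<lambda>\<omega>. grid_step (pos a \<omega>) c d D) -` {D'} \<inter> space (past W B d) =
          {\<omega> \<in> space (past W B d). grid_step (pos a \<omega>) c d D = D'}" by auto
      then show ?thesis by (simp only: eq)
    qed
    ultimately show ?thesis by (simp only: pred_def)
  qed
  moreover have "grid_step (pos a \<omega>) c d D \<in> Pow A" for \<omega>
    using A by (auto simp: grid_step_alt)
  ultimately show ?thesis
    using A(1) by (simp add: measurable_count_space_eq2)
qed

text \<open>The survivors at a grid time are known from the past up to that time: a step is
  measurable for each fixed set, and the random set takes finitely many values.\<close>

lemma grid_measurable:
  assumes t: "0 < t" and N: "0 < N" and A: "finite A"
  shows "(\<lambda>\<omega>. grid (pos a \<omega>) t N A p) \<in> measurable (past W B (real p * t / real N)) (count_space (Pow A))"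
proof (induction p)
  case (Suc p)
  let ?c = "real p * t / real N" and ?d = "real (Suc p) * t / real N"
  have cd: "0 \<le> ?c" "?c < ?d" using t N by (auto intro!: divide_strict_right_mono)
  show ?case
    unfolding grid.simps
  proof (rule measurable_compose_countable'[where I = "Pow A"
        and f = "\<lambda>D \<omega>. grid_step (pos a \<omega>) ?c ?d D" and g = "\<lambda>\<omega>. grid (pos a \<omega>) t N A p"])
    show "(\<lambda>\<omega>. grid_step (pos a \<omega>) ?c ?d D) \<in> measurable (past W B ?d) (count_space (Pow A))" if "D \<in> Pow A" for D
      using that by (intro grid_step_measurable cd A) auto
    show "(\<lambda>\<omega>. grid (pos a \<omega>) t N A p) \<in> measurable (past W B ?d) (count_space (Pow A))"
      by (rule measurable_past_mono[OF Suc less_imp_le[OF cd(2)]])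
    show "countable (Pow A)" using A by (simp add: uncountable_infinite countable_finite)
  qed
qed simp

lemma random_pfs_measurable:
  assumes D: "D \<in> measurable M (count_space (Pow {..<n}))"
    and g: "g \<in> borel_measurable borel" and y: "\<And>i. i < n \<Longrightarrow> (\<lambda>w. y w i) \<in> borel_measurable M"
  shows "(\<lambda>w. pfs (D w) g (y w)) \<in> borel_measurable M"
proof (rule measurable_compose_countable'[where f = "\<lambda>C w. pfs C g (y w)", OF _ D])
  show "(\<lambda>w. pfs C g (y w)) \<in> borel_measurable M" if "C \<in> Pow {..<n}" for C
    using that by (intro pfs_measurable g y) (auto intro: finite_subset)
qed (simp add: countable_finite)

text \<open>The set \<open>D\<close> is known at time \<open>s\<close>, and the increments after
  \<open>s\<close> are independent of it; averaging \<open>crossed\<close> over the remaining time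
  \<open>t - s\<close> gives \<open>F\<close> by \<open>pfs_gauss\<close>.\<close>

lemma pfs_markov:
  assumes s: "0 \<le> s" "s < t" and m: "0 < m"
    and D: "D \<in> measurable (past W B s) (count_space (Pow {..<2 * m}))"
  shows "(\<integral>\<omega>. pfs (D \<omega>) crossed (\<lambda>i. pos a \<omega> i t) \<partial>W) =
    (\<integral>\<omega>. pfs (D \<omega>) (\<lambda>d. F (d / sqrt (t - s))) (\<lambda>i. pos a \<omega> i s) \<partial>W)"
proof -
  let ?n = "2 * m"
  have n: "0 < ?n" using m by simp
  have Dsub: "D \<omega> \<subseteq> {..<?n}" if "\<omega> \<in> space W" for \<omega>
    using measurable_space[OF D] that by auto
  \<comment> \<open>The default 0 outside \<open>space W\<close> makes the bound hold at every
    argument, as \<open>markov_integral\<close> asks.\<close>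
  define f where "f = (\<lambda>(\<omega>, y). if \<omega> \<in> space W then pfs (D \<omega>) crossed (\<lambda>i. pos a \<omega> i s + y i) else 0)"
  have fm: "f \<in> borel_measurable (past W B s \<Otimes>\<^sub>M PiM {..<?n} (\<lambda>_. borel))"
  proof -
    have "(\<lambda>p. pfs (D (fst p)) crossed (\<lambda>i. pos a (fst p) i s + snd p i)) \<in> borel_measurable (past W B s \<Otimes>\<^sub>M PiM {..<?n} (\<lambda>_. borel))"
    proof (rule random_pfs_measurable)
      show "(\<lambda>p. D (fst p)) \<in> measurable (past W B s \<Otimes>\<^sub>M PiM {..<?n} (\<lambda>_. borel)) (count_space (Pow {..<?n}))"
        using D by (rule measurable_compose[OF measurable_fst])
      fix i assume "i < ?n"
      then have [measurable]: "(\<lambda>y. y i) \<in> borel_measurable (PiM {..<?n} (\<lambda>_. borel :: real measure))"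
        by (intro measurable_component_singleton) auto
      have [measurable]: "(\<lambda>\<omega>. pos a \<omega> i s) \<in> borel_measurable (past W B s)" using s by (intro pos_measurable_past) auto
      show "(\<lambda>p. pos a (fst p) i s + snd p i) \<in> borel_measurable (past W B s \<Otimes>\<^sub>M PiM {..<?n} (\<lambda>_. borel))"
        by measurable
    qed simp
    then show ?thesis
      by (subst measurable_cong[where g = "\<lambda>p. pfs (D (fst p)) crossed (\<lambda>i. pos a (fst p) i s + snd p i)"])
         (auto simp: f_def space_pair_measure)
  qed
  have bd: "\<bar>f z\<bar> \<le> fact (2 * m) * 2 ^ m" for z
    using abs_pfs_le[OF Dsub abs_crossed_le] by (auto simp: f_def split: prod.splits)
  have "(\<integral>\<omega>. f (\<omega>, incr ?n s t \<omega>) \<partial>W) = (\<integral>\<omega>. (\<integral>y. f (\<omega>, y) \<partial>gauss ?n (t - s)) \<partial>W)"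
    by (rule markov_integral[OF s n fm bd])
  moreover have "(\<integral>\<omega>. f (\<omega>, incr ?n s t \<omega>) \<partial>W) = (\<integral>\<omega>. pfs (D \<omega>) crossed (\<lambda>i. pos a \<omega> i t) \<partial>W)"
  proof (rule Bochner_Integration.integral_cong[OF refl])
    fix \<omega> assume \<omega>: "\<omega> \<in> space W"
    have "pfs (D \<omega>) crossed (\<lambda>i. pos a \<omega> i s + incr ?n s t \<omega> i) = pfs (D \<omega>) crossed (\<lambda>i. pos a \<omega> i t)"
      using Dsub[OF \<omega>] pos_incr[of _ ?n a \<omega> t s] by (intro pfs_cong) (auto intro: finite_subset)
    then show "f (\<omega>, incr ?n s t \<omega>) = pfs (D \<omega>) crossed (\<lambda>i. pos a \<omega> i t)" using \<omega> by (simp add: f_def)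
  qed
  moreover have "(\<integral>\<omega>. (\<integral>y. f (\<omega>, y) \<partial>gauss ?n (t - s)) \<partial>W) =
      (\<integral>\<omega>. pfs (D \<omega>) (\<lambda>d. F (d / sqrt (t - s))) (\<lambda>i. pos a \<omega> i s) \<partial>W)"
  proof (rule Bochner_Integration.integral_cong[OF refl])
    fix \<omega> assume \<omega>: "\<omega> \<in> space W"
    then show "(\<integral>y. f (\<omega>, y) \<partial>gauss ?n (t - s)) = pfs (D \<omega>) (\<lambda>d. F (d / sqrt (t - s))) (\<lambda>i. pos a \<omega> i s)"
      using pfs_gauss[OF _ Dsub[OF \<omega>] n, of "t - s" "\<lambda>i. pos a \<omega> i s"] s by (simp add: f_def)
  qed
  ultimately show ?thesis by simp
qed

lemma AE_pos_neq:
  assumes t: "0 < t" and ij: "i \<noteq> j"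
  shows "AE \<omega> in W. pos a \<omega> i t \<noteq> pos a \<omega> j t"
proof -
  define n where "n = Suc (max i j)"
  have n: "i < n" "j < n" "0 < n" by (auto simp: n_def)
  have ci: "(\<lambda>y. y l) \<in> borel_measurable (PiM {..<n} (\<lambda>_. borel :: real measure))" if "l < n" for l
    using that by (intro measurable_component_singleton) auto
  have "AE y in gauss n t. y j - y i \<noteq> a i - a j"
  proof -
    have gd: "distributed (gauss n t) lborel (\<lambda>y. y j - y i) (normal_density 0 (sqrt (t + t)))"
      by (rule gauss_diff_distributed[OF t n(1,2) ij])
    have "AE z in distr (gauss n t) lborel (\<lambda>y. y j - y i). z \<noteq> a i - a j"
      unfolding distributed_distr_eq_density[OF gd]
      using AE_lborel_singleton[of "a i - a j"] by (subst AE_density) auto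
    then show ?thesis
      by (subst (asm) AE_distr_iff) (use distributed_measurable[OF gd] in auto)
  qed
  moreover have "distr W (PiM {..<n} (\<lambda>_. borel)) (incr n 0 t) = gauss n t"
    using distr_incr[of 0 t n] t n by simp
  ultimately have "AE y in distr W (PiM {..<n} (\<lambda>_. borel)) (incr n 0 t). y j - y i \<noteq> a i - a j"
    by (simp only:)
  then have "AE \<omega> in W. incr n 0 t \<omega> j - incr n 0 t \<omega> i \<noteq> a i - a j"
    using t ci[OF n(1)] ci[OF n(2)] by (subst (asm) AE_distr_iff) (auto intro!: incr_measurable measurable_sets_borel)
  with AE_space show ?thesis
  proof eventually_elim
    case (elim \<omega>)
    then show ?case
      using pos_incr[OF n(1), of a \<omega> t 0] pos_incr[OF n(2), of a \<omega> t 0] by (simp add: pos_0)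
  qed
qed

text \<open>\<open>P\<close> is the terminal Pfaffian of free motions over a set of labels. For the
  initial set its mean is the claimed value; for the final survivors it tends to the indicator of
  extinction. The difference telescopes over the grid, and in the mean each jump of \<open>P\<close>
  may be replaced by a jump of \<open>H\<close> at the end of the cell, where it is small.\<close>

lemma prob_extinct_by:
  assumes t: "0 < t" and m: "0 < m" and a: "strict_mono_on {..<2 * m} a"
  shows "{\<omega> \<in> space W. extinct_by (pos a \<omega>) t 0 {..<2 * m}} \<in> events"
    and "prob {\<omega> \<in> space W. extinct_by (pos a \<omega>) t 0 {..<2 * m}} = pfs {..<2 * m} (\<lambda>d. F (d / sqrt t)) a"
proof -
  let ?A = "{..<2 * m}"
  define Ext where "Ext = {\<omega> \<in> space W. extinct_by (pos a \<omega>) t 0 ?A}"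
  define gr where "gr N p \<omega> = grid (pos a \<omega>) t N ?A p" for N p \<omega>
  define K where "K = (fact (2 * m) * 2 ^ m :: real)"
  \<comment> \<open>At \<open>s = t\<close> no time remains and \<open>crossed\<close> takes over,
    so that \<open>PH\<close> holds at the last grid time as well.\<close>
  define H where "H C s \<omega> = pfs C (if s < t then \<lambda>d. F (d / sqrt (t - s)) else crossed) (\<lambda>i. pos a \<omega> i s)" for C s \<omega>
  define P where "P D \<omega> = pfs D crossed (\<lambda>i. pos a \<omega> i t)" for D \<omega>
  define J where "J N \<omega> = (\<Sum>p<N. H (gr N p \<omega>) (real (Suc p) * t / real N) \<omega> - H (gr N (Suc p) \<omega>) (real (Suc p) * t / real N) \<omega>)" for N \<omega>
  have alt: "a i < a j" if "i \<in> ?A" "j \<in> ?A" "i < j" for i j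
    using a that by (rule strict_mono_onD)
  have meet0: "meeting (pos a \<omega>) ?A 0 = {}" if "\<omega> \<in> space W" for \<omega>
    using alt that by (auto simp: meeting_def pos_0) (metis lessThan_iff less_irrefl linorder_neqE_nat)
  have ev: "\<forall>\<^sub>F N in sequentially. gr N N \<omega> = {} \<longleftrightarrow> \<omega> \<in> Ext" if "\<omega> \<in> space W" for \<omega>
    using grid_extinct[of "pos a \<omega>" t ?A 0 ?A] pos_cont[OF that] t meet0[OF that] that
    by (simp add: gr_def Ext_def)
  have grp: "gr N p \<in> measurable (past W B (real p * t / real N)) (count_space (Pow ?A))" if "0 < N" for N p
    unfolding gr_def using t that by (intro grid_measurable) auto
  have gr: "gr N p \<in> measurable W (count_space (Pow ?A))" if "0 < N" for N p
    by (rule measurable_from_past[OF grp[OF that]])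
  \<comment> \<open>\<open>Suc N\<close> keeps away from the grid without cells.\<close>
  have empty_meas: "{\<omega> \<in> space W. gr (Suc N) (Suc N) \<omega> = {}} \<in> events" for N
  proof -
    have "gr (Suc N) (Suc N) -` {{}} \<inter> space W \<in> events"
      by (rule measurable_sets[OF gr]) auto
    moreover have "gr (Suc N) (Suc N) -` {{}} \<inter> space W = {\<omega> \<in> space W. gr (Suc N) (Suc N) \<omega> = {}}" by auto
    ultimately show ?thesis by simp
  qed
  have "Ext = {\<omega> \<in> space W. \<exists>N0. \<forall>N. N0 \<le> N \<longrightarrow> gr (Suc N) (Suc N) \<omega> = {}}"
  proof (intro equalityI subsetI)
    fix \<omega> assume \<omega>: "\<omega> \<in> Ext"
    then have \<omega>W: "\<omega> \<in> space W" by (simp add: Ext_def)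
    have "\<forall>\<^sub>F N in sequentially. gr (Suc N) (Suc N) \<omega> = {}"
      using ev[OF \<omega>W] \<omega> by (subst eventually_sequentially_Suc) simp
    then show "\<omega> \<in> {\<omega> \<in> space W. \<exists>N0. \<forall>N. N0 \<le> N \<longrightarrow> gr (Suc N) (Suc N) \<omega> = {}}"
      using \<omega>W by (simp add: eventually_sequentially)
  next
    fix \<omega> assume \<omega>: "\<omega> \<in> {\<omega> \<in> space W. \<exists>N0. \<forall>N. N0 \<le> N \<longrightarrow> gr (Suc N) (Suc N) \<omega> = {}}"
    then have \<omega>W: "\<omega> \<in> space W" by simp
    have "\<forall>\<^sub>F N in sequentially. gr (Suc N) (Suc N) \<omega> = {}"
      using \<omega> by (simp add: eventually_sequentially)
    then have "\<forall>\<^sub>F N in sequentially. gr N N \<omega> = {}"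
      by (subst (asm) eventually_sequentially_Suc)
    with ev[OF \<omega>W] have "\<forall>\<^sub>F N in sequentially. \<omega> \<in> Ext" by eventually_elim simp
    then show "\<omega> \<in> Ext" by simp
  qed
  moreover have "{\<omega> \<in> space W. \<exists>N0. \<forall>N. N0 \<le> N \<longrightarrow> gr (Suc N) (Suc N) \<omega> = {}} \<in> events"
    by (intro sets.sets_Collect_countable_Ex sets.sets_Collect_countable_All sets.sets_Collect_imp sets.sets_Collect_const empty_meas)
  ultimately have ExtM: "Ext \<in> events" by (simp only:)
  then show "{\<omega> \<in> space W. extinct_by (pos a \<omega>) t 0 ?A} \<in> events" by (simp only: Ext_def)
  have Hg: "(if s < t then \<lambda>d. F (d / sqrt (t - s)) else crossed) \<in> borel_measurable borel"
    "\<bar>(if s < t then \<lambda>d. F (d / sqrt (t - s)) else crossed) d\<bar> \<le> 2" for s d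
    using abs_F_le abs_crossed_le by simp_all
  have grs: "gr N p \<omega> \<subseteq> ?A" for N p \<omega> unfolding gr_def by (rule grid_subset)
  have HK: "\<bar>H (gr N p \<omega>) s \<omega>\<bar> \<le> K" for N p s \<omega>
    unfolding H_def K_def by (rule abs_pfs_le[OF grs Hg(2)])
  have PK: "\<bar>P (gr N p \<omega>) \<omega>\<bar> \<le> K" for N p \<omega>
    unfolding P_def K_def by (rule abs_pfs_le[OF grs abs_crossed_le])
  have Hm: "(\<lambda>\<omega>. H (gr N p \<omega>) s \<omega>) \<in> borel_measurable W" if "0 < N" "0 \<le> s" for N p s
    unfolding H_def using that by (intro random_pfs_measurable[OF gr Hg(1)] pos_measurable)
  have Pm: "(\<lambda>\<omega>. P (gr N p \<omega>) \<omega>) \<in> borel_measurable W" if "0 < N" for N p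
    unfolding P_def using that t by (intro random_pfs_measurable[OF gr] pos_measurable) auto
  have Hi: "integrable W (\<lambda>\<omega>. H (gr N p \<omega>) s \<omega>)" if "0 < N" "0 \<le> s" for N p s
    using HK that by (intro integrable_const_bound[of _ K] Hm) auto
  have Pi: "integrable W (\<lambda>\<omega>. P (gr N p \<omega>) \<omega>)" if "0 < N" for N p
    using PK that by (intro integrable_const_bound[of _ K] Pm) auto
  \<comment> \<open>The mean may be evaluated at any time \<open>s\<close> at which the set is
    already known. This freedom allows both sets of a jump to be compared at the common time
    \<open>Suc p * t / N\<close>.\<close>
  have PH: "(\<integral>\<omega>. P (gr N p \<omega>) \<omega> \<partial>W) = (\<integral>\<omega>. H (gr N p \<omega>) s \<omega> \<partial>W)"
    if N: "0 < N" and s: "real p * t / real N \<le> s" "s \<le> t" for N p s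
  proof (cases "s < t")
    case True
    have "0 \<le> real p * t / real N" using t by simp
    then have "0 \<le> s" using s by simp
    then show ?thesis
      using pfs_markov[OF _ True m measurable_past_mono[OF grp[OF N] s(1)]] True by (simp add: P_def H_def)
  next
    case False
    then have "s = t" using s by simp
    then show ?thesis by (simp add: P_def H_def)
  qed
  have sN: "real p * t / real N \<le> t" if "0 < N" "p \<le> N" for p N
    using that t mult_right_mono[of "real p" "real N" t] by (simp add: pos_divide_le_eq mult.commute)
  have identity: "pfs ?A (\<lambda>d. F (d / sqrt t)) a = (\<integral>\<omega>. J N \<omega> \<partial>W) + (\<integral>\<omega>. P (gr N N \<omega>) \<omega> \<partial>W)" if N: "0 < N" for N
  proof -
    have "pfs ?A (\<lambda>d. F (d / sqrt t)) a = (\<integral>\<omega>. H (gr N 0 \<omega>) 0 \<omega> \<partial>W)"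
    proof -
      have "H (gr N 0 \<omega>) 0 \<omega> = pfs ?A (\<lambda>d. F (d / sqrt t)) a" if "\<omega> \<in> space W" for \<omega>
        using t by (simp add: H_def gr_def pos_0[OF that])
      then have "(\<integral>\<omega>. H (gr N 0 \<omega>) 0 \<omega> \<partial>W) = (\<integral>\<omega>. pfs ?A (\<lambda>d. F (d / sqrt t)) a \<partial>W)"
        by (intro Bochner_Integration.integral_cong) auto
      then show ?thesis by (simp add: prob_space)
    qed
    also have "\<dots> = (\<integral>\<omega>. P (gr N 0 \<omega>) \<omega> \<partial>W)"
      using t N by (intro PH[symmetric]) auto
    also have "\<dots> = (\<integral>\<omega>. (\<Sum>p<N. P (gr N p \<omega>) \<omega> - P (gr N (Suc p) \<omega>) \<omega>) + P (gr N N \<omega>) \<omega> \<partial>W)"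
    proof (rule Bochner_Integration.integral_cong[OF refl])
      fix \<omega>
      show "P (gr N 0 \<omega>) \<omega> = (\<Sum>p<N. P (gr N p \<omega>) \<omega> - P (gr N (Suc p) \<omega>) \<omega>) + P (gr N N \<omega>) \<omega>"
        using sum_lessThan_telescope'[of "\<lambda>p. P (gr N p \<omega>) \<omega>" N] by simp
    qed
    also have "\<dots> = (\<integral>\<omega>. (\<Sum>p<N. P (gr N p \<omega>) \<omega> - P (gr N (Suc p) \<omega>) \<omega>) \<partial>W) + (\<integral>\<omega>. P (gr N N \<omega>) \<omega> \<partial>W)"
      by (intro Bochner_Integration.integral_add Bochner_Integration.integrable_sum Bochner_Integration.integrable_diff Pi N)
    also have "(\<integral>\<omega>. (\<Sum>p<N. P (gr N p \<omega>) \<omega> - P (gr N (Suc p) \<omega>) \<omega>) \<partial>W) =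
        (\<Sum>p<N. \<integral>\<omega>. P (gr N p \<omega>) \<omega> - P (gr N (Suc p) \<omega>) \<omega> \<partial>W)"
      by (intro Bochner_Integration.integral_sum Bochner_Integration.integrable_diff Pi N)
    also have "\<dots> = (\<Sum>p<N. (\<integral>\<omega>. P (gr N p \<omega>) \<omega> \<partial>W) - (\<integral>\<omega>. P (gr N (Suc p) \<omega>) \<omega> \<partial>W))"
      by (intro sum.cong refl Bochner_Integration.integral_diff Pi N)
    also have "(\<Sum>p<N. (\<integral>\<omega>. P (gr N p \<omega>) \<omega> \<partial>W) - (\<integral>\<omega>. P (gr N (Suc p) \<omega>) \<omega> \<partial>W)) =
        (\<Sum>p<N. (\<integral>\<omega>. H (gr N p \<omega>) (real (Suc p) * t / real N) \<omega> \<partial>W) - (\<integral>\<omega>. H (gr N (Suc p) \<omega>) (real (Suc p) * t / real N) \<omega> \<partial>W))"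
    proof (intro sum.cong refl)
      fix p assume "p \<in> {..<N}"
      then have le: "real (Suc p) * t / real N \<le> t" using N by (intro sN) auto
      have "real p * t / real N \<le> real (Suc p) * t / real N"
        using t by (intro divide_right_mono mult_right_mono) auto
      then show "(\<integral>\<omega>. P (gr N p \<omega>) \<omega> \<partial>W) - (\<integral>\<omega>. P (gr N (Suc p) \<omega>) \<omega> \<partial>W) =
          (\<integral>\<omega>. H (gr N p \<omega>) (real (Suc p) * t / real N) \<omega> \<partial>W) - (\<integral>\<omega>. H (gr N (Suc p) \<omega>) (real (Suc p) * t / real N) \<omega> \<partial>W)"
        using PH[OF N _ le, of p] PH[OF N order_refl le] by (simp only:)
    qed
    also have "\<dots> = (\<integral>\<omega>. J N \<omega> \<partial>W)"
    proof -
      have s0: "0 \<le> real (Suc p) * t / real N" for p using t by simp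
      have "(\<integral>\<omega>. J N \<omega> \<partial>W) = (\<Sum>p<N. \<integral>\<omega>. H (gr N p \<omega>) (real (Suc p) * t / real N) \<omega> - H (gr N (Suc p) \<omega>) (real (Suc p) * t / real N) \<omega> \<partial>W)"
        unfolding J_def by (intro Bochner_Integration.integral_sum Bochner_Integration.integrable_diff Hi N s0)
      also have "\<dots> = (\<Sum>p<N. (\<integral>\<omega>. H (gr N p \<omega>) (real (Suc p) * t / real N) \<omega> \<partial>W) - (\<integral>\<omega>. H (gr N (Suc p) \<omega>) (real (Suc p) * t / real N) \<omega> \<partial>W))"
        by (intro sum.cong refl Bochner_Integration.integral_diff Hi N s0)
      finally show ?thesis by (rule sym)
    qed
    finally show ?thesis .
  qed
  \<comment> \<open>A summand vanishes unless the surviving set changes, which happens at most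
    \<open>2 * m\<close> times; each change costs at most \<open>2 * K\<close>.\<close>
  have Jbd: "\<bar>J N \<omega>\<bar> \<le> 2 * K * (2 * m)" for N \<omega>
  proof -
    have K: "0 \<le> K" by (simp add: K_def)
    have "\<bar>J N \<omega>\<bar> \<le> (\<Sum>p<N. 2 * K * (if gr N p \<omega> \<noteq> gr N (Suc p) \<omega> then 1 else 0))"
      unfolding J_def
    proof (rule order_trans[OF sum_abs sum_mono])
      fix p
      show "\<bar>H (gr N p \<omega>) (real (Suc p) * t / real N) \<omega> - H (gr N (Suc p) \<omega>) (real (Suc p) * t / real N) \<omega>\<bar>
          \<le> 2 * K * (if gr N p \<omega> \<noteq> gr N (Suc p) \<omega> then 1 else 0)"
      proof (cases "gr N p \<omega> = gr N (Suc p) \<omega>")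
        case False
        then show ?thesis
          using HK[of N p \<omega> "real (Suc p) * t / real N"] HK[of N "Suc p" \<omega> "real (Suc p) * t / real N"] by simp
      qed simp
    qed
    also have "\<dots> = 2 * K * real (\<Sum>p<N. if gr N p \<omega> \<noteq> gr N (Suc p) \<omega> then 1 else 0)"
      unfolding of_nat_sum sum_distrib_left by (intro sum.cong refl) simp
    also have "\<dots> \<le> 2 * K * real (2 * m)"
    proof (intro mult_left_mono)
      have "(\<Sum>p<N. if gr N p \<omega> \<noteq> gr N (Suc p) \<omega> then 1 else 0) \<le> card ?A"
        unfolding gr_def by (rule order_trans[OF le_add1 grid_changes_le]) simp
      then show "real (\<Sum>p<N. if gr N p \<omega> \<noteq> gr N (Suc p) \<omega> then 1 else 0) \<le> real (2 * m)"
        by (simp only: of_nat_le_iff card_lessThan)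
    qed (use K in simp)
    finally show ?thesis by simp
  qed
  \<comment> \<open>Generic paths: distinct positions at \<open>t\<close>, and no triple collision
    up to \<open>t\<close>. Ordered starting points then turn into the order assumptions of
    \<open>grid_jumps_tendsto_0\<close>.\<close>
  have "AE \<omega> in W. \<forall>i\<in>?A. \<forall>j\<in>?A. i \<noteq> j \<longrightarrow> pos a \<omega> i t \<noteq> pos a \<omega> j t"
  proof (intro AE_finite_allI)
    fix i j
    show "AE \<omega> in W. i \<noteq> j \<longrightarrow> pos a \<omega> i t \<noteq> pos a \<omega> j t"
    proof (cases "i = j")
      case False
      from AE_pos_neq[OF t this, of a] show ?thesis by eventually_elim simp
    qed simp
  qed simp_all
  moreover have "AE \<omega> in W. \<forall>i\<in>?A. \<forall>j\<in>?A. \<forall>k\<in>?A. i < j \<longrightarrow> j < k \<longrightarrow>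
      (\<forall>v\<in>{0..t}. \<not> (pos a \<omega> i v = pos a \<omega> j v \<and> pos a \<omega> j v = pos a \<omega> k v))"
  proof (intro AE_finite_allI)
    fix i j k assume "i \<in> ?A" "j \<in> ?A" "k \<in> ?A"
    show "AE \<omega> in W. i < j \<longrightarrow> j < k \<longrightarrow> (\<forall>v\<in>{0..t}. \<not> (pos a \<omega> i v = pos a \<omega> j v \<and> pos a \<omega> j v = pos a \<omega> k v))"
    proof (cases "i < j \<and> j < k")
      case True
      then have "AE \<omega> in W. \<forall>v\<in>{0..t}. \<not> (pos a \<omega> i v = pos a \<omega> j v \<and> pos a \<omega> j v = pos a \<omega> k v)"
        using alt[OF \<open>i \<in> ?A\<close> \<open>j \<in> ?A\<close>] by (intro AE_no_triple_collision t) simp_all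
      then show ?thesis by eventually_elim simp
    qed (auto intro: AE_I2)
  qed simp_all
  ultimately have good: "AE \<omega> in W. (\<lambda>N. J N \<omega>) \<longlonglongrightarrow> 0 \<and> (\<lambda>N. P (gr N N \<omega>) \<omega>) \<longlonglongrightarrow> indicator Ext \<omega>"
    using AE_space
  proof eventually_elim
    case (elim \<omega>)
    then have \<omega>: "\<omega> \<in> space W" by simp
    have "(\<lambda>N. \<Sum>p=grid_index t 0 N..<N. H (grid (pos a \<omega>) t N ?A p) (real (Suc p) * t / real N) \<omega> -
          H (grid (pos a \<omega>) t N ?A (Suc p)) (real (Suc p) * t / real N) \<omega>) \<longlonglongrightarrow> 0
      \<and> (\<forall>\<^sub>F N in sequentially. even (card (grid (pos a \<omega>) t N ?A N)))
      \<and> (\<forall>\<^sub>F N in sequentially. \<forall>i\<in>grid (pos a \<omega>) t N ?A N. \<forall>j\<in>grid (pos a \<omega>) t N ?A N. i < j \<longrightarrow> pos a \<omega> i t < pos a \<omega> j t)"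
    proof (rule grid_jumps_tendsto_0[OF pos_cont[OF \<omega>] t])
      show "meeting (pos a \<omega>) ?A 0 = {}" by (rule meet0[OF \<omega>])
      show "\<forall>\<^sub>F N in sequentially. grid (pos a \<omega>) t N ?A (grid_index t 0 N) = ?A" by simp
      show "pos a \<omega> i 0 < pos a \<omega> j 0" if "i \<in> ?A" "j \<in> ?A" "i < j" for i j
        using alt[OF that] by (simp add: pos_0[OF \<omega>])
      show "meeting (pos a \<omega>) ?A t = {}" using elim(1) by (auto simp: meeting_def)
      show "\<not> (pos a \<omega> i v = pos a \<omega> j v \<and> pos a \<omega> j v = pos a \<omega> k v)"
        if "i \<in> ?A" "j \<in> ?A" "k \<in> ?A" "i < j" "j < k" "0 \<le> v" "v \<le> t" for i j k v
      proof -
        have "v \<in> {0..t}" using that(6,7) by simp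
        then show ?thesis using elim(2) that(1-5) by blast
      qed
      show "continuous_on {0..<t} (\<lambda>s. H D s \<omega>)" for D
      proof -
        have pc: "continuous_on {0..<t} (pos a \<omega> i)" for i
          by (rule continuous_on_subset[OF pos_cont[OF \<omega>]]) auto
        have "continuous_on {0..<t} (\<lambda>s. pfs D (\<lambda>d. F (d / sqrt (t - s))) (\<lambda>i. pos a \<omega> i s))"
          unfolding continuous_on_def
        proof (intro ballI pfs_tendsto)
          fix s i j assume s: "s \<in> {0..<t}"
          have "continuous_on {0..<t} (\<lambda>s. F ((pos a \<omega> j s - pos a \<omega> i s) / sqrt (t - s)))"
            using pc by (intro continuous_intros) auto
          then show "((\<lambda>s. F ((pos a \<omega> j s - pos a \<omega> i s) / sqrt (t - s))) \<longlongrightarrow> F ((pos a \<omega> j s - pos a \<omega> i s) / sqrt (t - s))) (at s within {0..<t})"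
            using s unfolding continuous_on_def by blast
        qed
        then show ?thesis
          by (rule continuous_on_eq) (auto simp: H_def)
      qed
      show "H (D - meeting (pos a \<omega>) D v) v \<omega> = H D v \<omega> \<and> even (card (D - meeting (pos a \<omega>) D v))"
        if "D \<subseteq> ?A" "even (card D)" "0 \<le> v" "v < t"
          "\<And>i j. i \<in> D \<Longrightarrow> j \<in> D \<Longrightarrow> i < j \<Longrightarrow> pos a \<omega> i v \<le> pos a \<omega> j v"
          "\<And>i j k. i \<in> D \<Longrightarrow> j \<in> D \<Longrightarrow> k \<in> D \<Longrightarrow> i < j \<Longrightarrow> j < k \<Longrightarrow> pos a \<omega> i v < pos a \<omega> k v" for D v
      proof -
        have "finite D" using that(1) finite_subset by blast
        then have "pfs (D - {i \<in> D. \<exists>j\<in>D. j \<noteq> i \<and> pos a \<omega> i v = pos a \<omega> j v}) (\<lambda>d. F (d / sqrt (t - v))) (\<lambda>i. pos a \<omega> i v) =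
            pfs D (\<lambda>d. F (d / sqrt (t - v))) (\<lambda>i. pos a \<omega> i v) \<and>
            even (card (D - {i \<in> D. \<exists>j\<in>D. j \<noteq> i \<and> pos a \<omega> i v = pos a \<omega> j v}))"
          using that(2) by (rule pfs_collapse[OF _ _ _ that(5,6)]) (simp_all add: F_0)
        then show ?thesis using that(4) by (simp add: H_def meeting_def)
      qed
    qed (use t in auto)
    then have J: "(\<lambda>N. J N \<omega>) \<longlonglongrightarrow> 0" and even: "\<forall>\<^sub>F N in sequentially. even (card (gr N N \<omega>))"
      and sorted: "\<forall>\<^sub>F N in sequentially. \<forall>i\<in>gr N N \<omega>. \<forall>j\<in>gr N N \<omega>. i < j \<longrightarrow> pos a \<omega> i t < pos a \<omega> j t"
      by (simp_all add: J_def gr_def lessThan_atLeast0)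
    \<comment> \<open>Without survivors the empty Pfaffian is 1. Otherwise the survivors are ordered
      at time \<open>t\<close>, every entry of \<open>crossed\<close> is 0, and so is the
      Pfaffian.\<close>
    have "\<forall>\<^sub>F N in sequentially. P (gr N N \<omega>) \<omega> = indicator Ext \<omega>"
      using even sorted ev[OF \<omega>]
    proof eventually_elim
      case (elim N)
      show ?case
      proof (cases "gr N N \<omega> = {}")
        case True
        then show ?thesis using elim(3) by (simp add: P_def)
      next
        case False
        have "pfs (gr N N \<omega>) crossed (\<lambda>i. pos a \<omega> i t) = 0"
          using elim(1,2) False finite_subset[OF grs]
          by (intro pfs_zero) (auto simp: crossed_def not_less less_imp_le)
        then show ?thesis using elim(3) False by (simp add: P_def)
      qed
    qed
    then show ?case using J by (auto intro: tendsto_eventually)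
  qed
  have Jm: "J N \<in> borel_measurable W" for N
  proof (cases "N = 0")
    case False
    then show ?thesis
      unfolding J_def using t by (intro borel_measurable_sum borel_measurable_diff Hm) auto
  next
    case True
    then have "J N = (\<lambda>_. 0)" by (simp add: J_def fun_eq_iff)
    then show ?thesis by simp
  qed
  have lim1: "(\<lambda>N. \<integral>\<omega>. J N \<omega> \<partial>W) \<longlonglongrightarrow> (\<integral>\<omega>. 0 \<partial>W)"
  proof (rule integral_dominated_convergence[where w = "\<lambda>_. 2 * K * (2 * m)"])
    show "AE \<omega> in W. (\<lambda>N. J N \<omega>) \<longlonglongrightarrow> 0" using good by eventually_elim (rule conjunct1)
    show "AE \<omega> in W. norm (J N \<omega>) \<le> 2 * K * (2 * m)" for N using Jbd by simp
  qed (simp_all add: Jm)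
  have lim2: "(\<lambda>N. \<integral>\<omega>. P (gr (Suc N) (Suc N) \<omega>) \<omega> \<partial>W) \<longlonglongrightarrow> (\<integral>\<omega>. indicator Ext \<omega> \<partial>W)"
  proof (rule integral_dominated_convergence[where w = "\<lambda>_. K"])
    show "AE \<omega> in W. (\<lambda>N. P (gr (Suc N) (Suc N) \<omega>) \<omega>) \<longlonglongrightarrow> indicator Ext \<omega>"
      using good by eventually_elim (rule LIMSEQ_Suc[of "\<lambda>N. P (gr N N _) _"], rule conjunct2)
    show "AE \<omega> in W. norm (P (gr (Suc N) (Suc N) \<omega>) \<omega>) \<le> K" for N using PK by simp
    show "indicat_real Ext \<in> borel_measurable W" using ExtM by (rule borel_measurable_indicator)
  qed (simp_all add: Pm)
  have "(\<lambda>N. (\<integral>\<omega>. J (Suc N) \<omega> \<partial>W) + (\<integral>\<omega>. P (gr (Suc N) (Suc N) \<omega>) \<omega> \<partial>W)) \<longlonglongrightarrow> (\<integral>\<omega>. 0 \<partial>W) + (\<integral>\<omega>. indicator Ext \<omega> \<partial>W)"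
    by (rule tendsto_add[OF LIMSEQ_Suc[OF lim1] lim2])
  then have "(\<lambda>N::nat. pfs ?A (\<lambda>d. F (d / sqrt t)) a) \<longlonglongrightarrow> (\<integral>\<omega>. 0 \<partial>W) + (\<integral>\<omega>. indicator Ext \<omega> \<partial>W)"
    by (simp only: identity[OF zero_less_Suc, symmetric])
  then have "pfs ?A (\<lambda>d. F (d / sqrt t)) a = (\<integral>\<omega>. 0 \<partial>W) + (\<integral>\<omega>. indicator Ext \<omega> \<partial>W)"
    by (rule LIMSEQ_unique[OF tendsto_const])
  then show "prob {\<omega> \<in> space W. extinct_by (pos a \<omega>) t 0 ?A} = pfs ?A (\<lambda>d. F (d / sqrt t)) a"
    using ExtM unfolding Ext_def[symmetric] by simp
qed

text \<open>The horizons t - t / (j + 2) increase to \<open>t\<close> without reaching it. The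
  summand 2 makes the first one t / 2, hence all are positive.\<close>

lemma extinction_time_less_iff:
  assumes t: "0 < t"
  shows "extinction_time x A < ereal t \<longleftrightarrow> (\<exists>j::nat. extinct_by x (t - t / (real j + 2)) 0 A)"
proof
  assume "extinction_time x A < ereal t"
  then obtain s k where k: "(annihilate x ^^ k) (0, A) = (s, {})" "s < t"
    unfolding extinction_time_def Inf_less_iff by auto
  obtain j :: nat where j: "t / (t - s) < j" using reals_Archimedean2 by blast
  have "t / (real j + 2) \<le> t - s"
    using j k(2) by (simp add: field_simps)
  then have "s \<le> t - t / (real j + 2)" by linarith
  then have "extinct_by x (t - t / (real j + 2)) 0 A"
    unfolding extinct_by_def using k(1) by blast
  then show "\<exists>j::nat. extinct_by x (t - t / (real j + 2)) 0 A" ..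
next
  assume "\<exists>j::nat. extinct_by x (t - t / (real j + 2)) 0 A"
  then obtain j :: nat and k s where k: "(annihilate x ^^ k) (0, A) = (s, {})" "s \<le> t - t / (real j + 2)"
    unfolding extinct_by_def by auto
  have "0 < t / (real j + 2)" using t by simp
  then have "s < t" using k(2) by linarith
  show "extinction_time x A < ereal t"
    unfolding extinction_time_def Inf_less_iff
  proof (rule bexI)
    show "ereal s \<in> {ereal s | s k. (annihilate x ^^ k) (0, A) = (s, {})}" using k(1) by blast
  qed (use \<open>s < t\<close> in simp)
qed

text \<open>The extinction events for the horizons \<open>c j\<close> increase to extinction
  strictly before \<open>t\<close>, and the Pfaffian of \<open>F\<close> is continuous in the
  horizon.\<close>

theorem annihilating_extinction_prob_eq:
  assumes t: "0 < t" and m: "0 < m" and a: "strict_mono_on {..<2 * m} a"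
  shows "annihilating_extinction_prob W B (2 * m) a t = pfaffian m (pair_entry (\<lambda>d. F (d / sqrt t)) a)"
proof -
  let ?A = "{..<2 * m}"
  define c where "c j = t - t / (real j + 2)" for j :: nat
  have c: "0 < c j" for j
  proof -
    have "t / (real j + 2) \<le> t / 2" using t by (intro divide_left_mono) auto
    then show ?thesis using t unfolding c_def by linarith
  qed
  have cmono: "c j \<le> c l" if "j \<le> l" for j l
    unfolding c_def using t that by (intro diff_left_mono divide_left_mono) auto
  define Ex where "Ex j = {\<omega> \<in> space W. extinct_by (pos a \<omega>) (c j) 0 ?A}" for j
  note E = prob_extinct_by[OF c m a, folded Ex_def]
  have eq: "{\<omega> \<in> space W. extinction_time (\<lambda>i s. a i + B i s \<omega>) ?A < ereal t} = (\<Union>j. Ex j)"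
    unfolding extinction_time_less_iff[OF t] Ex_def c_def pos_def[abs_def] by auto
  have "incseq Ex"
    unfolding incseq_def Ex_def extinct_by_def using cmono by (force intro: order_trans)
  then have "(\<lambda>j. prob (Ex j)) \<longlonglongrightarrow> prob (\<Union>j. Ex j)"
    using E(1) by (intro finite_Lim_measure_incseq) auto
  moreover have "(\<lambda>j. prob (Ex j)) \<longlonglongrightarrow> pfs ?A (\<lambda>d. F (d / sqrt t)) a"
    unfolding E(2)
  proof (intro pfs_tendsto tendsto_F tendsto_divide tendsto_const tendsto_real_sqrt)
    have "(\<lambda>j. t / real (j + 2)) \<longlonglongrightarrow> 0"
      using LIMSEQ_ignore_initial_segment[OF lim_const_over_n[of t], of 2] by simp
    then have "(\<lambda>j. t - t / real (j + 2)) \<longlonglongrightarrow> t - 0" by (intro tendsto_diff tendsto_const)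
    then show "c \<longlonglongrightarrow> t" by (simp add: c_def[abs_def] add.commute)
  qed (use t in simp)
  ultimately have "prob (\<Union>j. Ex j) = pfs ?A (\<lambda>d. F (d / sqrt t)) a"
    by (rule LIMSEQ_unique)
  then show ?thesis
    unfolding annihilating_extinction_prob_def eq by (simp add: pfs_lessThan)
qed

end

section \<open>Configurations\<close>

lemma space_config: "space config_space = configurations"
  unfolding config_space_def by (subst space_Sup_eq_UN) auto

lemma emeasure_counting:
  assumes "A \<in> sets borel"
  shows "emeasure (counting X) A = emeasure (count_space X) (A \<inter> X)"
  unfolding counting_def using assms by (subst emeasure_distr) auto

lemma emeasure_counting_bounded:
  assumes "A \<in> sets borel" "bounded A" "X \<in> configurations"
  shows "emeasure (counting X) A = of_nat (card (X \<inter> A))" "finite (X \<inter> A)"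
proof -
  show fin: "finite (X \<inter> A)" using assms by (auto simp: configurations_def)
  then show "emeasure (counting X) A = of_nat (card (X \<inter> A))"
    using emeasure_counting[OF assms(1), of X] by (simp add: Int_commute)
qed

lemma emeasure_counting_0_iff:
  assumes "A \<in> sets borel"
  shows "emeasure (counting X) A = 0 \<longleftrightarrow> X \<inter> A = {}"
  unfolding emeasure_counting[OF assms] by (subst emeasure_count_space_eq_0) (auto simp: Int_commute)

lemma emeasure_counting_measurable:
  assumes "A \<in> sets borel"
  shows "(\<lambda>X. emeasure (counting X) A) \<in> borel_measurable config_space"
  unfolding config_space_def using assms
  by (intro measurable_Sup1[of "vimage_algebra configurations (\<lambda>X. emeasure (counting X) A) borel"])
     (auto intro: measurable_vimage_algebra1)

lemma void_measurable:
  assumes "A \<in> sets borel"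
  shows "{X \<in> configurations. X \<inter> A = {}} \<in> sets config_space"
proof -
  have "(\<lambda>X. emeasure (counting X) A) -` {0} \<inter> space config_space \<in> sets config_space"
    by (rule measurable_sets[OF emeasure_counting_measurable[OF assms]]) simp
  moreover have "(\<lambda>X. emeasure (counting X) A) -` {0} \<inter> space config_space = {X \<in> configurations. X \<inter> A = {}}"
    using emeasure_counting_0_iff[OF assms] by (auto simp: space_config)
  ultimately show ?thesis by simp
qed

lemma point_process_lawD:
  assumes "point_process_law L"
  shows "prob_space L" "sets L = sets config_space" "space L = configurations"
  using assms sets_eq_imp_space_eq[of L config_space] by (auto simp: point_process_law_def space_config)

section \<open>Counting points by dyadic cells\<close>

definition cell_pt :: "real \<Rightarrow> real \<Rightarrow> nat \<Rightarrow> nat \<Rightarrow> real" where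
  "cell_pt c d k q = c + (d - c) * real q / 2 ^ k"

text \<open>Half-open cells partition \<open>{c<..d}\<close> without overlap at the grid
  points.\<close>

definition cell :: "real \<Rightarrow> real \<Rightarrow> nat \<Rightarrow> nat \<Rightarrow> real set" where
  "cell c d k q = {cell_pt c d k q<..cell_pt c d k (Suc q)}"

lemma cell_pt_mono: "c \<le> d \<Longrightarrow> p \<le> q \<Longrightarrow> cell_pt c d k p \<le> cell_pt c d k q"
  unfolding cell_pt_def by (intro add_left_mono divide_right_mono mult_left_mono) auto

lemma cell_pt_0 [simp]: "cell_pt c d k 0 = c"
  and cell_pt_top [simp]: "cell_pt c d k (2 ^ k) = d"
  by (simp_all add: cell_pt_def)

lemma cell_pt_double: "cell_pt c d (Suc k) (2 * q) = cell_pt c d k q"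
  by (simp add: cell_pt_def)

lemma cell_pt_step: "cell_pt c d k (Suc q) - cell_pt c d k q = (d - c) / 2 ^ k"
  by (simp add: cell_pt_def add_divide_distrib[symmetric] diff_divide_distrib[symmetric] algebra_simps)

lemma cell_split:
  assumes "c \<le> d"
  shows "cell c d k q = cell c d (Suc k) (2 * q) \<union> cell c d (Suc k) (2 * q + 1)"
proof -
  have "cell_pt c d (Suc k) (Suc (Suc (2 * q))) = cell_pt c d k (Suc q)"
    using cell_pt_double[of c d k "Suc q"] by simp
  moreover have "cell_pt c d (Suc k) (2 * q) \<le> cell_pt c d (Suc k) (Suc (2 * q))"
    "cell_pt c d (Suc k) (Suc (2 * q)) \<le> cell_pt c d (Suc k) (Suc (Suc (2 * q)))"
    using assms by (auto intro: cell_pt_mono)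
  ultimately show ?thesis
    unfolding cell_def cell_pt_double[symmetric, of c d k q] by auto
qed

lemma cell_disjoint:
  assumes "c \<le> d" "p \<noteq> q"
  shows "cell c d k p \<inter> cell c d k q = {}"
proof -
  have "cell c d k p \<inter> cell c d k q = {}" if "p < q" for p q
    using cell_pt_mono[OF assms(1), of "Suc p" q k] that by (auto simp: cell_def)
  then show ?thesis using assms(2) by (cases p q rule: linorder_cases) auto
qed

lemma sum_pairs: "(\<Sum>i<n. f (2 * i) + f (2 * i + 1)) = sum f {..<2 * n}"
  for f :: "nat \<Rightarrow> 'a::comm_monoid_add"
  by (induction n) (simp_all add: add_ac lessThan_Suc)

lemma UN_pairs: "(\<Union>i<n. f (2 * i) \<union> f (2 * i + 1)) = (\<Union>i<2 * n. f i)" for f :: "nat \<Rightarrow> 'a set"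
  by (induction n) (auto simp: lessThan_Suc)

lemma UN_cell:
  assumes "c \<le> d"
  shows "(\<Union>q<2 ^ k. cell c d k q) = {c<..d}"
proof (induction k)
  case 0
  then show ?case using cell_pt_top[of c d 0] by (simp add: cell_def lessThan_Suc del: cell_pt_top)
next
  case (Suc k)
  have "(\<Union>q<2 ^ Suc k. cell c d (Suc k) q) = (\<Union>q<2 ^ k. cell c d (Suc k) (2 * q) \<union> cell c d (Suc k) (2 * q + 1))"
    using UN_pairs[of "\<lambda>q. cell c d (Suc k) q" "2 ^ k"] by simp
  then show ?case using Suc cell_split[OF assms, of k] by simp
qed

text \<open>Occupied cells are counted in place of points because their indicators come from void
  events. The number increases under refinement and finally equals the number of points, so monotone
  convergence applies.\<close>

definition hits :: "real \<Rightarrow> real \<Rightarrow> nat \<Rightarrow> real set \<Rightarrow> nat" where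
  "hits c d k Y = (\<Sum>q<2 ^ k. if Y \<inter> cell c d k q \<noteq> {} then 1 else 0)"

lemma hits_mono:
  assumes "c \<le> d"
  shows "hits c d k Y \<le> hits c d (Suc k) Y"
proof -
  let ?f = "\<lambda>q. if Y \<inter> cell c d (Suc k) q \<noteq> {} then 1 else (0::nat)"
  have "hits c d k Y \<le> (\<Sum>q<2 ^ k. ?f (2 * q) + ?f (2 * q + 1))"
    unfolding hits_def cell_split[OF assms, of k] by (intro sum_mono) auto
  also have "\<dots> = hits c d (Suc k) Y"
    unfolding hits_def using sum_pairs[of ?f "2 ^ k"] by simp
  finally show ?thesis .
qed

text \<open>Once the cells are shorter than the least distance between two points, no cell holds
  more than one of them.\<close>

lemma hits_eventually:
  assumes cd: "c < d" and Y: "finite (Y \<inter> {c<..d})"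
  shows "\<forall>\<^sub>F k in sequentially. hits c d k Y = card (Y \<inter> {c<..d})"
proof -
  define Z where "Z = Y \<inter> {c<..d}"
  have "\<exists>e>0. \<forall>x\<in>Z. \<forall>y\<in>Z. x \<noteq> y \<longrightarrow> e \<le> \<bar>x - y\<bar>"
  proof (cases "\<exists>x\<in>Z. \<exists>y\<in>Z. x \<noteq> y")
    case True
    let ?D = "(\<lambda>(x, y). \<bar>x - y\<bar>) ` {(x, y) \<in> Z \<times> Z. x \<noteq> y}"
    have fin: "finite ?D"
      by (rule finite_imageI, rule finite_subset[of _ "Z \<times> Z"]) (use Y in \<open>auto simp: Z_def\<close>)
    have ne: "?D \<noteq> {}" using True by blast
    have "Min ?D \<in> ?D" by (rule Min_in[OF fin ne])
    then have "0 < Min ?D" by force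
    moreover have "Min ?D \<le> \<bar>x - y\<bar>" if "x \<in> Z" "y \<in> Z" "x \<noteq> y" for x y
      by (intro Min_le[OF fin] image_eqI[of _ _ "(x, y)"]) (use that in simp_all)
    ultimately show ?thesis by blast
  next
    case False
    show ?thesis
    proof (intro exI conjI)
      show "(0::real) < 1" by simp
      show "\<forall>x\<in>Z. \<forall>y\<in>Z. x \<noteq> y \<longrightarrow> 1 \<le> \<bar>x - y\<bar>" using False by blast
    qed
  qed
  then obtain e where e: "e > 0" "\<And>x y. x \<in> Z \<Longrightarrow> y \<in> Z \<Longrightarrow> x \<noteq> y \<Longrightarrow> e \<le> \<bar>x - y\<bar>" by blast
  have "(\<lambda>k. (d - c) / 2 ^ k) \<longlonglongrightarrow> 0"
    using tendsto_mult_right_zero[OF LIMSEQ_realpow_zero[of "1 / 2"], of "d - c"] by (simp add: power_divide)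
  then have "\<forall>\<^sub>F k in sequentially. (d - c) / 2 ^ k < e"
    using e(1) by (rule order_tendstoD(2))
  then show ?thesis
  proof eventually_elim
    case (elim k)
    have one: "(if Y \<inter> cell c d k q \<noteq> {} then 1 else 0) = card (Z \<inter> cell c d k q)" if q: "q < 2 ^ k" for q
    proof -
      have sub: "cell c d k q \<subseteq> {c<..d}" using UN_cell[of c d k] cd q by auto
      then have eq: "Y \<inter> cell c d k q = Z \<inter> cell c d k q" by (auto simp: Z_def)
      have finq: "finite (Z \<inter> cell c d k q)" using Y by (simp add: Z_def)
      have same: "x = y" if "x \<in> Z \<inter> cell c d k q" "y \<in> Z \<inter> cell c d k q" for x y
      proof (rule ccontr)
        assume "x \<noteq> y"
        then have "e \<le> \<bar>x - y\<bar>" using e(2) that by blast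
        moreover have "\<bar>x - y\<bar> \<le> (d - c) / 2 ^ k"
          using that cell_pt_step[of c d k q] unfolding cell_def by auto
        ultimately show False using elim by simp
      qed
      then have le: "card (Z \<inter> cell c d k q) \<le> Suc 0"
        using card_le_Suc0_iff_eq[OF finq] by blast
      show ?thesis
      proof (cases "Z \<inter> cell c d k q = {}")
        case False
        then have "0 < card (Z \<inter> cell c d k q)" using finq by (simp only: card_gt_0_iff simp_thms)
        then have "card (Z \<inter> cell c d k q) = 1" using le by simp
        then show ?thesis unfolding eq using False by (simp only: if_True simp_thms)
      qed (simp add: eq)
    qed
    have "hits c d k Y = (\<Sum>q<2 ^ k. card (Z \<inter> cell c d k q))"
      unfolding hits_def by (intro sum.cong refl one) simp
    also have "\<dots> = card (\<Union>q<2 ^ k. Z \<inter> cell c d k q)"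
    proof (rule card_UN_disjoint[symmetric])
      show "\<forall>p\<in>{..<2 ^ k}. \<forall>q\<in>{..<2 ^ k}. p \<noteq> q \<longrightarrow> (Z \<inter> cell c d k p) \<inter> (Z \<inter> cell c d k q) = {}"
        using cell_disjoint[OF less_imp_le[OF cd], of _ _ k] by blast
      show "\<forall>q\<in>{..<2 ^ k}. finite (Z \<inter> cell c d k q)" using Y by (simp add: Z_def)
    qed simp
    also have "(\<Union>q<2 ^ k. Z \<inter> cell c d k q) = Z"
      using UN_cell[of c d k] cd by (auto simp: Z_def)
    finally show ?case by (simp add: Z_def)
  qed
qed

section \<open>Differenced Pfaffians\<close>

text \<open>Index \<open>2 * i\<close> stands for evaluation at \<open>l i\<close>. Index \<open>2 * i + 1\<close> stands for evaluation at \<open>r i\<close>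
  if \<open>i\<close> is at least \<open>k\<close>, and for the difference of the evaluations at \<open>l i\<close> and \<open>r i\<close> otherwise.\<close>

definition evl :: "(nat \<Rightarrow> real) \<Rightarrow> (nat \<Rightarrow> real) \<Rightarrow> nat \<Rightarrow> nat \<Rightarrow> (real \<Rightarrow> real) \<Rightarrow> real" where
  "evl l r k a f = (if even a then f (l (a div 2))
     else if a div 2 < k then f (l (a div 2)) - f (r (a div 2)) else f (r (a div 2)))"

definition smat :: "(real \<Rightarrow> real) \<Rightarrow> (nat \<Rightarrow> real) \<Rightarrow> (nat \<Rightarrow> real) \<Rightarrow> nat \<Rightarrow> nat \<Rightarrow> nat \<Rightarrow> real" where
  "smat G l r k a b =
     (if a < b then evl l r k a (\<lambda>x. evl l r k b (\<lambda>y. G (y - x)))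
      else if b < a then - evl l r k b (\<lambda>x. evl l r k a (\<lambda>y. G (y - x))) else 0)"

lemma evl_diff: "evl l r k a (\<lambda>x. f x - g x) = evl l r k a f - evl l r k a g"
  by (simp add: evl_def)

lemma smat_0: "smat G l r 0 = pair_entry G (\<lambda>a. if even a then l (a div 2) else r (a div 2))"
  by (simp add: smat_def pair_entry_def evl_def fun_eq_iff)

text \<open>Row \<open>2 * k + 1\<close> of the new matrix is a difference of two evaluations, and
  the Pfaffian is linear in this row and its column. Evaluation at \<open>l k\<close> in place of
  \<open>r k\<close> corresponds to an empty interval \<open>k\<close>.\<close>

lemma pfaffian_smat_Suc:
  assumes "k < n"
  shows "pfaffian n (smat G l r (Suc k)) = pfaffian n (smat G l (r(k := l k)) k) - pfaffian n (smat G l r k)"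
proof (rule pfaffian_row_diff[where q = "2 * k + 1"])
  let ?q = "2 * k + 1" and ?r = "r(k := l k)"
  show "?q < 2 * n" using assms by simp
  have other: "evl l ?r k a f = evl l r (Suc k) a f" "evl l r k a f = evl l r (Suc k) a f" if "a \<noteq> ?q" for a f
  proof -
    have "odd a \<Longrightarrow> a div 2 \<noteq> k" using that by (auto elim!: oddE)
    then show "evl l ?r k a f = evl l r (Suc k) a f" "evl l r k a f = evl l r (Suc k) a f"
      by (auto simp: evl_def)
  qed
  have q: "evl l r (Suc k) ?q f = evl l ?r k ?q f - evl l r k ?q f" for f
    by (simp add: evl_def)
  show "smat G l ?r k a b = smat G l r (Suc k) a b" "smat G l r k a b = smat G l r (Suc k) a b"
    if "a \<noteq> ?q" "b \<noteq> ?q" for a b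
    unfolding smat_def using other[OF that(1)] other[OF that(2)] by simp_all
  show "smat G l r (Suc k) ?q b = smat G l ?r k ?q b - smat G l r k ?q b" if "b \<noteq> ?q" for b
    unfolding smat_def using other[OF that] q by (simp add: evl_diff)
  show "smat G l r (Suc k) b ?q = smat G l ?r k b ?q - smat G l r k b ?q" if "b \<noteq> ?q" for b
    unfolding smat_def using other[OF that] q by (simp add: evl_diff)
qed

lemma first_hits_step:
  fixes q q' :: "nat \<Rightarrow> bool"
  assumes "\<And>i. i \<noteq> k \<Longrightarrow> q' i = q i" "\<not> q' k" "k < n"
  shows "(\<forall>i<n. q i = (i < Suc k)) \<longleftrightarrow> (\<forall>i<n. q' i = (i < k)) \<and> \<not> (\<forall>i<n. q i = (i < k))"
    and "\<forall>i<n. q i = (i < k) \<Longrightarrow> \<forall>i<n. q' i = (i < k)"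
  using assms by (metis less_Suc_eq less_irrefl)+

text \<open>Inclusion-exclusion one interval at a time: being hit is the complement of being void,
  and no condition on interval \<open>k\<close> is the void condition for the empty interval from
  \<open>l k\<close> to \<open>l k\<close>. The recursion is that of
  \<open>pfaffian_smat_Suc\<close>.\<close>

lemma (in prob_space) prob_all_hit:
  fixes Z :: "'a \<Rightarrow> real set" and n :: nat
  assumes meas: "\<And>l r :: real. {X \<in> space M. Z X \<inter> {l<..r} = {}} \<in> events"
    and void: "\<And>l r. (\<And>i. i < n \<Longrightarrow> l i \<le> r i) \<Longrightarrow> (\<And>i. Suc i < n \<Longrightarrow> r i < l (Suc i)) \<Longrightarrow>
      prob {X \<in> space M. \<forall>i<n. Z X \<inter> {l i<..r i} = {}} = pfaffian n (smat G l r 0)"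
    and lr: "\<And>i. i < n \<Longrightarrow> l i \<le> r i" "\<And>i. Suc i < n \<Longrightarrow> r i < l (Suc i)" and k: "k \<le> n"
  shows "prob {X \<in> space M. \<forall>i<n. (Z X \<inter> {l i<..r i} \<noteq> {}) = (i < k)} = pfaffian n (smat G l r k)"
  using lr k
proof (induction k arbitrary: r)
  case 0
  then show ?case using void[of l r] by simp
next
  case (Suc k)
  let ?r = "r(k := l k)"
  let ?E = "\<lambda>k r. {X \<in> space M. \<forall>i<n. (Z X \<inter> {l i<..r i} \<noteq> {}) = (i < k)}"
  have E: "?E k r \<in> events" for k r
  proof -
    have "{X \<in> space M. (Z X \<inter> {l i<..r i} \<noteq> {}) = (i < k)} \<in> events" for i
    proof (cases "i < k")
      case True
      then have "{X \<in> space M. (Z X \<inter> {l i<..r i} \<noteq> {}) = (i < k)} = space M - {X \<in> space M. Z X \<inter> {l i<..r i} = {}}" by auto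
      then show ?thesis using meas[of "l i" "r i"] by simp
    next
      case False
      then show ?thesis using meas[of "l i" "r i"] by simp
    qed
    then have "{X \<in> space M. \<forall>i\<in>{..<n}. (Z X \<inter> {l i<..r i} \<noteq> {}) = (i < k)} \<in> events"
      by (intro sets.sets_Collect_finite_All finite_lessThan)
    then show ?thesis by (simp only: Ball_def lessThan_iff)
  qed
  have lkr: "l k \<le> r k" using Suc.prems(1,3) by simp
  have hit: "(Z X \<inter> {l i<..?r i} \<noteq> {}) = (Z X \<inter> {l i<..r i} \<noteq> {})" if "i \<noteq> k" for X i
    using that by (simp only: fun_upd_apply if_False)
  have nohit: "\<not> Z X \<inter> {l k<..?r k} \<noteq> {}" for X by simp
  have kn: "k < n" using Suc.prems(3) by simp
  note step = first_hits_step[where q' = "\<lambda>i. Z _ \<inter> {l i<..?r i} \<noteq> {}" and q = "\<lambda>i. Z _ \<inter> {l i<..r i} \<noteq> {}", OF hit nohit kn]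
  have "?E (Suc k) r = ?E k ?r - ?E k r"
    using step(1) by (intro set_eqI) (simp only: mem_Collect_eq Diff_iff, blast)
  moreover have "?E k r \<subseteq> ?E k ?r"
    using step(2) by (intro subsetI) (simp only: mem_Collect_eq, blast)
  ultimately have "prob (?E (Suc k) r) = prob (?E k ?r) - prob (?E k r)"
    using E by (simp only: finite_measure_Diff)
  also have "prob (?E k r) = pfaffian n (smat G l r k)"
    by (rule Suc.IH[OF Suc.prems(1,2)]) (use kn in simp_all)
  also have "prob (?E k ?r) = pfaffian n (smat G l ?r k)"
  proof (rule Suc.IH)
    show "l i \<le> ?r i" if "i < n" for i using Suc.prems(1)[OF that] by simp
    show "?r i < l (Suc i)" if "Suc i < n" for i using Suc.prems(2)[OF that] lkr by (cases "i = k") simp_all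
  qed (use kn in simp)
  finally show ?case unfolding pfaffian_smat_Suc[OF kn] .
qed

text \<open>The limit of the rescaled differenced matrices when all intervals shrink to points.\<close>

definition rmat :: "(nat \<Rightarrow> real \<Rightarrow> real) \<Rightarrow> (nat \<Rightarrow> real) \<Rightarrow> nat \<Rightarrow> nat \<Rightarrow> real" where
  "rmat D x a b =
    (let f = (\<lambda>a b. (let d = x (b div 2) - x (a div 2) in
       if even a then (if even b then D 0 d else - D 1 d) else (if even b then D 1 d else - D 2 d)))
     in if a < b then f a b else if b < a then - f b a else 0)"

section \<open>Shrinking intervals\<close>

text \<open>\<open>D 0\<close>, \<open>D 1\<close>, \<open>D 2\<close> stand for a function and its
  first two derivatives. The Lipschitz bound reaches up to \<open>D 2\<close> because the double
  differences tend to it and an explicit rate is wanted.\<close>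

locale smooth_kernel =
  fixes D :: "nat \<Rightarrow> real \<Rightarrow> real" and M :: real
  assumes deriv: "k < 2 \<Longrightarrow> (D k has_real_derivative D (Suc k) z) (at z)"
    and bound: "k \<le> 2 \<Longrightarrow> \<bar>D k z\<bar> \<le> M"
    and lipschitz: "k \<le> 2 \<Longrightarrow> \<bar>D k z - D k w\<bar> \<le> M * \<bar>z - w\<bar>"
    and M1: "1 \<le> M"
begin

lemma mean_value:
  assumes "k < 2" "a < b"
  obtains \<xi> where "a < \<xi>" "\<xi> < b" "D k b - D k a = (b - a) * D (Suc k) \<xi>"
  using MVT2[OF assms(2), of "D k" "D (Suc k)"] deriv[OF assms(1)] by blast

text \<open>A single difference is a derivative at an intermediate point by the mean value theorem;
  the entry with two odd indices is a double difference and uses the theorem twice. The intermediate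
  argument is written as a difference of points of the two intervals, so that its distance from the
  limit can be read off.\<close>

lemma scaled_entry:
  assumes ij: "l i < r i" "l j < r j"
  defines "h a \<equiv> if even a then 1 else r (a div 2) - l (a div 2)"
  assumes ab: "a div 2 = i" "b div 2 = j" "a div 2 < n" "b div 2 < n"
  obtains y x k s where "y \<in> {l j..r j}" "x \<in> {l i..r i}"
    "evl l r n a (\<lambda>x. evl l r n b (\<lambda>y. D 0 (y - x))) =
      h a * h b * (if even a then (if even b then D 0 (y - x) else - D 1 (y - x))
        else (if even b then D 1 (y - x) else - D 2 (y - x)))"
proof -
  note e = evl_def h_def ab
  have lr: "l i \<in> {l i..r i}" "l j \<in> {l j..r j}" using ij by auto
  consider "even a" "even b" | "even a" "odd b" | "odd a" "even b" | "odd a" "odd b" by blast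
  then show thesis
  proof cases
    case 1
    show thesis by (rule that[of "l j" "l i"]) (use 1 lr ab in \<open>simp_all add: e\<close>)
  next
    case 2
    obtain \<xi> where \<xi>: "l j - l i < \<xi>" "\<xi> < r j - l i" "D 0 (r j - l i) - D 0 (l j - l i) = (r j - l i - (l j - l i)) * D (Suc 0) \<xi>"
      using mean_value[of 0 "l j - l i" "r j - l i"] ij by auto
    show thesis
      by (rule that[of "\<xi> + l i" "l i"]) (use 2 lr ab \<xi> in \<open>simp_all add: e algebra_simps\<close>)
  next
    case 3
    obtain \<xi> where \<xi>: "l j - r i < \<xi>" "\<xi> < l j - l i" "D 0 (l j - l i) - D 0 (l j - r i) = (l j - l i - (l j - r i)) * D (Suc 0) \<xi>"
      using mean_value[of 0 "l j - r i" "l j - l i"] ij by auto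
    show thesis
      by (rule that[of "l j" "l j - \<xi>"]) (use 3 lr ab \<xi> in \<open>simp_all add: e algebra_simps\<close>)
  next
    case 4
    have "\<exists>\<xi>>l j. \<xi> < r j \<and> (D 0 (r j - l i) - D 0 (r j - r i)) - (D 0 (l j - l i) - D 0 (l j - r i)) = (r j - l j) * (D 1 (\<xi> - l i) - D 1 (\<xi> - r i))"
    proof (rule MVT2[OF ij(2)])
      fix y assume "l j \<le> y" "y \<le> r j"
      show "((\<lambda>y. D 0 (y - l i) - D 0 (y - r i)) has_real_derivative D 1 (y - l i) - D 1 (y - r i)) (at y)"
      proof -
        have "((\<lambda>y. D 0 (y - c)) has_real_derivative D 1 (y - c)) (at y)" for c
        proof -
          have "((\<lambda>y. y - c) has_real_derivative 1) (at y)" by (auto intro!: derivative_eq_intros)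
          from DERIV_chain2[OF deriv[of 0 "y - c"] this] show ?thesis by simp
        qed
        then show ?thesis by (intro DERIV_diff)
      qed
    qed
    then obtain y where y: "l j < y" "y < r j"
      "(D 0 (r j - l i) - D 0 (r j - r i)) - (D 0 (l j - l i) - D 0 (l j - r i)) = (r j - l j) * (D 1 (y - l i) - D 1 (y - r i))"
      by blast
    obtain \<xi> where \<xi>: "y - r i < \<xi>" "\<xi> < y - l i" "D 1 (y - l i) - D 1 (y - r i) = (y - l i - (y - r i)) * D (Suc 1) \<xi>"
      using mean_value[of 1 "y - r i" "y - l i"] ij by auto
    have two: "Suc 1 = (2::nat)" by simp
    have "(D 0 (l j - l i) - D 0 (r j - l i)) - (D 0 (l j - r i) - D 0 (r j - r i)) = (r i - l i) * (r j - l j) * - D 2 \<xi>"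
      using y(3) unfolding \<xi>(3) two by (simp add: algebra_simps)
    then show thesis
      by (intro that[of y "y - \<xi>"]) (use 4 lr ab \<xi>(1,2) y(1,2) in \<open>simp_all add: e\<close>)
  qed
qed

lemma rmat_bound: "\<bar>rmat D x a b\<bar> \<le> M"
  using bound M1 by (auto simp: rmat_def Let_def)

text \<open>The length of interval \<open>i\<close> is taken out of row \<open>2 * i + 1\<close>.
  What remains are derivatives at arguments within \<open>2 * \<delta>\<close> of the limiting ones,
  one \<open>\<delta>\<close> for each of the two intervals.\<close>

lemma pfaffian_smat_approx:
  assumes lr: "\<And>i. i < n \<Longrightarrow> l i < r i" and \<delta>: "\<And>i. i < n \<Longrightarrow> r i - l i \<le> \<delta>" "0 \<le> \<delta>"
    and x: "\<And>i. i < n \<Longrightarrow> x i \<in> {l i..r i}"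
  shows "\<bar>pfaffian n (smat (D 0) l r n) - (\<Prod>i<n. r i - l i) * pfaffian n (rmat D x)\<bar>
    \<le> (\<Prod>i<n. r i - l i) * (fact (2 * n) * (n * M ^ n * (M * (2 * \<delta>))))"
proof -
  define h where "h a = (if even a then 1 else r (a div 2) - l (a div 2))" for a
  have hpos: "0 < h a" if "a < 2 * n" for a
    using lr[of "a div 2"] that by (auto simp: h_def)
  define S where "S a b = smat (D 0) l r n a b / (h a * h b)" for a b
  have main: "\<bar>S a b\<bar> \<le> M \<and> \<bar>S a b - rmat D x a b\<bar> \<le> M * (2 * \<delta>)" if "a < b" "b < 2 * n" for a b
  proof -
    define i j where "i = a div 2" and "j = b div 2"
    have ij: "i < n" "j < n" using that by (auto simp: i_def j_def)
    from scaled_entry[OF lr[OF ij(1)] lr[OF ij(2)], of a b n]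
    obtain y x' where y: "y \<in> {l j..r j}" "x' \<in> {l i..r i}"
      "evl l r n a (\<lambda>x. evl l r n b (\<lambda>y. D 0 (y - x))) =
        h a * h b * (if even a then (if even b then D 0 (y - x') else - D 1 (y - x'))
          else (if even b then D 1 (y - x') else - D 2 (y - x')))"
      using ij unfolding i_def j_def h_def by blast
    have "0 < h a * h b" using hpos[of a] hpos[of b] that by simp
    then have S: "S a b = (if even a then (if even b then D 0 (y - x') else - D 1 (y - x'))
          else (if even b then D 1 (y - x') else - D 2 (y - x')))"
    proof -
      have "smat (D 0) l r n a b = h a * h b * (if even a then (if even b then D 0 (y - x') else - D 1 (y - x'))
          else (if even b then D 1 (y - x') else - D 2 (y - x')))"
        unfolding smat_def y(3)[symmetric] using that(1) by (simp only: if_True)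
      then show ?thesis
        unfolding S_def using hpos[of a] hpos[of b] that by (simp only:) (rule nonzero_mult_div_cancel_left, simp)
    qed
    have d: "\<bar>(y - x') - (x j - x i)\<bar> \<le> 2 * \<delta>"
      using y(1,2) x[OF ij(1)] x[OF ij(2)] \<delta>(1)[OF ij(1)] \<delta>(1)[OF ij(2)] by auto
    have dd: "\<bar>D k (y - x') - D k (x j - x i)\<bar> \<le> M * (2 * \<delta>)" if "k \<le> 2" for k
      using lipschitz[OF that, of "y - x'" "x j - x i"] mult_left_mono[OF d, of M] M1 by linarith
    have dd': "\<bar>D k (x j - x i) - D k (y - x')\<bar> \<le> M * (2 * \<delta>)" if "k \<le> 2" for k
      using dd[OF that] by (simp add: abs_minus_commute)
    have R: "rmat D x a b = (if even a then (if even b then D 0 (x j - x i) else - D 1 (x j - x i))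
          else (if even b then D 1 (x j - x i) else - D 2 (x j - x i)))"
      using that by (simp add: rmat_def Let_def i_def j_def)
    show ?thesis
      unfolding S R using bound[of 0] bound[of 1] bound[of 2] dd[of 0] dd[of 1] dd'[of 1] dd'[of 2] by auto
  qed
  have anti: "S b a = - S a b" "rmat D x b a = - rmat D x a b" if "a \<noteq> b" for a b
    using that by (auto simp: S_def smat_def rmat_def Let_def mult.commute)
  have diag: "S a a = 0" "rmat D x a a = 0" for a
    by (auto simp: S_def smat_def rmat_def)
  have Mpos: "0 \<le> M * (2 * \<delta>)" using M1 \<delta>(2) by simp
  have all: "\<bar>S a b\<bar> \<le> M \<and> \<bar>S a b - rmat D x a b\<bar> \<le> M * (2 * \<delta>)" if "a < 2 * n" "b < 2 * n" for a b
  proof (cases a b rule: linorder_cases)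
    case greater
    have "\<bar>- S b a - - rmat D x b a\<bar> = \<bar>S b a - rmat D x b a\<bar>" by linarith
    then show ?thesis
      using main[OF greater that(1)] anti[of b a] greater by simp
  qed (use main that diag M1 Mpos in auto)
  have "\<bar>pfaffian n S - pfaffian n (rmat D x)\<bar> \<le> fact (2 * n) * (n * M ^ n * (M * (2 * \<delta>)))"
    using all rmat_bound Mpos M1 by (intro abs_pfaffian_diff_le) auto
  moreover have "pfaffian n (smat (D 0) l r n) = (\<Prod>i<n. r i - l i) * pfaffian n S"
  proof -
    have "pfaffian n (smat (D 0) l r n) = pfaffian n (\<lambda>a b. h a * h b * S a b)"
      using hpos by (intro pfaffian_cong) (simp add: S_def less_imp_neq[symmetric])
    also have "\<dots> = (\<Prod>a<2 * n. h a) * pfaffian n S" by (rule pfaffian_scale)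
    also have "(\<Prod>a<2 * n. h a) = (\<Prod>i<n. r i - l i)"
      using prod_pairs[of h n] by (simp add: h_def)
    finally show ?thesis .
  qed
  moreover have "0 \<le> (\<Prod>i<n. r i - l i)" using lr by (intro prod_nonneg) (auto intro: less_imp_le)
  ultimately show ?thesis
    by (simp add: right_diff_distrib[symmetric] abs_mult mult_left_mono)
qed

end

section \<open>Void probabilities and box moments\<close>

text \<open>The law is given for open intervals with strictly increasing endpoints. The right
  endpoints are pushed out by \<open>e N\<close> and brought back in the limit, which yields
  half-open intervals and admits empty ones.\<close>

lemma (in brownian) maximal_coalescing_void:
  assumes t: "0 < t" and L: "maximal_coalescing_law W B t L" and n: "0 < n"
    and lr: "\<And>i. i < n \<Longrightarrow> l i \<le> r i" "\<And>i. Suc i < n \<Longrightarrow> r i < l (Suc i)"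
  shows "measure L {X \<in> space L. \<forall>i<n. X \<inter> {l i<..r i} = {}} = pfaffian n (smat (\<lambda>d. F (d / sqrt t)) l r 0)"
proof -
  have ppl: "point_process_law L" using L by (simp add: maximal_coalescing_law_def)
  note Lf = point_process_lawD[OF ppl]
  interpret L: prob_space L by (rule Lf(1))
  define e where "e N = 1 / real (Suc N)" for N
  define b where "b N a = (if even a then l (a div 2) else r (a div 2) + e N)" for N a
  have e: "0 < e N" for N by (simp add: e_def)
  have elim0: "e \<longlonglongrightarrow> 0" unfolding e_def by (rule LIMSEQ_inverse_real_of_nat[unfolded inverse_eq_divide])
  have "\<forall>\<^sub>F N in sequentially. \<forall>i\<in>{i. Suc i < n}. e N < l (Suc i) - r i"
  proof (rule eventually_ball_finite)
    show "finite {i. Suc i < n}" by (rule finite_subset[of _ "{..<n}"]) auto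
    show "\<forall>i\<in>{i. Suc i < n}. \<forall>\<^sub>F N in sequentially. e N < l (Suc i) - r i"
      using lr(2) by (intro ballI order_tendstoD(2)[OF elim0]) simp
  qed
  then have ev: "\<forall>\<^sub>F N in sequentially. strict_mono_on {..<2 * n} (b N)"
  proof eventually_elim
    case (elim N)
    have step: "b N a < b N (Suc a)" if "Suc a < 2 * n" for a
    proof (cases "even a")
      case True
      then show ?thesis using lr(1)[of "a div 2"] e[of N] that by (auto simp: b_def elim!: evenE)
    next
      case False
      then obtain i where i: "a = 2 * i + 1" by (auto elim: oddE)
      then have "Suc i < n" using that by simp
      then have "e N < l (Suc i) - r i" using elim by blast
      then show ?thesis by (simp add: i b_def)
    qed
    have up: "b N a < b N (a + Suc k)" if "a + Suc k < 2 * n" for a k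
      using that
    proof (induction k)
      case 0
      then show ?case using step[of a] by simp
    next
      case (Suc k)
      have "b N a < b N (a + Suc k)" using Suc by simp
      also have "b N (a + Suc k) < b N (Suc (a + Suc k))" using Suc.prems by (intro step) simp
      finally show ?case by simp
    qed
    show ?case
    proof (rule strict_mono_onI)
      fix a a' assume "a' \<in> {..<2 * n}" "a < a'"
      then show "b N a < b N a'" using up less_imp_Suc_add[of a a'] by auto
    qed
  qed
  define E where "E N = {X \<in> space L. \<forall>i<n. X \<inter> {l i<..<r i + e N} = {}}" for N
  have EM: "E N \<in> sets L" for N
  proof -
    have "{X \<in> space L. \<forall>i\<in>{..<n}. X \<inter> {l i<..<r i + e N} = {}} \<in> sets L"
    proof (intro sets.sets_Collect_finite_All finite_lessThan)
      fix i
      show "{X \<in> space L. X \<inter> {l i<..<r i + e N} = {}} \<in> sets L"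
        unfolding Lf(2,3) by (rule void_measurable) simp
    qed
    then show ?thesis by (simp only: E_def Ball_def lessThan_iff)
  qed
  have eq: "E N = {X \<in> space L. \<forall>i<n. emeasure (counting X) {b N (2 * i)<..<b N (2 * i + 1)} = 0}" for N
    by (simp add: E_def b_def emeasure_counting_0_iff)
  have eveq: "\<forall>\<^sub>F N in sequentially. pfaffian n (pair_entry (\<lambda>d. F (d / sqrt t)) (b N)) = measure L (E N)"
    using ev
  proof eventually_elim
    case (elim N)
    have "measure L (E N) = annihilating_extinction_prob W B (2 * n) (b N) t"
      unfolding eq using L n elim unfolding maximal_coalescing_law_def by simp
    then show ?case using annihilating_extinction_prob_eq[OF t n elim] by simp
  qed
  have lim0: "(\<lambda>N. pfaffian n (pair_entry (\<lambda>d. F (d / sqrt t)) (b N))) \<longlonglongrightarrow>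
      pfaffian n (pair_entry (\<lambda>d. F (d / sqrt t)) (\<lambda>a. if even a then l (a div 2) else r (a div 2)))"
  proof (rule pfaffian_tendsto)
    have b: "(\<lambda>N. b N a) \<longlonglongrightarrow> (if even a then l (a div 2) else r (a div 2))" for a
      using tendsto_add[OF tendsto_const elim0, of "r (a div 2)"] by (simp add: b_def)
    have "(\<lambda>N. F ((b N a - b N c) / sqrt t)) \<longlonglongrightarrow>
        F (((if even a then l (a div 2) else r (a div 2)) - (if even c then l (c div 2) else r (c div 2))) / sqrt t)" for a c
      using t by (intro tendsto_F tendsto_divide tendsto_diff b tendsto_const) simp
    then show "(\<lambda>N. pair_entry (\<lambda>d. F (d / sqrt t)) (b N) a c) \<longlonglongrightarrow>
        pair_entry (\<lambda>d. F (d / sqrt t)) (\<lambda>a. if even a then l (a div 2) else r (a div 2)) a c" for a c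
      unfolding pair_entry_def by (cases a c rule: linorder_cases) (simp_all add: tendsto_minus)
  qed
  have lim: "(\<lambda>N. measure L (E N)) \<longlonglongrightarrow> pfaffian n (smat (\<lambda>d. F (d / sqrt t)) l r 0)"
    unfolding smat_0 by (rule Lim_transform_eventually[OF lim0 eveq])
  have "incseq E"
  proof (rule incseq_SucI)
    fix N
    have "e (Suc N) \<le> e N" by (simp add: e_def field_simps)
    then have "{l i<..<r i + e (Suc N)} \<subseteq> {l i<..<r i + e N}" for i by auto
    then show "E N \<subseteq> E (Suc N)" unfolding E_def by blast
  qed
  then have "(\<lambda>N. measure L (E N)) \<longlonglongrightarrow> measure L (\<Union>N. E N)"
    using EM by (intro L.finite_Lim_measure_incseq) auto
  with lim have "measure L (\<Union>N. E N) = pfaffian n (smat (\<lambda>d. F (d / sqrt t)) l r 0)"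
    by (rule LIMSEQ_unique[rotated])
  \<comment> \<open>Local finiteness: only finitely many points lie closely to the right of
    \<open>r i\<close>, and a small \<open>e N\<close> stays below all of them.\<close>
  moreover have "(\<Union>N. E N) = {X \<in> space L. \<forall>i<n. X \<inter> {l i<..r i} = {}}"
  proof (intro equalityI subsetI)
    fix X assume "X \<in> (\<Union>N. E N)"
    then obtain N where N: "X \<in> E N" by blast
    have "{l i<..r i} \<subseteq> {l i<..<r i + e N}" for i using e[of N] by auto
    then show "X \<in> {X \<in> space L. \<forall>i<n. X \<inter> {l i<..r i} = {}}" using N unfolding E_def by blast
  next
    fix X assume X: "X \<in> {X \<in> space L. \<forall>i<n. X \<inter> {l i<..r i} = {}}"
    then have conf: "X \<in> configurations" using Lf by simp
    have "\<forall>\<^sub>F N in sequentially. \<forall>i\<in>{..<n}. X \<inter> {l i<..<r i + e N} = {}"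
    proof (rule eventually_ball_finite, simp, rule ballI)
      fix i assume i: "i \<in> {..<n}"
      have fin: "finite (X \<inter> {r i<..r i + 1})" using conf by (auto simp: configurations_def)
      have "\<forall>\<^sub>F N in sequentially. \<forall>x\<in>X \<inter> {r i<..r i + 1}. e N < x - r i"
        by (rule eventually_ball_finite[OF fin], intro ballI order_tendstoD(2)[OF elim0]) simp
      moreover have "\<forall>\<^sub>F N in sequentially. e N < 1" by (rule order_tendstoD(2)[OF elim0]) simp
      ultimately show "\<forall>\<^sub>F N in sequentially. X \<inter> {l i<..<r i + e N} = {}"
      proof eventually_elim
        case (elim N)
        have "x \<notin> {l i<..<r i + e N}" if x: "x \<in> X" for x
        proof
          assume x2: "x \<in> {l i<..<r i + e N}"
          have "X \<inter> {l i<..r i} = {}" using X i by blast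
          then have "r i < x" using x x2 by force
          then have "x \<in> X \<inter> {r i<..r i + 1}" using x x2 elim(2) by simp
          then have "e N < x - r i" using elim(1) by blast
          then show False using x2 by simp
        qed
        then show ?case by blast
      qed
    qed
    then obtain N where "\<forall>i\<in>{..<n}. X \<inter> {l i<..<r i + e N} = {}"
      by (auto simp: eventually_sequentially)
    then show "X \<in> (\<Union>N. E N)" using X unfolding E_def by blast
  qed
  ultimately show ?thesis by simp
qed

section \<open>Densities and moments over boxes\<close>

lemma pfaffian_measurable:
  assumes "\<And>a b. a < 2 * n \<Longrightarrow> b < 2 * n \<Longrightarrow> (\<lambda>x. A x a b) \<in> borel_measurable M"
  shows "(\<lambda>x. pfaffian n (A x)) \<in> borel_measurable M"
proof -
  have "(\<lambda>x. A x (p (2 * i)) (p (2 * i + 1))) \<in> borel_measurable M"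
    if p: "p permutes {..<2 * n}" and "i < n" for p i
    using permutes_in_image[OF p, of "2 * i"] permutes_in_image[OF p, of "2 * i + 1"] that(2)
    by (intro assms) auto
  then show ?thesis
    unfolding pfaffian_alt pfterm_def
    by (intro borel_measurable_divide borel_measurable_sum borel_measurable_times borel_measurable_prod borel_measurable_const) auto
qed

lemma prod_indicator_PiE:
  assumes "finite I" "x \<in> extensional I"
  shows "(\<Prod>i\<in>I. indicator (S i) (x i)) = (indicator (Pi\<^sub>E I S) x :: 'a :: {comm_semiring_1, semiring_no_zero_divisors})"
proof (cases "\<forall>i\<in>I. x i \<in> S i")
  case True
  then have "x \<in> Pi\<^sub>E I S" using assms(2) by (auto simp: PiE_def)
  then show ?thesis using True by (simp add: prod.neutral)
next
  case False
  then obtain i where i: "i \<in> I" "x i \<notin> S i" by blast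
  then have "x \<notin> Pi\<^sub>E I S" by (auto simp: PiE_def)
  moreover have "(\<Prod>i\<in>I. indicator (S i) (x i)) = (0 :: 'a)"
    using i by (intro prod_zero assms(1) bexI[of _ i]) simp_all
  ultimately show ?thesis by simp
qed

context smooth_kernel begin

lemma D_measurable: "k \<le> 2 \<Longrightarrow> D k \<in> borel_measurable borel"
proof -
  assume k: "k \<le> 2"
  have "M-lipschitz_on UNIV (D k)"
    using lipschitz[OF k] M1 by (intro lipschitz_onI) (auto simp: dist_real_def)
  then show ?thesis
    by (intro borel_measurable_continuous_onI lipschitz_on_continuous_on)
qed

definition rho :: "nat \<Rightarrow> (nat \<Rightarrow> real) \<Rightarrow> real" where
  "rho n x = pfaffian n (rmat D x)"

lemma rho_measurable: "rho n \<in> borel_measurable (PiM {..<n} (\<lambda>_. lborel))"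
proof -
  have "(\<lambda>x. rmat D x a b) \<in> borel_measurable (PiM {..<n} (\<lambda>_. lborel))" if "a < 2 * n" "b < 2 * n" for a b
  proof -
    have [measurable]: "(\<lambda>x. x (a div 2)) \<in> borel_measurable (PiM {..<n} (\<lambda>_. lborel :: real measure))"
      "(\<lambda>x. x (b div 2)) \<in> borel_measurable (PiM {..<n} (\<lambda>_. lborel :: real measure))"
      using that measurable_component_singleton[of _ "{..<n}" "\<lambda>_. lborel :: real measure"] by auto
    have [measurable]: "D 0 \<in> borel_measurable borel" "D 1 \<in> borel_measurable borel" "D 2 \<in> borel_measurable borel"
      by (auto intro: D_measurable)
    show ?thesis unfolding rmat_def Let_def by measurable
  qed
  then show ?thesis unfolding rho_def by (intro pfaffian_measurable)
qed

lemma abs_rho_le: "\<bar>rho n x\<bar> \<le> fact (2 * n) * M ^ n"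
  unfolding rho_def by (rule abs_pfaffian_le) (use M1 rmat_bound in auto)

text \<open>This property is all that the passage to moments uses of the coalescing law.\<close>

definition void_pfaffian :: "real set measure \<Rightarrow> nat \<Rightarrow> bool" where
  "void_pfaffian L n \<longleftrightarrow> point_process_law L \<and>
    (\<forall>l r. (\<forall>i<n. l i \<le> r i) \<longrightarrow> (\<forall>i. Suc i < n \<longrightarrow> r i < l (Suc i)) \<longrightarrow>
      measure L {X \<in> space L. \<forall>i<n. X \<inter> {l i<..r i} = {}} = pfaffian n (smat (D 0) l r 0))"

lemma prob_boxes_hit:
  assumes L: "void_pfaffian L n" and lr: "\<And>i. i < n \<Longrightarrow> l i \<le> r i" "\<And>i. Suc i < n \<Longrightarrow> r i < l (Suc i)"
  shows "measure L {X \<in> space L. \<forall>i<n. X \<inter> {l i<..r i} \<noteq> {}} = pfaffian n (smat (D 0) l r n)"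
proof -
  have ppl: "point_process_law L" using L by (simp add: void_pfaffian_def)
  note Lf = point_process_lawD[OF ppl]
  interpret L: prob_space L by (rule Lf(1))
  have meas: "{X \<in> space L. X \<inter> {l<..r} = {}} \<in> sets L" for l r :: real
    using void_measurable[of "{l<..r}"] by (simp add: Lf)
  have "measure L {X \<in> space L. \<forall>i<n. (X \<inter> {l i<..r i} \<noteq> {}) = (i < n)} = pfaffian n (smat (D 0) l r n)"
  proof (rule L.prob_all_hit[where Z = "\<lambda>X. X", OF meas])
    show "measure L {X \<in> space L. \<forall>i<n. X \<inter> {l i<..r i} = {}} = pfaffian n (smat (D 0) l r 0)"
      if "\<And>i. i < n \<Longrightarrow> l i \<le> r i" "\<And>i. Suc i < n \<Longrightarrow> r i < l (Suc i)" for l r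
      using L that unfolding void_pfaffian_def by blast
  qed (use lr in auto)
  moreover have "{X \<in> space L. \<forall>i<n. (X \<inter> {l i<..r i} \<noteq> {}) = (i < n)} = {X \<in> space L. \<forall>i<n. X \<inter> {l i<..r i} \<noteq> {}}"
    by auto
  ultimately show ?thesis by simp
qed

text \<open>The probability that all intervals from \<open>x i\<close> to \<open>x i + e\<close> are
  hit equals \<open>e ^ n * rho n x\<close> up to an error of order \<open>e ^ Suc n\<close>. A
  negative density would make it negative for small \<open>e\<close>.\<close>

lemma rho_nonneg:
  assumes L: "void_pfaffian L n" and x: "strict_mono_on {..<n} x"
  shows "0 \<le> rho n x"
proof (rule ccontr)
  assume neg: "\<not> 0 \<le> rho n x"
  \<comment> \<open>The summand 1 makes \<open>C\<close> positive, so that \<open>e\<close> can be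
    taken below \<open>- rho n x / C\<close>.\<close>
  define C where "C = fact (2 * n) * (n * M ^ n * (M * 2)) + 1"
  have "0 \<le> fact (2 * n) * (n * M ^ n * (M * 2))" using M1 by simp
  then have C: "0 < C" unfolding C_def by linarith
  have "\<forall>\<^sub>F e in at_right (0::real). \<forall>i\<in>{i. Suc i < n}. e < x (Suc i) - x i"
  proof (rule eventually_ball_finite)
    show "finite {i. Suc i < n}" by (rule finite_subset[of _ "{..<n}"]) auto
    show "\<forall>i\<in>{i. Suc i < n}. \<forall>\<^sub>F e in at_right 0. e < x (Suc i) - x i"
    proof
      fix i assume "i \<in> {i. Suc i < n}"
      then have "x i < x (Suc i)" using x by (auto simp: strict_mono_on_def)
      then show "\<forall>\<^sub>F e in at_right 0. e < x (Suc i) - x i"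
        by (intro eventually_at_right_real[THEN eventually_mono]) auto
    qed
  qed
  moreover have "\<forall>\<^sub>F e in at_right (0::real). e \<in> {0<..<- rho n x / C}"
    using neg C divide_neg_pos[of "rho n x" C] by (intro eventually_at_right_real) simp
  ultimately have "\<forall>\<^sub>F e in at_right (0::real). (\<forall>i\<in>{i. Suc i < n}. e < x (Suc i) - x i) \<and> e \<in> {0<..<- rho n x / C}"
    by (rule eventually_conj)
  from eventually_happens'[OF trivial_limit_at_right_real this] obtain e where e: "\<And>i. Suc i < n \<Longrightarrow> e < x (Suc i) - x i" "0 < e" "e < - rho n x / C"
    by auto
  have pr: "measure L {X \<in> space L. \<forall>i<n. X \<inter> {x i<..x i + e} \<noteq> {}} = pfaffian n (smat (D 0) x (\<lambda>i. x i + e) n)"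
    using e by (intro prob_boxes_hit[OF L]) (auto simp: less_diff_eq add.commute)
  have "\<bar>pfaffian n (smat (D 0) x (\<lambda>i. x i + e) n) - (\<Prod>i<n. x i + e - x i) * pfaffian n (rmat D x)\<bar>
      \<le> (\<Prod>i<n. x i + e - x i) * (fact (2 * n) * (n * M ^ n * (M * (2 * e))))"
    using e(2) by (intro pfaffian_smat_approx) auto
  then have "0 \<le> e ^ n * rho n x + e ^ n * (fact (2 * n) * (n * M ^ n * (M * (2 * e))))"
    using measure_nonneg[of L "{X \<in> space L. \<forall>i<n. X \<inter> {x i<..x i + e} \<noteq> {}}"] unfolding pr rho_def by simp
  then have "0 \<le> e ^ n * (rho n x + e * (fact (2 * n) * (n * M ^ n * (M * 2))))"
    by (simp add: algebra_simps)
  then have "0 \<le> rho n x + e * (fact (2 * n) * (n * M ^ n * (M * 2)))"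
    using zero_less_power[OF e(2), of n] by (simp add: zero_le_mult_iff del: zero_less_power)
  also have "\<dots> \<le> rho n x + e * C" using e(2) by (simp add: C_def)
  finally have "0 \<le> rho n x + e * C" .
  moreover have "e * C < - rho n x" using e(3) C by (simp only: less_divide_eq if_True)
  ultimately show False by linarith
qed

text \<open>Probability over volume is close to \<open>rho\<close> at every point of the box by
  \<open>pfaffian_smat_approx\<close>; the second claim integrates this pointwise estimate.\<close>

lemma box_integral_approx:
  assumes L: "void_pfaffian L n" and cd: "\<And>i. i < n \<Longrightarrow> l i < r i" "\<And>i. Suc i < n \<Longrightarrow> r i < l (Suc i)"
    and \<delta>: "\<And>i. i < n \<Longrightarrow> r i - l i \<le> \<delta>" "0 \<le> \<delta>"
  shows "integrable (PiM {..<n} (\<lambda>_. lborel)) (\<lambda>x. indicator (\<Pi>\<^sub>E i\<in>{..<n}. {l i<..r i}) x * rho n x)"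
    and "\<bar>measure L {X \<in> space L. \<forall>i<n. X \<inter> {l i<..r i} \<noteq> {}} - (\<integral>x. indicator (\<Pi>\<^sub>E i\<in>{..<n}. {l i<..r i}) x * rho n x \<partial>PiM {..<n} (\<lambda>_. lborel))\<bar>
      \<le> (\<Prod>i<n. r i - l i) * (fact (2 * n) * (n * M ^ n * (M * (2 * \<delta>))))"
proof -
  interpret P: product_sigma_finite "\<lambda>_::nat. lborel :: real measure" ..
  let ?P = "PiM {..<n} (\<lambda>_. lborel :: real measure)"
  let ?B = "\<Pi>\<^sub>E i\<in>{..<n}. {l i<..r i}"
  define v where "v = (\<Prod>i<n. r i - l i)"
  define K where "K = fact (2 * n) * (n * M ^ n * (M * (2 * \<delta>)))"
  have v: "0 < v" using cd(1) unfolding v_def by (intro prod_pos) auto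
  have BM: "?B \<in> sets ?P" by (intro sets_PiM_I_finite) auto
  have Bv: "emeasure ?P ?B = ennreal v"
  proof -
    have "emeasure ?P ?B = (\<Prod>i<n. emeasure lborel {l i<..r i})" by (rule P.emeasure_PiM) auto
    also have "\<dots> = (\<Prod>i<n. ennreal (r i - l i))"
      using cd(1) by (intro prod.cong refl emeasure_lborel_Ioc less_imp_le) simp
    also have "\<dots> = ennreal v"
      unfolding v_def using cd(1) by (intro prod_ennreal) (simp add: less_imp_le)
    finally show ?thesis .
  qed
  have int1: "integrable ?P (indicator ?B :: _ \<Rightarrow> real)"
    using BM Bv by (intro integrable_real_indicator) auto
  show int: "integrable ?P (\<lambda>x. indicator ?B x * rho n x)"
  proof (rule Bochner_Integration.integrable_bound)
    show "integrable ?P (\<lambda>x. indicator ?B x * (fact (2 * n) * M ^ n) :: real)" using int1 by simp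
    show "(\<lambda>x. indicator ?B x * rho n x) \<in> borel_measurable ?P"
      using BM rho_measurable by (intro borel_measurable_times borel_measurable_indicator)
    show "AE x in ?P. norm (indicator ?B x * rho n x) \<le> norm (indicator ?B x * (fact (2 * n) * M ^ n) :: real)"
      using abs_rho_le M1 by (auto simp: indicator_def)
  qed
  let ?p = "measure L {X \<in> space L. \<forall>i<n. X \<inter> {l i<..r i} \<noteq> {}}"
  have p: "?p = pfaffian n (smat (D 0) l r n)"
    using cd by (intro prob_boxes_hit[OF L]) (auto intro: less_imp_le)
  have pw: "\<bar>?p / v - rho n x\<bar> \<le> K" if "x \<in> ?B" for x
  proof -
    have "\<bar>?p - v * rho n x\<bar> \<le> v * K"
      unfolding p v_def rho_def K_def using cd(1) \<delta> that by (intro pfaffian_smat_approx) (auto simp: PiE_def Pi_def intro: less_imp_le)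
    moreover have "?p - v * rho n x = v * (?p / v - rho n x)" using v by (simp add: right_diff_distrib)
    ultimately have "v * \<bar>?p / v - rho n x\<bar> \<le> v * K" using v by (simp add: abs_mult)
    then show ?thesis using v by simp
  qed
  have eq: "?p - (\<integral>x. indicator ?B x * rho n x \<partial>?P) = (\<integral>x. indicator ?B x * (?p / v) - indicator ?B x * rho n x \<partial>?P)"
  proof -
    have "(\<integral>x. indicator ?B x * (?p / v) \<partial>?P) = v * (?p / v)"
      using int1 BM Bv v by (simp add: measure_def)
    then show ?thesis using int int1 v by (subst Bochner_Integration.integral_diff) auto
  qed
  have "\<bar>\<integral>x. indicator ?B x * (?p / v) - indicator ?B x * rho n x \<partial>?P\<bar> \<le> (\<integral>x. indicator ?B x * K \<partial>?P)"
  proof (rule order_trans[OF integral_abs_bound Bochner_Integration.integral_mono])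
    show "integrable ?P (\<lambda>x. \<bar>indicator ?B x * (?p / v) - indicator ?B x * rho n x\<bar>)"
      using int int1 by (intro integrable_abs Bochner_Integration.integrable_diff) auto
    show "integrable ?P (\<lambda>x. indicator ?B x * K)" using int1 by simp
    show "\<bar>indicator ?B x * (?p / v) - indicator ?B x * rho n x\<bar> \<le> indicator ?B x * K" for x
      using pw[of x] by (auto simp: indicator_def)
  qed
  also have "\<dots> = v * K" using int1 BM Bv v by (simp add: measure_def)
  finally show "\<bar>?p - (\<integral>x. indicator ?B x * rho n x \<partial>?P)\<bar> \<le> (\<Prod>i<n. r i - l i) * (fact (2 * n) * (n * M ^ n * (M * (2 * \<delta>))))"
    unfolding eq v_def K_def .
qed

text \<open>At level \<open>k\<close> there are \<open>2 ^ (k * n)\<close> cells, and the error of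
  each is its volume times a factor of order \<open>1 / 2 ^ k\<close>, so the total error vanishes.
  Meanwhile the number of occupied cells increases to the number of points in the box.\<close>

lemma box_moment:
  assumes L: "void_pfaffian L n" and cd: "\<And>i. i < n \<Longrightarrow> c i < d i" "\<And>i. Suc i < n \<Longrightarrow> d i < c (Suc i)"
  shows "(\<integral>\<^sup>+X. (\<Prod>i<n. emeasure (counting X) {c i<..d i}) \<partial>L) =
    ennreal (\<integral>x. indicator (\<Pi>\<^sub>E i\<in>{..<n}. {c i<..d i}) x * rho n x \<partial>PiM {..<n} (\<lambda>_. lborel))"
proof -
  have ppl: "point_process_law L" using L by (simp add: void_pfaffian_def)
  note Lf = point_process_lawD[OF ppl]
  interpret L: prob_space L by (rule Lf(1))
  let ?P = "PiM {..<n} (\<lambda>_. lborel :: real measure)"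
  let ?B = "\<Pi>\<^sub>E i\<in>{..<n}. {c i<..d i}"
  define R where "R = (\<integral>x. indicator ?B x * rho n x \<partial>?P)"
  define Q where "Q k = (\<Pi>\<^sub>E i\<in>{..<n}. {..<2 ^ k :: nat})" for k
  define ev where "ev k q = {X \<in> space L. \<forall>i<n. X \<inter> cell (c i) (d i) k (q i) \<noteq> {}}" for k q
  define Bx where "Bx k q = (\<Pi>\<^sub>E i\<in>{..<n}. cell (c i) (d i) k (q i))" for k q
  define v where "v = (\<Prod>i<n. d i - c i)"
  define \<Delta> where "\<Delta> = (\<Sum>i<n. d i - c i)"
  define C where "C = fact (2 * n) * (n * M ^ n * (M * 2))"
  define A where "A k = (\<Sum>q\<in>Q k. measure L (ev k q))" for k
  have Qfin: "finite (Q k)" for k unfolding Q_def by (intro finite_PiE) auto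
  have Qlt: "q i < 2 ^ k" if "q \<in> Q k" "i < n" for q i k using that by (auto simp: Q_def)
  have \<Delta>: "d i - c i \<le> \<Delta>" if "i < n" for i
    unfolding \<Delta>_def using cd(1) that by (intro member_le_sum) (auto intro: less_imp_le)
  have \<Delta>0: "0 \<le> \<Delta>" unfolding \<Delta>_def using cd(1) by (intro sum_nonneg) (auto intro: less_imp_le)
  have cells: "cell_pt (c i) (d i) k (q i) < cell_pt (c i) (d i) k (Suc (q i))"
    "cell_pt (c i) (d i) k (Suc (q i)) - cell_pt (c i) (d i) k (q i) = (d i - c i) / 2 ^ k"
    "c i \<le> cell_pt (c i) (d i) k (q i)" "cell_pt (c i) (d i) k (Suc (q i)) \<le> d i"
    if "q \<in> Q k" "i < n" for q i k
  proof -
    show e: "cell_pt (c i) (d i) k (Suc (q i)) - cell_pt (c i) (d i) k (q i) = (d i - c i) / 2 ^ k" by (rule cell_pt_step)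
    moreover have "0 < (d i - c i) / 2 ^ k" using cd(1)[OF that(2)] by simp
    ultimately show "cell_pt (c i) (d i) k (q i) < cell_pt (c i) (d i) k (Suc (q i))" by linarith
    show "c i \<le> cell_pt (c i) (d i) k (q i)"
      using cell_pt_mono[of "c i" "d i" 0 "q i" k] cd(1)[OF that(2)] by simp
    show "cell_pt (c i) (d i) k (Suc (q i)) \<le> d i"
      using cell_pt_mono[of "c i" "d i" "Suc (q i)" "2 ^ k" k] cd(1)[OF that(2)] Qlt[OF that] by simp
  qed
  have gap: "cell_pt (c i) (d i) k (Suc (q i)) < cell_pt (c (Suc i)) (d (Suc i)) k (q (Suc i))" if "q \<in> Q k" "Suc i < n" for q i k
    using cells(4)[OF that(1), of i] cells(3)[OF that(1), of "Suc i"] cd(2)[of i] that by simp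
  have approx: "integrable ?P (\<lambda>x. indicator (Bx k q) x * rho n x)"
    "\<bar>measure L (ev k q) - (\<integral>x. indicator (Bx k q) x * rho n x \<partial>?P)\<bar> \<le> v / 2 ^ (k * n) * (C * (\<Delta> / 2 ^ k))" if q: "q \<in> Q k" for k q
  proof -
    have len: "cell_pt (c i) (d i) k (Suc (q i)) - cell_pt (c i) (d i) k (q i) \<le> \<Delta> / 2 ^ k" if "i < n" for i
      unfolding cells(2)[OF q that] using \<Delta>[OF that] by (intro divide_right_mono) auto
    note a = box_integral_approx[OF L, of "\<lambda>i. cell_pt (c i) (d i) k (q i)" "\<lambda>i. cell_pt (c i) (d i) k (Suc (q i))" "\<Delta> / 2 ^ k",
        OF cells(1)[OF q] gap[OF q] len]
    have v': "(\<Prod>i<n. cell_pt (c i) (d i) k (Suc (q i)) - cell_pt (c i) (d i) k (q i)) = v / 2 ^ (k * n)"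
      unfolding cell_pt_step v_def by (simp add: prod_dividef power_mult)
    show "integrable ?P (\<lambda>x. indicator (Bx k q) x * rho n x)"
      unfolding Bx_def cell_def using \<Delta>0 by (intro a(1) divide_nonneg_nonneg) auto
    show "\<bar>measure L (ev k q) - (\<integral>x. indicator (Bx k q) x * rho n x \<partial>?P)\<bar> \<le> v / 2 ^ (k * n) * (C * (\<Delta> / 2 ^ k))"
    proof -
      have "0 \<le> \<Delta> / 2 ^ k" using \<Delta>0 by (intro divide_nonneg_nonneg) auto
      moreover have "fact (2 * n) * (n * M ^ n * (M * (2 * (\<Delta> / 2 ^ k)))) = C * (\<Delta> / 2 ^ k)" by (simp add: C_def)
      ultimately show ?thesis using a(2) unfolding v' ev_def Bx_def cell_def by (metis (no_types))
    qed
  qed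
  have ind: "(\<Sum>q\<in>Q k. indicator (Bx k q) x) = (indicator ?B x :: real)" if x: "x \<in> space ?P" for k x
  proof -
    have ext: "x \<in> extensional {..<n}" using x unfolding space_PiM PiE_def by (rule IntD2)
    have "(\<Sum>q\<in>Q k. indicator (Bx k q) x) = (\<Sum>q\<in>Q k. \<Prod>i<n. indicator (cell (c i) (d i) k (q i)) (x i) :: real)"
      unfolding Bx_def by (rule sum.cong[OF refl]) (rule prod_indicator_PiE[OF finite_lessThan ext, symmetric])
    also have "\<dots> = (\<Prod>i<n. \<Sum>q<2 ^ k. indicator (cell (c i) (d i) k q) (x i))"
      unfolding Q_def by (rule prod_sum_PiE[where f = "\<lambda>i q. indicator (cell (c i) (d i) k q) (x i)", symmetric]) auto
    also have "\<dots> = (\<Prod>i<n. indicator {c i<..d i} (x i))"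
    proof (intro prod.cong refl)
      fix i assume "i \<in> {..<n}"
      then have "c i \<le> d i" using cd(1)[of i] by simp
      then show "(\<Sum>q<2 ^ k. indicator (cell (c i) (d i) k q) (x i)) = (indicator {c i<..d i} (x i) :: real)"
        unfolding UN_cell[OF \<open>c i \<le> d i\<close>, of k, symmetric]
        using cell_disjoint[OF \<open>c i \<le> d i\<close>, of _ _ k]
        by (subst indicator_UN_disjoint) (auto simp: disjoint_family_on_def)
    qed
    also have "\<dots> = indicator ?B x"
      by (rule prod_indicator_PiE[OF finite_lessThan ext])
    finally show ?thesis .
  qed
  have Rsum: "R = (\<Sum>q\<in>Q k. \<integral>x. indicator (Bx k q) x * rho n x \<partial>?P)" for k
  proof -
    have "R = (\<integral>x. (\<Sum>q\<in>Q k. indicator (Bx k q) x * rho n x) \<partial>?P)"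
      unfolding R_def by (intro Bochner_Integration.integral_cong refl) (simp add: sum_distrib_right[symmetric] ind)
    also have "\<dots> = (\<Sum>q\<in>Q k. \<integral>x. indicator (Bx k q) x * rho n x \<partial>?P)"
      by (intro Bochner_Integration.integral_sum approx(1))
    finally show ?thesis .
  qed
  have AR: "\<bar>A k - R\<bar> \<le> v * (C * (\<Delta> / 2 ^ k))" for k
  proof -
    have "A k - R = (\<Sum>q\<in>Q k. measure L (ev k q) - (\<integral>x. indicator (Bx k q) x * rho n x \<partial>?P))"
      unfolding A_def Rsum[of k] sum_subtractf ..
    also have "\<bar>\<dots>\<bar> \<le> (\<Sum>q\<in>Q k. v / 2 ^ (k * n) * (C * (\<Delta> / 2 ^ k)))"
      by (intro order_trans[OF sum_abs] sum_mono approx(2))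
    also have "\<dots> = real (card (Q k)) * (v / 2 ^ (k * n)) * (C * (\<Delta> / 2 ^ k))" by simp
    also have "card (Q k) = 2 ^ (k * n)" unfolding Q_def by (simp add: card_PiE power_mult)
    finally show ?thesis by simp
  qed
  have "A \<longlonglongrightarrow> R"
  proof (rule Lim_null_comparison[THEN LIM_zero_cancel])
    show "\<forall>\<^sub>F k in sequentially. norm (A k - R) \<le> v * (C * (\<Delta> / 2 ^ k))" using AR by simp
    have "(\<lambda>k. (v * C * \<Delta>) * (1 / 2) ^ k) \<longlonglongrightarrow> (v * C * \<Delta>) * 0"
      by (intro tendsto_mult tendsto_const LIMSEQ_realpow_zero) auto
    then show "(\<lambda>k. v * (C * (\<Delta> / 2 ^ k))) \<longlonglongrightarrow> 0" by (simp add: power_divide mult_ac)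
  qed
  then have lim1: "(\<lambda>k. ennreal (A k)) \<longlonglongrightarrow> ennreal R" by (rule tendsto_ennrealI)
  \<comment> \<open>The indicator makes \<open>f\<close> converge to \<open>u\<close> at every
    argument and not only at locally finite sets.\<close>
  define f where "f k X = indicator (space L) X * (\<Prod>i<n. of_nat (hits (c i) (d i) k X) :: ennreal)" for k X
  define u where "u X = indicator (space L) X * (\<Prod>i<n. emeasure (counting X) {c i<..d i})" for X
  have evM: "ev k q \<in> sets L" for k q
  proof -
    have M: "{X \<in> space L. X \<inter> cell (c i) (d i) k (q i) \<noteq> {}} \<in> sets L" for i
    proof -
      have "space L - {X \<in> configurations. X \<inter> cell (c i) (d i) k (q i) = {}} \<in> sets L"
        using void_measurable[of "cell (c i) (d i) k (q i)"] Lf(2) by (auto simp: cell_def)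
      moreover have "space L - {X \<in> configurations. X \<inter> cell (c i) (d i) k (q i) = {}} = {X \<in> space L. X \<inter> cell (c i) (d i) k (q i) \<noteq> {}}"
        using Lf(3) by auto
      ultimately show ?thesis by simp
    qed
    have "{X \<in> space L. \<forall>i\<in>{..<n}. X \<inter> cell (c i) (d i) k (q i) \<noteq> {}} \<in> sets L"
      by (intro sets.sets_Collect_finite_All finite_lessThan M)
    then show ?thesis unfolding ev_def by (simp only: Ball_def lessThan_iff)
  qed
  \<comment> \<open>A product of numbers of occupied cells counts the multi-indices \<open>q\<close>
    for which all chosen cells are occupied.\<close>
  have f_alt: "f k X = (\<Sum>q\<in>Q k. indicator (ev k q) X)" for k X
  proof (cases "X \<in> space L")
    case True
    have "f k X = (\<Prod>i<n. \<Sum>q<2 ^ k. indicator {q. X \<inter> cell (c i) (d i) k q \<noteq> {}} q)"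
    proof -
      have "(\<Sum>q<2 ^ k. indicator {q. X \<inter> cell (c i) (d i) k q \<noteq> {}} q) = (of_nat (hits (c i) (d i) k X) :: ennreal)" for i
        by (simp add: hits_def indicator_def sum.If_cases Int_def)
      then show ?thesis using True by (simp add: f_def)
    qed
    also have "\<dots> = (\<Sum>q\<in>Q k. \<Prod>i<n. indicator {q. X \<inter> cell (c i) (d i) k q \<noteq> {}} (q i))"
      unfolding Q_def by (rule prod_sum_PiE[where f = "\<lambda>i. indicator {q. X \<inter> cell (c i) (d i) k q \<noteq> {}}"]) auto
    also have "\<dots> = (\<Sum>q\<in>Q k. indicator (ev k q) X)"
    proof (rule sum.cong[OF refl])
      fix q
      show "(\<Prod>i<n. indicator {q. X \<inter> cell (c i) (d i) k q \<noteq> {}} (q i)) = (indicator (ev k q) X :: ennreal)"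
      proof (cases "X \<in> ev k q")
        case True
        then show ?thesis by (simp add: ev_def prod.neutral)
      next
        case False
        then obtain i where "i < n" "X \<inter> cell (c i) (d i) k (q i) = {}"
          using \<open>X \<in> space L\<close> unfolding ev_def by blast
        then have "\<exists>i\<in>{..<n}. indicator {q. X \<inter> cell (c i) (d i) k q \<noteq> {}} (q i) = (0 :: ennreal)" by (intro bexI[of _ i]) simp_all
        then have "(\<Prod>i<n. indicator {q. X \<inter> cell (c i) (d i) k q \<noteq> {}} (q i)) = (0 :: ennreal)" by (intro prod_zero) simp_all
        then show ?thesis using False by simp
      qed
    qed
    finally show ?thesis .
  qed (simp add: f_def ev_def)
  have "(\<lambda>k. \<integral>\<^sup>+X. f k X \<partial>L) \<longlonglongrightarrow> (\<integral>\<^sup>+X. u X \<partial>L)"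
  proof (rule nn_integral_LIMSEQ)
    show "incseq f"
    proof (rule incseq_SucI, rule le_funI)
      fix k X
      show "f k X \<le> f (Suc k) X"
        unfolding f_def
      proof (intro mult_left_mono prod_mono_ennreal)
        fix i assume "i \<in> {..<n}"
        then have "c i \<le> d i" using cd(1)[of i] by simp
        then show "of_nat (hits (c i) (d i) k X) \<le> (of_nat (hits (c i) (d i) (Suc k) X) :: ennreal)"
          by (intro of_nat_mono hits_mono)
      qed simp
    qed
    show "f k \<in> borel_measurable L" for k
      unfolding f_alt[abs_def] using evM by (intro borel_measurable_sum borel_measurable_indicator)
    show "(\<lambda>k. f k X) \<longlonglongrightarrow> u X" for X
    proof (cases "X \<in> space L")
      case True
      then have conf: "X \<in> configurations" using Lf(3) by simp
      have "\<forall>\<^sub>F k in sequentially. \<forall>i\<in>{..<n}. hits (c i) (d i) k X = card (X \<inter> {c i<..d i})"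
      proof (rule eventually_ball_finite, simp, rule ballI)
        fix i assume "i \<in> {..<n}"
        then show "\<forall>\<^sub>F k in sequentially. hits (c i) (d i) k X = card (X \<inter> {c i<..d i})"
          using conf cd(1) by (intro hits_eventually) (auto simp: configurations_def)
      qed
      then have "\<forall>\<^sub>F k in sequentially. f k X = u X"
      proof eventually_elim
        case (elim k)
        have "(\<Prod>i<n. of_nat (hits (c i) (d i) k X)) = (\<Prod>i<n. emeasure (counting X) {c i<..d i})"
          using elim conf by (intro prod.cong refl) (simp add: emeasure_counting_bounded(1))
        then show ?case by (simp add: f_def u_def)
      qed
      then show ?thesis by (rule tendsto_eventually)
    qed (simp add: f_def u_def)
  qed
  moreover have "(\<integral>\<^sup>+X. f k X \<partial>L) = ennreal (A k)" for k
  proof -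
    have "(\<integral>\<^sup>+X. f k X \<partial>L) = (\<Sum>q\<in>Q k. emeasure L (ev k q))"
      unfolding f_alt using evM by (subst nn_integral_sum) auto
    also have "\<dots> = ennreal (A k)"
      unfolding A_def L.emeasure_eq_measure by (rule sum_ennreal) simp
    finally show ?thesis .
  qed
  ultimately have u1: "(\<integral>\<^sup>+X. u X \<partial>L) = ennreal R"
    using LIMSEQ_unique[OF lim1] by simp
  have u2: "(\<integral>\<^sup>+X. u X \<partial>L) = (\<integral>\<^sup>+X. (\<Prod>i<n. emeasure (counting X) {c i<..d i}) \<partial>L)"
    by (intro nn_integral_cong) (simp add: u_def)
  show ?thesis using u1 unfolding u2 R_def .
qed

end

section \<open>Moment measures\<close>

lemma sets_counting [simp]: "sets (counting X) = sets borel"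
  and space_counting [simp]: "space (counting X) = UNIV"
  by (simp_all add: counting_def)

lemma emeasure_counting_finite:
  assumes "X \<in> configurations" "A \<in> sets borel" "bounded A"
  shows "emeasure (counting X) A < \<infinity>"
  unfolding emeasure_counting_bounded(1)[OF assms(2,3,1)] by (simp add: of_nat_less_top)

lemma product_sigma_finite_counting:
  assumes "X \<in> configurations"
  shows "product_sigma_finite (\<lambda>_. counting X)"
proof -
  have "sigma_finite_measure (counting X)"
  proof
    show "\<exists>A. countable A \<and> A \<subseteq> sets (counting X) \<and> \<Union>A = space (counting X) \<and> (\<forall>a\<in>A. emeasure (counting X) a \<noteq> \<infinity>)"
    proof (intro exI conjI)
      show "\<Union>(range (\<lambda>k. {- real k..real k})) = space (counting X)"
      proof -
        have "\<exists>k. x \<in> {- real k..real k}" for x :: real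
          using real_arch_simple[of "\<bar>x\<bar>"] by (auto simp: abs_le_iff minus_le_iff)
        then show ?thesis by (simp add: set_eq_iff)
      qed
      show "\<forall>a\<in>range (\<lambda>k. {- real k..real k}). emeasure (counting X) a \<noteq> \<infinity>"
        using emeasure_counting_finite[OF assms] by (auto simp: less_top)
    qed auto
  qed
  then show ?thesis by (simp add: product_sigma_finite_def)
qed

abbreviation lborels :: "nat \<Rightarrow> (nat \<Rightarrow> real) measure" where
  "lborels n \<equiv> PiM {..<n} (\<lambda>_. lborel)"

lemma sets_PiM_counting: "sets (PiM I (\<lambda>_. counting X)) = sets (PiM I (\<lambda>_. lborel))"
  by (rule sets_PiM_cong) simp_all

lemma emeasure_PiM_counting_box:
  fixes n :: nat
  assumes "X \<in> configurations" "\<And>i. i < n \<Longrightarrow> A i \<in> sets borel"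
  shows "emeasure (PiM {..<n} (\<lambda>_. counting X)) (Pi\<^sub>E {..<n} A) = (\<Prod>i<n. emeasure (counting X) (A i))"
proof -
  interpret product_sigma_finite "\<lambda>_. counting X" by (rule product_sigma_finite_counting[OF assms(1)])
  show ?thesis by (rule emeasure_PiM) (use assms(2) in auto)
qed

text \<open>A Dynkin argument from boxes. Complements require subtraction of finite values, so every
  set is first cut with the bounded boxes \<open>C k\<close>, and these cuts are removed by a
  supremum.\<close>

lemma emeasure_PiM_counting_measurable:
  assumes E: "E \<in> sets (lborels n)"
  shows "(\<lambda>X. emeasure (PiM {..<n} (\<lambda>_. counting X)) E) \<in> borel_measurable config_space"
proof -
  let ?N = "\<lambda>X. emeasure (PiM {..<n} (\<lambda>_. counting X))"
  define C where "C k = (\<Pi>\<^sub>E i\<in>{..<n}. {- real k..real k})" for k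
  have CM: "C k \<in> sets (lborels n)" for k unfolding C_def by (intro sets_PiM_I_finite) auto
  have Cfin: "?N X (C k) \<noteq> \<infinity>" if X: "X \<in> configurations" for X k
  proof -
    have "?N X (C k) = (\<Prod>i<n. emeasure (counting X) {- real k..real k})"
      unfolding C_def by (rule emeasure_PiM_counting_box[OF X]) simp
    also have "\<dots> = of_nat (card (X \<inter> {- real k..real k}) ^ n)"
      using emeasure_counting_bounded(1)[OF _ _ X, of "{- real k..real k}"] by simp
    also have "\<dots> < \<infinity>" unfolding infinity_ennreal_def by (rule of_nat_less_top)
    finally show ?thesis by simp
  qed
  have gen: "sets (lborels n) = sigma_sets (\<Pi>\<^sub>E i\<in>{..<n}. UNIV) (prod_algebra {..<n} (\<lambda>_. lborel :: real measure))"
    by (simp add: sets_PiM)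
  have pow: "prod_algebra {..<n} (\<lambda>_. lborel :: real measure) \<subseteq> Pow (\<Pi>\<^sub>E i\<in>{..<n}. UNIV)"
    using prod_algebra_sets_into_space[of "{..<n}" "\<lambda>_. lborel :: real measure"] by simp
  have Cm: "(\<lambda>X. ?N X (D \<inter> C k)) \<in> borel_measurable config_space" if "D \<in> sets (lborels n)" for D k
    using Int_stable_prod_algebra pow that[unfolded gen]
  proof (induction rule: sigma_sets_induct_disjoint)
    case (basic D)
    then obtain A where A: "D = Pi\<^sub>E {..<n} A" "\<And>i. i < n \<Longrightarrow> A i \<in> sets borel"
      by (auto simp: prod_algebra_eq_finite)
    have "?N X (D \<inter> C k) = (\<Prod>i<n. emeasure (counting X) (A i \<inter> {- real k..real k}))" if "X \<in> space config_space" for X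
      unfolding A(1) C_def PiE_Int using that A(2) by (intro emeasure_PiM_counting_box) (auto simp: space_config)
    then have "(\<lambda>X. ?N X (D \<inter> C k)) \<in> borel_measurable config_space \<longleftrightarrow>
        (\<lambda>X. \<Prod>i<n. emeasure (counting X) (A i \<inter> {- real k..real k})) \<in> borel_measurable config_space"
      by (rule measurable_cong)
    moreover have "(\<lambda>X. \<Prod>i<n. emeasure (counting X) (A i \<inter> {- real k..real k})) \<in> borel_measurable config_space"
      using A(2) by (intro borel_measurable_prod_ennreal emeasure_counting_measurable) auto
    ultimately show ?case by simp
  next
    case empty
    show ?case by simp
  next
    case (compl D)
    have DM: "D \<in> sets (lborels n)" using compl(1) gen by simp
    have CM': "C k \<in> sets (PiM {..<n} (\<lambda>_. counting X))" and DM': "D \<inter> C k \<in> sets (PiM {..<n} (\<lambda>_. counting X))" for X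
      using CM[of k] DM by (simp_all add: sets_PiM_counting)
    have C: "(\<lambda>X. ?N X (C k)) \<in> borel_measurable config_space"
    proof -
      have "?N X (C k) = (\<Prod>i<n. emeasure (counting X) {- real k..real k})" if "X \<in> space config_space" for X
        unfolding C_def using that by (intro emeasure_PiM_counting_box) (auto simp: space_config)
      then have "(\<lambda>X. ?N X (C k)) \<in> borel_measurable config_space \<longleftrightarrow>
          (\<lambda>X. \<Prod>i<n. emeasure (counting X) {- real k..real k}) \<in> borel_measurable config_space"
        by (rule measurable_cong)
      moreover have "(\<lambda>X. \<Prod>i<n. emeasure (counting X) {- real k..real k}) \<in> borel_measurable config_space"
        by (intro borel_measurable_prod_ennreal emeasure_counting_measurable) auto
      ultimately show ?thesis by simp
    qed
    have "?N X ((Pi\<^sub>E {..<n} (\<lambda>_. UNIV) - D) \<inter> C k) = ?N X (C k) - ?N X (D \<inter> C k)" if "X \<in> space config_space" for X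
    proof -
      have e: "(Pi\<^sub>E {..<n} (\<lambda>_. UNIV) - D) \<inter> C k = C k - D \<inter> C k" unfolding C_def by (auto simp: PiE_def)
      have "?N X (D \<inter> C k) \<le> ?N X (C k)" by (rule emeasure_mono) (use CM' in auto)
      then have "?N X (D \<inter> C k) \<noteq> \<infinity>" using Cfin[of X k] that by (auto simp: space_config top_unique)
      then show ?thesis unfolding e by (intro emeasure_Diff CM' DM') auto
    qed
    then have "(\<lambda>X. ?N X ((Pi\<^sub>E {..<n} (\<lambda>_. UNIV) - D) \<inter> C k)) \<in> borel_measurable config_space \<longleftrightarrow>
        (\<lambda>X. ?N X (C k) - ?N X (D \<inter> C k)) \<in> borel_measurable config_space"
      by (rule measurable_cong)
    then show ?case using C compl(2) by (simp add: borel_measurable_minus_ennreal)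
  next
    case (union D)
    have DM: "D i \<in> sets (lborels n)" for i using union(2) gen by auto
    have "?N X (\<Union> (range D) \<inter> C k) = (\<Sum>i. ?N X (D i \<inter> C k))" for X
    proof -
      have "\<Union> (range D) \<inter> C k = (\<Union>i. D i \<inter> C k)" by auto
      moreover have "(\<Sum>i. ?N X (D i \<inter> C k)) = ?N X (\<Union>i. D i \<inter> C k)"
        using union(1) DM CM[of k] by (intro suminf_emeasure) (auto simp: sets_PiM_counting disjoint_family_on_def)
      ultimately show ?thesis by simp
    qed
    then show ?case using union(3) by (simp only:) (intro borel_measurable_suminf_order)
  qed
  have sup: "?N X E = (SUP k. ?N X (E \<inter> C k))" for X
  proof -
    have "E \<subseteq> (\<Union>k. C k)"
    proof
      fix x assume "x \<in> E"
      then have x: "x \<in> (\<Pi>\<^sub>E i\<in>{..<n}. UNIV)" using sets.sets_into_space[OF E] by (auto simp: space_PiM)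
      have "\<bar>x i\<bar> \<le> real (nat \<lceil>\<Sum>i<n. \<bar>x i\<bar>\<rceil>)" if "i < n" for i
      proof -
        have "\<bar>x i\<bar> \<le> (\<Sum>i<n. \<bar>x i\<bar>)" using that by (intro member_le_sum) auto
        then show ?thesis by (rule order_trans[OF _ real_nat_ceiling_ge])
      qed
      then have "x \<in> C (nat \<lceil>\<Sum>i<n. \<bar>x i\<bar>\<rceil>)" using x unfolding C_def by (auto simp: PiE_def abs_le_iff minus_le_iff)
      then show "x \<in> (\<Union>k. C k)" by blast
    qed
    then have "E = (\<Union>k. E \<inter> C k)" by auto
    moreover have "(SUP k. ?N X (E \<inter> C k)) = ?N X (\<Union>k. E \<inter> C k)"
    proof (rule SUP_emeasure_incseq)
      show "range (\<lambda>k. E \<inter> C k) \<subseteq> sets (PiM {..<n} (\<lambda>_. counting X))" using E CM by (auto simp: sets_PiM_counting)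
      show "incseq (\<lambda>k. E \<inter> C k)" unfolding C_def by (intro incseq_SucI) (auto simp: PiE_def Pi_def)
    qed
    ultimately show ?thesis by simp
  qed
  show ?thesis unfolding sup by (intro borel_measurable_SUP Cm E) auto
qed

text \<open>The product of counting measures also charges the diagonals. The comparison with the
  density takes place on strictly increasing points, where this is the factorial moment
  measure.\<close>

definition moment_measure :: "real set measure \<Rightarrow> nat \<Rightarrow> (nat \<Rightarrow> real) measure" where
  "moment_measure L n = measure_of (space (lborels n)) (sets (lborels n))
     (\<lambda>E. \<integral>\<^sup>+ X. emeasure (PiM {..<n} (\<lambda>_. counting X)) E \<partial>L)"

lemma sets_moment_measure [simp]: "sets (moment_measure L n) = sets (lborels n)"
  unfolding moment_measure_def by (rule sets.sets_measure_of_eq)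

lemma emeasure_moment_measure:
  assumes L: "point_process_law L" and E: "E \<in> sets (lborels n)"
  shows "emeasure (moment_measure L n) E = (\<integral>\<^sup>+ X. emeasure (PiM {..<n} (\<lambda>_. counting X)) E \<partial>L)"
  unfolding moment_measure_def
proof (rule emeasure_measure_of_sigma[OF sets.sigma_algebra_axioms _ _ E])
  let ?\<mu> = "\<lambda>E. \<integral>\<^sup>+ X. emeasure (PiM {..<n} (\<lambda>_. counting X)) E \<partial>L"
  show "positive (sets (lborels n)) ?\<mu>" by (simp add: positive_def)
  show "countably_additive (sets (lborels n)) ?\<mu>"
  proof (rule countably_additiveI)
    fix A :: "nat \<Rightarrow> (nat \<Rightarrow> real) set"
    assume A: "range A \<subseteq> sets (lborels n)" "disjoint_family A"
    have m: "(\<lambda>X. emeasure (PiM {..<n} (\<lambda>_. counting X)) (A i)) \<in> borel_measurable L" for i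
      using emeasure_PiM_counting_measurable[of "A i" n] A(1) point_process_lawD(2)[OF L] measurable_cong_sets[of L config_space borel borel] by auto
    have "(\<Sum>i. ?\<mu> (A i)) = (\<integral>\<^sup>+ X. (\<Sum>i. emeasure (PiM {..<n} (\<lambda>_. counting X)) (A i)) \<partial>L)"
      by (rule nn_integral_suminf[symmetric]) (rule m)
    also have "\<dots> = ?\<mu> (\<Union>i. A i)"
      using A by (intro nn_integral_cong suminf_emeasure) (auto simp: sets_PiM_counting)
    finally show "(\<Sum>i. ?\<mu> (A i)) = ?\<mu> (\<Union>i. A i)" .
  qed
qed

text \<open>The gaps between consecutive sides are those required by the void probabilities, so
  \<open>box_moment\<close> applies to exactly these boxes.\<close>

definition ordered_boxes :: "nat \<Rightarrow> (nat \<Rightarrow> real) set set" where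
  "ordered_boxes n = {\<Pi>\<^sub>E i\<in>{..<n}. {c i<..d i} | c d.
     (\<forall>i<n. c i < d i) \<and> (\<forall>i. Suc i < n \<longrightarrow> d i < c (Suc i))}"

lemma ordered_boxesI:
  assumes "\<And>i. i < n \<Longrightarrow> c i < d i" "\<And>i. Suc i < n \<Longrightarrow> d i < c (Suc i)"
  shows "(\<Pi>\<^sub>E i\<in>{..<n}. {c i<..d i}) \<in> ordered_boxes n"
  unfolding ordered_boxes_def by (rule CollectI, rule exI[of _ c], rule exI[of _ d]) (simp add: assms)

lemma ordered_boxes_sets: "Q \<in> ordered_boxes n \<Longrightarrow> Q \<in> sets (lborels n)"
  unfolding ordered_boxes_def by (auto intro!: sets_PiM_I_finite)

lemma gaps_strict_mono:
  fixes n :: nat and c d x :: "nat \<Rightarrow> real"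
  assumes "\<And>i. Suc i < n \<Longrightarrow> d i < c (Suc i)" "\<And>i. i < n \<Longrightarrow> c i < x i \<and> x i \<le> d i"
  shows "strict_mono_on {..<n} x"
proof (rule strict_mono_onI)
  fix i j :: nat assume ij: "j \<in> {..<n}" "i < j"
  have "x i < x (i + Suc k)" if "i + Suc k < n" for k
    using that
  proof (induction k)
    case 0
    then show ?case using assms(1)[of i] assms(2)[of i] assms(2)[of "Suc i"] by force
  next
    case (Suc k)
    then show ?case using assms(1)[of "i + Suc k"] assms(2)[of "i + Suc k"] assms(2)[of "Suc (i + Suc k)"] by force
  qed
  then show "x i < x j" using ij less_imp_Suc_add[of i j] by auto
qed

lemma ordered_boxes_cover:
  shows "\<exists>\<Q>. countable \<Q> \<and> \<Q> \<subseteq> ordered_boxes n \<and>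
    (\<forall>x\<in>space (lborels n). strict_mono_on {..<n} x \<longrightarrow> x \<in> \<Union>\<Q>)"
proof -
  define box where "box cd = (\<Pi>\<^sub>E i\<in>{..<n}. {fst (cd i)<..snd (cd i)})" for cd :: "nat \<Rightarrow> real \<times> real"
  define \<Q> where "\<Q> = box ` ({..<n} \<rightarrow>\<^sub>E \<rat> \<times> \<rat>) \<inter> ordered_boxes n"
  have "countable ({..<n} \<rightarrow>\<^sub>E \<rat> \<times> (\<rat> :: real set))"
    by (intro countable_PiE countable_SIGMA countable_rat) auto
  then have "countable \<Q>" unfolding \<Q>_def by (intro countable_Int1 countable_image)
  moreover have "x \<in> \<Union>\<Q>" if x: "x \<in> space (lborels n)" "strict_mono_on {..<n} x" for x
  proof -
    \<comment> \<open>Endpoints are chosen between \<open>x i\<close> and the midpoints to its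
      neighbours, so that a midpoint separates consecutive sides. The outermost endpoints have no
      neighbour to respect and are taken within distance 1.\<close>
    have "\<exists>cd. cd \<in> \<rat> \<times> \<rat> \<and> fst cd < x i \<and> x i < snd cd \<and>
        (0 < i \<longrightarrow> (x (i - 1) + x i) / 2 < fst cd) \<and> (Suc i < n \<longrightarrow> snd cd < (x i + x (Suc i)) / 2)"
      if i: "i < n" for i
    proof -
      have "(if 0 < i then (x (i - 1) + x i) / 2 else x i - 1) < x i"
        using strict_mono_onD[OF x(2), of "i - 1" i] i by auto
      then obtain c where c: "c \<in> \<rat>" "(if 0 < i then (x (i - 1) + x i) / 2 else x i - 1) < c" "c < x i"
        using Rats_dense_in_real by blast
      have "x i < (if Suc i < n then (x i + x (Suc i)) / 2 else x i + 1)"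
        using strict_mono_onD[OF x(2), of i "Suc i"] i by auto
      then obtain d where d: "d \<in> \<rat>" "x i < d" "d < (if Suc i < n then (x i + x (Suc i)) / 2 else x i + 1)"
        using Rats_dense_in_real by blast
      show ?thesis using c d by (intro exI[of _ "(c, d)"]) (auto split: if_splits)
    qed
    then have "\<forall>i\<in>{..<n}. \<exists>cd. cd \<in> \<rat> \<times> \<rat> \<and> fst cd < x i \<and> x i < snd cd \<and>
        (0 < i \<longrightarrow> (x (i - 1) + x i) / 2 < fst cd) \<and> (Suc i < n \<longrightarrow> snd cd < (x i + x (Suc i)) / 2)"
      by simp
    from bchoice[OF this] obtain cd where cd: "\<And>i. i < n \<Longrightarrow> cd i \<in> \<rat> \<times> \<rat>"
      "\<And>i. i < n \<Longrightarrow> fst (cd i) < x i" "\<And>i. i < n \<Longrightarrow> x i < snd (cd i)"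
      "\<And>i. i < n \<Longrightarrow> 0 < i \<Longrightarrow> (x (i - 1) + x i) / 2 < fst (cd i)"
      "\<And>i. i < n \<Longrightarrow> Suc i < n \<Longrightarrow> snd (cd i) < (x i + x (Suc i)) / 2"
      unfolding Ball_def lessThan_iff by blast
    let ?cd = "restrict cd {..<n}"
    have b: "box ?cd = (\<Pi>\<^sub>E i\<in>{..<n}. {fst (cd i)<..snd (cd i)})"
      unfolding box_def by (intro PiE_cong) simp
    have "snd (cd i) < fst (cd (Suc i))" if "Suc i < n" for i
      using cd(5)[of i] cd(4)[of "Suc i"] that by simp
    moreover have "fst (cd i) < snd (cd i)" if "i < n" for i using cd(2,3)[of i] that by simp
    ultimately have "box ?cd \<in> ordered_boxes n"
      unfolding b by (intro ordered_boxesI)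
    moreover have "?cd \<in> {..<n} \<rightarrow>\<^sub>E \<rat> \<times> \<rat>" using cd(1) by (auto simp: PiE_def)
    moreover have "x \<in> box ?cd"
      unfolding b using x(1) cd(2,3) by (auto simp: space_PiM PiE_def Pi_def intro: less_imp_le)
    ultimately show ?thesis unfolding \<Q>_def by blast
  qed
  ultimately show ?thesis unfolding \<Q>_def by blast
qed

text \<open>Within a fixed ordered box, intersections with arbitrary boxes are again ordered boxes
  or empty. The measures thus agree on a generator stable under intersection and then on all
  measurable subsets of the box. Countably many ordered boxes, made disjoint, cover the increasing
  points.\<close>

lemma moment_measure_eqI:
  fixes \<nu> :: "(nat \<Rightarrow> real) measure"
  assumes sets: "sets \<mu> = sets (lborels n)" "sets \<nu> = sets (lborels n)"
    and eq: "\<And>Q. Q \<in> ordered_boxes n \<Longrightarrow> emeasure \<mu> Q = emeasure \<nu> Q"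
    and fin: "\<And>Q. Q \<in> ordered_boxes n \<Longrightarrow> emeasure \<mu> Q \<noteq> \<infinity>"
    and E: "E \<in> sets (lborels n)" "\<And>x. x \<in> E \<Longrightarrow> strict_mono_on {..<n} x"
  shows "emeasure \<mu> E = emeasure \<nu> E"
proof -
  have box: "emeasure \<mu> (Q \<inter> A) = emeasure \<nu> (Q \<inter> A)" if Q: "Q \<in> ordered_boxes n" and A: "A \<in> sets (lborels n)" for Q A
  proof -
    obtain c d where cd: "Q = (\<Pi>\<^sub>E i\<in>{..<n}. {c i<..d i})" "\<And>i. i < n \<Longrightarrow> c i < d i" "\<And>i. Suc i < n \<Longrightarrow> d i < c (Suc i)"
      using Q unfolding ordered_boxes_def by blast
    have QM: "Q \<in> sets \<mu>" "Q \<in> sets \<nu>" using ordered_boxes_sets[OF Q] sets by simp_all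
    define G where "G = {Pi\<^sub>E {..<n} F | F. \<forall>i\<in>{..<n}. F i \<in> range (\<lambda>(a, b). {a<..b :: real})}"
    have gen: "sets (lborels n) = sigma_sets (space (lborels n)) G"
    proof -
      let ?E = "range (\<lambda>(a, b). {a<..b :: real})"
      have U: "\<exists>j. x \<in> {- real j<..real j}" for x :: real
        using reals_Archimedean2[of "\<bar>x\<bar>"] by (auto simp: abs_less_iff minus_less_iff intro: less_imp_le)
      have "sets (lborels n) = sets (PiM {..<n} (\<lambda>_. sigma UNIV ?E))"
        by (rule sets_PiM_cong) (simp_all add: borel_sigma_sets_Ioc[symmetric])
      also have "\<dots> = sets (sigma (\<Pi>\<^sub>E i\<in>{..<n}. UNIV)
          {{f \<in> \<Pi>\<^sub>E i\<in>{..<n}. UNIV. \<forall>i\<in>j. f i \<in> A i} | A j. j \<in> {{..<n}} \<and> A \<in> Pi j (\<lambda>_. ?E)})"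
      proof (rule sets_PiM_sigma)
        have "UNIV = \<Union>(range (\<lambda>j. {- real j<..real j}))" using U by (simp add: set_eq_iff)
        then show "\<exists>S\<subseteq>?E. countable S \<and> UNIV = \<Union>S"
          by (intro exI[of _ "range (\<lambda>j. {- real j<..real j})"]) auto
      qed auto
      also have "{{f \<in> \<Pi>\<^sub>E i\<in>{..<n}. UNIV. \<forall>i\<in>j. f i \<in> A i} | A j. j \<in> {{..<n}} \<and> A \<in> Pi j (\<lambda>_. ?E)} = G"
      proof -
        have e: "{f \<in> \<Pi>\<^sub>E i\<in>{..<n}. UNIV. \<forall>i\<in>{..<n}. f i \<in> A i} = Pi\<^sub>E {..<n} A" for A :: "nat \<Rightarrow> real set"
          by (auto simp: PiE_def)
        have "{{f \<in> \<Pi>\<^sub>E i\<in>{..<n}. UNIV. \<forall>i\<in>j. f i \<in> A i} | A j. j \<in> {{..<n}} \<and> A \<in> Pi j (\<lambda>_. ?E)}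
          = {{f \<in> \<Pi>\<^sub>E i\<in>{..<n}. UNIV. \<forall>i\<in>{..<n}. f i \<in> A i} | A. A \<in> Pi {..<n} (\<lambda>_. ?E)}" by simp
        then show ?thesis unfolding e G_def Pi_iff .
      qed
      also have "sets (sigma (\<Pi>\<^sub>E i\<in>{..<n}. UNIV) G) = sigma_sets (\<Pi>\<^sub>E i\<in>{..<n}. UNIV) G"
        by (rule sets_measure_of) (auto simp: G_def)
      finally show ?thesis by (simp add: space_PiM)
    qed
    \<comment> \<open>A density given by an indicator is the restriction to \<open>Q\<close>; it
      provides the finiteness that the uniqueness theorem asks for.\<close>
    have "density \<mu> (indicator Q) = density \<nu> (indicator Q)"
    proof (rule measure_eqI_generator_eq[where E = G and \<Omega> = "space (lborels n)" and A = "\<lambda>k. \<Pi>\<^sub>E i\<in>{..<n}. {- real k<..real k}"])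
      show "Int_stable G"
      proof (rule Int_stableI)
        fix S T assume "S \<in> G" "T \<in> G"
        then obtain F F' where F: "S = Pi\<^sub>E {..<n} F" "T = Pi\<^sub>E {..<n} F'"
          "\<forall>i\<in>{..<n}. F i \<in> range (\<lambda>(a, b). {a<..b :: real})" "\<forall>i\<in>{..<n}. F' i \<in> range (\<lambda>(a, b). {a<..b :: real})"
          unfolding G_def by blast
        have "F i \<inter> F' i \<in> range (\<lambda>(a, b). {a<..b :: real})" if i: "i \<in> {..<n}" for i
        proof -
          obtain p where p: "F i = {fst p<..snd p}" using bspec[OF F(3) i] by (auto simp: case_prod_beta)
          obtain p' where p': "F' i = {fst p'<..snd p'}" using bspec[OF F(4) i] by (auto simp: case_prod_beta)
          have "F i \<inter> F' i = (\<lambda>(a, b). {a<..b}) (max (fst p) (fst p'), min (snd p) (snd p'))"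
            unfolding p p' by auto
          then show ?thesis by blast
        qed
        then show "S \<inter> T \<in> G" unfolding G_def F(1,2) PiE_Int by blast
      qed
      show "G \<subseteq> Pow (space (lborels n))" unfolding G_def by (auto simp: space_PiM)
      show "sets (density \<mu> (indicator Q)) = sigma_sets (space (lborels n)) G"
        "sets (density \<nu> (indicator Q)) = sigma_sets (space (lborels n)) G"
        using sets gen by simp_all
      show "(\<Union>k. \<Pi>\<^sub>E i\<in>{..<n}. {- real k<..real k}) = space (lborels n)"
      proof
        show "space (lborels n) \<subseteq> (\<Union>k. \<Pi>\<^sub>E i\<in>{..<n}. {- real k<..real k})"
        proof
          fix x assume x: "x \<in> space (lborels n)"
          obtain k where k: "(\<Sum>i<n. \<bar>x i\<bar>) < real k" using reals_Archimedean2 by blast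
          have "\<bar>x i\<bar> < real k" if "i < n" for i
            using member_le_sum[of i "{..<n}" "\<lambda>i. \<bar>x i\<bar>"] that k by simp
          then have "x i \<in> {- real k<..real k}" if "i < n" for i
            using that by (auto simp: abs_less_iff minus_less_iff intro: less_imp_le)
          then show "x \<in> (\<Union>k. \<Pi>\<^sub>E i\<in>{..<n}. {- real k<..real k})"
            using x by (auto simp: space_PiM PiE_def Pi_def simp del: greaterThanAtMost_iff)
        qed
      qed (auto simp: space_PiM)
      show G: "range (\<lambda>k. \<Pi>\<^sub>E i\<in>{..<n}. {- real k<..real k}) \<subseteq> G"
      proof
        fix S assume "S \<in> range (\<lambda>k. \<Pi>\<^sub>E i\<in>{..<n}. {- real k<..real k})"
        then obtain k where S: "S = (\<Pi>\<^sub>E i\<in>{..<n}. {- real k<..real k})" by blast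
        have R: "{- real k<..real k} \<in> range (\<lambda>(a, b). {a<..b :: real})" by (rule range_eqI[of _ _ "(- real k, real k)"]) simp
        show "S \<in> G"
          unfolding G_def by (rule CollectI, rule exI[of _ "\<lambda>_. {- real k<..real k}"], rule conjI[OF S], rule ballI, rule R)
      qed
      have GM: "G \<subseteq> sets (lborels n)" unfolding gen by (auto intro: sigma_sets.Basic)
      show "emeasure (density \<mu> (indicator Q)) (\<Pi>\<^sub>E i\<in>{..<n}. {- real k<..real k}) \<noteq> \<infinity>" for k
      proof -
        have "(\<Pi>\<^sub>E i\<in>{..<n}. {- real k<..real k}) \<in> sets \<mu>" using G GM sets by blast
        then have "emeasure (density \<mu> (indicator Q)) (\<Pi>\<^sub>E i\<in>{..<n}. {- real k<..real k}) = emeasure \<mu> (Q \<inter> (\<Pi>\<^sub>E i\<in>{..<n}. {- real k<..real k}))"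
          by (rule emeasure_restricted[OF QM(1)])
        also have "\<dots> \<le> emeasure \<mu> Q" by (rule emeasure_mono[OF Int_lower1 QM(1)])
        finally show ?thesis using fin[OF Q] by (auto simp: top_unique)
      qed
      show "emeasure (density \<mu> (indicator Q)) S = emeasure (density \<nu> (indicator Q)) S" if S: "S \<in> G" for S
      proof -
        have SM: "S \<in> sets \<mu>" "S \<in> sets \<nu>" using S GM sets by auto
        obtain F where F: "S = Pi\<^sub>E {..<n} F" "\<forall>i\<in>{..<n}. F i \<in> range (\<lambda>(a, b). {a<..b :: real})"
          using S unfolding G_def by blast
        from F(2) have "\<forall>i\<in>{..<n}. \<exists>ab. F i = {fst ab<..snd ab}"
          by (auto simp: case_prod_beta image_iff)
        from bchoice[OF this] obtain ab where ab: "\<And>i. i < n \<Longrightarrow> F i = {fst (ab i)<..snd (ab i)}" by auto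
        let ?c = "\<lambda>i. max (c i) (fst (ab i))" and ?d = "\<lambda>i. min (d i) (snd (ab i))"
        have QS: "Q \<inter> S = (\<Pi>\<^sub>E i\<in>{..<n}. {?c i<..?d i})"
          unfolding cd(1) F(1) PiE_Int by (rule PiE_cong) (auto simp: ab)
        have "emeasure \<mu> (Q \<inter> S) = emeasure \<nu> (Q \<inter> S)"
        proof (cases "\<forall>i<n. ?c i < ?d i")
          case True
          have "?d i < ?c (Suc i)" if "Suc i < n" for i using cd(3)[OF that] by linarith
          then have "Q \<inter> S \<in> ordered_boxes n" unfolding QS using True by (intro ordered_boxesI) blast+
          then show ?thesis by (rule eq)
        next
          case False
          then obtain i where "i < n" "{?c i<..?d i} = {}" by auto
          then have "Q \<inter> S = {}" unfolding QS PiE_eq_empty_iff by blast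
          then show ?thesis by simp
        qed
        then show ?thesis using emeasure_restricted[OF QM(1) SM(1)] emeasure_restricted[OF QM(2) SM(2)] by simp
      qed
    qed
    then have "emeasure (density \<mu> (indicator Q)) A = emeasure (density \<nu> (indicator Q)) A" by simp
    then show ?thesis using emeasure_restricted[OF QM(1), of A] emeasure_restricted[OF QM(2), of A] A sets by simp
  qed
  obtain \<Q> where \<Q>: "countable \<Q>" "\<Q> \<subseteq> ordered_boxes n"
    "\<And>x. x \<in> space (lborels n) \<Longrightarrow> strict_mono_on {..<n} x \<Longrightarrow> x \<in> \<Union>\<Q>"
    using ordered_boxes_cover[of n] by blast
  show ?thesis
  proof (cases "E = {}")
    case False
    then have ne: "\<Q> \<noteq> {}" using \<Q>(3) E sets.sets_into_space[OF E(1)] by blast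
    define q where "q = from_nat_into \<Q>"
    have q: "q k \<in> ordered_boxes n" for k unfolding q_def using from_nat_into[OF ne] \<Q>(2) by blast
    have qM: "range q \<subseteq> sets (lborels n)" using q ordered_boxes_sets by blast
    have rq: "range q = \<Q>" unfolding q_def by (rule range_from_nat_into[OF ne \<Q>(1)])
    let ?D = "\<lambda>k. E \<inter> disjointed q k"
    have D1: "?D k \<in> sets (lborels n)" for k
      using sets.range_disjointed_sets[OF qM] by (intro sets.Int E(1)) blast
    have Ddis: "disjoint_family ?D" using disjoint_family_disjointed[of q] unfolding disjoint_family_on_def by blast
    have "E \<subseteq> (\<Union>k. q k)"
    proof
      fix x assume x: "x \<in> E"
      show "x \<in> (\<Union>k. q k)"
        unfolding rq by (rule \<Q>(3)[OF subsetD[OF sets.sets_into_space[OF E(1)] x] E(2)[OF x]])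
    qed
    then have UD: "(\<Union>k. ?D k) = E" unfolding Int_UN_distrib[symmetric] UN_disjointed_eq by (rule Int_absorb2)
    have "emeasure \<mu> (?D k) = emeasure \<nu> (?D k)" for k
    proof -
      have "q k \<inter> ?D k = ?D k" using disjointed_subset[of q k] by blast
      then show ?thesis using box[OF q D1, of k k] by (simp only:)
    qed
    then have "(\<Sum>k. emeasure \<mu> (?D k)) = (\<Sum>k. emeasure \<nu> (?D k))" by (simp only:)
    moreover have "range ?D \<subseteq> sets \<mu>" "range ?D \<subseteq> sets \<nu>"
      unfolding sets using D1 by (rule image_subsetI)+
    note suminf_emeasure[OF this(1) Ddis] suminf_emeasure[OF this(2) Ddis]
    ultimately show ?thesis unfolding UD by argo
  qed simp
qed

section \<open>Independent thinning\<close>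

abbreviation coins :: "real set \<Rightarrow> (real \<Rightarrow> bool) measure" where
  "coins X \<equiv> PiM X (\<lambda>_. measure_pmf (bernoulli_pmf (1 / 2)))"

lemma countable_configuration:
  assumes "X \<in> configurations"
  shows "countable X"
proof -
  have "x \<in> (\<Union>k. {- real k..real k})" for x :: real
    using real_arch_simple[of "\<bar>x\<bar>"] by (auto simp: abs_le_iff minus_le_iff)
  then have "X = (\<Union>k. X \<inter> {- real k..real k})" by auto
  moreover have "countable (X \<inter> {- real k..real k})" for k
    by (rule countable_finite) (use assms in \<open>auto simp: configurations_def\<close>)
  then have "countable (\<Union>k. X \<inter> {- real k..real k})" by (rule countable_UN[OF countableI_type])
  ultimately show ?thesis by simp
qed

lemma thinned_configuration: "X \<in> configurations \<Longrightarrow> {x \<in> X. P x} \<in> configurations"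
  unfolding configurations_def by (auto intro: rev_finite_subset)

text \<open>The count of the thinned configuration is an integral over the countable set
  \<open>X\<close> of functions of single coins, so measurability of each coin suffices.\<close>

lemma thinning_measurable:
  assumes X: "X \<in> configurations"
  shows "(\<lambda>r. {x \<in> X. \<not> r x}) \<in> coins X \<rightarrow>\<^sub>M config_space"
  unfolding config_space_def
proof (rule measurable_Sup2)
  fix m assume "m \<in> (\<lambda>A. vimage_algebra configurations (\<lambda>X. emeasure (counting X) A) borel) ` sets borel"
  then obtain A where A: "A \<in> sets borel" "m = vimage_algebra configurations (\<lambda>X. emeasure (counting X) A) (borel :: ennreal measure)"
    by blast
  show "(\<lambda>r. {x \<in> X. \<not> r x}) \<in> coins X \<rightarrow>\<^sub>M m"
    unfolding A(2)
  proof (rule measurable_vimage_algebra2)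
    show "(\<lambda>r. {x \<in> X. \<not> r x}) \<in> space (coins X) \<rightarrow> configurations" by (rule Pi_I) (rule thinned_configuration[OF X])
    have eq: "emeasure (counting {x \<in> X. \<not> r x}) A = (\<integral>\<^sup>+x. (if r x then 0 else indicator A x) \<partial>count_space X)" for r
    proof -
      have "emeasure (counting {x \<in> X. \<not> r x}) A = emeasure (count_space X) (A \<inter> {x \<in> X. \<not> r x})"
        unfolding emeasure_counting[OF A(1)] by (subst (1 2) emeasure_count_space) auto
      also have "\<dots> = (\<integral>\<^sup>+x. indicator (A \<inter> {x \<in> X. \<not> r x}) x \<partial>count_space X)"
        by (rule nn_integral_indicator[symmetric]) auto
      also have "\<dots> = (\<integral>\<^sup>+x. (if r x then 0 else indicator A x) \<partial>count_space X)"
        by (intro nn_integral_cong) (auto simp: indicator_def)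
      finally show ?thesis .
    qed
    interpret C: sigma_finite_measure "count_space X"
      by (rule sigma_finite_measure_count_space_countable[OF countable_configuration[OF X]])
    have "(\<lambda>p. if fst p (snd p) then 0 else indicator A (snd p) :: ennreal) \<in> borel_measurable (coins X \<Otimes>\<^sub>M count_space X)"
    proof (rule measurable_compose_countable'[where f = "\<lambda>i p. if fst p i then 0 else indicator A i" and g = snd and I = X])
      fix i assume i: "i \<in> X"
      have c: "(\<lambda>r. r i) \<in> coins X \<rightarrow>\<^sub>M measure_pmf (bernoulli_pmf (1 / 2))"
        by (rule measurable_component_singleton[OF i])
      have d: "(\<lambda>b. if b then 0 else indicator A i :: ennreal) \<in> borel_measurable (measure_pmf (bernoulli_pmf (1 / 2)))" by simp
      show "(\<lambda>p. if fst p i then 0 else indicator A i :: ennreal) \<in> borel_measurable (coins X \<Otimes>\<^sub>M count_space X)"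
        by (rule measurable_compose[OF measurable_compose[OF measurable_fst c] d])
    qed (auto intro: countable_configuration[OF X])
    then have "(\<lambda>r. \<integral>\<^sup>+x. (if r x then 0 else indicator A x) \<partial>count_space X) \<in> borel_measurable (coins X)"
      by (intro C.borel_measurable_nn_integral) (simp add: case_prod_beta')
    then show "(\<lambda>r. emeasure (counting {x \<in> X. \<not> r x}) A) \<in> borel_measurable (coins X)" unfolding eq .
  qed
qed auto

lemma sets_independent_removal: "sets (independent_removal p X) = sets config_space"
  by (simp add: independent_removal_def)

lemma prob_space_coins: "prob_space (coins X)"
  by (intro prob_space_PiM prob_space_measure_pmf)

lemma prob_space_independent_removal:
  assumes "X \<in> configurations"
  shows "prob_space (independent_removal (1 / 2) X)"
  unfolding independent_removal_def
  by (rule prob_space.prob_space_distr[OF prob_space_coins thinning_measurable[OF assms]])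

text \<open>\<open>True\<close> means removal and \<open>False\<close> survival; at probability 1/2
  both have the same weight. Void events need the first case, moments the second.\<close>

lemma emeasure_coins:
  assumes J: "J \<subseteq> X" "finite J"
  shows "{r \<in> space (coins X). \<forall>x\<in>J. r x = b} \<in> sets (coins X)"
    and "emeasure (coins X) {r \<in> space (coins X). \<forall>x\<in>J. r x = b} = ennreal ((1 / 2) ^ card J)"
proof -
  let ?b = "measure_pmf (bernoulli_pmf (1 / 2))"
  interpret product_prob_space "\<lambda>_ :: real. ?b" X by (intro product_prob_spaceI prob_space_measure_pmf)
  have e: "{r \<in> space (coins X). \<forall>x\<in>J. r x = b} = prod_emb X (\<lambda>_. ?b) J (Pi\<^sub>E J (\<lambda>_. {b}))"
    unfolding prod_emb_def space_PiM by (rule set_eqI) (simp only: vimage_def Int_iff mem_Collect_eq restrict_PiE_iff singleton_iff conj_commute)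
  show "{r \<in> space (coins X). \<forall>x\<in>J. r x = b} \<in> sets (coins X)"
    unfolding e using J by (intro sets_PiM_I) auto
  have "emeasure (coins X) (prod_emb X (\<lambda>_. ?b) J (Pi\<^sub>E J (\<lambda>_. {b}))) = (\<Prod>x\<in>J. emeasure ?b {b})"
    using J by (intro emeasure_PiM_emb) auto
  also have "emeasure ?b {b} = ennreal (1 / 2)" unfolding emeasure_pmf_single by (cases b) simp_all
  also have "(\<Prod>x\<in>J. ennreal (1 / 2)) = ennreal ((1 / 2) ^ card J)"
    unfolding prod_constant by (rule ennreal_power) simp
  finally show "emeasure (coins X) {r \<in> space (coins X). \<forall>x\<in>J. r x = b} = ennreal ((1 / 2) ^ card J)"
    unfolding e .
qed

lemma emeasure_independent_removal_void:
  assumes X: "X \<in> configurations" and A: "A \<in> sets borel" "bounded A"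
  shows "emeasure (independent_removal (1 / 2) X) {Y \<in> configurations. Y \<inter> A = {}} = ennreal ((1 / 2) ^ card (X \<inter> A))"
proof -
  have fin: "finite (X \<inter> A)" using X A by (auto simp: configurations_def)
  have "emeasure (independent_removal (1 / 2) X) {Y \<in> configurations. Y \<inter> A = {}} =
      emeasure (coins X) ((\<lambda>r. {x \<in> X. \<not> r x}) -` {Y \<in> configurations. Y \<inter> A = {}} \<inter> space (coins X))"
    unfolding independent_removal_def by (rule emeasure_distr[OF thinning_measurable[OF X] void_measurable[OF A(1)]])
  also have "(\<lambda>r. {x \<in> X. \<not> r x}) -` {Y \<in> configurations. Y \<inter> A = {}} \<inter> space (coins X) =
      {r \<in> space (coins X). \<forall>x\<in>X \<inter> A. r x = True}"
    using thinned_configuration[OF X] by auto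
  finally show ?thesis using emeasure_coins(2)[of "X \<inter> A" X True] fin by simp
qed

text \<open>Counts are limits of sums of void indicators over dyadic cells, so the void events generate.\<close>

lemma sets_config_space_void:
  "sets config_space = sigma_sets configurations {{X \<in> configurations. X \<inter> A = {}} | A. A \<in> sets borel \<and> bounded A}"
  (is "_ = sigma_sets _ ?G")
proof
  define S where "S = sigma configurations ?G"
  have GP: "?G \<subseteq> Pow configurations" by auto
  have S: "space S = configurations" "sets S = sigma_sets configurations ?G"
    unfolding S_def by (simp_all add: space_measure_of[OF GP] sets_measure_of[OF GP])
  have void: "{X \<in> space S. X \<inter> A \<noteq> {}} \<in> sets S" if "A \<in> sets borel" "bounded A" for A
  proof -
    have "{X \<in> configurations. X \<inter> A = {}} \<in> sets S" unfolding S(2) using that by (intro sigma_sets.Basic) blast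
    then have "space S - {X \<in> configurations. X \<inter> A = {}} \<in> sets S" by (rule sets.compl_sets)
    moreover have "space S - {X \<in> configurations. X \<inter> A = {}} = {X \<in> space S. X \<inter> A \<noteq> {}}" using S(1) by auto
    ultimately show ?thesis by simp
  qed
  have count: "(\<lambda>X. emeasure (counting X) A) \<in> borel_measurable S" if A: "A \<in> sets borel" for A
  proof -
    let ?A = "\<lambda>m :: nat. A \<inter> {- real (Suc m)<..real (Suc m)}"
    let ?h = "\<lambda>m k X. of_nat (hits (- real (Suc m)) (real (Suc m)) k (X \<inter> A)) :: ennreal"
    have hm: "?h m k \<in> borel_measurable S" for m k
    proof -
      have "(\<lambda>X. of_nat (if (X \<inter> A) \<inter> cell (- real (Suc m)) (real (Suc m)) k q \<noteq> {} then 1 else 0) :: ennreal) \<in> borel_measurable S" for q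
      proof -
        have "A \<inter> cell (- real (Suc m)) (real (Suc m)) k q \<in> sets borel" "bounded (A \<inter> cell (- real (Suc m)) (real (Suc m)) k q)"
          using A by (auto simp: cell_def intro!: bounded_Int)
        from borel_measurable_indicator[OF void[OF this]]
        have "(indicator {X \<in> space S. X \<inter> (A \<inter> cell (- real (Suc m)) (real (Suc m)) k q) \<noteq> {}} :: _ \<Rightarrow> ennreal) \<in> borel_measurable S" .
        moreover have "of_nat (if (X \<inter> A) \<inter> cell (- real (Suc m)) (real (Suc m)) k q \<noteq> {} then 1 else 0) =
            (indicator {X \<in> space S. X \<inter> (A \<inter> cell (- real (Suc m)) (real (Suc m)) k q) \<noteq> {}} X :: ennreal)" if "X \<in> space S" for X
          using that by (simp add: indicator_def Int_assoc)
        ultimately show ?thesis by (subst measurable_cong) auto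
      qed
      then show ?thesis unfolding hits_def of_nat_sum by (rule borel_measurable_sum)
    qed
    have lim: "(\<lambda>k. ?h m k X) \<longlonglongrightarrow> emeasure (counting X) (?A m)" if X: "X \<in> space S" for m X
    proof (rule tendsto_eventually)
      have conf: "X \<in> configurations" using X S(1) by simp
      have b: "bounded {- real (Suc m)<..real (Suc m)}" by simp
      have e: "emeasure (counting X) (?A m) = of_nat (card (X \<inter> ?A m))"
        using A b conf by (intro emeasure_counting_bounded(1)) (auto intro: bounded_subset[OF b])
      have "finite (X \<inter> {- real (Suc m)<..real (Suc m)})" using conf b by (auto simp: configurations_def)
      then have "\<forall>\<^sub>F k in sequentially. hits (- real (Suc m)) (real (Suc m)) k (X \<inter> A) = card ((X \<inter> A) \<inter> {- real (Suc m)<..real (Suc m)})"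
        by (intro hits_eventually) (auto intro: rev_finite_subset)
      then show "\<forall>\<^sub>F k in sequentially. ?h m k X = emeasure (counting X) (?A m)"
        unfolding e by eventually_elim (simp add: Int_assoc)
    qed
    have m1: "(\<lambda>X. emeasure (counting X) (?A m)) \<in> borel_measurable S" for m
      by (rule borel_measurable_LIMSEQ_order[OF lim hm])
    have sup: "emeasure (counting X) A = (SUP m. emeasure (counting X) (?A m))" for X
    proof -
      have "(SUP m. emeasure (counting X) (?A m)) = emeasure (counting X) (\<Union>m. ?A m)"
        using A by (intro SUP_emeasure_incseq) (auto simp: incseq_def)
      moreover have "x \<in> (\<Union>m :: nat. {- real (Suc m)<..real (Suc m)})" for x :: real
      proof -
        obtain m where "\<bar>x\<bar> < real m" using reals_Archimedean2 by blast
        then have "x \<in> {- real (Suc m)<..real (Suc m)}" by auto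
        then show ?thesis by blast
      qed
      then have "(\<Union>m. ?A m) = A" by blast
      ultimately show ?thesis by simp
    qed
    show ?thesis unfolding sup by (intro borel_measurable_SUP m1) auto
  qed
  have id: "(\<lambda>X. X) \<in> S \<rightarrow>\<^sub>M config_space"
    unfolding config_space_def
  proof (rule measurable_Sup2)
    fix m assume "m \<in> (\<lambda>A. vimage_algebra configurations (\<lambda>X. emeasure (counting X) A) borel) ` sets borel"
    then obtain A where A: "A \<in> sets borel" "m = vimage_algebra configurations (\<lambda>X. emeasure (counting X) A) (borel :: ennreal measure)"
      by blast
    show "(\<lambda>X. X) \<in> S \<rightarrow>\<^sub>M m"
      unfolding A(2) by (rule measurable_vimage_algebra2) (use S(1) count[OF A(1)] in auto)
  qed auto
  show "sets config_space \<subseteq> sigma_sets configurations ?G"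
  proof
    fix E assume E: "E \<in> sets config_space"
    then have "E \<subseteq> configurations" using sets.sets_into_space space_config by blast
    then have "(\<lambda>X. X) -` E \<inter> space S = E" using S(1) by blast
    then show "E \<in> sigma_sets configurations ?G" using measurable_sets[OF id E] S(2) by simp
  qed
  show "sigma_sets configurations ?G \<subseteq> sets config_space"
    unfolding space_config[symmetric]
    by (rule sets.sigma_sets_subset) (auto simp: space_config intro: void_measurable)
qed

text \<open>A set with N points is emptied with probability 2^(-N), and void events form a generator
  stable under intersection. Written with \<open>powr\<close>, this probability is a measurable
  function of the extended count.\<close>

lemma independent_removal_measurable:
  "independent_removal (1 / 2) \<in> config_space \<rightarrow>\<^sub>M prob_algebra config_space"
proof (rule measurable_prob_algebra_generated[OF sets_config_space_void])
  let ?G = "{{X \<in> configurations. X \<inter> A = {}} | A. A \<in> sets borel \<and> bounded A}"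
  show "Int_stable ?G"
  proof (rule Int_stableI)
    fix a b assume "a \<in> ?G" "b \<in> ?G"
    then obtain A B where AB: "a = {X \<in> configurations. X \<inter> A = {}}" "b = {X \<in> configurations. X \<inter> B = {}}"
      "A \<in> sets borel" "bounded A" "B \<in> sets borel" "bounded B" by blast
    have "a \<inter> b = {X \<in> configurations. X \<inter> (A \<union> B) = {}}" unfolding AB by blast
    moreover have "A \<union> B \<in> sets borel" "bounded (A \<union> B)" using AB by auto
    ultimately show "a \<inter> b \<in> ?G" by blast
  qed
  show "?G \<subseteq> Pow configurations" by blast
  show "prob_space (independent_removal (1 / 2) X)" if "X \<in> space config_space" for X
    using that by (intro prob_space_independent_removal) (simp add: space_config)
  show "sets (independent_removal (1 / 2) X) = sets config_space" for X by (rule sets_independent_removal)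
  fix E assume "E \<in> ?G"
  then obtain A where A: "E = {X \<in> configurations. X \<inter> A = {}}" "A \<in> sets borel" "bounded A" by blast
  have "emeasure (independent_removal (1 / 2) X) E = ennreal ((1 / 2) powr enn2real (emeasure (counting X) A))"
    if "X \<in> space config_space" for X
  proof -
    have X: "X \<in> configurations" using that by (simp add: space_config)
    show ?thesis
      unfolding A(1) emeasure_independent_removal_void[OF X A(2,3)] emeasure_counting_bounded(1)[OF A(2,3) X]
      by (simp add: powr_realpow)
  qed
  moreover have "(\<lambda>X. ennreal ((1 / 2) powr enn2real (emeasure (counting X) A))) \<in> borel_measurable config_space"
  proof -
    note [measurable] = emeasure_counting_measurable[OF A(2)]
    show ?thesis by measurable
  qed
  ultimately show "(\<lambda>X. emeasure (independent_removal (1 / 2) X) E) \<in> borel_measurable config_space"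
    by (subst measurable_cong) auto
qed

lemma independent_removal_subprob:
  assumes "point_process_law L"
  shows "independent_removal (1 / 2) \<in> L \<rightarrow>\<^sub>M subprob_algebra config_space"
  using measurable_prob_algebraD[OF independent_removal_measurable]
  by (subst measurable_cong_sets[OF point_process_lawD(2)[OF assms] refl])

lemma point_process_law_thinned:
  assumes L: "point_process_law L"
  shows "point_process_law (L \<bind> independent_removal (1 / 2))"
proof -
  note Lf = point_process_lawD[OF L]
  interpret prob_space L by (rule Lf(1))
  have "prob_space (L \<bind> independent_removal (1 / 2))"
    using Lf(3) by (intro prob_space_bind[OF _ independent_removal_subprob[OF L]] AE_I2 prob_space_independent_removal) simp
  moreover have "sets (L \<bind> independent_removal (1 / 2)) = sets config_space"
    by (rule sets_bind[OF sets_independent_removal not_empty])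
  ultimately show ?thesis by (simp add: point_process_law_def)
qed

text \<open>The product of counts is the number of ways to choose one point in each
  \<open>I i\<close>. The sets are disjoint, so the \<open>n\<close> chosen points are different and
  survive together with probability \<open>(1 / 2) ^ n\<close>.\<close>

lemma thinned_box_moment_given:
  assumes X: "X \<in> configurations" and I: "\<And>i. i < n \<Longrightarrow> I i \<in> sets borel" "\<And>i. i < n \<Longrightarrow> bounded (I i)"
    and dis: "\<And>i j. i < n \<Longrightarrow> j < n \<Longrightarrow> i \<noteq> j \<Longrightarrow> I i \<inter> I j = {}"
  shows "(\<integral>\<^sup>+Y. (\<Prod>i<n. emeasure (counting Y) (I i)) \<partial>independent_removal (1 / 2) X) =
    ennreal ((1 / 2) ^ n) * (\<Prod>i<n. emeasure (counting X) (I i))"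
proof -
  let ?S = "\<Pi>\<^sub>E i\<in>{..<n}. X \<inter> I i"
  define ev where "ev g = {r \<in> space (coins X). \<forall>x\<in>g ` {..<n}. r x = False}" for g :: "nat \<Rightarrow> real"
  have fin: "finite (X \<inter> I i)" if "i < n" for i using X I(2)[OF that] by (auto simp: configurations_def)
  have m: "(\<lambda>Y. \<Prod>i<n. emeasure (counting Y) (I i)) \<in> borel_measurable config_space"
    using I(1) by (intro borel_measurable_prod_ennreal emeasure_counting_measurable) auto
  have gX: "g ` {..<n} \<subseteq> X" "card (g ` {..<n}) = n" if g: "g \<in> ?S" for g
  proof -
    have gI: "g i \<in> X \<and> g i \<in> I i" if "i < n" for i using PiE_mem[OF g, of i] that by simp
    show "g ` {..<n} \<subseteq> X" using gI by auto
    have "inj_on g {..<n}"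
    proof (rule inj_onI)
      fix i j assume ij: "i \<in> {..<n}" "j \<in> {..<n}" "g i = g j"
      show "i = j" using dis[of i j] gI[of i] gI[of j] ij by (cases "i = j") auto
    qed
    then show "card (g ` {..<n}) = n" by (simp add: card_image)
  qed
  have pw: "(\<Prod>i<n. emeasure (counting {x \<in> X. \<not> r x}) (I i)) = (\<Sum>g\<in>?S. indicator (ev g) r)" if r: "r \<in> space (coins X)" for r
  proof -
    have "(\<Prod>i<n. emeasure (counting {x \<in> X. \<not> r x}) (I i)) = (\<Prod>i<n. \<Sum>x\<in>X \<inter> I i. if r x then 0 else 1 :: ennreal)"
    proof (rule prod.cong[OF refl])
      fix i assume "i \<in> {..<n}"
      then have i: "i < n" by simp
      have "emeasure (counting {x \<in> X. \<not> r x}) (I i) = of_nat (card ({x \<in> X. \<not> r x} \<inter> I i))"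
        by (rule emeasure_counting_bounded(1)[OF I(1,2)[OF i] thinned_configuration[OF X]])
      also have "{x \<in> X. \<not> r x} \<inter> I i = (X \<inter> I i) \<inter> - {x. r x}" by blast
      also have "of_nat (card ((X \<inter> I i) \<inter> - {x. r x})) = (\<Sum>x\<in>X \<inter> I i. if r x then 0 else 1 :: ennreal)"
        using fin[OF i] by (subst sum.If_cases) auto
      finally show "emeasure (counting {x \<in> X. \<not> r x}) (I i) = (\<Sum>x\<in>X \<inter> I i. if r x then 0 else 1)" .
    qed
    also have "\<dots> = (\<Sum>g\<in>?S. \<Prod>i<n. if r (g i) then 0 else 1)"
      by (rule prod_sum_PiE[where f = "\<lambda>_ x. if r x then 0 else 1"]) (use fin in auto)
    also have "\<dots> = (\<Sum>g\<in>?S. indicator (ev g) r)"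
    proof (rule sum.cong[OF refl])
      fix g :: "nat \<Rightarrow> real"
      show "(\<Prod>i<n. if r (g i) then 0 else 1 :: ennreal) = indicator (ev g) r"
      proof (cases "r \<in> ev g")
        case True
        then have "(\<Prod>i<n. if r (g i) then 0 else 1 :: ennreal) = 1" unfolding ev_def by (intro prod.neutral) auto
        then show ?thesis using True by simp
      next
        case False
        then obtain i where "i < n" "r (g i)" using r unfolding ev_def by auto
        then have "(\<Prod>i<n. if r (g i) then 0 else 1 :: ennreal) = 0" by (intro prod_zero bexI[of _ i]) auto
        then show ?thesis using False by simp
      qed
    qed
    finally show ?thesis .
  qed
  have "(\<integral>\<^sup>+Y. (\<Prod>i<n. emeasure (counting Y) (I i)) \<partial>independent_removal (1 / 2) X) =
      (\<integral>\<^sup>+r. (\<Prod>i<n. emeasure (counting {x \<in> X. \<not> r x}) (I i)) \<partial>coins X)"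
    unfolding independent_removal_def by (rule nn_integral_distr[OF thinning_measurable[OF X]]) (simp add: m)
  also have "\<dots> = (\<integral>\<^sup>+r. (\<Sum>g\<in>?S. indicator (ev g) r) \<partial>coins X)"
    by (rule nn_integral_cong[OF pw])
  also have "\<dots> = (\<Sum>g\<in>?S. \<integral>\<^sup>+r. indicator (ev g) r \<partial>coins X)"
    unfolding ev_def using gX by (intro nn_integral_sum borel_measurable_indicator emeasure_coins(1)) auto
  also have "\<dots> = (\<Sum>g\<in>?S. ennreal ((1 / 2) ^ n))"
  proof (rule sum.cong[OF refl])
    fix g assume g: "g \<in> ?S"
    have "(\<integral>\<^sup>+r. indicator (ev g) r \<partial>coins X) = emeasure (coins X) (ev g)"
      unfolding ev_def using gX[OF g] by (intro nn_integral_indicator emeasure_coins(1)) auto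
    also have "\<dots> = ennreal ((1 / 2) ^ n)"
      using emeasure_coins(2)[OF gX(1)[OF g], of False] gX(2)[OF g] unfolding ev_def by simp
    finally show "(\<integral>\<^sup>+r. indicator (ev g) r \<partial>coins X) = ennreal ((1 / 2) ^ n)" .
  qed
  also have "\<dots> = ennreal ((1 / 2) ^ n) * of_nat (card ?S)" by (simp add: mult.commute)
  also have "of_nat (card ?S) = (\<Prod>i<n. emeasure (counting X) (I i))"
  proof -
    have "(\<Prod>i<n. emeasure (counting X) (I i)) = (\<Prod>i<n. of_nat (card (X \<inter> I i)))"
      using I by (intro prod.cong refl emeasure_counting_bounded(1) X) auto
    then show ?thesis by (simp add: card_PiE)
  qed
  finally show ?thesis .
qed

lemma thinned_box_moment:
  assumes L: "point_process_law L" and I: "\<And>i. i < n \<Longrightarrow> I i \<in> sets borel" "\<And>i. i < n \<Longrightarrow> bounded (I i)"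
    and dis: "\<And>i j. i < n \<Longrightarrow> j < n \<Longrightarrow> i \<noteq> j \<Longrightarrow> I i \<inter> I j = {}"
  shows "(\<integral>\<^sup>+Y. (\<Prod>i<n. emeasure (counting Y) (I i)) \<partial>(L \<bind> independent_removal (1 / 2))) =
    ennreal ((1 / 2) ^ n) * (\<integral>\<^sup>+X. (\<Prod>i<n. emeasure (counting X) (I i)) \<partial>L)"
proof -
  note Lf = point_process_lawD[OF L]
  have m: "(\<lambda>Y. \<Prod>i<n. emeasure (counting Y) (I i)) \<in> borel_measurable config_space"
    using I(1) by (intro borel_measurable_prod_ennreal emeasure_counting_measurable) auto
  then have mL: "(\<lambda>Y. \<Prod>i<n. emeasure (counting Y) (I i)) \<in> borel_measurable L"
    by (subst measurable_cong_sets[OF Lf(2) refl])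
  have "(\<integral>\<^sup>+Y. (\<Prod>i<n. emeasure (counting Y) (I i)) \<partial>(L \<bind> independent_removal (1 / 2))) =
      (\<integral>\<^sup>+X. \<integral>\<^sup>+Y. (\<Prod>i<n. emeasure (counting Y) (I i)) \<partial>independent_removal (1 / 2) X \<partial>L)"
    by (rule nn_integral_bind[OF m independent_removal_subprob[OF L]])
  also have "\<dots> = (\<integral>\<^sup>+X. ennreal ((1 / 2) ^ n) * (\<Prod>i<n. emeasure (counting X) (I i)) \<partial>L)"
    using Lf(3) by (intro nn_integral_cong thinned_box_moment_given I dis) auto
  also have "\<dots> = ennreal ((1 / 2) ^ n) * (\<integral>\<^sup>+X. (\<Prod>i<n. emeasure (counting X) (I i)) \<partial>L)"
    by (rule nn_integral_cmult[OF mL])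
  finally show ?thesis .
qed

section \<open>The kernel\<close>

lemma deriv_F: "deriv F = (\<lambda>x. - exp (- x\<^sup>2 / 4) / sqrt pi)"
  by (rule ext, rule DERIV_imp_deriv, rule F_has_derivative)

lemma gauss_has_derivative:
  "((\<lambda>x. - exp (- x\<^sup>2 / 4) / sqrt pi) has_real_derivative x / 2 * exp (- x\<^sup>2 / 4) / sqrt pi) (at x)"
  by (auto intro!: derivative_eq_intros simp: field_simps)

lemma deriv2_F: "deriv (deriv F) = (\<lambda>x. x / 2 * exp (- x\<^sup>2 / 4) / sqrt pi)"
  unfolding deriv_F by (rule ext, rule DERIV_imp_deriv, rule gauss_has_derivative)

lemma deriv2_F_has_derivative:
  "((\<lambda>x. x / 2 * exp (- x\<^sup>2 / 4) / sqrt pi) has_real_derivative (1 / 2 - x\<^sup>2 / 4) * exp (- x\<^sup>2 / 4) / sqrt pi) (at x)"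
  by (auto intro!: derivative_eq_intros simp: field_simps power2_eq_square)

lemma deriv_F_minus: "deriv F (- x) = deriv F x"
  and deriv2_F_minus: "deriv (deriv F) (- x) = - deriv (deriv F) x"
  unfolding deriv2_F unfolding deriv_F by simp_all

lemma sqrt_pi_ge_1: "1 \<le> sqrt pi"
  using pi_gt3 by (intro real_le_rsqrt) simp

definition DF :: "nat \<Rightarrow> real \<Rightarrow> real" where
  "DF k = (if k = 0 then F else if k = 1 then deriv F else deriv (deriv F))"

lemma DF_simps: "DF 0 = F" "DF (Suc 0) = deriv F" "DF 1 = deriv F" "DF 2 = deriv (deriv F)"
  by (simp_all add: DF_def)

lemma times_exp_le_1:
  assumes "a \<le> 1 + (z :: real)"
  shows "a * exp (- z) \<le> 1"
proof -
  have "a \<le> exp z" using assms exp_ge_add_one_self[of z] by linarith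
  then have "a * exp (- z) \<le> exp z * exp (- z)" by (intro mult_right_mono) auto
  then show ?thesis by (simp add: exp_minus_inverse)
qed

lemma DF_bound: "\<bar>DF k x\<bar> \<le> 2"
proof -
  have "\<bar>exp (- x\<^sup>2 / 4) / sqrt pi\<bar> \<le> 1 / 1"
    unfolding abs_divide using sqrt_pi_ge_1 by (intro frac_le) auto
  then have "\<bar>- exp (- x\<^sup>2 / 4) / sqrt pi\<bar> \<le> 2" unfolding abs_divide abs_minus by linarith
  moreover have "\<bar>x / 2 * exp (- x\<^sup>2 / 4) / sqrt pi\<bar> \<le> 2 / 1"
  proof -
    \<comment> \<open>The square gives |x| / 2 <= 1 + x^2 / 4, and the exponential dominates the
      right side.\<close>
    have "0 \<le> (\<bar>x\<bar> / 2 - 1)\<^sup>2" by simp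
    then have "\<bar>x\<bar> / 2 \<le> 1 + x\<^sup>2 / 4" unfolding power2_diff by (simp add: power_divide)
    then have "\<bar>x\<bar> / 2 * exp (- (x\<^sup>2 / 4)) \<le> 1" by (rule times_exp_le_1)
    then show ?thesis
      unfolding abs_divide using sqrt_pi_ge_1 by (intro frac_le) (auto simp: abs_mult)
  qed
  ultimately have "\<bar>deriv F x\<bar> \<le> 2" "\<bar>deriv (deriv F) x\<bar> \<le> 2"
    unfolding deriv2_F unfolding deriv_F by (simp_all only: div_by_1)
  moreover have "\<bar>F x\<bar> \<le> 2" using F_nonneg[of x] F_le_2[of x] by simp
  ultimately show ?thesis by (simp add: DF_def)
qed

text \<open>Serves both as the derivative relation below order 2 and as the derivative bound behind
  the Lipschitz estimate; at order 2 the latter involves the third derivative of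
  \<open>F\<close>.\<close>

lemma DF_derivative: "\<exists>l. (DF k has_real_derivative l) (at x) \<and> \<bar>l\<bar> \<le> 2 \<and> (k < 2 \<longrightarrow> l = DF (Suc k) x)"
proof -
  consider "k = 0" | "k = 1" | "k \<ge> 2" by linarith
  then show ?thesis
  proof cases
    case 1
    have "(F has_real_derivative DF 1 x) (at x)" using F_has_derivative[of x] by (simp add: DF_simps deriv_F)
    then show ?thesis using 1 DF_bound[of 1 x] by (intro exI[of _ "DF 1 x"]) (simp add: DF_def)
  next
    case 2
    have "(deriv F has_real_derivative DF 2 x) (at x)"
      unfolding DF_simps deriv2_F unfolding deriv_F by (rule gauss_has_derivative)
    then show ?thesis using 2 DF_bound[of 2 x] by (intro exI[of _ "DF 2 x"]) (simp add: DF_def)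
  next
    case 3
    let ?l = "(1 / 2 - x\<^sup>2 / 4) * exp (- x\<^sup>2 / 4) / sqrt pi"
    have "(x\<^sup>2 / 4) * exp (- (x\<^sup>2 / 4)) \<le> 1" by (rule times_exp_le_1) simp
    moreover have "0 \<le> (x\<^sup>2 / 4) * exp (- (x\<^sup>2 / 4))" by simp
    moreover have "exp (- (x\<^sup>2 / 4)) \<le> 1" "0 < exp (- (x\<^sup>2 / 4))" by simp_all
    ultimately have "\<bar>(1 / 2 - x\<^sup>2 / 4) * exp (- x\<^sup>2 / 4)\<bar> \<le> 2"
      unfolding left_diff_distrib minus_divide_left by linarith
    then have "\<bar>?l\<bar> \<le> 2 / 1"
      unfolding abs_divide using sqrt_pi_ge_1 by (intro frac_le) auto
    moreover have "(DF k has_real_derivative ?l) (at x)"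
      using 3 deriv2_F_has_derivative[of x] by (simp add: DF_def deriv2_F)
    ultimately show ?thesis using 3 by (intro exI[of _ ?l]) simp
  qed
qed

lemma DF_lipschitz: "\<bar>DF k z - DF k w\<bar> \<le> 2 * \<bar>z - w\<bar>"
proof -
  from DF_derivative obtain l where "\<And>x. (DF k has_real_derivative l x) (at x)" "\<And>x. \<bar>l x\<bar> \<le> 2" by metis
  then show ?thesis
    using field_differentiable_bound[of UNIV "DF k" l 2 z w] by simp
qed

text \<open>For \<open>k\<close> up to 2 this is the derivative of order \<open>k\<close> of
  \<open>F (d * s)\<close> in \<open>d\<close>; the scale is \<open>s = 1 / sqrt t\<close> in the
  conclusion.\<close>

definition DFs :: "real \<Rightarrow> nat \<Rightarrow> real \<Rightarrow> real" where
  "DFs s k d = s ^ k * DF k (d * s)"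

text \<open>The power 3 covers \<open>s ^ Suc k\<close> for \<open>k\<close> up to 2: the Lipschitz
  bound at order \<open>k\<close> costs one more factor \<open>s\<close>.\<close>

lemma smooth_kernel_DFs:
  assumes s: "0 < s"
  shows "smooth_kernel (DFs s) (2 * (1 + s) ^ 3)"
proof
  have p: "s ^ k \<le> (1 + s) ^ 3" if "k \<le> 3" for k
  proof -
    have "s ^ k \<le> (1 + s) ^ k" using s by (intro power_mono) auto
    also have "\<dots> \<le> (1 + s) ^ 3" using s that by (intro power_increasing) auto
    finally show ?thesis .
  qed
  show "(DFs s k has_real_derivative DFs s (Suc k) z) (at z)" if k: "k < 2" for k z
  proof -
    have "(DF k has_real_derivative DF (Suc k) (z * s)) (at (z * s))" using DF_derivative[of k "z * s"] k by auto
    from DERIV_chain2[OF this DERIV_cmult_right[OF DERIV_ident]] 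
    have "((\<lambda>d. DF k (d * s)) has_real_derivative DF (Suc k) (z * s) * (1 * s)) (at z)" .
    from DERIV_cmult[OF this, of "s ^ k"] show ?thesis
      unfolding DFs_def[abs_def] by (simp add: mult_ac)
  qed
  show "\<bar>DFs s k z\<bar> \<le> 2 * (1 + s) ^ 3" if "k \<le> 2" for k z
  proof -
    have "\<bar>DFs s k z\<bar> = s ^ k * \<bar>DF k (z * s)\<bar>" using s by (simp add: DFs_def abs_mult)
    also have "\<dots> \<le> (1 + s) ^ 3 * 2" using s that p[of k] DF_bound by (intro mult_mono) auto
    finally show ?thesis by simp
  qed
  show "\<bar>DFs s k z - DFs s k w\<bar> \<le> 2 * (1 + s) ^ 3 * \<bar>z - w\<bar>" if "k \<le> 2" for k z w
  proof -
    have "\<bar>DFs s k z - DFs s k w\<bar> = s ^ k * \<bar>DF k (z * s) - DF k (w * s)\<bar>"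
      using s by (simp add: DFs_def abs_mult right_diff_distrib[symmetric])
    also have "\<dots> \<le> s ^ k * (2 * \<bar>z * s - w * s\<bar>)" using s DF_lipschitz by (intro mult_left_mono) auto
    also have "\<dots> = s ^ Suc k * (2 * \<bar>z - w\<bar>)" using s by (simp add: left_diff_distrib[symmetric] abs_mult)
    also have "\<dots> \<le> (1 + s) ^ 3 * (2 * \<bar>z - w\<bar>)" using p[of "Suc k"] that by (intro mult_right_mono) auto
    finally show ?thesis by simp
  qed
  have "1 ^ 3 \<le> (1 + s) ^ 3" using s by (intro power_mono) auto
  then show "1 \<le> 2 * (1 + s) ^ 3" by simp
qed

text \<open>\<open>\<kappa>\<close> is 1 for the coalescing law and 1/2 after thinning.\<close>

definition scaled_K :: "real \<Rightarrow> real \<Rightarrow> real \<Rightarrow> real \<Rightarrow> real ^ 2 ^ 2" where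
  "scaled_K \<kappa> s x y = (\<kappa> * s) *\<^sub>R K (x * s) (y * s)"

lemma scaled_K_entries:
  "scaled_K \<kappa> s x y $ 1 $ 1 = - (\<kappa> * s) * deriv (deriv F) ((y - x) * s)"
  "scaled_K \<kappa> s x y $ 1 $ 2 = - (\<kappa> * s) * deriv F ((y - x) * s)"
  "scaled_K \<kappa> s x y $ 2 $ 1 = \<kappa> * s * deriv F ((y - x) * s)"
  "scaled_K \<kappa> s x y $ 2 $ 2 = \<kappa> * s * (sgn ((y - x) * s) * F \<bar>(y - x) * s\<bar>)"
  by (simp_all add: scaled_K_def K_def left_diff_distrib)

lemma antisymmetric_scaled_K: "antisymmetric_kernel (scaled_K \<kappa> s)"
  unfolding antisymmetric_kernel_def
proof (intro allI)
  fix x y :: real and i j :: 2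
  have e: "(y - x) * s = - ((x - y) * s)" by (simp add: algebra_simps)
  have "(i = 1 \<or> i = 2) \<and> (j = 1 \<or> j = 2)" using exhaust_2 by blast
  then show "scaled_K \<kappa> s x y $ i $ j = - (scaled_K \<kappa> s y x $ j $ i)"
    by (elim conjE disjE) (simp_all add: scaled_K_entries deriv_F_minus deriv2_F_minus e sgn_minus)
qed

section \<open>From the matrix of derivatives to the kernel \<open>K\<close>\<close>

text \<open>Within a block, \<open>K\<close> has the second derivative in the first row and
  \<open>rmat\<close> has it in the second, so the two rows of every block have to be
  exchanged.\<close>

fun swap_pairs :: "nat \<Rightarrow> nat \<Rightarrow> nat" where
  "swap_pairs 0 = id"
| "swap_pairs (Suc m) = swap_pairs m \<circ> Transposition.transpose (2 * m) (Suc (2 * m))"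

lemma swap_pairs_permutes_sign: "swap_pairs m permutes {..<2 * m} \<and> sign (swap_pairs m) = (- 1) ^ m"
proof (induction m)
  case 0
  show ?case by (auto simp: id_def)
next
  case (Suc m)
  have t: "Transposition.transpose (2 * m) (Suc (2 * m)) permutes {..<2 * Suc m}"
    by (intro permutes_swap_id) auto
  from Suc have P: "swap_pairs m permutes {..<2 * m}" and S: "sign (swap_pairs m) = (- 1) ^ m" by blast+
  have "swap_pairs m permutes {..<2 * Suc m}" by (rule permutes_subset[OF P]) simp
  with t have "swap_pairs (Suc m) permutes {..<2 * Suc m}" unfolding swap_pairs.simps by (rule permutes_compose)
  moreover have "sign (swap_pairs (Suc m)) = (- 1) ^ Suc m"
    unfolding swap_pairs.simps sign_compose[OF permutes_permutation[OF P] permutes_permutation[OF t]] S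
    by (simp add: sign_swap_id)
  ultimately show ?case by (rule conjI)
qed

lemma swap_pairs_eq: "k < 2 * m \<Longrightarrow> swap_pairs m k = (if even k then Suc k else k - 1)"
proof (induction m arbitrary: k)
  case (Suc m)
  have fix_: "swap_pairs m j = j" if "2 * m \<le> j" for j
    using swap_pairs_permutes_sign[of m] that by (auto simp: permutes_def)
  consider "k < 2 * m" | "k = 2 * m" | "k = Suc (2 * m)" using Suc.prems by fastforce
  then show ?case
  proof cases
    case 1
    then show ?thesis using Suc.IH[of k] by (simp add: transpose_apply_other)
  qed (simp_all add: fix_)
qed simp

lemma swap_pairs_div: "k < 2 * m \<Longrightarrow> swap_pairs m k div 2 = k div 2"
  and even_swap_pairs: "k < 2 * m \<Longrightarrow> even (swap_pairs m k) \<longleftrightarrow> odd k"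
  unfolding swap_pairs_eq by (auto elim!: evenE oddE)

text \<open>The row factors multiply to \<open>\<kappa> * s\<close> on \<open>F\<close>, to
  \<open>\<kappa> / s\<close> on the second derivative and to \<open>- \<kappa>\<close> on mixed
  entries. This evens out the powers of \<open>s\<close> in \<open>DFs\<close>, and the minus sign
  on odd rows corrects the sign of the first derivative.\<close>

lemma block_entry_less:
  assumes "0 < s" "strict_mono_on {..<n} x" "a < b" "b < 2 * n"
    and u: "u = (\<lambda>k :: nat. if even k then sqrt (\<kappa> * s) else - sqrt (\<kappa> / s))" and \<kappa>: "0 < \<kappa>"
  shows "block_matrix (scaled_K \<kappa> s) x (swap_pairs n a) (swap_pairs n b) = u a * u b * rmat (DFs s) x a b"
proof -
  have a: "a < 2 * n" using assms by simp
  note [simp] = swap_pairs_div[OF a] swap_pairs_div[OF assms(4)] even_swap_pairs[OF a] even_swap_pairs[OF assms(4)]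
  have uu: "sqrt (\<kappa> * s) * sqrt (\<kappa> * s) = \<kappa> * s" "sqrt (\<kappa> / s) * sqrt (\<kappa> / s) = \<kappa> / s"
    "sqrt (\<kappa> * s) * sqrt (\<kappa> / s) = \<kappa>" "sqrt (\<kappa> / s) * sqrt (\<kappa> * s) = \<kappa>"
    using assms(1) \<kappa> by (simp_all add: real_sqrt_mult[symmetric])
  have [simp]: "\<bar>\<kappa>\<bar> = \<kappa>" "\<bar>s\<bar> = s" "\<bar>\<kappa> * s\<bar> = \<kappa> * s" using assms(1) \<kappa> by simp_all
  let ?d = "x (b div 2) - x (a div 2)"
  \<comment> \<open>Two even indices with \<open>a < b\<close> belong to different points in
    increasing order, so the sign factor in \<open>K\<close> is 1.\<close>
  have pos: "0 < ?d" if "even a" "even b"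
  proof -
    have "a div 2 < b div 2" "b div 2 < n" using that assms(3,4) by (auto elim!: evenE)
    then show ?thesis using strict_mono_onD[OF assms(2), of "a div 2" "b div 2"] by simp
  qed
  show ?thesis
  proof (cases "even a"; cases "even b")
    assume e: "even a" "even b"
    have "0 < ?d * s" using pos[OF e] assms(1) by simp
    then show ?thesis using e assms(3) by (simp add: block_matrix_def scaled_K_entries rmat_def u uu DFs_def DF_simps)
  next
    assume e: "even a" "odd b"
    then show ?thesis using assms(3) uu by (simp add: block_matrix_def scaled_K_entries rmat_def u DFs_def DF_simps)
  next
    assume e: "odd a" "even b"
    then show ?thesis using assms(3) uu by (simp add: block_matrix_def scaled_K_entries rmat_def u DFs_def DF_simps)
  next
    assume e: "odd a" "odd b"
    then show ?thesis using assms(1,3) by (simp add: block_matrix_def scaled_K_entries rmat_def u uu DFs_def DF_simps power2_eq_square)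
  qed
qed

lemma block_matrix_antisym:
  assumes "antisymmetric_kernel k"
  shows "block_matrix k x a b = - block_matrix k x b a"
  using assms unfolding antisymmetric_kernel_def block_matrix_def by metis

text \<open>The exchange of rows has sign \<open>(- 1) ^ n\<close> and the row factors multiply to
  \<open>(- \<kappa>) ^ n\<close>, so the signs cancel.\<close>

lemma pfaffian_block_matrix_scaled_K:
  assumes s: "0 < s" and x: "strict_mono_on {..<n} x" and \<kappa>: "0 < \<kappa>"
  shows "pfaffian n (block_matrix (scaled_K \<kappa> s) x) = \<kappa> ^ n * pfaffian n (rmat (DFs s) x)"
proof -
  define u where "u = (\<lambda>k :: nat. if even k then sqrt (\<kappa> * s) else - sqrt (\<kappa> / s))"
  let ?B = "block_matrix (scaled_K \<kappa> s) x"
  have "?B (swap_pairs n a) (swap_pairs n b) = u a * u b * rmat (DFs s) x a b" if ab: "a < 2 * n" "b < 2 * n" "a \<noteq> b" for a b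
  proof (cases "a < b")
    case True
    then show ?thesis using block_entry_less[OF s x _ _ u_def \<kappa>] ab by blast
  next
    case False
    then have ba: "b < a" using ab by simp
    have "?B (swap_pairs n a) (swap_pairs n b) = - ?B (swap_pairs n b) (swap_pairs n a)"
      by (rule block_matrix_antisym[OF antisymmetric_scaled_K])
    also have "\<dots> = - (u b * u a * rmat (DFs s) x b a)" using block_entry_less[OF s x ba ab(1) u_def \<kappa>] by (simp only:)
    also have "rmat (DFs s) x b a = - rmat (DFs s) x a b" using ba by (simp add: rmat_def Let_def)
    finally show ?thesis by simp
  qed
  then have "pfaffian n (\<lambda>a b. ?B (swap_pairs n a) (swap_pairs n b)) = pfaffian n (\<lambda>a b. u a * u b * rmat (DFs s) x a b)"
    by (rule pfaffian_cong)
  also have "\<dots> = (\<Prod>k<2 * n. u k) * pfaffian n (rmat (DFs s) x)" by (rule pfaffian_scale)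
  also have "(\<Prod>k<2 * n. u k) = (- \<kappa>) ^ n"
  proof (induction n)
    case (Suc n)
    have "sqrt (\<kappa> * s) * sqrt (\<kappa> / s) = \<kappa>" using s \<kappa> by (simp add: real_sqrt_mult[symmetric])
    then show ?case using Suc by (simp add: u_def mult.assoc)
  qed simp
  finally have "(- 1) ^ n * pfaffian n ?B = (- 1) ^ n * (\<kappa> ^ n * pfaffian n (rmat (DFs s) x))"
    using pfaffian_permute[of "swap_pairs n" n ?B] swap_pairs_permutes_sign[of n] by (simp add: power_minus[of \<kappa>])
  then show ?thesis by simp
qed

lemma block_matrix_permute: "block_matrix k (x \<circ> p) = (\<lambda>a b. block_matrix k x (blockperm p a) (blockperm p b))"
  by (simp add: block_matrix_def fun_eq_iff)

lemma pfaffian_block_matrix_permute: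
  assumes "p permutes {..<n}"
  shows "pfaffian n (block_matrix k (x \<circ> p)) = pfaffian n (block_matrix k x)"
  unfolding block_matrix_permute
  using pfaffian_permute[of "blockperm p" n "block_matrix k x"] blockperm_permutes_sign[OF assms] by simp

text \<open>Exchanging the first indices of the two equal blocks fixes the matrix and reverses the
  sign of the Pfaffian.\<close>

lemma pfaffian_block_matrix_coincide:
  assumes "i < n" "j < n" "i \<noteq> j" "x i = x j"
  shows "pfaffian n (block_matrix k x) = 0"
proof -
  let ?q = "Transposition.transpose (2 * i) (2 * j)"
  have q: "?q permutes {..<2 * n}" using assms by (intro permutes_swap_id) auto
  have "x (?q a div 2) = x (a div 2)" "even (?q a) = even a" for a
    using assms(4) by (auto simp: Transposition.transpose_def)
  then have "(\<lambda>a b. block_matrix k x (?q a) (?q b)) = block_matrix k x"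
    unfolding block_matrix_def by (simp only:)
  moreover have "sign ?q = - 1" using assms(3) by (simp add: sign_swap_id)
  ultimately have "pfaffian n (block_matrix k x) = - pfaffian n (block_matrix k x)"
    using pfaffian_permute[OF q, of "block_matrix k x"] by (simp only: of_int_minus of_int_1 mult_minus1)
  then show ?thesis by linarith
qed

lemma sorting_permutation:
  fixes x :: "nat \<Rightarrow> real"
  assumes "inj_on x {..<n}"
  shows "\<exists>p. p permutes {..<n} \<and> strict_mono_on {..<n} (x \<circ> p)"
proof -
  define xs where "xs = sorted_list_of_set (x ` {..<n})"
  have xs: "set xs = x ` {..<n}" "distinct xs" "sorted xs" "length xs = n"
    unfolding xs_def using assms by (auto simp: card_image)
  define p where "p i = (if i < n then inv_into {..<n} x (xs ! i) else i)" for i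
  have xp: "x (p i) = xs ! i" and pn: "p i \<in> {..<n}" if "i < n" for i
  proof -
    have "xs ! i \<in> x ` {..<n}" using xs that nth_mem by blast
    then show "x (p i) = xs ! i" "p i \<in> {..<n}" using that by (simp_all add: p_def f_inv_into_f inv_into_into del: lessThan_iff)
  qed
  have "p permutes {..<n}"
  proof (rule bij_imp_permutes)
    have "inj_on p {..<n}"
    proof (rule inj_onI)
      fix i j assume "i \<in> {..<n}" "j \<in> {..<n}" "p i = p j"
      then show "i = j" using xp[of i] xp[of j] xs nth_eq_iff_index_eq[of xs i j] by simp
    qed
    then show "bij_betw p {..<n} {..<n}"
      unfolding bij_betw_def using pn by (intro conjI endo_inj_surj) auto
  qed (simp add: p_def)
  moreover have "strict_mono_on {..<n} (x \<circ> p)"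
  proof (rule strict_mono_onI)
    fix i j assume ij: "i \<in> {..<n}" "j \<in> {..<n}" "i < j"
    have "xs ! i < xs ! j" using xs ij by (simp add: strict_sorted_iff sorted_wrt_nth_less)
    then show "(x \<circ> p) i < (x \<circ> p) j" using ij xp by simp
  qed
  ultimately show ?thesis by blast
qed

text \<open>Symmetry and vanishing at coinciding points extend nonnegativity from increasing points
  to all points. The density identity follows from its case for ordered boxes by
  \<open>moment_measure_eqI\<close>.\<close>

lemma pfaffian_point_processI:
  assumes L: "point_process_law L"
    and meas: "(\<lambda>(x, y). k x y) \<in> borel_measurable (borel \<Otimes>\<^sub>M borel)"
    and anti: "antisymmetric_kernel k" and bdd: "bounded_L2_kernel k"
    and nonneg: "\<And>n x. 1 \<le> n \<Longrightarrow> strict_mono_on {..<n} x \<Longrightarrow> 0 \<le> pfaffian n (block_matrix k x)"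
    and box: "\<And>n c d. 1 \<le> n \<Longrightarrow> (\<And>i. i < n \<Longrightarrow> c i < d i) \<Longrightarrow> (\<And>i. Suc i < n \<Longrightarrow> d i < c (Suc i)) \<Longrightarrow>
      (\<integral>\<^sup>+X. (\<Prod>i<n. emeasure (counting X) {c i<..d i}) \<partial>L) =
      (\<integral>\<^sup>+x\<in>(\<Pi>\<^sub>E i\<in>{..<n}. {c i<..d i}). ennreal (pfaffian n (block_matrix k x)) \<partial>lborels n) \<and>
      (\<integral>\<^sup>+X. (\<Prod>i<n. emeasure (counting X) {c i<..d i}) \<partial>L) \<noteq> \<infinity>"
  shows "pfaffian_point_process L k"
proof -
  have "n_point_density L n (\<lambda>x. pfaffian n (block_matrix k x))" if n: "1 \<le> n" for n
    unfolding n_point_density_def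
  proof (intro conjI ballI allI impI)
    let ?\<rho> = "\<lambda>x. pfaffian n (block_matrix k x)"
    show meas_rho: "?\<rho> \<in> borel_measurable (lborels n)"
    proof (rule pfaffian_measurable)
      fix a b assume ab: "a < 2 * n" "b < 2 * n"
      have "(\<lambda>x. (x (a div 2), x (b div 2))) \<in> lborels n \<rightarrow>\<^sub>M borel \<Otimes>\<^sub>M borel"
      proof (rule measurable_Pair)
        show "(\<lambda>x. x (a div 2)) \<in> lborels n \<rightarrow>\<^sub>M borel" "(\<lambda>x. x (b div 2)) \<in> lborels n \<rightarrow>\<^sub>M borel"
          using ab measurable_component_singleton[of _ "{..<n}" "\<lambda>_. lborel :: real measure"] by auto
      qed
      from measurable_compose[OF this meas]
      have k: "(\<lambda>x. k (x (a div 2)) (x (b div 2))) \<in> borel_measurable (lborels n)" by simp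
      have "(\<lambda>A :: real ^ 2 ^ 2. A $ i $ j) \<in> borel_measurable borel" for i j
        by (intro borel_measurable_continuous_onI continuous_intros)
      from measurable_compose[OF k this]
      show "(\<lambda>x. block_matrix k x a b) \<in> borel_measurable (lborels n)" unfolding block_matrix_def .
    qed
    show "?\<rho> (x \<circ> p) = ?\<rho> x" if "p permutes {..<n}" for x p
      by (rule pfaffian_block_matrix_permute[OF that])
    have "0 \<le> ?\<rho> x" for x
    proof (cases "inj_on x {..<n}")
      case True
      then obtain p where p: "p permutes {..<n}" "strict_mono_on {..<n} (x \<circ> p)" using sorting_permutation by blast
      show ?thesis using nonneg[OF n p(2)] unfolding pfaffian_block_matrix_permute[OF p(1)] .
    next
      case False
      then obtain i j where "i < n" "j < n" "i \<noteq> j" "x i = x j" by (auto simp: inj_on_def)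
      then show ?thesis by (simp add: pfaffian_block_matrix_coincide)
    qed
    then show "AE x in lborels n. 0 \<le> ?\<rho> x" by simp
    fix E assume E: "E \<in> sets (lborels n)" "\<forall>x\<in>E. strict_mono_on {..<n} x"
    let ?\<nu> = "density (lborels n) (\<lambda>x. ennreal (?\<rho> x))"
    have m: "(\<lambda>x. ennreal (?\<rho> x)) \<in> borel_measurable (lborels n)" using meas_rho by simp
    have mom: "emeasure (moment_measure L n) Q = emeasure ?\<nu> Q \<and> emeasure (moment_measure L n) Q \<noteq> \<infinity>" if Q: "Q \<in> ordered_boxes n" for Q
    proof -
      obtain c d where cd: "Q = (\<Pi>\<^sub>E i\<in>{..<n}. {c i<..d i})" "\<And>i. i < n \<Longrightarrow> c i < d i" "\<And>i. Suc i < n \<Longrightarrow> d i < c (Suc i)"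
        using Q unfolding ordered_boxes_def by blast
      have "emeasure (moment_measure L n) Q = (\<integral>\<^sup>+X. emeasure (PiM {..<n} (\<lambda>_. counting X)) Q \<partial>L)"
        by (rule emeasure_moment_measure[OF L ordered_boxes_sets[OF Q]])
      also have "\<dots> = (\<integral>\<^sup>+X. (\<Prod>i<n. emeasure (counting X) {c i<..d i}) \<partial>L)"
        unfolding cd(1) using point_process_lawD(3)[OF L] by (intro nn_integral_cong emeasure_PiM_counting_box) auto
      finally have e: "emeasure (moment_measure L n) Q = (\<integral>\<^sup>+X. (\<Prod>i<n. emeasure (counting X) {c i<..d i}) \<partial>L)" .
      show ?thesis
        unfolding e emeasure_density[OF m ordered_boxes_sets[OF Q]] unfolding cd(1) using cd(2,3) by (intro box n)
    qed
    have "emeasure (moment_measure L n) E = emeasure ?\<nu> E"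
      by (rule moment_measure_eqI[where n = n, OF _ _ conjunct1[OF mom] conjunct2[OF mom] E(1)]) (use E(2) in auto)
    then show "(\<integral>\<^sup>+ X. emeasure (PiM {..<n} (\<lambda>_. counting X)) E \<partial>L) = (\<integral>\<^sup>+ x\<in>E. ennreal (?\<rho> x) \<partial>lborels n)"
      unfolding emeasure_moment_measure[OF L E(1)] emeasure_density[OF m E(1)] .
  qed
  then show ?thesis unfolding pfaffian_point_process_def using L meas anti bdd by blast
qed

section \<open>Boundedness on square-integrable functions\<close>

lemma matrix_vector_mult_measurable:
  assumes "A \<in> borel_measurable M" "v \<in> borel_measurable M"
  shows "(\<lambda>p. (A p :: real ^ 2 ^ 2) *v v p) \<in> borel_measurable M"
  by (rule borel_measurable_continuous_Pair[OF assms])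
     (simp add: matrix_vector_mult_def, intro continuous_intros)

text \<open>Schur's test for a convolution majorant: Cauchy--Schwarz against the weight \<open>g (y - x)\<close>.\<close>

lemma bounded_L2_kernelI:
  fixes k :: "real \<Rightarrow> real \<Rightarrow> real ^ 2 ^ 2" and g :: "real \<Rightarrow> real"
  assumes k: "(\<lambda>(x, y). k x y) \<in> borel_measurable (borel \<Otimes>\<^sub>M borel)"
    and g: "integrable lborel g" "\<And>z. 0 \<le> g z"
    and kg: "\<And>x y v. norm (k x y *v v) \<le> g (y - x) * norm v"
  shows "bounded_L2_kernel k"
  unfolding bounded_L2_kernel_def
proof (intro exI[of _ "(\<integral>z. g z \<partial>lborel)\<^sup>2"] allI impI)
  fix f :: "real \<Rightarrow> real ^ 2"
  assume f: "f \<in> borel_measurable lborel \<and> integrable lborel (\<lambda>y. (norm (f y))\<^sup>2)"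
  define G where "G = (\<integral>z. g z \<partial>lborel)"
  define N where "N = (\<integral>y. (norm (f y))\<^sup>2 \<partial>lborel)"
  have gm [measurable]: "g \<in> borel_measurable borel" using g(1) by simp
  have fm [measurable]: "f \<in> borel_measurable borel" using f by simp
  have G0: "0 \<le> G" "0 \<le> N" unfolding G_def N_def using g(2) by (auto intro!: integral_nonneg_AE)
  have gG: "(\<integral>\<^sup>+z. ennreal (g z) \<partial>lborel) = ennreal G"
    unfolding G_def by (rule nn_integral_eq_integral[OF g(1)]) (simp add: g(2))
  have fN: "(\<integral>\<^sup>+y. ennreal ((norm (f y))\<^sup>2) \<partial>lborel) = ennreal N"
    unfolding N_def using f by (intro nn_integral_eq_integral) auto
  have shift1: "(\<integral>\<^sup>+y. ennreal (g (y - x)) \<partial>lborel) = ennreal G" for x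
    using nn_integral_real_affine[of "\<lambda>y. ennreal (g (y - x))" 1 x] gG by simp
  have shift2: "(\<integral>\<^sup>+x. ennreal (g (y - x)) \<partial>lborel) = ennreal G" for y
    using nn_integral_real_affine[of "\<lambda>x. ennreal (g (y - x))" "- 1" y] gG by simp
  define u where "u x = (\<integral>\<^sup>+y. ennreal (g (y - x)) * ennreal (norm (f y)) \<partial>lborel)" for x
  define w where "w x = (\<integral>\<^sup>+y. ennreal (g (y - x)) * ennreal ((norm (f y))\<^sup>2) \<partial>lborel)" for x
  have wm [measurable]: "w \<in> borel_measurable borel" unfolding w_def[abs_def] by measurable
  have um [measurable]: "u \<in> borel_measurable borel" unfolding u_def[abs_def] by measurable
  have uw: "(u x)\<^sup>2 \<le> ennreal G * w x" for x
  proof -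
    \<comment> \<open>Splitting the weight into two square roots leaves the constant
      \<open>G\<close> as one Cauchy-Schwarz factor.\<close>
    have u: "u x = (\<integral>\<^sup>+y. ennreal (sqrt (g (y - x))) * ennreal (sqrt (g (y - x)) * norm (f y)) \<partial>lborel)"
      unfolding u_def by (intro nn_integral_cong) (simp add: ennreal_mult[symmetric] g(2) mult.assoc[symmetric])
    have "(u x)\<^sup>2 \<le> (\<integral>\<^sup>+y. (ennreal (sqrt (g (y - x))))\<^sup>2 \<partial>lborel) * (\<integral>\<^sup>+y. (ennreal (sqrt (g (y - x)) * norm (f y)))\<^sup>2 \<partial>lborel)"
      unfolding u by (rule Cauchy_Schwarz_nn_integral) measurable
    also have "(\<integral>\<^sup>+y. (ennreal (sqrt (g (y - x))))\<^sup>2 \<partial>lborel) = ennreal G"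
      unfolding shift1[of x, symmetric] by (intro nn_integral_cong) (simp add: ennreal_power g(2))
    also have "(\<integral>\<^sup>+y. (ennreal (sqrt (g (y - x)) * norm (f y)))\<^sup>2 \<partial>lborel) = w x"
      unfolding w_def by (intro nn_integral_cong) (simp add: ennreal_power g(2) power_mult_distrib ennreal_mult)
    finally show ?thesis .
  qed
  have wint: "(\<integral>\<^sup>+x. w x \<partial>lborel) = ennreal G * ennreal N"
  proof -
    have "(\<integral>\<^sup>+x. w x \<partial>lborel) = (\<integral>\<^sup>+y. \<integral>\<^sup>+x. ennreal (g (y - x)) * ennreal ((norm (f y))\<^sup>2) \<partial>lborel \<partial>lborel)"
      unfolding w_def by (rule lborel_pair.Fubini'[symmetric]) measurable
    also have "\<dots> = (\<integral>\<^sup>+y. ennreal G * ennreal ((norm (f y))\<^sup>2) \<partial>lborel)"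
      by (intro nn_integral_cong) (simp add: nn_integral_multc shift2)
    also have "\<dots> = ennreal G * ennreal N" by (simp add: nn_integral_cmult fN)
    finally show ?thesis .
  qed
  have u2: "(\<integral>\<^sup>+x. (u x)\<^sup>2 \<partial>lborel) \<le> ennreal (G\<^sup>2 * N)"
  proof -
    have "(\<integral>\<^sup>+x. (u x)\<^sup>2 \<partial>lborel) \<le> (\<integral>\<^sup>+x. ennreal G * w x \<partial>lborel)" by (intro nn_integral_mono uw)
    also have "\<dots> = ennreal G * (ennreal G * ennreal N)" by (simp add: nn_integral_cmult wint)
    also have "\<dots> = ennreal (G\<^sup>2 * N)" using G0 by (simp add: ennreal_mult[symmetric] power2_eq_square mult.assoc)
    finally show ?thesis .
  qed
  have km: "(\<lambda>(x, y). k x y *v f y) \<in> borel_measurable (lborel \<Otimes>\<^sub>M lborel)"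
  proof -
    have "(\<lambda>p. case_prod k p *v f (snd p)) \<in> borel_measurable (borel \<Otimes>\<^sub>M borel)"
      using k by (intro matrix_vector_mult_measurable) (auto intro: measurable_compose[OF measurable_snd fm])
    then have "(\<lambda>p. case_prod k p *v f (snd p)) \<in> borel_measurable (lborel \<Otimes>\<^sub>M lborel)"
      by (subst measurable_cong_sets[OF sets_pair_measure_cong[OF sets_lborel sets_lborel] refl])
    then show ?thesis by (simp add: case_prod_beta')
  qed
  have kmx: "(\<lambda>y. k x y *v f y) \<in> borel_measurable lborel" for x
    using measurable_compose[OF measurable_Pair1'[of x lborel lborel] km] by simp
  have kle: "(\<integral>\<^sup>+y. ennreal (norm (k x y *v f y)) \<partial>lborel) \<le> u x" for x
    unfolding u_def
  proof (rule nn_integral_mono)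
    fix y
    show "ennreal (norm (k x y *v f y)) \<le> ennreal (g (y - x)) * ennreal (norm (f y))"
      using kg[of x y "f y"] g(2)[of "y - x"] by (simp add: ennreal_mult[symmetric])
  qed
  define v where "v x = (\<integral>y. k x y *v f y \<partial>lborel)" for x
  have vm [measurable]: "v \<in> borel_measurable lborel"
    unfolding v_def[abs_def] by (rule lborel.borel_measurable_lebesgue_integral) (rule km)
  \<comment> \<open>Where the integrand is not integrable, the Bochner integral is 0 by convention
    and the bound is trivial.\<close>
  have vu: "ennreal (norm (v x)) \<le> u x" for x
  proof (cases "integrable lborel (\<lambda>y. k x y *v f y)")
    case True
    then show ?thesis unfolding v_def by (intro order_trans[OF integral_norm_bound_ennreal kle])
  qed (simp add: v_def not_integrable_integral_eq)
  have "(\<integral>\<^sup>+x. ennreal ((norm (v x))\<^sup>2) \<partial>lborel) \<le> (\<integral>\<^sup>+x. (u x)\<^sup>2 \<partial>lborel)"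
    by (intro nn_integral_mono) (simp add: ennreal_power[symmetric] power_mono vu)
  then have v2: "(\<integral>\<^sup>+x. ennreal ((norm (v x))\<^sup>2) \<partial>lborel) \<le> ennreal (G\<^sup>2 * N)" using u2 by (rule order_trans)
  have vint: "integrable lborel (\<lambda>x. (norm (v x))\<^sup>2)"
    by (rule integrableI_nonneg) (use le_less_trans[OF v2 ennreal_less_top] in auto)
  have "ennreal (\<integral>x. (norm (v x))\<^sup>2 \<partial>lborel) \<le> ennreal (G\<^sup>2 * N)"
    using v2 nn_integral_eq_integral[OF vint] by simp
  then have vle: "(\<integral>x. (norm (v x))\<^sup>2 \<partial>lborel) \<le> G\<^sup>2 * N" using G0 by (subst (asm) ennreal_le_iff) auto
  have "AE x in lborel. w x \<noteq> \<infinity>"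
    by (rule nn_integral_PInf_AE) (simp_all add: wint ennreal_mult[symmetric] G0)
  then have "AE x in lborel. integrable lborel (\<lambda>y. k x y *v f y)"
  proof eventually_elim
    case (elim x)
    have "ennreal G * w x < \<infinity>" using elim by (simp add: ennreal_mult_less_top less_top)
    then have "(u x)\<^sup>2 < \<infinity>" by (rule le_less_trans[OF uw])
    then have "u x < \<infinity>" by (cases "u x" rule: ennreal_cases) (auto simp: power2_eq_square ennreal_top_mult)
    then show ?case by (intro integrableI_bounded kmx le_less_trans[OF kle])
  qed
  then show "(AE x in lborel. integrable lborel (\<lambda>y. k x y *v f y)) \<and>
      integrable lborel (\<lambda>x. (norm (\<integral>y. k x y *v f y \<partial>lborel))\<^sup>2) \<and>
      (\<integral>x. (norm (\<integral>y. k x y *v f y \<partial>lborel))\<^sup>2 \<partial>lborel) \<le> (\<integral>z. g z \<partial>lborel)\<^sup>2 * (\<integral>y. (norm (f y))\<^sup>2 \<partial>lborel)"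
    using vint vle unfolding v_def G_def N_def by blast
qed

text \<open>After a shift by \<open>x\<close>, the inequality (x + z)^2 >= x^2 + z^2 on the
  half-line splits off exp(- x^2 / 4); the remaining normalised integral is 1.\<close>

lemma F_le_gauss:
  assumes x: "0 \<le> x"
  shows "F x \<le> exp (- x\<^sup>2 / 4)"
proof -
  let ?h = "\<lambda>z :: real. indicator {x..} z *\<^sub>R exp (- z\<^sup>2 / 4)" and ?k = "\<lambda>z :: real. indicator {0..} z *\<^sub>R exp (- z\<^sup>2 / 4)"
  have int0: "integrable lborel ?k" "(\<integral>z. ?k z \<partial>lborel) = sqrt pi"
    using gaussian_half_line by (auto simp: has_bochner_integral_iff)
  have "integrable lborel ?h" using set_integrable_gaussian[of "{x..}"] by (simp add: set_integrable_def)
  then have inth: "integrable lborel (\<lambda>z. ?h (x + 1 * z))" by (rule lborel_integrable_real_affine) simp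
  have "(\<integral>z. ?h z \<partial>lborel) = (\<integral>z. ?h (x + 1 * z) \<partial>lborel)"
    using lborel_integral_real_affine[of 1 ?h x] by simp
  also have "\<dots> \<le> (\<integral>z. exp (- x\<^sup>2 / 4) * ?k z \<partial>lborel)"
  proof (rule integral_mono[OF inth])
    show "integrable lborel (\<lambda>z. exp (- x\<^sup>2 / 4) * ?k z)" using int0(1) by (rule integrable_mult_right)
    fix z
    show "?h (x + 1 * z) \<le> exp (- x\<^sup>2 / 4) * ?k z"
    proof (cases "0 \<le> z")
      case True
      have "x\<^sup>2 + z\<^sup>2 \<le> (x + z)\<^sup>2" using x True by (simp add: power2_sum)
      then have "exp (- (x + z)\<^sup>2 / 4) \<le> exp (- x\<^sup>2 / 4 + - z\<^sup>2 / 4)" by simp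
      then show ?thesis using True unfolding exp_add by simp
    qed simp
  qed
  also have "\<dots> = exp (- x\<^sup>2 / 4) * sqrt pi" using int0 by simp
  finally have "(1 / sqrt pi) * (\<integral>z. ?h z \<partial>lborel) \<le> (1 / sqrt pi) * (exp (- x\<^sup>2 / 4) * sqrt pi)"
    by (rule mult_left_mono) simp
  then show ?thesis by (simp add: F_def set_lebesgue_integral_def)
qed

text \<open>Half of the Gaussian exponent absorbs the factor z / 2 of the second derivative, hence 8
  in place of 4 in the common majorant.\<close>

lemma DF_le_gauss:
  "\<bar>deriv F z\<bar> \<le> exp (- z\<^sup>2 / 8)" "\<bar>deriv (deriv F) z\<bar> \<le> exp (- z\<^sup>2 / 8)" "F \<bar>z\<bar> \<le> exp (- z\<^sup>2 / 8)"
proof -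
  have e: "exp (- z\<^sup>2 / 4) \<le> exp (- z\<^sup>2 / 8)" by simp
  have "\<bar>exp (- z\<^sup>2 / 4) / sqrt pi\<bar> \<le> exp (- z\<^sup>2 / 8) / 1"
    unfolding abs_divide using sqrt_pi_ge_1 e by (intro frac_le) auto
  then show "\<bar>deriv F z\<bar> \<le> exp (- z\<^sup>2 / 8)" unfolding deriv_F by simp
  have "0 \<le> (\<bar>z\<bar> - 2)\<^sup>2" by simp
  then have "\<bar>z\<bar> / 2 \<le> 1 + z\<^sup>2 / 8" unfolding power2_diff by simp
  then have "\<bar>z\<bar> / 2 * exp (- (z\<^sup>2 / 8)) * exp (- (z\<^sup>2 / 8)) \<le> 1 * exp (- (z\<^sup>2 / 8))"
    by (intro mult_right_mono times_exp_le_1) auto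
  then have "\<bar>z / 2 * exp (- z\<^sup>2 / 4)\<bar> \<le> exp (- z\<^sup>2 / 8)"
    by (simp add: abs_mult mult.assoc exp_add[symmetric])
  then have "\<bar>z / 2 * exp (- z\<^sup>2 / 4) / sqrt pi\<bar> \<le> exp (- z\<^sup>2 / 8) / 1"
    unfolding abs_divide[of _ "sqrt pi"] using sqrt_pi_ge_1 by (intro frac_le) auto
  then show "\<bar>deriv (deriv F) z\<bar> \<le> exp (- z\<^sup>2 / 8)" unfolding deriv2_F by simp
  show "F \<bar>z\<bar> \<le> exp (- z\<^sup>2 / 8)" using order_trans[OF F_le_gauss[of "\<bar>z\<bar>"], of "exp (- z\<^sup>2 / 8)"] e by simp
qed

lemma scaled_K_measurable: "(\<lambda>(x, y). scaled_K \<kappa> s x y) \<in> borel_measurable (borel \<Otimes>\<^sub>M borel)"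
proof -
  have m: "deriv F \<in> borel_measurable borel" "deriv (deriv F) \<in> borel_measurable borel"
    unfolding deriv2_F unfolding deriv_F by measurable
  note m [measurable]
  have e: "(\<lambda>p. (case p of (x, y) \<Rightarrow> scaled_K \<kappa> s x y) $ i $ j) \<in> borel_measurable (borel \<Otimes>\<^sub>M borel)" for i j :: 2
  proof -
    have "(i = 1 \<or> i = 2) \<and> (j = 1 \<or> j = 2)" using exhaust_2 by blast
    then show ?thesis by (elim conjE disjE) (simp_all add: case_prod_beta' scaled_K_entries)
  qed
  show ?thesis
    by (subst borel_measurable_euclidean_space) (use e in \<open>auto simp: Basis_vec_def inner_axis\<close>)
qed

lemma norm_matrix_vector_mult_le:
  fixes A :: "real ^ 2 ^ 2"
  assumes "\<And>i j. \<bar>A $ i $ j\<bar> \<le> c"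
  shows "norm (A *v v) \<le> 4 * c * norm v"
proof -
  have "\<bar>A $ i $ j * v $ j\<bar> \<le> c * norm v" for i j
    unfolding abs_mult using assms[of i j] component_le_norm_cart[of v j] by (intro mult_mono) auto
  then have "\<bar>A $ i $ 1 * v $ 1 + A $ i $ 2 * v $ 2\<bar> \<le> 2 * (c * norm v)" for i
    using abs_triangle_ineq[of "A $ i $ 1 * v $ 1" "A $ i $ 2 * v $ 2"] by (smt (verit))
  then have i: "\<bar>(A *v v) $ i\<bar> \<le> 2 * (c * norm v)" for i by (simp add: matrix_vector_mult_def sum_2)
  have "norm (A *v v) \<le> (\<Sum>i\<in>UNIV. \<bar>(A *v v) $ i\<bar>)" by (rule norm_le_l1_cart)
  also have "\<dots> \<le> 4 * (c * norm v)" unfolding sum_2 using i[of 1] i[of 2] by linarith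
  finally show ?thesis by simp
qed

lemma bounded_L2_scaled_K:
  assumes s: "0 < s" and \<kappa>: "0 < \<kappa>"
  shows "bounded_L2_kernel (scaled_K \<kappa> s)"
proof (rule bounded_L2_kernelI[OF scaled_K_measurable])
  let ?g = "\<lambda>z. 4 * (\<kappa> * s * exp (- (z * s)\<^sup>2 / 8))"
  \<comment> \<open>The scale \<open>s / sqrt 2\<close> turns the exponent with 4 into the one with
    8.\<close>
  have "integrable lborel (\<lambda>z. exp (- (0 + s / sqrt 2 * z)\<^sup>2 / 4))"
    using s by (intro lborel_integrable_real_affine integrable_gaussian) simp
  moreover have "- (0 + s / sqrt 2 * z)\<^sup>2 / 4 = - (z * s)\<^sup>2 / 8" for z by (simp add: power_mult_distrib power_divide)
  ultimately have "integrable lborel (\<lambda>z. exp (- (z * s)\<^sup>2 / 8))" by (simp only:)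
  then show "integrable lborel ?g" by (intro integrable_mult_right)
  show "0 \<le> ?g z" for z using s \<kappa> by simp
  show "norm (scaled_K \<kappa> s x y *v v) \<le> ?g (y - x) * norm v" for x y v
  proof (rule norm_matrix_vector_mult_le)
    fix i j :: 2
    have c: "0 \<le> \<kappa> * s" using s \<kappa> by simp
    have b: "\<bar>\<kappa> * s * a\<bar> \<le> \<kappa> * s * exp (- ((y - x) * s)\<^sup>2 / 8)" if "\<bar>a\<bar> \<le> exp (- ((y - x) * s)\<^sup>2 / 8)" for a
      unfolding abs_mult[of "\<kappa> * s"] abs_of_nonneg[OF c] using that c by (rule mult_left_mono)
    have sg: "\<bar>sgn ((y - x) * s) * F \<bar>(y - x) * s\<bar>\<bar> \<le> exp (- ((y - x) * s)\<^sup>2 / 8)"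
      using DF_le_gauss(3)[of "(y - x) * s"] F_nonneg[of "\<bar>(y - x) * s\<bar>"] by (auto simp: abs_mult sgn_if)
    have "(i = 1 \<or> i = 2) \<and> (j = 1 \<or> j = 2)" using exhaust_2 by blast
    then show "\<bar>scaled_K \<kappa> s x y $ i $ j\<bar> \<le> \<kappa> * s * exp (- ((y - x) * s)\<^sup>2 / 8)"
      using b[OF DF_le_gauss(1)] b[OF DF_le_gauss(2)] b[OF sg]
      by (elim conjE disjE) (simp_all only: scaled_K_entries mult_minus_left abs_minus)
  qed
qed

section \<open>Conclusion\<close>

text \<open>\<open>L\<close> carries the void probabilities and \<open>L'\<close> the process in
  question. The two uses are \<open>L' = L\<close> with \<open>\<kappa> = 1\<close>, and
  \<open>L'\<close> the thinning of \<open>L\<close> with \<open>\<kappa> = 1 / 2\<close>.\<close>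

lemma pfaffian_point_process_scaled_K:
  assumes s: "0 < s" and \<kappa>: "0 < \<kappa>" and L': "point_process_law L'"
    and L: "\<And>n. 1 \<le> n \<Longrightarrow> smooth_kernel.void_pfaffian (DFs s) L n"
    and box: "\<And>n c d. 1 \<le> n \<Longrightarrow> (\<And>i. i < n \<Longrightarrow> c i < d i) \<Longrightarrow> (\<And>i. Suc i < n \<Longrightarrow> d i < c (Suc i)) \<Longrightarrow>
      (\<integral>\<^sup>+X. (\<Prod>i<n. emeasure (counting X) {c i<..d i}) \<partial>L') =
      ennreal (\<kappa> ^ n) * (\<integral>\<^sup>+X. (\<Prod>i<n. emeasure (counting X) {c i<..d i}) \<partial>L)"
  shows "pfaffian_point_process L' (scaled_K \<kappa> s)"
proof (rule pfaffian_point_processI[OF L' scaled_K_measurable antisymmetric_scaled_K bounded_L2_scaled_K[OF s \<kappa>]])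
  interpret S: smooth_kernel "DFs s" "2 * (1 + s) ^ 3" by (rule smooth_kernel_DFs[OF s])
  show "0 \<le> pfaffian n (block_matrix (scaled_K \<kappa> s) x)" if n: "1 \<le> n" and x: "strict_mono_on {..<n} x" for n x
    unfolding pfaffian_block_matrix_scaled_K[OF s x \<kappa>] using S.rho_nonneg[OF L[OF n] x] \<kappa> by (simp add: S.rho_def)
  fix n :: nat and c d :: "nat \<Rightarrow> real"
  assume n: "1 \<le> n" and cd: "\<And>i. i < n \<Longrightarrow> c i < d i" "\<And>i. Suc i < n \<Longrightarrow> d i < c (Suc i)"
  let ?Q = "\<Pi>\<^sub>E i\<in>{..<n}. {c i<..d i}"
  have rho: "pfaffian n (block_matrix (scaled_K \<kappa> s) x) = \<kappa> ^ n * S.rho n x \<and> 0 \<le> S.rho n x" if "x \<in> ?Q" for x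
  proof -
    have x: "strict_mono_on {..<n} x"
      by (rule gaps_strict_mono[of n d c]) (use cd(2) that in \<open>auto simp: PiE_def Pi_def\<close>)
    show ?thesis using pfaffian_block_matrix_scaled_K[OF s x \<kappa>] S.rho_nonneg[OF L[OF n] x] by (simp add: S.rho_def)
  qed
  \<comment> \<open>The sum of the side lengths is a convenient common bound for them.\<close>
  have "integrable (lborels n) (\<lambda>x. indicator ?Q x * S.rho n x)"
    by (rule S.box_integral_approx(1)[where \<delta> = "\<Sum>i<n. d i - c i"])
       (use L[OF n] cd in \<open>auto intro!: member_le_sum sum_nonneg intro: less_imp_le\<close>)
  then have "ennreal (\<integral>x. indicator ?Q x * S.rho n x \<partial>lborels n) = (\<integral>\<^sup>+x. ennreal (indicator ?Q x * S.rho n x) \<partial>lborels n)"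
    by (intro nn_integral_eq_integral[symmetric]) (use rho in \<open>auto simp: indicator_def\<close>)
  moreover have "(\<integral>\<^sup>+X. (\<Prod>i<n. emeasure (counting X) {c i<..d i}) \<partial>L') =
      ennreal (\<kappa> ^ n) * ennreal (\<integral>x. indicator ?Q x * S.rho n x \<partial>lborels n)"
  proof -
    have "(\<integral>\<^sup>+X. (\<Prod>i<n. emeasure (counting X) {c i<..d i}) \<partial>L) = ennreal (\<integral>x. indicator ?Q x * S.rho n x \<partial>lborels n)"
      using cd by (intro S.box_moment L n)
    moreover have "(\<integral>\<^sup>+X. (\<Prod>i<n. emeasure (counting X) {c i<..d i}) \<partial>L') =
        ennreal (\<kappa> ^ n) * (\<integral>\<^sup>+X. (\<Prod>i<n. emeasure (counting X) {c i<..d i}) \<partial>L)"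
      using cd by (intro box n)
    ultimately show ?thesis by (simp only:)
  qed
  ultimately have "(\<integral>\<^sup>+X. (\<Prod>i<n. emeasure (counting X) {c i<..d i}) \<partial>L') =
      ennreal (\<kappa> ^ n) * (\<integral>\<^sup>+x. ennreal (indicator ?Q x * S.rho n x) \<partial>lborels n)"
    "(\<integral>\<^sup>+X. (\<Prod>i<n. emeasure (counting X) {c i<..d i}) \<partial>L') \<noteq> \<infinity>"
    by (auto simp: ennreal_mult_eq_top_iff)
  moreover have "ennreal (\<kappa> ^ n) * (\<integral>\<^sup>+x. ennreal (indicator ?Q x * S.rho n x) \<partial>lborels n) =
      (\<integral>\<^sup>+x\<in>?Q. ennreal (pfaffian n (block_matrix (scaled_K \<kappa> s) x)) \<partial>lborels n)"
  proof -
    have "(\<lambda>x. ennreal (indicator ?Q x * S.rho n x)) \<in> borel_measurable (lborels n)"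
      by (intro measurable_compose[OF _ measurable_ennreal] borel_measurable_times S.rho_measurable borel_measurable_indicator sets_PiM_I_finite) auto
    from nn_integral_cmult[OF this, symmetric] show ?thesis
      by (rule trans, intro nn_integral_cong) (use rho \<kappa> in \<open>auto simp: indicator_def ennreal_mult\<close>)
  qed
  ultimately show "(\<integral>\<^sup>+X. (\<Prod>i<n. emeasure (counting X) {c i<..d i}) \<partial>L') =
      (\<integral>\<^sup>+x\<in>?Q. ennreal (pfaffian n (block_matrix (scaled_K \<kappa> s) x)) \<partial>lborels n) \<and>
      (\<integral>\<^sup>+X. (\<Prod>i<n. emeasure (counting X) {c i<..d i}) \<partial>L') \<noteq> \<infinity>"
    by simp
qed

theorem theorem2:
  fixes W :: "'w measure" and B :: "nat \<Rightarrow> real \<Rightarrow> 'w \<Rightarrow> real" and t :: real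
  assumes "independent_brownian_motions W B" and "t > 0"
  shows "(\<forall>L. maximal_coalescing_law W B t L \<longrightarrow>
            pfaffian_point_process L
              (\<lambda>x y. (1 / sqrt t) *\<^sub>R K (x / sqrt t) (y / sqrt t))) \<and>
         (\<forall>L. maximal_annihilating_law W B t L \<longrightarrow>
            pfaffian_point_process L
              (\<lambda>x y. (1 / 2 * (1 / sqrt t)) *\<^sub>R K (x / sqrt t) (y / sqrt t)))"
proof -
  interpret brownian W B by (unfold_locales) (rule assms(1))
  let ?s = "1 / sqrt t"
  have s: "0 < ?s" using assms(2) by simp
  interpret S: smooth_kernel "DFs ?s" "2 * (1 + ?s) ^ 3" by (rule smooth_kernel_DFs[OF s])
  have void: "S.void_pfaffian L n" if L: "maximal_coalescing_law W B t L" and n: "1 \<le> n" for L n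
    unfolding S.void_pfaffian_def
  proof (intro conjI allI impI)
    show "point_process_law L" using L by (simp add: maximal_coalescing_law_def)
    fix l r :: "nat \<Rightarrow> real"
    assume lr: "\<forall>i<n. l i \<le> r i" "\<forall>i. Suc i < n \<longrightarrow> r i < l (Suc i)"
    have "DFs ?s 0 = (\<lambda>d. F (d / sqrt t))" by (simp add: DFs_def DF_simps fun_eq_iff)
    then show "measure L {X \<in> space L. \<forall>i<n. X \<inter> {l i<..r i} = {}} = pfaffian n (smat (DFs ?s 0) l r 0)"
      using maximal_coalescing_void[OF assms(2) L, of n l r] n lr by simp
  qed
  have c: "pfaffian_point_process L (scaled_K 1 ?s)" if L: "maximal_coalescing_law W B t L" for L
  proof (rule pfaffian_point_process_scaled_K[OF s])
    show "point_process_law L" using L by (simp add: maximal_coalescing_law_def)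
    show "S.void_pfaffian L n" if "1 \<le> n" for n by (rule void[OF L that])
  qed simp_all
  have a: "pfaffian_point_process L (scaled_K (1 / 2) ?s)" if La: "maximal_annihilating_law W B t L" for L
  proof -
    obtain L' where L': "maximal_coalescing_law W B t L'" and L: "L = L' \<bind> independent_removal (1 / 2)"
      using La unfolding maximal_annihilating_law_def by blast
    have ppl: "point_process_law L'" using L' by (simp add: maximal_coalescing_law_def)
    show ?thesis
    proof (rule pfaffian_point_process_scaled_K[OF s, where L = L'])
      show "point_process_law L" unfolding L by (rule point_process_law_thinned[OF ppl])
      show "S.void_pfaffian L' n" if "1 \<le> n" for n by (rule void[OF L' that])
      fix n :: nat and c d :: "nat \<Rightarrow> real"
      assume cd: "\<And>i. i < n \<Longrightarrow> c i < d i" "\<And>i. Suc i < n \<Longrightarrow> d i < c (Suc i)"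
      have dis: "{c i<..d i} \<inter> {c j<..d j} = {}" if ij: "i < n" "j < n" "i \<noteq> j" for i j
      proof (rule ccontr)
        assume "{c i<..d i} \<inter> {c j<..d j} \<noteq> {}"
        then obtain z where z: "z \<in> {c i<..d i}" "z \<in> {c j<..d j}" by blast
        \<comment> \<open>A point common to two sides would give a strictly increasing
          \<open>x\<close> with \<open>x i = x j\<close>.\<close>
        define x where "x k = (if k = i \<or> k = j then z else d k)" for k
        have "c k < x k \<and> x k \<le> d k" if "k < n" for k
          using cd(1)[OF that] z by (auto simp: x_def)
        then have "strict_mono_on {..<n} x"
          by (intro gaps_strict_mono[of n d c] cd(2))
        then have "i = j" by (rule strict_mono_on_eqD) (use ij in \<open>auto simp: x_def\<close>)
        then show False using ij(3) by contradiction
      qed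
      show "(\<integral>\<^sup>+X. (\<Prod>i<n. emeasure (counting X) {c i<..d i}) \<partial>L) =
          ennreal ((1 / 2) ^ n) * (\<integral>\<^sup>+X. (\<Prod>i<n. emeasure (counting X) {c i<..d i}) \<partial>L')"
        unfolding L by (rule thinned_box_moment[OF ppl _ _ dis]) simp_all
    qed simp
  qed
  have "scaled_K \<kappa> ?s = (\<lambda>x y. (\<kappa> * (1 / sqrt t)) *\<^sub>R K (x / sqrt t) (y / sqrt t))" for \<kappa>
    by (simp add: scaled_K_def fun_eq_iff)
  then show ?thesis using c a by simp
qed

end
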